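(* $\mathcal U_{\mathbb Z}(\widehat{\mathfrak{gl}}_n)$ is a $\mathbb Z$-Hopf subalgebra of $\mathcal U(\widehat{\mathfrak{gl}}_n)$, with comultiplication given by $$\Delta(\iota^+(u_{\lambda,1}))=\sum_{\substack{\lambda^{(1)},\lambda^{(2)}\in\mathbb N^n_\triangle\\ \lambda=\lambda^{(1)}+\lambda^{(2)}}}\iota^+(u_{\lambda^{(1)},1})\otimes\iota^+(u_{\lambda^{(2)},1}),$$ $$\Delta(\iota^-(u_{\lambda,1}))=\sum_{\substack{\lambda^{(1)},\lambda^{(2)}\in\mathbb N^n_\triangle\\ \lambda=\lambda^{(1)}+\lambda^{(2)}}}\iota^-(u_{\lambda^{(1)},1})\otimes\iota^-(u_{\lambda^{(2)},1}),$$ $$\Delta\left(\binom{E^\triangle_{i,i}}{t}\right)=\sum_{0\le j\le t}\binom{E^\triangle_{i,i}}{j}\otimes\binom{E^\triangle_{i,i}}{t-j}$$ for $\lambda\in\mathbb N^n_\triangle$, $1\le i\le n$ and $t\in\mathbb N$.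
   Context: Let $n\ge2$ be an integer, $\mathbb N=\{0,1,2,\dots\}$. $M_{\triangle,n}(\mathbb Q)$ is the set of rational matrices $A=(a_{i,j})_{i,j\in\mathbb Z}$ with $a_{i,j}=a_{i+n,j+n}$ and with finitely many nonzero entries in every row and column. $\Theta^+_\triangle(n)$ is the set of such matrices with entries in $\mathbb N$ and $a_{i,j}=0$ for $i\ge j$. $E^\triangle_{i,j}$ is the matrix with entry $1$ at positions $(i+sn,j+sn)$, $s\in\mathbb Z$, and $0$ elsewhere. $\mathbb N^n_\triangle$ is the set of $n$-periodic sequences $(\lambda_i)_{i\in\mathbb Z}$ in $\mathbb N$, identified with $\mathbb N^n$. Ringel–Hall algebra. Let $\triangle(n)$ be the cyclic quiver with vertex set $I=\mathbb Z/n\mathbb Z$ and arrows $i\to i+1$. Over a field $\mathbb F$, $S_i$ is the simple nilpotent representation at $i$, $M^{i,j}$ ($i<j$) the unique indecomposable nilpotent representation of length $j-i$ with top $S_i$; for $A\in\Theta^+_\triangle(n)$, $M_{\mathbb F}(A)=\bigoplus_{1\le i\le n,\,i<j}a_{i,j}M^{i,j}$ with dimension vector $\mathbf d(A)\in\mathbb N^n$. $\langle\mathbf a,\mathbf b\rangle=\sum_{i\in I}a_ib_i-\sum_{i\in I}a_ib_{i+1}$. For $A,B,C\in\Theta^+_\triangle(n)$ there is a (Hall) polynomial $\varphi^C_{A,B}\in\mathbb Z[v^2]$ whose value at $v^2=q$, for each finite field $\mathbb F$ of $q$ elements, is the number of subrepresentations $N\subseteq M_{\mathbb F}(C)$ with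 $N\cong M_{\mathbb F}(B)$ and $M_{\mathbb F}(C)/N\cong M_{\mathbb F}(A)$. $\mathfrak H_\triangle(n)$ is the algebra over $\mathcal Z=\mathbb Z[v,v^{-1}]$ with basis $\{u_A\}_{A\in\Theta^+_\triangle(n)}$ and $u_Au_B=v^{\langle\mathbf d(A),\mathbf d(B)\rangle}\sum_C\varphi^C_{A,B}u_C$. $\mathfrak H_\triangle(n)_{\mathbb Z}$, $\mathfrak H_\triangle(n)_{\mathbb Q}$ are the specializations at $v=1$; $u_{A,1}=u_A\otimes1$. For $\lambda\in\mathbb N^n_\triangle$, $u_{\lambda,1}=u_{A,1}$ with $A=\sum_{1\le i\le n}\lambda_iE^\triangle_{i,i+1}$ (so $M(A)=S_\lambda=\bigoplus_i\lambda_iS_i$). Enveloping algebra and integral form. $\widehat{\mathfrak{gl}}_n=\mathfrak{gl}_n(\mathbb Q)\otimes\mathbb Q[t,t^{-1}]$ is identified as a Lie algebra with $M_{\triangle,n}(\mathbb Q)$ via $E_{i,j}\otimes t^l\leftrightarrow E^\triangle_{i,j+ln}$ ($1\le i,j\le n$, $l\in\mathbb Z$); $\mathcal U(\widehat{\mathfrak{gl}}_n)$ is its universal enveloping algebra over $\mathbb Q$ with its standard Hopf algebra structure. There are unique injective algebra homomorphisms $\iota^+:\mathfrak H_\triangle(n)_{\mathbb Q}\to\mathcal U(\widehat{\mathfrak{gl}}_n)$ and $\iota^-:\mathfrak H_\triangle(n)_{\mathbb Q}^{\mathrm{op}}\to\mathcal U(\widehat{\mathfrak{gl}}_n)$ with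 $\iota^+(u_{E^\triangle_{i,j},1})=E^\triangle_{i,j}$ and $\iota^-(u_{E^\triangle_{i,j},1})=E^\triangle_{j,i}$ for all $i<j$. Put $\mathcal U^+_{\mathbb Z}=\iota^+(\mathfrak H_\triangle(n)_{\mathbb Z})$, $\mathcal U^-_{\mathbb Z}=\iota^-(\mathfrak H_\triangle(n)_{\mathbb Z}^{\mathrm{op}})$, $\mathcal U^0_{\mathbb Z}$ the $\mathbb Z$-span of $\prod_{1\le i\le n}\binom{E^\triangle_{i,i}}{\lambda_i}$, $\lambda\in\mathbb N^n_\triangle$, where $\binom{y}{t}=y(y-1)\cdots(y-t+1)/t!$, and $\mathcal U_{\mathbb Z}(\widehat{\mathfrak{gl}}_n)=\mathcal U^+_{\mathbb Z}\,\mathcal U^0_{\mathbb Z}\,\mathcal U^-_{\mathbb Z}$ (the $\mathbb Z$-span of products). *)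

theory Defs
  imports
    "HOL-Computational_Algebra.Polynomial"
    "HOL-Algebra.QuotRing"
    "HOL-Algebra.Module"
    "HOL-Algebra.Generated_Groups"
    "HOL-Algebra.Subrings"
    "HOL-Library.FuncSet"
    "HOL-Library.Poly_Mapping"
begin

section \<open>Algebras with a basis, quotients, opposite algebras\<close>

text \<open>The free \<open>'k\<close>-module on \<open>X\<close> with multiplication
  \<open>u\<^sub>x u\<^sub>y = (\<Sum>z\<in>X. c x y z u\<^sub>z)\<close> and unit \<open>u\<^sub>e\<close>; an element is its
  finitely supported coefficient function.\<close>

definition basis_alg ::
  "'x set \<Rightarrow> ('x \<Rightarrow> 'x \<Rightarrow> 'x \<Rightarrow> 'k) \<Rightarrow> 'x \<Rightarrow> ('k::comm_ring_1, 'x \<Rightarrow> 'k) module" where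
  "basis_alg X c e =
    \<lparr>carrier = {f. finite {x. f x \<noteq> 0} \<and> {x. f x \<noteq> 0} \<subseteq> X},
     mult = (\<lambda>f g z. if z \<in> X
       then \<Sum>(x, y) \<in> {x. f x \<noteq> 0} \<times> {y. g y \<noteq> 0}. f x * g y * c x y z else 0),
     one = (\<lambda>x. if x = e then 1 else 0),
     zero = (\<lambda>x. 0),
     add = (\<lambda>f g x. f x + g x),
     smult = (\<lambda>a f x. a * f x)\<rparr>"

definition bvec :: "'x \<Rightarrow> 'x \<Rightarrow> 'k::comm_ring_1" where
  "bvec x = (\<lambda>y. if y = x then 1 else 0)"

definition monoid_alg :: "('x, 'm) monoid_scheme \<Rightarrow> ('k::comm_ring_1, 'x \<Rightarrow> 'k) module" where
  "monoid_alg G =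
    basis_alg (carrier G) (\<lambda>x y z. if x \<otimes>\<^bsub>G\<^esub> y = z then 1 else 0) \<one>\<^bsub>G\<^esub>"

text \<open>Quotient of a module by a submodule, or of an algebra by a two-sided ideal. The ring part
  is that of \<^const>\<open>FactRing\<close>; for a mere module the fields \<open>mult\<close> and \<open>one\<close> carry no meaning.\<close>

definition quot_alg :: "('k, 'a) module \<Rightarrow> 'a set \<Rightarrow> ('k, 'a set) module" where
  "quot_alg M J =
    \<lparr>carrier = a_rcosets\<^bsub>M\<^esub> J, mult = rcoset_mult M J, one = J +>\<^bsub>M\<^esub> \<one>\<^bsub>M\<^esub>,
     zero = J, add = set_add M, smult = (\<lambda>a X. \<Union>x\<in>X. J +>\<^bsub>M\<^esub> (a \<odot>\<^bsub>M\<^esub> x))\<rparr>"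

definition op_alg :: "('k, 'a) module \<Rightarrow> ('k, 'a) module" where
  "op_alg M = M\<lparr>mult := (\<lambda>x y. y \<otimes>\<^bsub>M\<^esub> x)\<rparr>"

definition alg_hom :: "('k, 'a) module \<Rightarrow> ('k, 'b) module \<Rightarrow> ('a \<Rightarrow> 'b) set" where
  "alg_hom M N =
    {h \<in> ring_hom M N. \<forall>a. \<forall>x\<in>carrier M. h (a \<odot>\<^bsub>M\<^esub> x) = a \<odot>\<^bsub>N\<^esub> h x}"

definition Q_alg :: "(rat, rat) module" where
  "Q_alg = \<lparr>carrier = UNIV, mult = (*), one = 1, zero = 0, add = (+), smult = (*)\<rparr>"

definition Z_span :: "('k, 'a) module \<Rightarrow> 'a set \<Rightarrow> 'a set" where
  "Z_span M X = generate (add_monoid M) X"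


section \<open>Tensor products of algebras over the rationals\<close>

text \<open>The free vector space on \<open>carrier A \<times> carrier B\<close>, with multiplication
  \<open>(a, b)(a', b') = (aa', bb')\<close>, modulo the bilinearity relations; since the multiplications of
  \<open>A\<close> and \<open>B\<close> are bilinear, the linear span of these relations is already an ideal.\<close>

definition tensor_free ::
  "(rat, 'a) module \<Rightarrow> (rat, 'b) module \<Rightarrow> (rat, 'a \<times> 'b \<Rightarrow> rat) module" where
  "tensor_free A B = monoid_alg (A \<times>\<times> B)"

definition tensor_ideal :: "(rat, 'a) module \<Rightarrow> (rat, 'b) module \<Rightarrow> ('a \<times> 'b \<Rightarrow> rat) set" where
  "tensor_ideal A B = (let T = tensor_free A B in genideal T
    ({bvec (a \<oplus>\<^bsub>A\<^esub> a', b) \<ominus>\<^bsub>T\<^esub> (bvec (a, b) \<oplus>\<^bsub>T\<^esub> bvec (a', b)) | a a' b.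
        a \<in> carrier A \<and> a' \<in> carrier A \<and> b \<in> carrier B} \<union>
     {bvec (a, b \<oplus>\<^bsub>B\<^esub> b') \<ominus>\<^bsub>T\<^esub> (bvec (a, b) \<oplus>\<^bsub>T\<^esub> bvec (a, b')) | a b b'.
        a \<in> carrier A \<and> b \<in> carrier B \<and> b' \<in> carrier B} \<union>
     {bvec (r \<odot>\<^bsub>A\<^esub> a, b) \<ominus>\<^bsub>T\<^esub> (r \<odot>\<^bsub>T\<^esub> bvec (a, b)) | r a b.
        a \<in> carrier A \<and> b \<in> carrier B} \<union>
     {bvec (a, r \<odot>\<^bsub>B\<^esub> b) \<ominus>\<^bsub>T\<^esub> (r \<odot>\<^bsub>T\<^esub> bvec (a, b)) | r a b.
        a \<in> carrier A \<and> b \<in> carrier B}))"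

definition tensor_alg ::
  "(rat, 'a) module \<Rightarrow> (rat, 'b) module \<Rightarrow> (rat, ('a \<times> 'b \<Rightarrow> rat) set) module" where
  "tensor_alg A B = quot_alg (tensor_free A B) (tensor_ideal A B)"

definition tens ::
  "(rat, 'a) module \<Rightarrow> (rat, 'b) module \<Rightarrow> 'a \<Rightarrow> 'b \<Rightarrow> ('a \<times> 'b \<Rightarrow> rat) set" where
  "tens A B a b = tensor_ideal A B +>\<^bsub>tensor_free A B\<^esub> bvec (a, b)"


section \<open>Universal enveloping algebras and their Hopf structure\<close>

text \<open>The enveloping algebra of the Lie algebra obtained from an associative algebra \<open>A\<close> with the
  commutator bracket: the free algebra on the set \<open>carrier A\<close> modulo linearity of the generators
  (which gives the tensor algebra of \<open>A\<close>) and \<open>xy - yx = [x, y]\<close>.\<close>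

definition lie_bracket :: "(rat, 'a) module \<Rightarrow> 'a \<Rightarrow> 'a \<Rightarrow> 'a" where
  "lie_bracket A x y = (x \<otimes>\<^bsub>A\<^esub> y) \<ominus>\<^bsub>A\<^esub> (y \<otimes>\<^bsub>A\<^esub> x)"

definition word_alg :: "(rat, 'a) module \<Rightarrow> (rat, 'a list \<Rightarrow> rat) module" where
  "word_alg A = monoid_alg \<lparr>carrier = lists (carrier A), mult = (@), one = []\<rparr>"

definition env_ideal :: "(rat, 'a) module \<Rightarrow> ('a list \<Rightarrow> rat) set" where
  "env_ideal A = (let T = word_alg A in genideal T
    ({bvec [x \<oplus>\<^bsub>A\<^esub> y] \<ominus>\<^bsub>T\<^esub> (bvec [x] \<oplus>\<^bsub>T\<^esub> bvec [y]) | x y.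
        x \<in> carrier A \<and> y \<in> carrier A} \<union>
     {bvec [r \<odot>\<^bsub>A\<^esub> x] \<ominus>\<^bsub>T\<^esub> (r \<odot>\<^bsub>T\<^esub> bvec [x]) | r x. x \<in> carrier A} \<union>
     {(bvec [x, y] \<ominus>\<^bsub>T\<^esub> bvec [y, x]) \<ominus>\<^bsub>T\<^esub> bvec [lie_bracket A x y] | x y.
        x \<in> carrier A \<and> y \<in> carrier A}))"

definition env_alg :: "(rat, 'a) module \<Rightarrow> (rat, ('a list \<Rightarrow> rat) set) module" where
  "env_alg A = quot_alg (word_alg A) (env_ideal A)"

definition env_gen :: "(rat, 'a) module \<Rightarrow> 'a \<Rightarrow> ('a list \<Rightarrow> rat) set" where
  "env_gen A x = env_ideal A +>\<^bsub>word_alg A\<^esub> bvec [x]"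

text \<open>The algebra homomorphism out of the enveloping algebra with prescribed values on the
  Lie algebra.\<close>

definition env_lift ::
  "(rat, 'a) module \<Rightarrow> (rat, 'b) module \<Rightarrow> ('a \<Rightarrow> 'b) \<Rightarrow> ('a list \<Rightarrow> rat) set \<Rightarrow> 'b" where
  "env_lift A B g = (THE h. h \<in> alg_hom (env_alg A) B \<and> h \<in> extensional (carrier (env_alg A)) \<and>
     (\<forall>x\<in>carrier A. h (env_gen A x) = g x))"

definition env_comult ::
  "(rat, 'a) module \<Rightarrow> ('a list \<Rightarrow> rat) set
     \<Rightarrow> (('a list \<Rightarrow> rat) set \<times> ('a list \<Rightarrow> rat) set \<Rightarrow> rat) set" where
  "env_comult A = (let U = env_alg A; T = tensor_alg U U in
     env_lift A T (\<lambda>x. tens U U (env_gen A x) \<one>\<^bsub>U\<^esub> \<oplus>\<^bsub>T\<^esub> tens U U \<one>\<^bsub>U\<^esub> (env_gen A x)))"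

definition env_counit :: "(rat, 'a) module \<Rightarrow> ('a list \<Rightarrow> rat) set \<Rightarrow> rat" where
  "env_counit A = env_lift A Q_alg (\<lambda>x. 0)"

definition env_antipode ::
  "(rat, 'a) module \<Rightarrow> ('a list \<Rightarrow> rat) set \<Rightarrow> ('a list \<Rightarrow> rat) set" where
  "env_antipode A = env_lift A (op_alg (env_alg A)) (\<lambda>x. \<ominus>\<^bsub>env_alg A\<^esub> env_gen A x)"

text \<open>Integral Hopf subalgebras of a rational Hopf algebra \<open>U\<close>. As \<open>U\<close> is torsion-free, for a
  subring \<open>H\<close> the natural map from the tensor square of \<open>H\<close> over the integers to \<open>tensor_alg U U\<close> is
  injective, with image the integral span of the pure tensors of elements of \<open>H\<close>.\<close>

definition Z_hopf_subalgebra ::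
  "(rat, 'u) module \<Rightarrow> ('u \<Rightarrow> ('u \<times> 'u \<Rightarrow> rat) set) \<Rightarrow> ('u \<Rightarrow> rat) \<Rightarrow> ('u \<Rightarrow> 'u) \<Rightarrow> 'u set \<Rightarrow> bool" where
  "Z_hopf_subalgebra U \<Delta> \<epsilon> S H \<longleftrightarrow>
     subring H U \<and>
     (\<forall>x\<in>H. \<Delta> x \<in> Z_span (tensor_alg U U) {tens U U a b | a b. a \<in> H \<and> b \<in> H}) \<and>
     (\<forall>x\<in>H. \<epsilon> x \<in> \<int>) \<and>
     (\<forall>x\<in>H. S x \<in> H)"

primrec falling :: "(rat, 'u) module \<Rightarrow> 'u \<Rightarrow> nat \<Rightarrow> 'u" where
  "falling U y 0 = \<one>\<^bsub>U\<^esub>"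
| "falling U y (Suc t) = falling U y t \<otimes>\<^bsub>U\<^esub> (y \<ominus>\<^bsub>U\<^esub> (of_nat t \<odot>\<^bsub>U\<^esub> \<one>\<^bsub>U\<^esub>))"

definition binom :: "(rat, 'u) module \<Rightarrow> 'u \<Rightarrow> nat \<Rightarrow> 'u" where
  "binom U y t = (1 / fact t) \<odot>\<^bsub>U\<^esub> falling U y t"


section \<open>Periodic matrices\<close>

definition per_mats :: "nat \<Rightarrow> (int \<Rightarrow> int \<Rightarrow> 'a::zero) set" where
  "per_mats n = {A. (\<forall>i j. A i j = A (i + int n) (j + int n)) \<and>
     (\<forall>i. finite {j. A i j \<noteq> 0}) \<and> (\<forall>j. finite {i. A i j \<noteq> 0})}"

definition Emat :: "nat \<Rightarrow> int \<Rightarrow> int \<Rightarrow> int \<Rightarrow> int \<Rightarrow> 'a::zero_neq_one" where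
  "Emat n i j = (\<lambda>k l. if \<exists>s. k = i + s * int n \<and> l = j + s * int n then 1 else 0)"

definition mat_alg :: "nat \<Rightarrow> (rat, int \<Rightarrow> int \<Rightarrow> rat) module" where
  "mat_alg n =
    \<lparr>carrier = per_mats n,
     mult = (\<lambda>A B i j. \<Sum>k | A i k \<noteq> 0. A i k * B k j),
     one = (\<lambda>i j. if i = j then 1 else 0),
     zero = (\<lambda>i j. 0),
     add = (\<lambda>A B i j. A i j + B i j),
     smult = (\<lambda>r A i j. r * A i j)\<rparr>"

definition Theta_plus :: "nat \<Rightarrow> (int \<Rightarrow> int \<Rightarrow> nat) set" where
  "Theta_plus n = {A \<in> per_mats n. \<forall>i j. i \<ge> j \<longrightarrow> A i j = 0}"

definition per_seqs :: "nat \<Rightarrow> (int \<Rightarrow> nat) set" where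
  "per_seqs n = {l. \<forall>i. l (i + int n) = l i}"

definition ss_mat :: "nat \<Rightarrow> (int \<Rightarrow> nat) \<Rightarrow> int \<Rightarrow> int \<Rightarrow> nat" where
  "ss_mat n \<mu> = (\<lambda>k l. \<Sum>i = 1..int n. \<mu> i * Emat n i (i + 1) k l)"


section \<open>Representations of the cyclic quiver\<close>

text \<open>The vertices are the residues \<open>{0..<int n}\<close>, with arrows \<open>i \<rightarrow> (i + 1) mod n\<close>. A representation
  consists of the vector spaces at the vertices and the maps along the arrows, indexed by their
  sources.\<close>

type_synonym ('f, 'v) rep = "(int \<Rightarrow> ('f, 'v) module) \<times> (int \<Rightarrow> 'v \<Rightarrow> 'v)"

definition rep_iso :: "nat \<Rightarrow> ('f, 'm) ring_scheme \<Rightarrow> ('f, 'v) rep \<Rightarrow> ('f, 'w) rep \<Rightarrow> bool" where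
  "rep_iso n F M N \<longleftrightarrow> (case M of (V, f) \<Rightarrow> case N of (W, g) \<Rightarrow>
     \<exists>h. \<forall>i\<in>{0..<int n}.
       bij_betw (h i) (carrier (V i)) (carrier (W i)) \<and>
       (\<forall>x\<in>carrier (V i). \<forall>y\<in>carrier (V i). h i (x \<oplus>\<^bsub>V i\<^esub> y) = h i x \<oplus>\<^bsub>W i\<^esub> h i y) \<and>
       (\<forall>a\<in>carrier F. \<forall>x\<in>carrier (V i). h i (a \<odot>\<^bsub>V i\<^esub> x) = a \<odot>\<^bsub>W i\<^esub> h i x) \<and>
       (\<forall>x\<in>carrier (V i). h ((i + 1) mod int n) (f i x) = g i (h i x)))"

definition is_subrep ::
  "nat \<Rightarrow> ('f, 'm) ring_scheme \<Rightarrow> ('f, 'v) rep \<Rightarrow> (int \<Rightarrow> 'v set) \<Rightarrow> bool" where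
  "is_subrep n F M N \<longleftrightarrow> (case M of (V, f) \<Rightarrow>
     N \<in> extensional {0..<int n} \<and>
     (\<forall>i\<in>{0..<int n}. submodule (N i) F (V i) \<and> f i ` N i \<subseteq> N ((i + 1) mod int n)))"

definition sub_rep :: "('f, 'v) rep \<Rightarrow> (int \<Rightarrow> 'v set) \<Rightarrow> ('f, 'v) rep" where
  "sub_rep M N = (case M of (V, f) \<Rightarrow> (\<lambda>i. (V i)\<lparr>carrier := N i\<rparr>, f))"

definition quot_rep :: "nat \<Rightarrow> ('f, 'v) rep \<Rightarrow> (int \<Rightarrow> 'v set) \<Rightarrow> ('f, 'v set) rep" where
  "quot_rep n M N = (case M of (V, f) \<Rightarrow>
     (\<lambda>i. quot_alg (V i) (N i),
      \<lambda>i X. let i' = (i + 1) mod int n in \<Union>x\<in>X. N i' +>\<^bsub>V i'\<^esub> f i x))"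

text \<open>\<open>M\<^sup>i\<^sup>,\<^sup>j\<close> has a basis \<open>e\<^sub>i, \<dots>, e\<^sub>j\<^sub>-\<^sub>1\<close> with \<open>e\<^sub>k\<close> at the vertex \<open>k mod n\<close> and arrows acting by
  \<open>e\<^sub>k \<mapsto> e\<^sub>k\<^sub>+\<^sub>1\<close>, where \<open>e\<^sub>j = 0\<close>. The tuple \<open>(i, j, c, k)\<close> stands for \<open>e\<^sub>k\<close> in the copy number
  \<open>c < A i j\<close> of \<open>M\<^sup>i\<^sup>,\<^sup>j\<close> in \<open>M(A)\<close>; a vector is its coordinate function.\<close>

type_synonym bas = "int \<times> int \<times> nat \<times> int"

definition rep_basis :: "nat \<Rightarrow> (int \<Rightarrow> int \<Rightarrow> nat) \<Rightarrow> int \<Rightarrow> bas set" where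
  "rep_basis n A v = {(i, j, c, k).
     1 \<le> i \<and> i \<le> int n \<and> i < j \<and> c < A i j \<and> i \<le> k \<and> k < j \<and> k mod int n = v}"

definition rep_of ::
  "nat \<Rightarrow> ('f, 'm) ring_scheme \<Rightarrow> (int \<Rightarrow> int \<Rightarrow> nat) \<Rightarrow> ('f, bas \<Rightarrow> 'f) rep" where
  "rep_of n F A =
    (\<lambda>v. \<lparr>carrier = {x. (\<forall>b. x b \<in> carrier F) \<and> (\<forall>b. b \<notin> rep_basis n A v \<longrightarrow> x b = \<zero>\<^bsub>F\<^esub>)},
          mult = undefined,
          one = undefined,
          zero = (\<lambda>b. \<zero>\<^bsub>F\<^esub>),
          add = (\<lambda>x y b. x b \<oplus>\<^bsub>F\<^esub> y b),
          smult = (\<lambda>a x b. a \<otimes>\<^bsub>F\<^esub> x b)\<rparr>,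
     \<lambda>v x (i, j, c, k). if k < j then x (i, j, c, k - 1) else \<zero>\<^bsub>F\<^esub>)"

definition dim_vec :: "nat \<Rightarrow> (int \<Rightarrow> int \<Rightarrow> nat) \<Rightarrow> int \<Rightarrow> nat" where
  "dim_vec n A v = card (rep_basis n A v)"

definition euler_form :: "nat \<Rightarrow> (int \<Rightarrow> nat) \<Rightarrow> (int \<Rightarrow> nat) \<Rightarrow> int" where
  "euler_form n a b =
    (\<Sum>i\<in>{0..<int n}. int (a i) * int (b i)) -
    (\<Sum>i\<in>{0..<int n}. int (a i) * int (b ((i + 1) mod int n)))"


section \<open>The Ringel--Hall algebra\<close>

definition hall_number ::
  "nat \<Rightarrow> ('f, 'm) ring_scheme \<Rightarrow> (int \<Rightarrow> int \<Rightarrow> nat) \<Rightarrow> (int \<Rightarrow> int \<Rightarrow> nat)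
     \<Rightarrow> (int \<Rightarrow> int \<Rightarrow> nat) \<Rightarrow> nat" where
  "hall_number n F A B C = card {N. is_subrep n F (rep_of n F C) N \<and>
     rep_iso n F (sub_rep (rep_of n F C) N) (rep_of n F B) \<and>
     rep_iso n F (quot_rep n (rep_of n F C) N) (rep_of n F A)}"

type_synonym hall_polys =
  "(int \<Rightarrow> int \<Rightarrow> nat) \<Rightarrow> (int \<Rightarrow> int \<Rightarrow> nat) \<Rightarrow> (int \<Rightarrow> int \<Rightarrow> nat) \<Rightarrow> int poly"

text \<open>\<open>\<phi> A B C\<close> is the Hall polynomial \<open>\<phi>\<^sup>C\<^sub>A\<^sub>,\<^sub>B\<close>, as a polynomial in the variable \<open>v\<^sup>2\<close>. Every finite
  field is isomorphic to one whose elements are natural numbers.\<close>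

definition hall_polynomials :: "nat \<Rightarrow> hall_polys \<Rightarrow> bool" where
  "hall_polynomials n \<phi> \<longleftrightarrow>
    (\<forall>A\<in>Theta_plus n. \<forall>B\<in>Theta_plus n. \<forall>C\<in>Theta_plus n. \<forall>F :: nat ring.
       field F \<longrightarrow> finite (carrier F) \<longrightarrow>
       poly (\<phi> A B C) (int (card (carrier F))) = int (hall_number n F A B C))"

text \<open>Laurent polynomials in \<open>v\<close> with integer coefficients; the basis element at \<open>k\<close> is \<open>v\<^sup>k\<close>.\<close>

type_synonym laurent = "int \<Rightarrow>\<^sub>0 int"

definition v_pow :: "int \<Rightarrow> laurent" where
  "v_pow k = Poly_Mapping.single k 1"

definition in_v2 :: "int poly \<Rightarrow> laurent" where
  "in_v2 p = (\<Sum>k\<le>Polynomial.degree p. Poly_Mapping.single (2 * int k) (Polynomial.coeff p k))"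

definition at_one :: "laurent \<Rightarrow> int" where
  "at_one p = (\<Sum>k\<in>Poly_Mapping.keys p. Poly_Mapping.lookup p k)"

definition hall_const ::
  "nat \<Rightarrow> hall_polys \<Rightarrow> (int \<Rightarrow> int \<Rightarrow> nat) \<Rightarrow> (int \<Rightarrow> int \<Rightarrow> nat) \<Rightarrow> (int \<Rightarrow> int \<Rightarrow> nat) \<Rightarrow> laurent" where
  "hall_const n \<phi> A B C = v_pow (euler_form n (dim_vec n A) (dim_vec n B)) * in_v2 (\<phi> A B C)"

text \<open>The Hall algebra over the Laurent polynomials is free with basis \<open>u\<^sub>A\<close> and structure constants
  \<^const>\<open>hall_const\<close>; hence its base change along \<open>v \<mapsto> 1\<close> is free with basis \<open>u\<^sub>A \<otimes> 1\<close>
  and the structure constants evaluated at \<open>v = 1\<close>. The coefficient ring \<open>'k\<close> is \<open>int\<close> or \<open>rat\<close>.\<close>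

definition hall_generic :: "nat \<Rightarrow> hall_polys \<Rightarrow> (laurent, (int \<Rightarrow> int \<Rightarrow> nat) \<Rightarrow> laurent) module" where
  "hall_generic n \<phi> = basis_alg (Theta_plus n) (hall_const n \<phi>) (\<lambda>i j. 0)"

definition hall_at_one ::
  "nat \<Rightarrow> hall_polys \<Rightarrow> ('k::comm_ring_1, (int \<Rightarrow> int \<Rightarrow> nat) \<Rightarrow> 'k) module" where
  "hall_at_one n \<phi> =
     basis_alg (Theta_plus n) (\<lambda>A B C. of_int (at_one (hall_const n \<phi> A B C))) (\<lambda>i j. 0)"

definition hall_Z :: "nat \<Rightarrow> hall_polys \<Rightarrow> (int, (int \<Rightarrow> int \<Rightarrow> nat) \<Rightarrow> int) module" where
  "hall_Z n \<phi> = hall_at_one n \<phi>"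

definition hall_Q :: "nat \<Rightarrow> hall_polys \<Rightarrow> (rat, (int \<Rightarrow> int \<Rightarrow> nat) \<Rightarrow> rat) module" where
  "hall_Q n \<phi> = hall_at_one n \<phi>"

definition hall_Z_in_Q :: "nat \<Rightarrow> hall_polys \<Rightarrow> ((int \<Rightarrow> int \<Rightarrow> nat) \<Rightarrow> rat) set" where
  "hall_Z_in_Q n \<phi> = (\<lambda>f A. of_int (f A)) ` carrier (hall_Z n \<phi>)"


section \<open>The enveloping algebra of affine gl and its integral form\<close>

text \<open>The loop algebra of \<open>gl\<^sub>n\<close> over the rationals is identified with the periodic matrices.\<close>

type_synonym ugl = "((int \<Rightarrow> int \<Rightarrow> rat) list \<Rightarrow> rat) set"

type_synonym iota = "((int \<Rightarrow> int \<Rightarrow> nat) \<Rightarrow> rat) \<Rightarrow> ugl"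

definition Ugl :: "nat \<Rightarrow> (rat, ugl) module" where
  "Ugl n = env_alg (mat_alg n)"

definition UE :: "nat \<Rightarrow> int \<Rightarrow> int \<Rightarrow> ugl" where
  "UE n i j = env_gen (mat_alg n) (Emat n i j)"

definition is_iota_plus :: "nat \<Rightarrow> hall_polys \<Rightarrow> iota \<Rightarrow> bool" where
  "is_iota_plus n \<phi> \<iota> \<longleftrightarrow>
     \<iota> \<in> alg_hom (hall_Q n \<phi>) (Ugl n) \<and> inj_on \<iota> (carrier (hall_Q n \<phi>)) \<and>
     (\<forall>i j. i < j \<longrightarrow> \<iota> (bvec (Emat n i j)) = UE n i j)"

definition is_iota_minus :: "nat \<Rightarrow> hall_polys \<Rightarrow> iota \<Rightarrow> bool" where
  "is_iota_minus n \<phi> \<iota> \<longleftrightarrow>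
     \<iota> \<in> alg_hom (op_alg (hall_Q n \<phi>)) (Ugl n) \<and> inj_on \<iota> (carrier (hall_Q n \<phi>)) \<and>
     (\<forall>i j. i < j \<longrightarrow> \<iota> (bvec (Emat n i j)) = UE n j i)"

definition UZ_zero :: "nat \<Rightarrow> ugl set" where
  "UZ_zero n = Z_span (Ugl n)
     {foldr (mult (Ugl n)) (map (\<lambda>i. binom (Ugl n) (UE n i i) (l i)) [1..int n]) \<one>\<^bsub>Ugl n\<^esub> | l.
        l \<in> per_seqs n}"

definition UZ :: "nat \<Rightarrow> hall_polys \<Rightarrow> iota \<Rightarrow> iota \<Rightarrow> ugl set" where
  "UZ n \<phi> \<iota>p \<iota>m = Z_span (Ugl n)
     {x \<otimes>\<^bsub>Ugl n\<^esub> y \<otimes>\<^bsub>Ugl n\<^esub> z | x y z.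
        x \<in> \<iota>p ` hall_Z_in_Q n \<phi> \<and> y \<in> UZ_zero n \<and> z \<in> \<iota>m ` hall_Z_in_Q n \<phi>}"

definition splittings :: "nat \<Rightarrow> (int \<Rightarrow> nat) \<Rightarrow> ((int \<Rightarrow> nat) \<times> (int \<Rightarrow> nat)) set" where
  "splittings n l =
     {(l1, l2). l1 \<in> per_seqs n \<and> l2 \<in> per_seqs n \<and> (\<forall>i. l i = l1 i + l2 i)}"

abbreviation u_lam :: "nat \<Rightarrow> (int \<Rightarrow> nat) \<Rightarrow> (int \<Rightarrow> int \<Rightarrow> nat) \<Rightarrow> rat" where
  "u_lam n l \<equiv> bvec (ss_mat n l)"

end

theory Submission
  imports Defs "HOL-Library.Multiset"
begin

text \<open>
  Let \<open>U\<close> be the enveloping algebra. The elements \<open>w\<^sub>A = \<iota>\<^sup>+(u\<^sub>A)\<close> satisfy a rule of divided-power type for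
  multiplication by a single root vector \<open>b = (i, j)\<close>,
  \<open>w\<^sub>b w\<^sub>A = (A\<^sub>b + 1) w\<^bsub>A+b\<^esub> + (\<Sum>c. ((A - c)\<^bsub>bc\<^esub> + 1) w\<^bsub>A-c+bc\<^esub>)\<close>,
  where \<open>A\<close> is a multiset of pairs and \<open>bc\<close> is the product of matrix units, defined only for some pairs;
  the elements \<open>\<iota>\<^sup>-(u\<^sub>A)\<close> satisfy it in the opposite algebra, and the binomials in one \<open>E\<^sub>i\<^sub>i\<close> satisfy it
  with \<open>bb = b\<close>. A solution of this recursion (a family, predicate \<open>fam\<close>) is determined by its
  values at singletons. That one remark yields all formulas: if the generators are sums of generators
  of two commuting families, the family is their convolution (\<open>fam_conv\<close>), which is the coproduct
  formula; the same comparison gives the recursion for the antipode (\<open>fam_antipode\<close>); and if the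
  generators multiply exactly like the matrix units, the family vanishes on multisets of size at
  least two (\<open>fam_vanish\<close>).

  For the Hall algebra the rule (\<open>hall_fam\<close>) needs only the values at 1 of the Hall polynomials for a
  quotient \<open>M\<^sup>i\<^sup>,\<^sup>j\<close>. Over a field with \<open>p\<close> elements, scale one indecomposable summand of \<open>M(C)\<close> at a
  time. A subrepresentation is either stable under the projection to that summand or lies in an
  orbit of size \<open>p - 1\<close>. Hence, modulo \<open>p - 1\<close>, the Hall number is the number of subrepresentations
  spanned by tails of the summands, which is a combinatorial number independent of \<open>p\<close>
  (\<open>torus_count\<close>, \<open>fixed_count\<close>). As the Hall polynomial takes congruent values at \<open>p\<close> and at 1 modulo
  \<open>p - 1\<close>, and there are infinitely many primes, this number is its value at 1 (\<open>hall_poly_one\<close>).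

  The integral form is closed under multiplication because it has an intrinsic description. Let \<open>U\<close>
  act on functions on words, diagonally in the positions of a word, where one letter behaves like
  the matrix algebra with a unit adjoined. Call \<open>u\<close> integral if it preserves integer-valued functions
  (\<open>Wint\<close>). Integral elements visibly form a ring. They contain all families above: by the coproduct
  rule the action of \<open>w\<^sub>A\<close> distributes over the positions, and at a single position only multisets of
  size at most one act, by \<open>fam_vanish\<close> (\<open>fam_integral\<close>). Conversely, a triangular product \<open>z\<^sub>D\<close> of an
  element of the positive family, binomials and an element of the negative family has, for the
  filtration by word length, the leading term \<open>1 / \<Prod>D\<^sub>c!\<close> times the word \<open>D\<close>. Applying such an
  element to the indicator function of a word of matrix units and evaluating at the word of units
  reads off coefficients of leading terms, and the factorials cancel (\<open>kap_lead\<close>). So an integral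
  element has integral leading coefficients with respect to the \<open>z\<^sub>D\<close>, and by induction on the
  filtration it is an integral combination of them (\<open>Wint_span\<close>). Thus the integral form equals the
  ring of integral elements (\<open>H_eq_Wint\<close>), and its closure under products needs no straightening of products of the three parts. Compatibility with
  coproduct and antipode is then checked on generators.
\<close>

section \<open>Associative algebras over the rationals\<close>

locale Qalg = ring M for M :: "(rat, 'a) module" (structure) +
  assumes sm_closed [simp, intro]: "x \<in> carrier M \<Longrightarrow> a \<odot> x \<in> carrier M"
    and sm_ladd: "x \<in> carrier M \<Longrightarrow> (a + b) \<odot> x = a \<odot> x \<oplus> b \<odot> x"
    and sm_radd: "x \<in> carrier M \<Longrightarrow> y \<in> carrier M \<Longrightarrow> a \<odot> (x \<oplus> y) = a \<odot> x \<oplus> a \<odot> y"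
    and sm_assoc: "x \<in> carrier M \<Longrightarrow> (a * b) \<odot> x = a \<odot> (b \<odot> x)"
    and sm_one [simp]: "x \<in> carrier M \<Longrightarrow> 1 \<odot> x = x"
    and sm_lmult: "x \<in> carrier M \<Longrightarrow> y \<in> carrier M \<Longrightarrow> (a \<odot> x) \<otimes> y = a \<odot> (x \<otimes> y)"
    and sm_rmult: "x \<in> carrier M \<Longrightarrow> y \<in> carrier M \<Longrightarrow> x \<otimes> (a \<odot> y) = a \<odot> (x \<otimes> y)"
begin

lemma sm_zero [simp]: "x \<in> carrier M \<Longrightarrow> 0 \<odot> x = \<zero>"
  using sm_ladd[of x 0 0] by (simp add: a_closed)

lemma sm_rzero [simp]: "a \<odot> \<zero> = \<zero>"
  using sm_radd[of "\<zero>" "\<zero>" a] by simp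

lemma sm_uminus: "x \<in> carrier M \<Longrightarrow> (- a) \<odot> x = \<ominus> (a \<odot> x)"
  using sm_ladd[of x "-a" a] by (simp add: minus_equality)

lemma sm_ruminus: "x \<in> carrier M \<Longrightarrow> a \<odot> (\<ominus> x) = \<ominus> (a \<odot> x)"
  using sm_radd[of "\<ominus> x" x a] by (simp add: minus_equality l_neg)

lemma sm_m1: "x \<in> carrier M \<Longrightarrow> (- 1) \<odot> x = \<ominus> x"
  using sm_uminus[of x 1] by simp

lemma sm_finsum: "f \<in> A \<rightarrow> carrier M \<Longrightarrow> a \<odot> finsum M f A = finsum M (\<lambda>x. a \<odot> f x) A"
proof (induction A rule: infinite_finite_induct)
  case (insert x F)
  then have "f \<in> F \<rightarrow> carrier M" "f x \<in> carrier M" by auto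
  with insert show ?case by (simp add: sm_radd finsum_closed Pi_iff)
qed (auto)

lemma Qalg_op: "Qalg (op_alg M)"
proof -
  have r: "ring (op_alg M)"
    by (rule ringI; (rule abelian_groupI monoidI)?)
      (auto simp: op_alg_def m_assoc a_assoc a_comm l_distr r_distr a_ac intro!: bexI[of _ "\<ominus>\<^bsub>M\<^esub> x" for x] l_neg)
  show ?thesis
    by (intro Qalg.intro r Qalg_axioms.intro)
      (auto simp: op_alg_def sm_ladd sm_radd sm_assoc sm_lmult sm_rmult)
qed

end

text \<open>The algebra axioms pass along surjections that respect all operations; this covers every quotient
  used below.\<close>

lemma Qalg_image:
  fixes M :: "(rat, 'a) module" and N :: "(rat, 'b) module"
  assumes "Qalg M" and c: "carrier N = h ` carrier M"
    and a: "\<And>x y. x \<in> carrier M \<Longrightarrow> y \<in> carrier M \<Longrightarrow> h x \<oplus>\<^bsub>N\<^esub> h y = h (x \<oplus>\<^bsub>M\<^esub> y)"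
    and m: "\<And>x y. x \<in> carrier M \<Longrightarrow> y \<in> carrier M \<Longrightarrow> h x \<otimes>\<^bsub>N\<^esub> h y = h (x \<otimes>\<^bsub>M\<^esub> y)"
    and s: "\<And>r x. x \<in> carrier M \<Longrightarrow> r \<odot>\<^bsub>N\<^esub> h x = h (r \<odot>\<^bsub>M\<^esub> x)"
    and z: "\<zero>\<^bsub>N\<^esub> = h \<zero>\<^bsub>M\<^esub>" and o: "\<one>\<^bsub>N\<^esub> = h \<one>\<^bsub>M\<^esub>"
  shows "Qalg N" and "h \<in> alg_hom M N"
proof -
  interpret A: Qalg M by fact
  have r: "ring N"
  proof (rule ringI)
    show "abelian_group N"
    proof (rule abelian_groupI)
      fix x assume "x \<in> carrier N"
      then obtain x' where "x' \<in> carrier M" "x = h x'" by (auto simp: c)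
      then show "\<exists>y\<in>carrier N. y \<oplus>\<^bsub>N\<^esub> x = \<zero>\<^bsub>N\<^esub>"
        by (intro bexI[of _ "h (\<ominus>\<^bsub>M\<^esub> x')"]) (auto simp: c a z A.l_neg)
    next
      fix x y assume "x \<in> carrier N" "y \<in> carrier N"
      then obtain x' y' where "x' \<in> carrier M" "x = h x'" "y' \<in> carrier M" "y = h y'" by (auto simp: c)
      then show "x \<oplus>\<^bsub>N\<^esub> y = y \<oplus>\<^bsub>N\<^esub> x" using A.a_comm[of x' y'] by (simp add: a)
    qed (auto simp: c a z A.a_assoc)
    show "monoid N" by (rule monoidI) (auto simp: c m o A.m_assoc)
  qed (auto simp: c m a A.l_distr A.r_distr)
  show "Qalg N"
    by (intro Qalg.intro r Qalg_axioms.intro)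
      (auto simp: c m a s A.sm_ladd A.sm_radd A.sm_assoc A.sm_lmult A.sm_rmult)
  show "h \<in> alg_hom M N"
    by (auto simp: alg_hom_def ring_hom_def c a m s o)
qed

section \<open>Quotients\<close>

context Qalg begin

lemma quot_alg_Qalg:
  assumes J: "ideal J M" and sJ: "\<And>r x. x \<in> J \<Longrightarrow> r \<odot> x \<in> J"
  shows "Qalg (quot_alg M J)" and "(+>) J \<in> alg_hom M (quot_alg M J)"
proof -
  interpret J: ideal J M by fact
  have 1: "carrier (quot_alg M J) = (+>) J ` carrier M"
    by (auto simp: quot_alg_def A_RCOSETS_def')
  have 2: "(J +> x) \<oplus>\<^bsub>quot_alg M J\<^esub> (J +> y) = J +> (x \<oplus> y)" if "x \<in> carrier M" "y \<in> carrier M" for x y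
    using that by (simp add: quot_alg_def J.a_rcos_sum)
  have 3: "(J +> x) \<otimes>\<^bsub>quot_alg M J\<^esub> (J +> y) = J +> (x \<otimes> y)" if "x \<in> carrier M" "y \<in> carrier M" for x y
    using that by (simp add: quot_alg_def J.rcoset_mult_add)
  have 4: "r \<odot>\<^bsub>quot_alg M J\<^esub> (J +> x) = J +> (r \<odot> x)" if x: "x \<in> carrier M" for r x
  proof -
    have "J +> (r \<odot> y) = J +> (r \<odot> x)" if y: "y \<in> J +> x" for y
    proof -
      from y obtain k where k: "k \<in> J" "y = k \<oplus> x" by (auto simp: a_r_coset_def')
      then have kc: "k \<in> carrier M" using J.a_Hcarr by auto
      have 1: "r \<odot> y = r \<odot> k \<oplus> r \<odot> x" using k kc x by (simp add: sm_radd)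
      have 2: "r \<odot> k \<in> J" using k sJ by auto
      have "r \<odot> y \<in> J +> (r \<odot> x)" unfolding a_r_coset_def' by (rule UN_I[OF 2]) (simp add: 1)
      from a_repr_independence[OF this sm_closed[OF x] J.a_subgroup] show ?thesis by (rule sym)
    qed
    then have "(\<Union>y\<in>J +> x. J +> (r \<odot> y)) = (\<Union>y\<in>J +> x. J +> (r \<odot> x))" by (rule SUP_cong[OF refl])
    also have "\<dots> = J +> (r \<odot> x)" using J.a_rcos_self[OF x] by (subst UN_constant) auto
    finally show ?thesis by (simp add: quot_alg_def)
  qed
  have 5: "\<zero>\<^bsub>quot_alg M J\<^esub> = J +> \<zero>" using J.a_subset by (simp add: quot_alg_def)
  have 6: "\<one>\<^bsub>quot_alg M J\<^esub> = J +> \<one>" by (simp add: quot_alg_def)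
  show "Qalg (quot_alg M J)" by (rule Qalg_image[OF Qalg_axioms 1 2 3 4 5 6])
  show "(+>) J \<in> alg_hom M (quot_alg M J)" by (rule Qalg_image[OF Qalg_axioms 1 2 3 4 5 6])
qed

text \<open>An ideal absorbs \<open>r \<odot> 1\<close>, hence is stable under scalars.\<close>
lemma ideal_smult: "ideal J M \<Longrightarrow> x \<in> J \<Longrightarrow> r \<odot> x \<in> J"
  using ideal.I_l_closed[of J M x "r \<odot> \<one>"] ideal.Icarr[of J M x]
  by (simp add: sm_lmult)

end

lemma alg_homD:
  assumes "h \<in> alg_hom M N"
  shows "x \<in> carrier M \<Longrightarrow> h x \<in> carrier N"
    and "x \<in> carrier M \<Longrightarrow> y \<in> carrier M \<Longrightarrow> h (x \<oplus>\<^bsub>M\<^esub> y) = h x \<oplus>\<^bsub>N\<^esub> h y"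
    and "x \<in> carrier M \<Longrightarrow> y \<in> carrier M \<Longrightarrow> h (x \<otimes>\<^bsub>M\<^esub> y) = h x \<otimes>\<^bsub>N\<^esub> h y"
    and "x \<in> carrier M \<Longrightarrow> h (r \<odot>\<^bsub>M\<^esub> x) = r \<odot>\<^bsub>N\<^esub> h x"
    and "h \<one>\<^bsub>M\<^esub> = \<one>\<^bsub>N\<^esub>"
  using assms by (auto simp: alg_hom_def ring_hom_def)

lemma alg_homI:
  assumes "\<And>x. x \<in> carrier M \<Longrightarrow> h x \<in> carrier N"
    and "\<And>x y. x \<in> carrier M \<Longrightarrow> y \<in> carrier M \<Longrightarrow> h (x \<oplus>\<^bsub>M\<^esub> y) = h x \<oplus>\<^bsub>N\<^esub> h y"
    and "\<And>x y. x \<in> carrier M \<Longrightarrow> y \<in> carrier M \<Longrightarrow> h (x \<otimes>\<^bsub>M\<^esub> y) = h x \<otimes>\<^bsub>N\<^esub> h y"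
    and "\<And>r x. x \<in> carrier M \<Longrightarrow> h (r \<odot>\<^bsub>M\<^esub> x) = r \<odot>\<^bsub>N\<^esub> h x"
    and "h \<one>\<^bsub>M\<^esub> = \<one>\<^bsub>N\<^esub>"
  shows "h \<in> alg_hom M N"
  using assms by (auto simp: alg_hom_def ring_hom_def)

locale Qalg_hom = A: Qalg M + B: Qalg N for M :: "(rat, 'a) module" and N :: "(rat, 'b) module" +
  fixes h assumes hom: "h \<in> alg_hom M N"
begin
lemmas hclosed [simp] = alg_homD(1)[OF hom]
lemmas hadd = alg_homD(2)[OF hom]
lemmas hmult = alg_homD(3)[OF hom]
lemmas hsm = alg_homD(4)[OF hom]
lemmas hone = alg_homD(5)[OF hom]

lemma hzero: "h \<zero>\<^bsub>M\<^esub> = \<zero>\<^bsub>N\<^esub>"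
  using hsm[of "\<zero>\<^bsub>M\<^esub>" 0] by simp

lemma huminus: "x \<in> carrier M \<Longrightarrow> h (\<ominus>\<^bsub>M\<^esub> x) = \<ominus>\<^bsub>N\<^esub> h x"
  using hsm[of x "-1"] by (simp add: A.sm_m1 B.sm_m1)

lemma hminus: "x \<in> carrier M \<Longrightarrow> y \<in> carrier M \<Longrightarrow> h (x \<ominus>\<^bsub>M\<^esub> y) = h x \<ominus>\<^bsub>N\<^esub> h y"
  by (simp add: a_minus_def hadd huminus)

lemma ring_hom_ring_h: "ring_hom_ring M N h"
  using hom by (auto simp: alg_hom_def intro!: ring_hom_ringI2 A.ring_axioms B.ring_axioms)

text \<open>Universal property of a quotient. The induced map evaluates \<open>h\<close> at a chosen representative of a
  coset, which is harmless as \<open>h\<close> kills \<open>J\<close>.\<close>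

lemma quot_factor:
  assumes J: "ideal J M" and k: "\<And>x. x \<in> J \<Longrightarrow> h x = \<zero>\<^bsub>N\<^esub>"
  obtains g where "g \<in> alg_hom (quot_alg M J) N" "\<And>x. x \<in> carrier M \<Longrightarrow> g (J +>\<^bsub>M\<^esub> x) = h x"
proof -
  interpret J: ideal J M by fact
  define g where "g X = h (SOME x. x \<in> X)" for X
  have g: "g (J +>\<^bsub>M\<^esub> x) = h x" if x: "x \<in> carrier M" for x
  proof -
    have "x \<in> J +>\<^bsub>M\<^esub> x" using x J.a_rcos_self by simp
    then have "(SOME y. y \<in> J +>\<^bsub>M\<^esub> x) \<in> J +>\<^bsub>M\<^esub> x" by (rule someI)
    then obtain k where k: "k \<in> J" "(SOME y. y \<in> J +>\<^bsub>M\<^esub> x) = k \<oplus>\<^bsub>M\<^esub> x"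
      by (auto simp: a_r_coset_def')
    then have kc: "k \<in> carrier M" using J.a_Hcarr by auto
    have "h (k \<oplus>\<^bsub>M\<^esub> x) = h x" using kc x assms(2)[OF k(1)] by (simp add: hadd)
    then show ?thesis using k(2) by (simp add: g_def)
  qed
  have sJ: "\<And>r x. x \<in> J \<Longrightarrow> r \<odot>\<^bsub>M\<^esub> x \<in> J" using A.ideal_smult[OF J] by auto
  note q = A.quot_alg_Qalg[OF J sJ]
  note qh = alg_homD[OF q(2)]
  have c: "carrier (quot_alg M J) = (+>\<^bsub>M\<^esub>) J ` carrier M"
    by (auto simp: quot_alg_def A_RCOSETS_def')
  have "g \<in> alg_hom (quot_alg M J) N"
  proof (rule alg_homI, goal_cases)
    case 1 then show ?case by (auto simp: c g) next
    case 2 then show ?case by (auto simp: c g qh(2)[symmetric] hadd) next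
    case 3 then show ?case by (auto simp: c g qh(3)[symmetric] hmult) next
    case 4 then show ?case by (auto simp: c g qh(4)[symmetric] hsm) next
    case 5 show ?case by (simp add: qh(5)[symmetric] g hone)
  qed
  then show ?thesis using g that by blast
qed

lemma vanish_genideal:
  assumes S: "S \<subseteq> carrier M" and k: "\<And>x. x \<in> S \<Longrightarrow> h x = \<zero>\<^bsub>N\<^esub>"
  shows "x \<in> genideal M S \<Longrightarrow> h x = \<zero>\<^bsub>N\<^esub>"
proof -
  have "ideal (a_kernel M N h) M" by (rule ring_hom_ring.kernel_is_ideal[OF ring_hom_ring_h])
  then have "genideal M S \<subseteq> a_kernel M N h"
    by (rule A.genideal_minimal) (use S k in \<open>auto simp: a_kernel_def'\<close>)
  then show "x \<in> genideal M S \<Longrightarrow> h x = \<zero>\<^bsub>N\<^esub>" by (auto simp: a_kernel_def')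
qed

end

lemma op_alg_sel [simp]: "carrier (op_alg M) = carrier M" "add (op_alg M) = add M" "zero (op_alg M) = zero M"
  "one (op_alg M) = one M" "smult (op_alg M) = smult M" "x \<otimes>\<^bsub>op_alg M\<^esub> y = y \<otimes>\<^bsub>M\<^esub> x"
  by (auto simp: op_alg_def)

lemma op_alg_op [simp]: "op_alg (op_alg M) = M" by (simp add: op_alg_def)

lemma alg_hom_op: "f \<in> alg_hom A B \<Longrightarrow> f \<in> alg_hom (op_alg A) (op_alg B)"
  by (rule alg_homI) (auto dest: alg_homD)

lemma finsum_op [simp]: "finsum (op_alg M) = finsum M"
proof -
  have "add_monoid (op_alg M) = add_monoid M" by (simp add: op_alg_def)
  then show ?thesis unfolding finsum_def by (rule arg_cong)
qed

section \<open>Monoid algebras\<close>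

definition supp :: "('x \<Rightarrow> rat) \<Rightarrow> 'x set" where "supp f = {x. f x \<noteq> 0}"

text \<open>The reordering of sums behind associativity of a convolution product.\<close>

lemma sum_rotate4:
  "(\<Sum>u\<in>U. \<Sum>w\<in>W. \<Sum>x\<in>X. \<Sum>y\<in>Y. g u w x y) = (\<Sum>x\<in>X. \<Sum>y\<in>Y. \<Sum>w\<in>W. \<Sum>u\<in>U. g u w x y)"
proof -
  have "(\<Sum>u\<in>U. \<Sum>w\<in>W. \<Sum>x\<in>X. \<Sum>y\<in>Y. g u w x y) = (\<Sum>w\<in>W. \<Sum>x\<in>X. \<Sum>y\<in>Y. \<Sum>u\<in>U. g u w x y)"
    by (subst sum.swap, intro sum.cong refl, subst sum.swap, intro sum.cong refl, rule sum.swap)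
  also have "\<dots> = (\<Sum>x\<in>X. \<Sum>y\<in>Y. \<Sum>w\<in>W. \<Sum>u\<in>U. g u w x y)"
    by (subst sum.swap, intro sum.cong refl, rule sum.swap)
  finally show ?thesis .
qed

lemma monoid_alg_sel:
  fixes G :: "('x, 'm) monoid_scheme"
  defines "M \<equiv> monoid_alg G :: (rat, 'x \<Rightarrow> rat) module"
  shows "carrier M = {f. finite (supp f) \<and> supp f \<subseteq> carrier G}"
    "add M = (\<lambda>f g x. f x + g x)" "zero M = (\<lambda>x. 0)" "one M = bvec \<one>\<^bsub>G\<^esub>"
    "smult M = (\<lambda>a f x. a * f x)"
  by (auto simp: M_def monoid_alg_def basis_alg_def supp_def bvec_def)

context monoid begin

text \<open>The defining sum runs over the supports; being able to enlarge them to arbitrary finite sets is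
  what makes bilinearity and associativity provable by rearranging sums.\<close>

lemma monoid_alg_mult:
  assumes "finite S" "finite T" "S \<subseteq> carrier G" "T \<subseteq> carrier G" "supp f \<subseteq> S" "supp g \<subseteq> T"
  shows "mult (monoid_alg G) f g z = (\<Sum>x\<in>S. \<Sum>y\<in>T. f x * g y * (if x \<otimes> y = z then 1 else (0::rat)))"
proof (cases "z \<in> carrier G")
  case True
  have "(\<Sum>(x, y)\<in>supp f \<times> supp g. f x * g y * (if x \<otimes> y = z then 1 else (0::rat)))
    = (\<Sum>(x, y)\<in>S \<times> T. f x * g y * (if x \<otimes> y = z then 1 else (0::rat)))"
    using assms by (intro sum.mono_neutral_left) (auto simp: supp_def)
  with True show ?thesis
    by (simp add: monoid_alg_def basis_alg_def supp_def sum.cartesian_product)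
next
  case False
  then have "x \<otimes> y \<noteq> z" if "x \<in> S" "y \<in> T" for x y using that assms by auto
  with False show ?thesis by (simp add: monoid_alg_def basis_alg_def cong: sum.cong)
qed

lemma bvec_carrier: "x \<in> carrier G \<Longrightarrow> bvec x \<in> carrier (monoid_alg G :: (rat, 'a \<Rightarrow> rat) module)"
  by (auto simp: monoid_alg_sel supp_def bvec_def)

lemma supp_bvec: "supp (bvec x) = {x}" by (auto simp: supp_def bvec_def)

lemma bvec_mult:
  assumes "x \<in> carrier G" "y \<in> carrier G"
  shows "bvec x \<otimes>\<^bsub>monoid_alg G\<^esub> bvec y = (bvec (x \<otimes> y) :: _ \<Rightarrow> rat)"
  by (rule ext, subst monoid_alg_mult[of "{x}" "{y}"]) (use assms in \<open>auto simp: supp_bvec\<close>, auto simp: bvec_def)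

lemma supp_monoid_alg_mult:
  assumes "finite S" "finite T" "S \<subseteq> carrier G" "T \<subseteq> carrier G" "supp f \<subseteq> S" "supp g \<subseteq> T"
  shows "supp (mult (monoid_alg G) f g) \<subseteq> (\<lambda>(x, y). x \<otimes> y) ` (S \<times> T)"
proof
  fix z assume "z \<in> supp (mult (monoid_alg G) f g)"
  then have "(\<Sum>x\<in>S. \<Sum>y\<in>T. f x * g y * (if x \<otimes> y = z then 1 else (0::rat))) \<noteq> 0"
    unfolding monoid_alg_mult[OF assms, symmetric] by (simp add: supp_def)
  then obtain x where "x \<in> S" "(\<Sum>y\<in>T. f x * g y * (if x \<otimes> y = z then 1 else (0::rat))) \<noteq> 0"
    by (meson sum.not_neutral_contains_not_neutral)
  then obtain y where "x \<in> S" "y \<in> T" "f x * g y * (if x \<otimes> y = z then 1 else (0::rat)) \<noteq> 0"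
    by (meson sum.not_neutral_contains_not_neutral)
  then show "z \<in> (\<lambda>(x, y). x \<otimes> y) ` (S \<times> T)" by (auto split: if_splits)
qed

lemma supp_add: "supp (\<lambda>x. f x + g x) \<subseteq> supp f \<union> supp g" by (auto simp: supp_def)
lemma supp_sm: "supp (\<lambda>x. a * f x) \<subseteq> supp f" by (auto simp: supp_def)

lemma monoid_alg_Qalg: "Qalg (monoid_alg G :: (rat, 'a \<Rightarrow> rat) module)"
proof -
  let ?M = "monoid_alg G :: (rat, 'a \<Rightarrow> rat) module"
  have ag: "abelian_group ?M"
  proof (rule abelian_groupI)
    fix f assume "f \<in> carrier ?M"
    then show "\<exists>g\<in>carrier ?M. g \<oplus>\<^bsub>?M\<^esub> f = \<zero>\<^bsub>?M\<^esub>"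
      by (intro bexI[of _ "\<lambda>x. - f x"]) (auto simp: monoid_alg_sel supp_def)
  next
    fix f g assume "f \<in> carrier ?M" "g \<in> carrier ?M"
    then show "f \<oplus>\<^bsub>?M\<^esub> g \<in> carrier ?M"
      using supp_add[of f g] finite_subset[OF supp_add, of f g] by (auto simp: monoid_alg_sel)
  next
    show "\<zero>\<^bsub>?M\<^esub> \<in> carrier ?M" by (simp add: monoid_alg_sel supp_def)
  qed (simp_all add: monoid_alg_sel add_ac)
  have cl: "f \<otimes>\<^bsub>?M\<^esub> g \<in> carrier ?M" if "f \<in> carrier ?M" "g \<in> carrier ?M" for f g
  proof -
    have fg: "finite (supp f)" "finite (supp g)" "supp f \<subseteq> carrier G" "supp g \<subseteq> carrier G"
      using that by (auto simp: monoid_alg_sel)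
    have "supp (f \<otimes>\<^bsub>?M\<^esub> g) \<subseteq> (\<lambda>(x, y). x \<otimes> y) ` (supp f \<times> supp g)"
      by (rule supp_monoid_alg_mult) (use fg in auto)
    moreover have "(\<lambda>(x, y). x \<otimes> y) ` (supp f \<times> supp g) \<subseteq> carrier G" using fg by auto
    ultimately show ?thesis using fg by (simp add: monoid_alg_sel) (metis finite_SigmaI finite_imageI finite_subset subset_trans)
  qed
  have ldist: "(f \<oplus>\<^bsub>?M\<^esub> g) \<otimes>\<^bsub>?M\<^esub> h = f \<otimes>\<^bsub>?M\<^esub> h \<oplus>\<^bsub>?M\<^esub> g \<otimes>\<^bsub>?M\<^esub> h"
    if "f \<in> carrier ?M" "g \<in> carrier ?M" "h \<in> carrier ?M" for f g h
  proof -
    note * = monoid_alg_mult[where S = "supp f \<union> supp g" and T = "supp h"]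
    have "supp (\<lambda>x. f x + g x) \<subseteq> supp f \<union> supp g" by (rule supp_add)
    then show ?thesis using that unfolding monoid_alg_sel
      by (intro ext) (simp add: * distrib_right sum.distrib)
  qed
  have rdist: "h \<otimes>\<^bsub>?M\<^esub> (f \<oplus>\<^bsub>?M\<^esub> g) = h \<otimes>\<^bsub>?M\<^esub> f \<oplus>\<^bsub>?M\<^esub> h \<otimes>\<^bsub>?M\<^esub> g"
    if "f \<in> carrier ?M" "g \<in> carrier ?M" "h \<in> carrier ?M" for f g h
  proof -
    note * = monoid_alg_mult[where T = "supp f \<union> supp g" and S = "supp h"]
    have "supp (\<lambda>x. f x + g x) \<subseteq> supp f \<union> supp g" by (rule supp_add)
    then show ?thesis using that unfolding monoid_alg_sel
      by (intro ext) (simp add: * distrib_right distrib_left sum.distrib)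
  qed
  have assoc: "(f \<otimes>\<^bsub>?M\<^esub> g) \<otimes>\<^bsub>?M\<^esub> h = f \<otimes>\<^bsub>?M\<^esub> (g \<otimes>\<^bsub>?M\<^esub> h)"
    if fgh: "f \<in> carrier ?M" "g \<in> carrier ?M" "h \<in> carrier ?M" for f g h
  proof
    fix z
    define F where "F = supp f" define K where "K = supp g" define H where "H = supp h"
    have fin: "finite F" "finite K" "finite H" "F \<subseteq> carrier G" "K \<subseteq> carrier G" "H \<subseteq> carrier G"
      "supp f \<subseteq> F" "supp g \<subseteq> K" "supp h \<subseteq> H"
      using fgh by (auto simp: monoid_alg_sel F_def K_def H_def)
    let ?d = "\<lambda>a b. if a = b then 1 else (0::rat)"
    let ?S = "(\<lambda>(x, y). x \<otimes> y) ` (F \<times> K)" let ?T = "(\<lambda>(x, y). x \<otimes> y) ` (K \<times> H)"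
    have S: "finite ?S" "?S \<subseteq> carrier G" "finite ?T" "?T \<subseteq> carrier G" using fin by auto
    have "((f \<otimes>\<^bsub>?M\<^esub> g) \<otimes>\<^bsub>?M\<^esub> h) z = (\<Sum>u\<in>?S. \<Sum>w\<in>H. (f \<otimes>\<^bsub>?M\<^esub> g) u * h w * ?d (u \<otimes> w) z)"
      by (rule monoid_alg_mult) (use S fin supp_monoid_alg_mult[of F K f g] in auto)
    also have "\<dots> = (\<Sum>u\<in>?S. \<Sum>w\<in>H. \<Sum>x\<in>F. \<Sum>y\<in>K. f x * g y * h w * ?d (x \<otimes> y) u * ?d (u \<otimes> w) z)"
      by (simp add: monoid_alg_mult[of F K f g] fin sum_distrib_right sum_distrib_left mult_ac)
    also have "\<dots> = (\<Sum>x\<in>F. \<Sum>y\<in>K. \<Sum>w\<in>H. \<Sum>u\<in>?S. f x * g y * h w * ?d (x \<otimes> y) u * ?d (u \<otimes> w) z)"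
      by (rule sum_rotate4)
    also have "\<dots> = (\<Sum>x\<in>F. \<Sum>y\<in>K. \<Sum>w\<in>H. f x * g y * h w * ?d (x \<otimes> y \<otimes> w) z)"
    proof (intro sum.cong refl)
      fix x y w assume "x \<in> F" "y \<in> K" "w \<in> H"
      then have i: "x \<otimes> y \<in> ?S" by auto
      have "(\<Sum>u\<in>?S. f x * g y * h w * ?d (x \<otimes> y) u * ?d (u \<otimes> w) z) =
        (\<Sum>u\<in>?S. if u = x \<otimes> y then f x * g y * h w * ?d (x \<otimes> y \<otimes> w) z else 0)"
        by (intro sum.cong refl) auto
      then show "(\<Sum>u\<in>?S. f x * g y * h w * ?d (x \<otimes> y) u * ?d (u \<otimes> w) z) = f x * g y * h w * ?d (x \<otimes> y \<otimes> w) z"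
        using S i by (simp only: sum.delta if_True)
    qed
    finally have L: "((f \<otimes>\<^bsub>?M\<^esub> g) \<otimes>\<^bsub>?M\<^esub> h) z = (\<Sum>x\<in>F. \<Sum>y\<in>K. \<Sum>w\<in>H. f x * g y * h w * ?d (x \<otimes> y \<otimes> w) z)" .
    have "(f \<otimes>\<^bsub>?M\<^esub> (g \<otimes>\<^bsub>?M\<^esub> h)) z = (\<Sum>x\<in>F. \<Sum>u\<in>?T. f x * (g \<otimes>\<^bsub>?M\<^esub> h) u * ?d (x \<otimes> u) z)"
      by (rule monoid_alg_mult) (use S fin supp_monoid_alg_mult[of K H g h] in auto)
    also have "\<dots> = (\<Sum>x\<in>F. \<Sum>u\<in>?T. \<Sum>y\<in>K. \<Sum>w\<in>H. f x * g y * h w * ?d (y \<otimes> w) u * ?d (x \<otimes> u) z)"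
      by (simp add: monoid_alg_mult[of K H g h] fin sum_distrib_right sum_distrib_left mult_ac)
    also have "\<dots> = (\<Sum>x\<in>F. \<Sum>y\<in>K. \<Sum>w\<in>H. \<Sum>u\<in>?T. f x * g y * h w * ?d (y \<otimes> w) u * ?d (x \<otimes> u) z)"
      by (rule sum.cong[OF refl], subst sum.swap, rule sum.cong[OF refl], rule sum.swap)
    also have "\<dots> = (\<Sum>x\<in>F. \<Sum>y\<in>K. \<Sum>w\<in>H. f x * g y * h w * ?d (x \<otimes> (y \<otimes> w)) z)"
    proof (intro sum.cong refl)
      fix x y w assume "x \<in> F" "y \<in> K" "w \<in> H"
      then have i: "y \<otimes> w \<in> ?T" by auto
      have "(\<Sum>u\<in>?T. f x * g y * h w * ?d (y \<otimes> w) u * ?d (x \<otimes> u) z) =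
        (\<Sum>u\<in>?T. if u = y \<otimes> w then f x * g y * h w * ?d (x \<otimes> (y \<otimes> w)) z else 0)"
        by (intro sum.cong refl) auto
      then show "(\<Sum>u\<in>?T. f x * g y * h w * ?d (y \<otimes> w) u * ?d (x \<otimes> u) z) = f x * g y * h w * ?d (x \<otimes> (y \<otimes> w)) z"
        using S i by (simp only: sum.delta if_True)
    qed
    also have "\<dots> = (\<Sum>x\<in>F. \<Sum>y\<in>K. \<Sum>w\<in>H. f x * g y * h w * ?d (x \<otimes> y \<otimes> w) z)"
      by (intro sum.cong refl) (use fin in \<open>auto simp: m_assoc subset_eq\<close>)
    finally show "((f \<otimes>\<^bsub>?M\<^esub> g) \<otimes>\<^bsub>?M\<^esub> h) z = (f \<otimes>\<^bsub>?M\<^esub> (g \<otimes>\<^bsub>?M\<^esub> h)) z" using L by simp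
  qed
  let ?d = "\<lambda>a b. if a = b then 1 else (0::rat)"
  have onel: "\<one>\<^bsub>?M\<^esub> \<otimes>\<^bsub>?M\<^esub> f = f" if f: "f \<in> carrier ?M" for f
  proof
    fix z
    have "(bvec \<one> \<otimes>\<^bsub>?M\<^esub> f) z = (\<Sum>x\<in>{\<one>}. \<Sum>y\<in>supp f. bvec \<one> x * f y * ?d (x \<otimes> y) z)"
      by (rule monoid_alg_mult) (use f in \<open>auto simp: monoid_alg_sel supp_bvec\<close>)
    also have "\<dots> = (\<Sum>y\<in>supp f. if y = z then f y else 0)"
      by (simp, intro sum.cong refl) (use f in \<open>auto simp: monoid_alg_sel bvec_def subset_eq\<close>)
    finally show "(\<one>\<^bsub>?M\<^esub> \<otimes>\<^bsub>?M\<^esub> f) z = f z" using f by (auto simp: monoid_alg_sel supp_def)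
  qed
  have oner: "f \<otimes>\<^bsub>?M\<^esub> \<one>\<^bsub>?M\<^esub> = f" if f: "f \<in> carrier ?M" for f
  proof
    fix z
    have "(f \<otimes>\<^bsub>?M\<^esub> bvec \<one>) z = (\<Sum>x\<in>supp f. \<Sum>y\<in>{\<one>}. f x * bvec \<one> y * ?d (x \<otimes> y) z)"
      by (rule monoid_alg_mult) (use f in \<open>auto simp: monoid_alg_sel supp_bvec\<close>)
    also have "\<dots> = (\<Sum>y\<in>supp f. if y = z then f y else 0)"
      by (intro sum.cong refl) (use f in \<open>auto simp: monoid_alg_sel bvec_def subset_eq\<close>)
    finally show "(f \<otimes>\<^bsub>?M\<^esub> \<one>\<^bsub>?M\<^esub>) z = f z" using f by (auto simp: monoid_alg_sel supp_def)
  qed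
  have mon: "monoid ?M"
    by (rule monoidI) (auto simp: cl assoc onel oner, auto simp: monoid_alg_sel supp_bvec)
  have ring: "ring ?M"
    by (rule ringI[OF ag mon]) (auto simp: ldist rdist)
  have sm: "r \<odot>\<^bsub>?M\<^esub> f \<in> carrier ?M" if "f \<in> carrier ?M" for r f
    using that supp_sm[of r f] by (auto simp: monoid_alg_sel intro: finite_subset)
  have lm: "(r \<odot>\<^bsub>?M\<^esub> f) \<otimes>\<^bsub>?M\<^esub> g = r \<odot>\<^bsub>?M\<^esub> (f \<otimes>\<^bsub>?M\<^esub> g)" if "f \<in> carrier ?M" "g \<in> carrier ?M" for r f g
    using that supp_sm[of r f] unfolding monoid_alg_sel
    by (intro ext) (simp add: monoid_alg_mult[where S = "supp f" and T = "supp g"] sum_distrib_left mult_ac)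
  have rm: "f \<otimes>\<^bsub>?M\<^esub> (r \<odot>\<^bsub>?M\<^esub> g) = r \<odot>\<^bsub>?M\<^esub> (f \<otimes>\<^bsub>?M\<^esub> g)" if "f \<in> carrier ?M" "g \<in> carrier ?M" for r f g
    using that supp_sm[of r g] unfolding monoid_alg_sel
    by (intro ext) (simp add: monoid_alg_mult[where S = "supp f" and T = "supp g"] sum_distrib_left mult_ac)
  show ?thesis
    by (intro Qalg.intro ring Qalg_axioms.intro sm lm rm)
      (auto simp: monoid_alg_sel algebra_simps)
qed

lemma monoid_alg_induct [consumes 1, case_names zero add]:
  assumes f: "f \<in> carrier (monoid_alg G :: (rat, 'a \<Rightarrow> rat) module)"
    and 0: "P \<zero>\<^bsub>(monoid_alg G :: (rat, 'a \<Rightarrow> rat) module)\<^esub>"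
    and step: "\<And>f a x. f \<in> carrier (monoid_alg G :: (rat, 'a \<Rightarrow> rat) module) \<Longrightarrow> P f \<Longrightarrow> x \<in> carrier G \<Longrightarrow>
      P (f \<oplus>\<^bsub>monoid_alg G\<^esub> a \<odot>\<^bsub>monoid_alg G\<^esub> bvec x)"
  shows "P f"
proof -
  let ?M = "monoid_alg G :: (rat, 'a \<Rightarrow> rat) module"
  have "finite S \<Longrightarrow> S \<subseteq> carrier G \<Longrightarrow> supp f \<subseteq> S \<Longrightarrow> P f" for S f
  proof (induction S arbitrary: f rule: finite_induct)
    case empty
    then have "f = \<zero>\<^bsub>?M\<^esub>" by (auto simp: monoid_alg_sel supp_def)
    with 0 show ?case by simp
  next
    case (insert x S)
    let ?g = "f(x := 0)"
    have "supp ?g \<subseteq> S" using insert.prems by (auto simp: supp_def)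
    with insert have "P ?g" "?g \<in> carrier ?M" by (auto simp: monoid_alg_sel intro: finite_subset)
    then have "P (?g \<oplus>\<^bsub>?M\<^esub> f x \<odot>\<^bsub>?M\<^esub> bvec x)" using step insert.prems by auto
    also have "?g \<oplus>\<^bsub>?M\<^esub> f x \<odot>\<^bsub>?M\<^esub> bvec x = f" by (auto simp: monoid_alg_sel bvec_def)
    finally show ?case .
  qed
  from this[of "supp f" f] f show ?thesis by (auto simp: monoid_alg_sel)
qed

end

text \<open>Linear extension of a monoid homomorphism is multiplicative. Both the tensor product and the
  enveloping algebra are quotients of monoid algebras, so all maps out of them come from here.\<close>

lemma monoid_alg_lift:
  fixes G :: "('x, 'm) monoid_scheme"
  assumes "monoid G" "Qalg B" and m: "m \<in> carrier G \<rightarrow> carrier B"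
    and mm: "\<And>x y. x \<in> carrier G \<Longrightarrow> y \<in> carrier G \<Longrightarrow> m (x \<otimes>\<^bsub>G\<^esub> y) = m x \<otimes>\<^bsub>B\<^esub> m y"
    and m1: "m \<one>\<^bsub>G\<^esub> = \<one>\<^bsub>B\<^esub>"
  obtains h where "h \<in> alg_hom (monoid_alg G) B" "\<And>x. x \<in> carrier G \<Longrightarrow> h (bvec x) = m x"
proof -
  interpret G: monoid G by fact
  interpret B: Qalg B by fact
  let ?M = "monoid_alg G :: (rat, 'x \<Rightarrow> rat) module"
  interpret M: Qalg ?M by (rule G.monoid_alg_Qalg)
  define h where "h f = finsum B (\<lambda>x. f x \<odot>\<^bsub>B\<^esub> m x) (supp f)" for f
  have mc: "m x \<in> carrier B" if "x \<in> carrier G" for x using m that by auto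
  have h: "h f = finsum B (\<lambda>x. f x \<odot>\<^bsub>B\<^esub> m x) S"
    if "finite S" "S \<subseteq> carrier G" "supp f \<subseteq> S" for f S
    unfolding h_def
    by (rule B.add.finprod_mono_neutral_cong_left) (use that mc in \<open>auto simp: supp_def subset_eq\<close>)
  have cl: "h f \<in> carrier B" if "f \<in> carrier ?M" for f
    unfolding h_def by (rule B.finsum_closed) (use that mc in \<open>auto simp: monoid_alg_sel\<close>)
  have add: "h (f \<oplus>\<^bsub>?M\<^esub> g) = h f \<oplus>\<^bsub>B\<^esub> h g" if "f \<in> carrier ?M" "g \<in> carrier ?M" for f g
  proof -
    let ?S = "supp f \<union> supp g"
    have S: "finite ?S" "?S \<subseteq> carrier G" using that by (auto simp: monoid_alg_sel)
    have "h (f \<oplus>\<^bsub>?M\<^esub> g) = finsum B (\<lambda>x. f x \<odot>\<^bsub>B\<^esub> m x \<oplus>\<^bsub>B\<^esub> g x \<odot>\<^bsub>B\<^esub> m x) ?S"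
      unfolding monoid_alg_sel
      by (subst h[OF S G.supp_add], rule B.finsum_cong') (use S mc in \<open>auto simp: B.sm_ladd subset_eq\<close>)
    also have "\<dots> = h f \<oplus>\<^bsub>B\<^esub> h g"
      by (subst B.finsum_addf) (use S mc h[OF S, of f] h[OF S, of g] in auto)
    finally show ?thesis .
  qed
  have sm: "h (r \<odot>\<^bsub>?M\<^esub> f) = r \<odot>\<^bsub>B\<^esub> h f" if "f \<in> carrier ?M" for r f
  proof -
    have S: "finite (supp f)" "supp f \<subseteq> carrier G" using that by (auto simp: monoid_alg_sel)
    show ?thesis unfolding monoid_alg_sel
      by (subst h[OF S G.supp_sm], subst h[OF S subset_refl], subst B.sm_finsum)
        (use S mc in \<open>auto simp: B.sm_assoc subset_eq intro!: B.finsum_cong'\<close>)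
  qed
  have b: "h (bvec x) = m x" if "x \<in> carrier G" for x
    using that mc by (subst h[of "{x}"]) (auto simp: G.supp_bvec, simp add: bvec_def)
  have z: "h \<zero>\<^bsub>?M\<^esub> = \<zero>\<^bsub>B\<^esub>" by (simp add: h_def monoid_alg_sel supp_def)
  have mult1: "h (bvec x \<otimes>\<^bsub>?M\<^esub> g) = m x \<otimes>\<^bsub>B\<^esub> h g" if "x \<in> carrier G" "g \<in> carrier ?M" for x g
    using that(2)
  proof (induction rule: G.monoid_alg_induct)
    case zero
    then show ?case using that mc by (simp add: z G.bvec_carrier)
  next
    case (add f a y)
    have yc: "y \<in> carrier G" using add by auto
    note bc = G.bvec_carrier[OF that(1)] G.bvec_carrier[OF yc]
    have "h (bvec x \<otimes>\<^bsub>?M\<^esub> (f \<oplus>\<^bsub>?M\<^esub> a \<odot>\<^bsub>?M\<^esub> bvec y)) =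
      h (bvec x \<otimes>\<^bsub>?M\<^esub> f \<oplus>\<^bsub>?M\<^esub> a \<odot>\<^bsub>?M\<^esub> bvec (x \<otimes>\<^bsub>G\<^esub> y))"
      using add bc that by (simp add: M.r_distr M.sm_rmult G.bvec_mult)
    also have "\<dots> = m x \<otimes>\<^bsub>B\<^esub> h f \<oplus>\<^bsub>B\<^esub> a \<odot>\<^bsub>B\<^esub> (m x \<otimes>\<^bsub>B\<^esub> m y)"
      using add bc that G.bvec_carrier[of "x \<otimes>\<^bsub>G\<^esub> y"] by (simp add: \<open>\<And>g f. f \<in> carrier ?M \<Longrightarrow> g \<in> carrier ?M \<Longrightarrow> h (f \<oplus>\<^bsub>?M\<^esub> g) = h f \<oplus>\<^bsub>B\<^esub> h g\<close> sm b mm)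
    also have "\<dots> = m x \<otimes>\<^bsub>B\<^esub> h (f \<oplus>\<^bsub>?M\<^esub> a \<odot>\<^bsub>?M\<^esub> bvec y)"
      using add bc that mc cl by (simp add: \<open>\<And>g f. f \<in> carrier ?M \<Longrightarrow> g \<in> carrier ?M \<Longrightarrow> h (f \<oplus>\<^bsub>?M\<^esub> g) = h f \<oplus>\<^bsub>B\<^esub> h g\<close> sm b B.r_distr B.sm_rmult)
    finally show ?case .
  qed
  have mult: "h (f \<otimes>\<^bsub>?M\<^esub> g) = h f \<otimes>\<^bsub>B\<^esub> h g" if "f \<in> carrier ?M" "g \<in> carrier ?M" for f g
    using that(1)
  proof (induction rule: G.monoid_alg_induct)
    case zero
    then show ?case using that cl by (simp add: z)
  next
    case (add f a y)
    have yc: "y \<in> carrier G" using add by auto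
    note bc = G.bvec_carrier[OF yc]
    show ?case using add bc that mc cl
      by (simp add: M.l_distr M.sm_lmult B.l_distr B.sm_lmult \<open>\<And>g f. f \<in> carrier ?M \<Longrightarrow> g \<in> carrier ?M \<Longrightarrow> h (f \<oplus>\<^bsub>?M\<^esub> g) = h f \<oplus>\<^bsub>B\<^esub> h g\<close> sm b mult1)
  qed
  have "h \<in> alg_hom ?M B"
    by (rule alg_homI) (auto simp: cl add mult sm monoid_alg_sel(4) b m1)
  then show ?thesis using b that by blast
qed

section \<open>Tensor products\<close>

locale tensor_pair = A: Qalg A + B: Qalg B for A :: "(rat, 'a) module" and B :: "(rat, 'b) module"
begin

sublocale F: Qalg "tensor_free A B"
  unfolding tensor_free_def by (intro monoid.monoid_alg_Qalg DirProd_monoid A.is_monoid B.is_monoid)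

lemma bv: "a \<in> carrier A \<Longrightarrow> b \<in> carrier B \<Longrightarrow> bvec (a, b) \<in> carrier (tensor_free A B)"
  unfolding tensor_free_def by (intro monoid.bvec_carrier DirProd_monoid A.is_monoid B.is_monoid) simp

lemma ideal_tensor: "ideal (tensor_ideal A B) (tensor_free A B)"
  unfolding tensor_ideal_def Let_def
  by (rule F.genideal_ideal) (auto intro!: F.minus_closed F.add.m_closed bv)

lemma Qalg_tensor: "Qalg (tensor_alg A B)"
  and tensor_quot: "(+>\<^bsub>tensor_free A B\<^esub>) (tensor_ideal A B) \<in> alg_hom (tensor_free A B) (tensor_alg A B)"
  unfolding tensor_alg_def using F.quot_alg_Qalg[OF ideal_tensor] F.ideal_smult[OF ideal_tensor] by auto

sublocale T: Qalg "tensor_alg A B" by (rule Qalg_tensor)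

sublocale q: Qalg_hom "tensor_free A B" "tensor_alg A B" "(+>\<^bsub>tensor_free A B\<^esub>) (tensor_ideal A B)"
  by unfold_locales (rule tensor_quot)

lemma tens_closed [simp]: "a \<in> carrier A \<Longrightarrow> b \<in> carrier B \<Longrightarrow> tens A B a b \<in> carrier (tensor_alg A B)"
  by (simp add: tens_def bv)

lemma tens_mult: "a \<in> carrier A \<Longrightarrow> b \<in> carrier B \<Longrightarrow> a' \<in> carrier A \<Longrightarrow> b' \<in> carrier B \<Longrightarrow>
  tens A B a b \<otimes>\<^bsub>tensor_alg A B\<^esub> tens A B a' b' = tens A B (a \<otimes>\<^bsub>A\<^esub> a') (b \<otimes>\<^bsub>B\<^esub> b')"
  unfolding tens_def using monoid.bvec_mult[OF DirProd_monoid[OF A.is_monoid B.is_monoid], of "(a,b)" "(a',b')"]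
  by (simp add: q.hmult[symmetric] bv tensor_free_def[symmetric])

lemma tens_one: "tens A B \<one>\<^bsub>A\<^esub> \<one>\<^bsub>B\<^esub> = \<one>\<^bsub>tensor_alg A B\<^esub>"
  unfolding q.hone[symmetric] tens_def by (simp add: tensor_free_def monoid_alg_sel)

lemma q_eq:
  assumes "x \<ominus>\<^bsub>tensor_free A B\<^esub> y \<in> tensor_ideal A B" "x \<in> carrier (tensor_free A B)" "y \<in> carrier (tensor_free A B)"
  shows "tensor_ideal A B +>\<^bsub>tensor_free A B\<^esub> x = tensor_ideal A B +>\<^bsub>tensor_free A B\<^esub> y"
  using assms by (simp add: F.quotient_eq_iff_same_a_r_cos[OF ideal_tensor])

lemma gen_in: "S \<subseteq> carrier (tensor_free A B) \<Longrightarrow> x \<in> S \<Longrightarrow> x \<in> genideal (tensor_free A B) S"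
  using F.genideal_self by blast

lemma tens_ladd: "a \<in> carrier A \<Longrightarrow> a' \<in> carrier A \<Longrightarrow> b \<in> carrier B \<Longrightarrow>
  tens A B (a \<oplus>\<^bsub>A\<^esub> a') b = tens A B a b \<oplus>\<^bsub>tensor_alg A B\<^esub> tens A B a' b"
  unfolding tens_def q.hadd[OF bv bv, symmetric]
  apply (rule q_eq)
  subgoal
    unfolding tensor_ideal_def Let_def
    by (rule gen_in) (auto intro!: F.minus_closed F.add.m_closed bv)
  by (auto simp: bv)

lemma tens_radd: "a \<in> carrier A \<Longrightarrow> b \<in> carrier B \<Longrightarrow> b' \<in> carrier B \<Longrightarrow>
  tens A B a (b \<oplus>\<^bsub>B\<^esub> b') = tens A B a b \<oplus>\<^bsub>tensor_alg A B\<^esub> tens A B a b'"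
  unfolding tens_def q.hadd[OF bv bv, symmetric]
  apply (rule q_eq)
  subgoal
    unfolding tensor_ideal_def Let_def
    by (rule gen_in) (auto intro!: F.minus_closed F.add.m_closed bv)
  by (auto simp: bv)

lemma tens_lsm: "a \<in> carrier A \<Longrightarrow> b \<in> carrier B \<Longrightarrow> tens A B (r \<odot>\<^bsub>A\<^esub> a) b = r \<odot>\<^bsub>tensor_alg A B\<^esub> tens A B a b"
  unfolding tens_def q.hsm[OF bv, symmetric]
  apply (rule q_eq)
  subgoal
    unfolding tensor_ideal_def Let_def
    by (rule gen_in) (auto intro!: F.minus_closed F.add.m_closed F.sm_closed bv)
  by (auto simp: bv)

lemma tens_rsm: "a \<in> carrier A \<Longrightarrow> b \<in> carrier B \<Longrightarrow> tens A B a (r \<odot>\<^bsub>B\<^esub> b) = r \<odot>\<^bsub>tensor_alg A B\<^esub> tens A B a b"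
  unfolding tens_def q.hsm[OF bv, symmetric]
  apply (rule q_eq)
  subgoal
    unfolding tensor_ideal_def Let_def
    by (rule gen_in) (auto intro!: F.minus_closed F.add.m_closed F.sm_closed bv)
  by (auto simp: bv)

end

section \<open>Enveloping algebras\<close>

lemma Qalg_Q: "Qalg Q_alg"
proof -
  have "ring Q_alg"
  proof (rule ringI)
    show "abelian_group Q_alg"
      by (rule abelian_groupI) (auto simp: Q_alg_def intro: exI[of _ "- x" for x])
    show "monoid Q_alg" by (rule monoidI) (auto simp: Q_alg_def)
  qed (auto simp: Q_alg_def algebra_simps)
  then show ?thesis
    by (intro Qalg.intro Qalg_axioms.intro) (auto simp: Q_alg_def algebra_simps)
qed

lemma (in Qalg) add_diff: "x \<in> carrier M \<Longrightarrow> y \<in> carrier M \<Longrightarrow> y \<oplus> (x \<ominus> y) = x"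
  by (simp add: a_minus_def a_lcomm[of y x] r_neg)

locale enveloping = A: Qalg A for A :: "(rat, 'a) module"
begin

abbreviation "W \<equiv> \<lparr>carrier = lists (carrier A), mult = (@), one = []\<rparr>"
abbreviation "U \<equiv> env_alg A"
abbreviation "gen \<equiv> env_gen A"

lemma monoid_W: "monoid W" by (rule monoidI) auto

sublocale F: Qalg "word_alg A"
  unfolding word_alg_def by (rule monoid.monoid_alg_Qalg[OF monoid_W])

lemma bw: "set w \<subseteq> carrier A \<Longrightarrow> bvec w \<in> carrier (word_alg A)"
  unfolding word_alg_def by (intro monoid.bvec_carrier[OF monoid_W]) auto

lemma bw_mult: "set v \<subseteq> carrier A \<Longrightarrow> set w \<subseteq> carrier A \<Longrightarrow>
  bvec v \<otimes>\<^bsub>word_alg A\<^esub> bvec w = bvec (v @ w)"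
  unfolding word_alg_def by (subst monoid.bvec_mult[OF monoid_W]) (auto simp: lists_eq_set)

lemma bracket_closed: "x \<in> carrier A \<Longrightarrow> y \<in> carrier A \<Longrightarrow> lie_bracket A x y \<in> carrier A"
  by (auto simp: lie_bracket_def)

text \<open>The relations imposed in \<^const>\<open>env_ideal\<close>, named separately to be checked on maps.\<close>

definition env_rels where "env_rels = ({bvec [x \<oplus>\<^bsub>A\<^esub> y] \<ominus>\<^bsub>word_alg A\<^esub> (bvec [x] \<oplus>\<^bsub>word_alg A\<^esub> bvec [y]) | x y.
        x \<in> carrier A \<and> y \<in> carrier A} \<union>
     {bvec [r \<odot>\<^bsub>A\<^esub> x] \<ominus>\<^bsub>word_alg A\<^esub> (r \<odot>\<^bsub>word_alg A\<^esub> bvec [x]) | r x. x \<in> carrier A} \<union>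
     {(bvec [x, y] \<ominus>\<^bsub>word_alg A\<^esub> bvec [y, x]) \<ominus>\<^bsub>word_alg A\<^esub> bvec [lie_bracket A x y] | x y.
        x \<in> carrier A \<and> y \<in> carrier A})"

lemma env_rels_sub: "env_rels \<subseteq> carrier (word_alg A)"
  unfolding env_rels_def
  by (auto intro!: F.minus_closed F.add.m_closed bw bracket_closed)

lemma env_ideal_eq: "env_ideal A = genideal (word_alg A) env_rels"
  unfolding env_ideal_def Let_def env_rels_def ..

lemma ideal_env: "ideal (env_ideal A) (word_alg A)"
  unfolding env_ideal_eq by (rule F.genideal_ideal[OF env_rels_sub])

lemma Qalg_env: "Qalg U"
  and env_quot: "(+>\<^bsub>word_alg A\<^esub>) (env_ideal A) \<in> alg_hom (word_alg A) U"
  unfolding env_alg_def using F.quot_alg_Qalg[OF ideal_env] F.ideal_smult[OF ideal_env] by auto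

sublocale U: Qalg U by (rule Qalg_env)

sublocale q: Qalg_hom "word_alg A" U "(+>\<^bsub>word_alg A\<^esub>) (env_ideal A)"
  by unfold_locales (rule env_quot)

lemma carrier_U: "carrier U = (+>\<^bsub>word_alg A\<^esub>) (env_ideal A) ` carrier (word_alg A)"
  by (auto simp: env_alg_def quot_alg_def A_RCOSETS_def')

lemma gen_closed [simp, intro]: "x \<in> carrier A \<Longrightarrow> gen x \<in> carrier U"
  by (simp add: env_gen_def bw)

lemma q_eq:
  assumes "x \<ominus>\<^bsub>word_alg A\<^esub> y \<in> env_rels" "x \<in> carrier (word_alg A)" "y \<in> carrier (word_alg A)"
  shows "env_ideal A +>\<^bsub>word_alg A\<^esub> x = env_ideal A +>\<^bsub>word_alg A\<^esub> y"
proof -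
  have "x \<ominus>\<^bsub>word_alg A\<^esub> y \<in> env_ideal A"
    unfolding env_ideal_eq using F.genideal_self[OF env_rels_sub] assms(1) by blast
  then show ?thesis
    using assms by (simp add: F.quotient_eq_iff_same_a_r_cos[OF ideal_env])
qed

lemma gen_add:
  assumes "x \<in> carrier A" "y \<in> carrier A"
  shows "gen (x \<oplus>\<^bsub>A\<^esub> y) = gen x \<oplus>\<^bsub>U\<^esub> gen y"
proof -
  have "gen (x \<oplus>\<^bsub>A\<^esub> y) = env_ideal A +>\<^bsub>word_alg A\<^esub> (bvec [x] \<oplus>\<^bsub>word_alg A\<^esub> bvec [y])"
    unfolding env_gen_def
    by (rule q_eq) (use assms in \<open>auto simp: bw env_rels_def\<close>)
  then show ?thesis using assms by (simp add: q.hadd bw env_gen_def)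
qed

lemma gen_sm:
  assumes "x \<in> carrier A"
  shows "gen (r \<odot>\<^bsub>A\<^esub> x) = r \<odot>\<^bsub>U\<^esub> gen x"
proof -
  have "gen (r \<odot>\<^bsub>A\<^esub> x) = env_ideal A +>\<^bsub>word_alg A\<^esub> (r \<odot>\<^bsub>word_alg A\<^esub> bvec [x])"
    unfolding env_gen_def
    by (rule q_eq) (use assms in \<open>auto simp: bw env_rels_def\<close>)
  then show ?thesis using assms by (simp add: q.hsm bw env_gen_def)
qed

lemma gen_bracket:
  assumes "x \<in> carrier A" "y \<in> carrier A"
  shows "gen x \<otimes>\<^bsub>U\<^esub> gen y \<ominus>\<^bsub>U\<^esub> gen y \<otimes>\<^bsub>U\<^esub> gen x = gen (lie_bracket A x y)"
proof -
  have 1: "bvec [x, y] = bvec [x] \<otimes>\<^bsub>word_alg A\<^esub> bvec [y]" "bvec [y, x] = bvec [y] \<otimes>\<^bsub>word_alg A\<^esub> bvec [x]"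
    using assms by (simp_all add: bw_mult)
  have "env_ideal A +>\<^bsub>word_alg A\<^esub> (bvec [x, y] \<ominus>\<^bsub>word_alg A\<^esub> bvec [y, x]) = gen (lie_bracket A x y)"
    unfolding env_gen_def
  proof (rule q_eq)
    show "bvec [x, y] \<ominus>\<^bsub>word_alg A\<^esub> bvec [y, x] \<ominus>\<^bsub>word_alg A\<^esub> bvec [lie_bracket A x y] \<in> env_rels"
      unfolding env_rels_def using assms by blast
  qed (use assms in \<open>simp_all add: bw bracket_closed\<close>)
  then show ?thesis using assms unfolding 1 env_gen_def
    by (simp add: q.hminus q.hmult bw)
qed

lemma gen_swap: "x \<in> carrier A \<Longrightarrow> y \<in> carrier A \<Longrightarrow>
  gen x \<otimes>\<^bsub>U\<^esub> gen y = gen y \<otimes>\<^bsub>U\<^esub> gen x \<oplus>\<^bsub>U\<^esub> gen (lie_bracket A x y)"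
  unfolding gen_bracket[symmetric] by (subst U.add_diff) auto

lemma q_bw: "set w \<subseteq> carrier A \<Longrightarrow> env_ideal A +>\<^bsub>word_alg A\<^esub> bvec w = foldr (\<lambda>x u. gen x \<otimes>\<^bsub>U\<^esub> u) w \<one>\<^bsub>U\<^esub>"
proof (induction w)
  case Nil
  have "bvec [] = \<one>\<^bsub>word_alg A\<^esub>" by (simp add: word_alg_def monoid_alg_sel)
  then show ?case using q.hone by simp
next
  case (Cons x w)
  then have "bvec (x # w) = bvec [x] \<otimes>\<^bsub>word_alg A\<^esub> bvec w" by (simp add: bw_mult)
  with Cons show ?case by (simp add: q.hmult bw env_gen_def)
qed

lemma foldr_gen_closed: "set w \<subseteq> carrier A \<Longrightarrow> foldr (\<lambda>x u. gen x \<otimes>\<^bsub>U\<^esub> u) w \<one>\<^bsub>U\<^esub> \<in> carrier U"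
  by (induction w) auto

text \<open>Left multiplication by generators suffices to reach all of \<open>U\<close>, since words are built up from
  the left; properties are thus proved without mentioning cosets.\<close>

lemma env_induct [consumes 1, case_names one gen add sm]:
  assumes u: "u \<in> carrier U"
    and 1: "P \<one>\<^bsub>U\<^esub>"
    and g: "\<And>x u. x \<in> carrier A \<Longrightarrow> u \<in> carrier U \<Longrightarrow> P u \<Longrightarrow> P (gen x \<otimes>\<^bsub>U\<^esub> u)"
    and a: "\<And>u v. u \<in> carrier U \<Longrightarrow> v \<in> carrier U \<Longrightarrow> P u \<Longrightarrow> P v \<Longrightarrow> P (u \<oplus>\<^bsub>U\<^esub> v)"
    and s: "\<And>r u. u \<in> carrier U \<Longrightarrow> P u \<Longrightarrow> P (r \<odot>\<^bsub>U\<^esub> u)"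
  shows "P u"
proof -
  have w: "P (foldr (\<lambda>x u. gen x \<otimes>\<^bsub>U\<^esub> u) w \<one>\<^bsub>U\<^esub>)" if "set w \<subseteq> carrier A" for w
    using that by (induction w) (auto intro: 1 g foldr_gen_closed)
  have z: "P \<zero>\<^bsub>U\<^esub>" using s[of "\<one>\<^bsub>U\<^esub>" 0] 1 by simp
  from u obtain f where f: "f \<in> carrier (word_alg A)" and uf: "u = env_ideal A +>\<^bsub>word_alg A\<^esub> f"
    by (auto simp: carrier_U)
  have "P (env_ideal A +>\<^bsub>word_alg A\<^esub> f)"
    using f unfolding word_alg_def
  proof (induction rule: monoid.monoid_alg_induct[OF monoid_W, consumes 1, case_names zero add])
    case zero
    then show ?case using z q.hzero by (simp add: word_alg_def)
  next
    case (add f a w)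
    then have w': "set w \<subseteq> carrier A" by auto
    have f: "f \<in> carrier (word_alg A)" using add by (simp add: word_alg_def)
    have "P ((env_ideal A +>\<^bsub>word_alg A\<^esub> f) \<oplus>\<^bsub>U\<^esub> a \<odot>\<^bsub>U\<^esub> (env_ideal A +>\<^bsub>word_alg A\<^esub> bvec w))"
      using add w' f w[OF w'] by (intro a s) (auto simp: bw q_bw[symmetric] word_alg_def[symmetric])
    then show ?case using f w' by (simp add: q.hadd q.hsm bw word_alg_def[symmetric])
  qed
  then show ?thesis by (simp add: uf)
qed

lemma alg_hom_eqI:
  assumes B: "Qalg B" and h: "h \<in> alg_hom U B" and k: "k \<in> alg_hom U B"
    and g: "\<And>x. x \<in> carrier A \<Longrightarrow> h (gen x) = k (gen x)" and u: "u \<in> carrier U"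
  shows "h u = k u"
  using u by (induction rule: env_induct) (simp_all add: alg_homD[OF h] alg_homD[OF k] g)

lemma env_lift_exists:
  assumes B: "Qalg B" and g: "g \<in> carrier A \<rightarrow> carrier B"
    and ga: "\<And>x y. x \<in> carrier A \<Longrightarrow> y \<in> carrier A \<Longrightarrow> g (x \<oplus>\<^bsub>A\<^esub> y) = g x \<oplus>\<^bsub>B\<^esub> g y"
    and gs: "\<And>r x. x \<in> carrier A \<Longrightarrow> g (r \<odot>\<^bsub>A\<^esub> x) = r \<odot>\<^bsub>B\<^esub> g x"
    and gb: "\<And>x y. x \<in> carrier A \<Longrightarrow> y \<in> carrier A \<Longrightarrow> g (lie_bracket A x y) = g x \<otimes>\<^bsub>B\<^esub> g y \<ominus>\<^bsub>B\<^esub> g y \<otimes>\<^bsub>B\<^esub> g x"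
  obtains h where "h \<in> alg_hom U B" "\<And>x. x \<in> carrier A \<Longrightarrow> h (gen x) = g x"
proof -
  interpret B: Qalg B by fact
  have gc: "x \<in> carrier A \<Longrightarrow> g x \<in> carrier B" for x using g by auto
  define m where "m w = foldr (\<lambda>x u. g x \<otimes>\<^bsub>B\<^esub> u) w \<one>\<^bsub>B\<^esub>" for w
  have mc: "set w \<subseteq> carrier A \<Longrightarrow> m w \<in> carrier B" for w by (induction w) (auto simp: m_def gc)
  have mm: "set v \<subseteq> carrier A \<Longrightarrow> set w \<subseteq> carrier A \<Longrightarrow> m (v @ w) = m v \<otimes>\<^bsub>B\<^esub> m w" for v w
  proof (induction v)
    case Nil then show ?case using mc[of w] by (simp add: m_def)
  next
    case (Cons x v)
    then show ?case using mc[of v] mc[of w] gc[of x] by (simp add: m_def B.m_assoc)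
  qed
  obtain k where k: "k \<in> alg_hom (word_alg A) B" "\<And>w. set w \<subseteq> carrier A \<Longrightarrow> k (bvec w) = m w"
  proof (rule monoid_alg_lift[OF monoid_W B, of m])
    show "m \<in> carrier W \<rightarrow> carrier B" by (auto simp: mc lists_eq_set)
  next
    fix x y assume "x \<in> carrier W" "y \<in> carrier W"
    then show "m (x \<otimes>\<^bsub>W\<^esub> y) = m x \<otimes>\<^bsub>B\<^esub> m y" by (simp add: mm lists_eq_set)
  next
    show "m \<one>\<^bsub>W\<^esub> = \<one>\<^bsub>B\<^esub>" by (simp add: m_def)
  qed (auto simp: word_alg_def lists_eq_set)
  interpret k: Qalg_hom "word_alg A" B k by unfold_locales (rule k(1))
  have m1: "x \<in> carrier A \<Longrightarrow> m [x] = g x" for x by (simp add: m_def gc)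
  have m2: "x \<in> carrier A \<Longrightarrow> y \<in> carrier A \<Longrightarrow> m [x, y] = g x \<otimes>\<^bsub>B\<^esub> g y" for x y by (simp add: m_def gc)
  have "k x = \<zero>\<^bsub>B\<^esub>" if "x \<in> env_rels" for x
    using that unfolding env_rels_def
    by (auto simp: k.hminus k.hadd k.hsm bw k(2) m1 m2 ga gs gb gc bracket_closed)
  then have kz: "k x = \<zero>\<^bsub>B\<^esub>" if "x \<in> env_ideal A" for x
    using k.vanish_genideal[OF env_rels_sub] that unfolding env_ideal_eq by blast
  obtain h where h: "h \<in> alg_hom U B" "\<And>x. x \<in> carrier (word_alg A) \<Longrightarrow> h (env_ideal A +>\<^bsub>word_alg A\<^esub> x) = k x"
    using k.quot_factor[OF ideal_env kz] unfolding env_alg_def[symmetric] by blast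
  have "h (gen x) = g x" if "x \<in> carrier A" for x
    using that by (simp add: env_gen_def h(2) bw k(2) m1)
  then show ?thesis using h(1) that by blast
qed

text \<open>Existence comes from the construction and uniqueness from \<open>alg_hom_eqI\<close>, so the description
  defining \<^const>\<open>env_lift\<close> denotes.\<close>

lemma env_lift:
  assumes B: "Qalg B" and g: "g \<in> carrier A \<rightarrow> carrier B"
    and ga: "\<And>x y. x \<in> carrier A \<Longrightarrow> y \<in> carrier A \<Longrightarrow> g (x \<oplus>\<^bsub>A\<^esub> y) = g x \<oplus>\<^bsub>B\<^esub> g y"
    and gs: "\<And>r x. x \<in> carrier A \<Longrightarrow> g (r \<odot>\<^bsub>A\<^esub> x) = r \<odot>\<^bsub>B\<^esub> g x"
    and gb: "\<And>x y. x \<in> carrier A \<Longrightarrow> y \<in> carrier A \<Longrightarrow> g (lie_bracket A x y) = g x \<otimes>\<^bsub>B\<^esub> g y \<ominus>\<^bsub>B\<^esub> g y \<otimes>\<^bsub>B\<^esub> g x"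
  shows "env_lift A B g \<in> alg_hom U B" and "\<And>x. x \<in> carrier A \<Longrightarrow> env_lift A B g (gen x) = g x"
proof -
  obtain h where h: "h \<in> alg_hom U B" "\<And>x. x \<in> carrier A \<Longrightarrow> h (gen x) = g x"
    using env_lift_exists[OF assms] by blast
  let ?P = "\<lambda>h. h \<in> alg_hom U B \<and> h \<in> extensional (carrier U) \<and> (\<forall>x\<in>carrier A. h (gen x) = g x)"
  have "?P (restrict h (carrier U))"
    using h by (auto simp: alg_homD[OF h(1)] intro!: alg_homI)
  moreover have "h1 = h2" if "?P h1" "?P h2" for h1 h2
  proof (rule extensionalityI[of _ "carrier U"])
    show "h1 u = h2 u" if "u \<in> carrier U" for u
      by (rule alg_hom_eqI[OF B _ _ _ that]) (use \<open>?P h1\<close> \<open>?P h2\<close> in auto)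
  qed (use that in auto)
  ultimately have "\<exists>!h. ?P h" by blast
  then have "?P (env_lift A B g)" unfolding env_lift_def by (rule theI')
  then show "env_lift A B g \<in> alg_hom U B" and "\<And>x. x \<in> carrier A \<Longrightarrow> env_lift A B g (gen x) = g x" by auto
qed

sublocale UU: tensor_pair U U ..

text \<open>The map \<open>x \<mapsto> x \<otimes> 1 + 1 \<otimes> x\<close> respects brackets since the mixed terms \<open>x \<otimes> y\<close> and \<open>y \<otimes> x\<close> cancel in the
  commutator.\<close>

lemma comult:
  shows "env_comult A \<in> alg_hom U (tensor_alg U U)"
    and "\<And>x. x \<in> carrier A \<Longrightarrow> env_comult A (gen x) = tens U U (gen x) \<one>\<^bsub>U\<^esub> \<oplus>\<^bsub>tensor_alg U U\<^esub> tens U U \<one>\<^bsub>U\<^esub> (gen x)"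
proof -
  let ?T = "tensor_alg U U"
  let ?g = "\<lambda>x. tens U U (gen x) \<one>\<^bsub>U\<^esub> \<oplus>\<^bsub>?T\<^esub> tens U U \<one>\<^bsub>U\<^esub> (gen x)"
  have g: "?g \<in> carrier A \<rightarrow> carrier ?T" by auto
  have ga: "?g (x \<oplus>\<^bsub>A\<^esub> y) = ?g x \<oplus>\<^bsub>?T\<^esub> ?g y" if "x \<in> carrier A" "y \<in> carrier A" for x y
    using that by (simp add: gen_add UU.tens_ladd UU.tens_radd UU.T.a_ac)
  have gs: "?g (r \<odot>\<^bsub>A\<^esub> x) = r \<odot>\<^bsub>?T\<^esub> ?g x" if "x \<in> carrier A" for r x
    using that by (simp add: gen_sm UU.tens_lsm UU.tens_rsm UU.T.sm_radd)
  have gb: "?g (lie_bracket A x y) = ?g x \<otimes>\<^bsub>?T\<^esub> ?g y \<ominus>\<^bsub>?T\<^esub> ?g y \<otimes>\<^bsub>?T\<^esub> ?g x"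
    if xy: "x \<in> carrier A" "y \<in> carrier A" for x y
  proof -
    let ?b = "gen (lie_bracket A x y)"
    have b: "?b \<in> carrier U" using xy bracket_closed by auto
    let ?l = "\<lambda>u. tens U U u \<one>\<^bsub>U\<^esub>" and ?r = "\<lambda>u. tens U U \<one>\<^bsub>U\<^esub> u"
    let ?X = "tens U U (gen x) (gen y)" and ?Y = "tens U U (gen y) (gen x)"
    let ?yx = "gen y \<otimes>\<^bsub>U\<^esub> gen x"
    have 1: "?g x \<otimes>\<^bsub>?T\<^esub> ?g y = (?l ?yx \<oplus>\<^bsub>?T\<^esub> ?l ?b) \<oplus>\<^bsub>?T\<^esub> ?X \<oplus>\<^bsub>?T\<^esub> (?Y \<oplus>\<^bsub>?T\<^esub> (?r ?yx \<oplus>\<^bsub>?T\<^esub> ?r ?b))"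
      using xy b by (simp add: UU.T.l_distr UU.T.r_distr UU.tens_mult gen_swap[of x y] UU.tens_ladd UU.tens_radd UU.T.a_ac)
    have 2: "?g y \<otimes>\<^bsub>?T\<^esub> ?g x = ?l ?yx \<oplus>\<^bsub>?T\<^esub> ?X \<oplus>\<^bsub>?T\<^esub> (?Y \<oplus>\<^bsub>?T\<^esub> ?r ?yx)"
      using xy b by (simp add: UU.T.l_distr UU.T.r_distr UU.tens_mult UU.T.a_ac)
    have c: "?l ?yx \<in> carrier ?T" "?X \<in> carrier ?T" "?Y \<in> carrier ?T" "?r ?yx \<in> carrier ?T" "?l ?b \<in> carrier ?T" "?r ?b \<in> carrier ?T"
      using xy b by auto
    have 3: "?g x \<otimes>\<^bsub>?T\<^esub> ?g y = ?g (lie_bracket A x y) \<oplus>\<^bsub>?T\<^esub> ?g y \<otimes>\<^bsub>?T\<^esub> ?g x"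
      unfolding 1 2 using c by (simp add: UU.T.a_ac)
    show ?thesis unfolding 3 using xy b by (simp add: UU.T.a_assoc a_minus_def UU.T.r_neg)
  qed
  note * = env_lift[OF UU.Qalg_tensor g ga gs gb]
  show "env_comult A \<in> alg_hom U ?T" "\<And>x. x \<in> carrier A \<Longrightarrow> env_comult A (gen x) = ?g x"
    unfolding env_comult_def Let_def using * by auto
qed

lemma counit:
  shows "env_counit A \<in> alg_hom U Q_alg" and "\<And>x. x \<in> carrier A \<Longrightarrow> env_counit A (gen x) = 0"
proof -
  interpret Q: Qalg Q_alg by (rule Qalg_Q)
  have "a \<ominus>\<^bsub>Q_alg\<^esub> a = 0" for a using Q.r_neg[of a] by (simp add: a_minus_def Q_alg_def)
  then have gb: "0 = 0 \<otimes>\<^bsub>Q_alg\<^esub> 0 \<ominus>\<^bsub>Q_alg\<^esub> 0 \<otimes>\<^bsub>Q_alg\<^esub> 0" by simp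
  show "env_counit A \<in> alg_hom U Q_alg" "\<And>x. x \<in> carrier A \<Longrightarrow> env_counit A (gen x) = 0"
    unfolding env_counit_def
    using env_lift[of Q_alg "\<lambda>_. 0", OF Qalg_Q _ _ _ gb] by (auto simp: Q_alg_def)
qed

lemma antipode:
  shows "env_antipode A \<in> alg_hom U (op_alg U)"
    and "\<And>x. x \<in> carrier A \<Longrightarrow> env_antipode A (gen x) = \<ominus>\<^bsub>U\<^esub> gen x"
proof -
  let ?g = "\<lambda>x. \<ominus>\<^bsub>U\<^esub> gen x"
  interpret O: Qalg "op_alg U" by (rule U.Qalg_op)
  have [simp]: "a_inv (op_alg U) x = \<ominus>\<^bsub>U\<^esub> x" for x
    unfolding a_inv_def by (simp add: op_alg_def)
  have "?g (lie_bracket A x y) = ?g x \<otimes>\<^bsub>op_alg U\<^esub> ?g y \<ominus>\<^bsub>op_alg U\<^esub> ?g y \<otimes>\<^bsub>op_alg U\<^esub> ?g x"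
    if "x \<in> carrier A" "y \<in> carrier A" for x y
    using that by (simp add: gen_bracket[symmetric] a_minus_def U.l_minus U.r_minus U.minus_add U.a_ac)
  then show "env_antipode A \<in> alg_hom U (op_alg U)"
     "\<And>x. x \<in> carrier A \<Longrightarrow> env_antipode A (gen x) = \<ominus>\<^bsub>U\<^esub> gen x"
    unfolding env_antipode_def
    using env_lift[OF U.Qalg_op, of ?g] by (auto simp: gen_add gen_sm U.minus_add U.sm_ruminus)
qed

end

section \<open>Linear operators on functions\<close>

definition lin_op :: "(('s \<Rightarrow> rat) \<Rightarrow> 's \<Rightarrow> rat) \<Rightarrow> bool" where
  "lin_op T \<longleftrightarrow> (\<forall>f g. T (\<lambda>s. f s + g s) = (\<lambda>s. T f s + T g s)) \<and> (\<forall>r f. T (\<lambda>s. r * f s) = (\<lambda>s. r * T f s))"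

definition op_ring :: "(rat, ('s \<Rightarrow> rat) \<Rightarrow> 's \<Rightarrow> rat) module" where
  "op_ring = \<lparr>carrier = {T. lin_op T}, mult = (\<lambda>S T f. S (T f)), one = (\<lambda>f. f), zero = (\<lambda>f s. 0),
     add = (\<lambda>S T f s. S f s + T f s), smult = (\<lambda>r T f s. r * T f s)\<rparr>"

lemma op_ring_Qalg: "Qalg op_ring"
proof -
  have "ring op_ring"
  proof (rule ringI)
    show "abelian_group op_ring"
    proof (rule abelian_groupI)
      fix x :: "('s \<Rightarrow> rat) \<Rightarrow> 's \<Rightarrow> rat" assume "x \<in> carrier op_ring"
      then show "\<exists>y\<in>carrier op_ring. y \<oplus>\<^bsub>op_ring\<^esub> x = \<zero>\<^bsub>op_ring\<^esub>"
        by (intro bexI[of _ "\<lambda>f s. - x f s"]) (auto simp: op_ring_def lin_op_def)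
    qed (auto simp: op_ring_def lin_op_def algebra_simps)
    show "monoid op_ring" by (rule monoidI) (auto simp: op_ring_def lin_op_def)
  qed (auto simp: op_ring_def lin_op_def)
  then show ?thesis
    by (intro Qalg.intro Qalg_axioms.intro) (auto simp: op_ring_def lin_op_def algebra_simps)
qed

interpretation OP: Qalg op_ring by (rule op_ring_Qalg)

lemma op_ring_sel [simp]: "carrier op_ring = {T. lin_op T}" "S \<otimes>\<^bsub>op_ring\<^esub> T = (\<lambda>f. S (T f))"
  "\<one>\<^bsub>op_ring\<^esub> = (\<lambda>f. f)" "\<zero>\<^bsub>op_ring\<^esub> = (\<lambda>f s. 0)" "S \<oplus>\<^bsub>op_ring\<^esub> T = (\<lambda>f s. S f s + T f s)"
  "r \<odot>\<^bsub>op_ring\<^esub> T = (\<lambda>f s. r * T f s)"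
  by (auto simp: op_ring_def)

lemma op_ring_minus: "lin_op S \<Longrightarrow> lin_op T \<Longrightarrow> S \<ominus>\<^bsub>op_ring\<^esub> T = (\<lambda>f s. S f s - T f s)"
proof -
  assume "lin_op S" "lin_op T"
  then have "\<ominus>\<^bsub>op_ring\<^esub> T = (\<lambda>f s. - T f s)" using OP.sm_m1[of T] by simp
  then show ?thesis by (simp add: a_minus_def)
qed

lemma op_ring_finsum: "finite I \<Longrightarrow> (\<And>i. i \<in> I \<Longrightarrow> lin_op (T i)) \<Longrightarrow> finsum op_ring T I = (\<lambda>f s. \<Sum>i\<in>I. T i f s)"
  by (induction I rule: finite_induct) (auto simp: OP.finsum_empty Pi_iff)

section \<open>Families with divided-power multiplication rules\<close>

definition sub :: "'b multiset \<Rightarrow> 'b multiset set" where "sub A = {X. X \<subseteq># A}"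

lemma sub_iff: "X \<in> sub A \<longleftrightarrow> (\<forall>x. count X x \<le> count A x)"
  by (simp add: sub_def subseteq_mset_def)

lemma sub_add: "sub (add_mset c A) = sub A \<union> add_mset c ` sub A"
proof (intro equalityI subsetI)
  fix X assume X: "X \<in> sub (add_mset c A)"
  show "X \<in> sub A \<union> add_mset c ` sub A"
  proof (cases "count X c \<le> count A c")
    case True
    have "count X x \<le> count A x" for x
      using X True by (cases "x = c") (auto simp: sub_iff dest: spec[of _ x])
    then have "X \<in> sub A" unfolding sub_iff by blast
    then show ?thesis ..
  next
    case False
    have "count (X - {#c#}) x \<le> count A x" for x
      using X by (cases "x = c") (auto simp: sub_iff dest: spec[of _ x])
    then have "X - {#c#} \<in> sub A" unfolding sub_iff by blast
    moreover have "X = add_mset c (X - {#c#})" using False by (simp add: count_greater_zero_iff[symmetric] del: count_greater_zero_iff)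
    ultimately show ?thesis by blast
  qed
next
  fix X assume "X \<in> sub A \<union> add_mset c ` sub A"
  then have "count X x \<le> count (add_mset c A) x" for x
    by (auto simp: sub_iff intro: le_SucI)
  then show "X \<in> sub (add_mset c A)" unfolding sub_iff by blast
qed

lemma finite_sub [simp]: "finite (sub A)"
proof (induction A)
  case empty
  show ?case by (simp add: sub_def)
qed (simp add: sub_add)

lemma sub_D: "X \<in> sub A \<Longrightarrow> X \<subseteq># A" by (simp add: sub_def)

lemma sub_with: "c \<in># A \<Longrightarrow> {X \<in> sub A. c \<in># X} = add_mset c ` sub (A - {#c#})"
proof (intro equalityI subsetI)
  fix X assume X: "X \<in> {X \<in> sub A. c \<in># X}"
  then have "X = add_mset c (X - {#c#})" by simp
  moreover have "X - {#c#} \<in> sub (A - {#c#})" using X by (simp add: sub_iff diff_le_mono)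
  ultimately show "X \<in> add_mset c ` sub (A - {#c#})" by (rule image_eqI)
next
  fix X assume "c \<in># A" "X \<in> add_mset c ` sub (A - {#c#})"
  then show "X \<in> {X \<in> sub A. c \<in># X}" by (auto simp: sub_def insert_subset_eq_iff)
qed

lemma sub_without: "c \<in># A \<Longrightarrow> {X \<in> sub A. c \<in># A - X} = sub (A - {#c#})"
proof (intro equalityI subsetI)
  fix X assume X: "X \<in> {X \<in> sub A. c \<in># A - X}"
  then have "count X c < count A c" by (simp add: in_diff_count)
  then have "count X x \<le> count (A - {#c#}) x" for x
    using X by (cases "x = c") (auto simp: sub_iff dest: spec[of _ x])
  then show "X \<in> sub (A - {#c#})" unfolding sub_iff by blast
next
  fix X assume c: "c \<in># A" and X: "X \<in> sub (A - {#c#})"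
  have "count X c \<le> count A c - 1" using X by (auto simp: sub_iff dest!: spec[of _ c])
  moreover have "count A c > 0" using c by (simp only: count_greater_zero_iff)
  ultimately have "count X c < count A c" by linarith
  then have "c \<in># A - X" by (simp add: in_diff_count)
  moreover have "X \<in> sub A" using X unfolding sub_iff by (metis count_diff diff_le_self le_trans)
  ultimately show "X \<in> {X \<in> sub A. c \<in># A - X}" by simp
qed

lemma (in Qalg) finsum_swap:
  assumes "finite I" "finite J" "\<And>i j. i \<in> I \<Longrightarrow> j \<in> J \<Longrightarrow> f i j \<in> carrier M"
  shows "(\<Oplus>i\<in>I. \<Oplus>j\<in>J. f i j) = (\<Oplus>j\<in>J. \<Oplus>i\<in>I. f i j)"
  using assms(1,3)
proof (induction I rule: finite_induct)
  case empty
  then show ?case by (simp add: add.finprod_one)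
next
  case (insert x I)
  have "(\<Oplus>i\<in>insert x I. \<Oplus>j\<in>J. f i j) = (\<Oplus>j\<in>J. f x j) \<oplus> (\<Oplus>j\<in>J. \<Oplus>i\<in>I. f i j)"
    using insert by (subst finsum_insert) (auto intro!: finsum_closed)
  also have "\<dots> = (\<Oplus>j\<in>J. f x j \<oplus> (\<Oplus>i\<in>I. f i j))"
    using insert by (subst finsum_addf) (auto intro!: finsum_closed)
  also have "\<dots> = (\<Oplus>j\<in>J. \<Oplus>i\<in>insert x I. f i j)"
    using insert by (intro finsum_cong') (auto intro!: finsum_closed)
  finally show ?case .
qed

lemma (in Qalg) finsum_if:
  assumes "finite I" "\<And>i. i \<in> I \<Longrightarrow> P i \<Longrightarrow> f i \<in> carrier M"
  shows "(\<Oplus>i\<in>{i\<in>I. P i}. f i) = (\<Oplus>i\<in>I. if P i then f i else \<zero>)"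
  by (rule add.finprod_mono_neutral_cong_left) (use assms in auto)

text \<open>The abstract setting of the recursion: \<open>mu\<close> is the partial product on indices. For matrix units
  it is \<open>E\<^sub>i\<^sub>jE\<^sub>j\<^sub>l = E\<^sub>i\<^sub>l\<close>, undefined when the product is zero; positive, negative
  and diagonal matrix units are three instances.\<close>

locale partial_mult =
  fixes B :: "'b set" and mu :: "'b \<Rightarrow> 'b \<Rightarrow> 'b option"
  assumes mu_closed: "b \<in> B \<Longrightarrow> c \<in> B \<Longrightarrow> mu b c = Some d \<Longrightarrow> d \<in> B"
begin

definition ok :: "'b \<Rightarrow> 'b multiset \<Rightarrow> 'b set" where
  "ok b A = {c \<in> set_mset A. mu b c \<noteq> None}"

text \<open>The right-hand side of the rule \<open>w\<^sub>b w\<^sub>A = \<dots>\<close>, as an operator on arbitrary functions \<open>G\<close> of multisets.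
  It models the divided powers \<open>\<Prod>x\<^sub>c\<^bsup>A(c)\<^esup> / A(c)!\<close>: adding \<open>b\<close> costs \<open>A\<^sub>b + 1\<close>, and \<open>b\<close> can be absorbed by
  an entry \<open>c\<close>, once for each element of the set of entries.\<close>

definition rec :: "(rat, 't) module \<Rightarrow> 'b \<Rightarrow> ('b multiset \<Rightarrow> 't) \<Rightarrow> 'b multiset \<Rightarrow> 't" where
  "rec T b G A = of_nat (count A b + 1) \<odot>\<^bsub>T\<^esub> G (add_mset b A) \<oplus>\<^bsub>T\<^esub>
     (\<Oplus>\<^bsub>T\<^esub>c\<in>ok b A. of_nat (count (A - {#c#}) (the (mu b c)) + 1) \<odot>\<^bsub>T\<^esub> G (add_mset (the (mu b c)) (A - {#c#})))"

definition conv :: "(rat, 't) module \<Rightarrow> ('b multiset \<Rightarrow> 'b multiset \<Rightarrow> 't) \<Rightarrow> 'b multiset \<Rightarrow> 't" where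
  "conv T \<beta> A = (\<Oplus>\<^bsub>T\<^esub>X\<in>sub A. \<beta> X (A - X))"

lemma finite_ok [simp]: "finite (ok b A)" by (simp add: ok_def)

lemma okD: "c \<in> ok b A \<Longrightarrow> c \<in># A" by (simp add: ok_def)

lemma ok_closed: "b \<in> B \<Longrightarrow> set_mset A \<subseteq> B \<Longrightarrow> c \<in> ok b A \<Longrightarrow> the (mu b c) \<in> B"
  using mu_closed[of b c "the (mu b c)"] by (auto simp: ok_def)

lemma set_diff: "set_mset A \<subseteq> B \<Longrightarrow> set_mset (A - X) \<subseteq> B"
  by (meson in_diffD subset_iff)

lemma set_sub: "set_mset A \<subseteq> B \<Longrightarrow> X \<in> sub A \<Longrightarrow> set_mset X \<subseteq> B"
  by (meson sub_D set_mset_mono subset_trans)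

definition clos :: "(rat, 't) module \<Rightarrow> ('b multiset \<Rightarrow> 't) \<Rightarrow> bool" where
  "clos T G \<longleftrightarrow> (\<forall>A. set_mset A \<subseteq> B \<longrightarrow> G A \<in> carrier T)"

lemma closD: "clos T G \<Longrightarrow> set_mset A \<subseteq> B \<Longrightarrow> G A \<in> carrier T" by (simp add: clos_def)

lemma rec_summand_closed:
  assumes "Qalg T" "clos T G" "b \<in> B" "set_mset A \<subseteq> B" "c \<in> ok b A"
  shows "G (add_mset (the (mu b c)) (A - {#c#})) \<in> carrier T"
  using assms ok_closed[OF assms(3-5)] set_diff[OF assms(4), of "{#c#}"] by (auto intro!: closD)

lemma rec_closed:
  assumes "Qalg T" "clos T G" "b \<in> B" "set_mset A \<subseteq> B"
  shows "rec T b G A \<in> carrier T"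
proof -
  interpret T: Qalg T by fact
  have 1: "G (add_mset b A) \<in> carrier T" using assms by (intro closD) auto
  show ?thesis unfolding rec_def
    by (intro T.add.m_closed T.sm_closed T.finsum_closed Pi_I rec_summand_closed[OF assms] 1)
qed

lemma rec_linear:
  assumes T: "Qalg T" and T': "Qalg T'" and G: "clos T G" and b: "b \<in> B" and A: "set_mset A \<subseteq> B"
    and hc: "\<And>x. x \<in> carrier T \<Longrightarrow> h x \<in> carrier T'"
    and ha: "\<And>x y. x \<in> carrier T \<Longrightarrow> y \<in> carrier T \<Longrightarrow> h (x \<oplus>\<^bsub>T\<^esub> y) = h x \<oplus>\<^bsub>T'\<^esub> h y"
    and hs: "\<And>r x. x \<in> carrier T \<Longrightarrow> h (r \<odot>\<^bsub>T\<^esub> x) = r \<odot>\<^bsub>T'\<^esub> h x"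
  shows "rec T' b (\<lambda>X. h (G X)) A = h (rec T b G A)"
proof -
  interpret T: Qalg T by fact
  interpret T': Qalg T' by fact
  have h0: "h \<zero>\<^bsub>T\<^esub> = \<zero>\<^bsub>T'\<^esub>" using hs[of "\<zero>\<^bsub>T\<^esub>" 0] by (simp add: hc)
  have hfin: "h (finsum T f I) = finsum T' (\<lambda>i. h (f i)) I" if "f \<in> I \<rightarrow> carrier T" for f and I :: "'b set"
    using that by (induction I rule: infinite_finite_induct) (auto simp: h0 ha hc Pi_iff)
  have 1: "G (add_mset b A) \<in> carrier T" using A b by (intro closD[OF G]) auto
  note 2 = rec_summand_closed[OF T G b A]
  show ?thesis unfolding rec_def
    using 1 2 by (subst ha) (auto simp: hs hfin hc intro!: T'.finsum_cong' arg_cong2[of _ _ _ _ "add T'"])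
qed

text \<open>In \<open>conv T \<beta> (add_mset d A)\<close> write the weight of \<open>d\<close> in the whole multiset as the sum of its
  weights in the two parts, and move one copy of \<open>d\<close> out of the part that carries the weight.\<close>

lemma conv_shift:
  assumes T: "Qalg T" and cl: "\<And>X Y. set_mset X \<subseteq> B \<Longrightarrow> set_mset Y \<subseteq> B \<Longrightarrow> \<beta> X Y \<in> carrier T"
    and A: "set_mset A \<subseteq> B" and d: "d \<in> B"
  shows "(\<Oplus>\<^bsub>T\<^esub>X\<in>sub A. of_nat (count X d + 1) \<odot>\<^bsub>T\<^esub> \<beta> (add_mset d X) (A - X)) \<oplus>\<^bsub>T\<^esub>
         (\<Oplus>\<^bsub>T\<^esub>X\<in>sub A. of_nat (count (A - X) d + 1) \<odot>\<^bsub>T\<^esub> \<beta> X (add_mset d (A - X)))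
         = of_nat (count A d + 1) \<odot>\<^bsub>T\<^esub> conv T \<beta> (add_mset d A)"
proof -
  interpret T: Qalg T by fact
  let ?D = "add_mset d A"
  have D: "set_mset ?D \<subseteq> B" using A d by auto
  have c: "\<beta> X (?D - X) \<in> carrier T" if "X \<in> sub ?D" for X
    using that D by (intro cl set_sub[OF D] set_diff[OF D])
  have 1: "{X \<in> sub ?D. d \<in># X} = add_mset d ` sub A" using sub_with[of d ?D] by simp
  have 2: "{X \<in> sub ?D. d \<in># ?D - X} = sub A" using sub_without[of d ?D] by simp
  have e: "of_nat (count A d + 1) \<odot>\<^bsub>T\<^esub> \<beta> X (?D - X) =
     of_nat (count X d) \<odot>\<^bsub>T\<^esub> \<beta> X (?D - X) \<oplus>\<^bsub>T\<^esub> of_nat (count (?D - X) d) \<odot>\<^bsub>T\<^esub> \<beta> X (?D - X)"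
    if X: "X \<in> sub ?D" for X
  proof -
    have "count X d \<le> count ?D d" using X by (simp only: sub_iff)
    then have "count A d + 1 = count X d + count (?D - X) d" by simp
    then show ?thesis using c[OF X] by (simp only: of_nat_add T.sm_ladd)
  qed
  have "of_nat (count A d + 1) \<odot>\<^bsub>T\<^esub> conv T \<beta> ?D =
     (\<Oplus>\<^bsub>T\<^esub>X\<in>sub ?D. of_nat (count X d) \<odot>\<^bsub>T\<^esub> \<beta> X (?D - X) \<oplus>\<^bsub>T\<^esub> of_nat (count (?D - X) d) \<odot>\<^bsub>T\<^esub> \<beta> X (?D - X))"
    unfolding conv_def
  proof (subst T.sm_finsum, use c in blast, rule T.finsum_cong')
    show "of_nat (count A d + 1) \<odot>\<^bsub>T\<^esub> \<beta> X (?D - X) =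
     of_nat (count X d) \<odot>\<^bsub>T\<^esub> \<beta> X (?D - X) \<oplus>\<^bsub>T\<^esub> of_nat (count (?D - X) d) \<odot>\<^bsub>T\<^esub> \<beta> X (?D - X)"
      if "X \<in> sub ?D" for X by (rule e[OF that])
  qed (use c in auto)
  also have "\<dots> = (\<Oplus>\<^bsub>T\<^esub>X\<in>sub ?D. of_nat (count X d) \<odot>\<^bsub>T\<^esub> \<beta> X (?D - X)) \<oplus>\<^bsub>T\<^esub>
    (\<Oplus>\<^bsub>T\<^esub>X\<in>sub ?D. of_nat (count (?D - X) d) \<odot>\<^bsub>T\<^esub> \<beta> X (?D - X))"
    using c by (intro T.finsum_addf) auto
  also have "(\<Oplus>\<^bsub>T\<^esub>X\<in>sub ?D. of_nat (count X d) \<odot>\<^bsub>T\<^esub> \<beta> X (?D - X)) =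
     (\<Oplus>\<^bsub>T\<^esub>X\<in>add_mset d ` sub A. of_nat (count X d) \<odot>\<^bsub>T\<^esub> \<beta> X (?D - X))"
    unfolding 1[symmetric]
  proof (rule T.add.finprod_mono_neutral_cong_right)
    fix X assume X: "X \<in> sub ?D - {X \<in> sub ?D. d \<in># X}"
    then have "count X d = 0" by (auto simp: not_in_iff)
    then show "of_nat (count X d) \<odot>\<^bsub>T\<^esub> \<beta> X (?D - X) = \<zero>\<^bsub>T\<^esub>" using T.sm_zero[OF c[of X]] X by (simp only: of_nat_0 Diff_iff)
  qed (use c in auto)
  also have "\<dots> = (\<Oplus>\<^bsub>T\<^esub>X\<in>sub A. of_nat (count X d + 1) \<odot>\<^bsub>T\<^esub> \<beta> (add_mset d X) (A - X))"
    by (subst T.finsum_reindex) (use c 1 in \<open>auto simp: inj_on_def intro!: T.finsum_cong'\<close>)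
  also have "(\<Oplus>\<^bsub>T\<^esub>X\<in>sub ?D. of_nat (count (?D - X) d) \<odot>\<^bsub>T\<^esub> \<beta> X (?D - X)) =
     (\<Oplus>\<^bsub>T\<^esub>X\<in>sub A. of_nat (count (?D - X) d) \<odot>\<^bsub>T\<^esub> \<beta> X (?D - X))"
    unfolding 2[symmetric]
  proof (rule T.add.finprod_mono_neutral_cong_right)
    fix X assume X: "X \<in> sub ?D - {X \<in> sub ?D. d \<in># ?D - X}"
    then have "count (?D - X) d = 0" by (auto simp: not_in_iff)
    then show "of_nat (count (?D - X) d) \<odot>\<^bsub>T\<^esub> \<beta> X (?D - X) = \<zero>\<^bsub>T\<^esub>" using T.sm_zero[OF c[of X]] X by (simp only: of_nat_0 Diff_iff)
  qed (use c in auto)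
  also have "\<dots> = (\<Oplus>\<^bsub>T\<^esub>X\<in>sub A. of_nat (count (A - X) d + 1) \<odot>\<^bsub>T\<^esub> \<beta> X (add_mset d (A - X)))"
  proof (rule T.finsum_cong')
    fix X assume X: "X \<in> sub A"
    have "?D - X = add_mset d (A - X)"
    proof (rule multiset_eqI)
      fix x have "count X x \<le> count A x" using X by (simp only: sub_iff)
      then show "count (?D - X) x = count (add_mset d (A - X)) x" by (simp add: Suc_diff_le)
    qed
    then show "of_nat (count (?D - X) d) \<odot>\<^bsub>T\<^esub> \<beta> X (?D - X) = of_nat (count (A - X) d + 1) \<odot>\<^bsub>T\<^esub> \<beta> X (add_mset d (A - X))"
      by simp
  next
    show "(\<lambda>X. of_nat (count (A - X) d + 1) \<odot>\<^bsub>T\<^esub> \<beta> X (add_mset d (A - X))) \<in> sub A \<rightarrow> carrier T"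
    proof (intro Pi_I T.sm_closed)
      fix X assume X: "X \<in> sub A"
      show "\<beta> X (add_mset d (A - X)) \<in> carrier T"
        by (rule cl[OF set_sub[OF A X]]) (use d set_diff[OF A, of X] in simp)
    qed
  qed simp
  finally show ?thesis by simp
qed

lemma ok_sub: "X \<in> sub A \<Longrightarrow> ok b X = {c \<in> ok b A. c \<in># X}"
  by (auto simp: ok_def dest: sub_D mset_subset_eqD)

lemma ok_diff: "ok b (A - X) = {c \<in> ok b A. c \<in># A - X}"
  by (auto simp: ok_def dest: in_diffD)

text \<open>The Leibniz rule: \<open>b\<close> is added to, or absorbed by an entry of, one of the two parts. Each kind
  of term is an instance of \<open>conv_shift\<close>, with \<open>d\<close> the added entry and, for absorption, \<open>A\<close> replaced
  by \<open>A - {#c#}\<close>.\<close>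
lemma rec_conv:
  assumes T: "Qalg T" and cl: "\<And>X Y. set_mset X \<subseteq> B \<Longrightarrow> set_mset Y \<subseteq> B \<Longrightarrow> \<beta> X Y \<in> carrier T"
    and A: "set_mset A \<subseteq> B" and b: "b \<in> B"
  shows "rec T b (conv T \<beta>) A =
    (\<Oplus>\<^bsub>T\<^esub>X\<in>sub A. rec T b (\<lambda>X'. \<beta> X' (A - X)) X \<oplus>\<^bsub>T\<^esub> rec T b (\<beta> X) (A - X))"
proof -
  interpret T: Qalg T by fact
  define m where "m c = the (mu b c)" for c
  define k1 where "k1 X c = of_nat (count (X - {#c#}) (m c) + 1) \<odot>\<^bsub>T\<^esub> \<beta> (add_mset (m c) (X - {#c#})) (A - X)" for X c
  define k2 where "k2 X c = of_nat (count (A - X - {#c#}) (m c) + 1) \<odot>\<^bsub>T\<^esub> \<beta> X (add_mset (m c) (A - X - {#c#}))" for X c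
  define p1 where "p1 X = of_nat (count X b + 1) \<odot>\<^bsub>T\<^esub> \<beta> (add_mset b X) (A - X)" for X
  define p2 where "p2 X = of_nat (count (A - X) b + 1) \<odot>\<^bsub>T\<^esub> \<beta> X (add_mset b (A - X))" for X
  have mB: "c \<in> ok b A \<Longrightarrow> m c \<in> B" for c using ok_closed[OF b A] by (simp add: m_def)
  have AX: "set_mset (A - X) \<subseteq> B" for X by (rule set_diff[OF A])
  have XB: "X \<in> sub A \<Longrightarrow> set_mset X \<subseteq> B" for X by (rule set_sub[OF A])
  have p1: "X \<in> sub A \<Longrightarrow> p1 X \<in> carrier T" and p2: "X \<in> sub A \<Longrightarrow> p2 X \<in> carrier T" for X
    unfolding p1_def p2_def using b XB[of X] AX[of X] by (auto intro!: T.sm_closed cl)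
  have k1: "X \<in> sub A \<Longrightarrow> c \<in> ok b A \<Longrightarrow> k1 X c \<in> carrier T"
    and k2: "X \<in> sub A \<Longrightarrow> c \<in> ok b A \<Longrightarrow> k2 X c \<in> carrier T" for X c
    unfolding k1_def k2_def using mB[of c] XB[of X] AX[of X] set_diff[OF XB[of X], of "{#c#}"] set_diff[OF AX[of X], of "{#c#}"]
    by (auto intro!: T.sm_closed cl)
  have e1: "rec T b (\<lambda>X'. \<beta> X' (A - X)) X = p1 X \<oplus>\<^bsub>T\<^esub> (\<Oplus>\<^bsub>T\<^esub>c\<in>ok b A. if c \<in># X then k1 X c else \<zero>\<^bsub>T\<^esub>)"
    if X: "X \<in> sub A" for X
    unfolding rec_def m_def[symmetric] k1_def[symmetric] p1_def[symmetric]
    by (subst ok_sub[OF X], subst T.finsum_if) (use k1 X in auto)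
  have e2: "rec T b (\<beta> X) (A - X) = p2 X \<oplus>\<^bsub>T\<^esub> (\<Oplus>\<^bsub>T\<^esub>c\<in>ok b A. if c \<in># A - X then k2 X c else \<zero>\<^bsub>T\<^esub>)"
    if X: "X \<in> sub A" for X
    unfolding rec_def m_def[symmetric] k2_def[symmetric] p2_def[symmetric]
    by (subst ok_diff, subst T.finsum_if) (use k2 X in auto)
  let ?R1 = "\<lambda>X. \<Oplus>\<^bsub>T\<^esub>c\<in>ok b A. if c \<in># X then k1 X c else \<zero>\<^bsub>T\<^esub>"
  let ?R2 = "\<lambda>X. \<Oplus>\<^bsub>T\<^esub>c\<in>ok b A. if c \<in># A - X then k2 X c else \<zero>\<^bsub>T\<^esub>"
  have R: "X \<in> sub A \<Longrightarrow> ?R1 X \<in> carrier T" "X \<in> sub A \<Longrightarrow> ?R2 X \<in> carrier T" for X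
    using k1 k2 by (auto intro!: T.finsum_closed)
  let ?S = "\<lambda>f. finsum T f (sub A)"
  have "(\<Oplus>\<^bsub>T\<^esub>X\<in>sub A. rec T b (\<lambda>X'. \<beta> X' (A - X)) X \<oplus>\<^bsub>T\<^esub> rec T b (\<beta> X) (A - X)) =
    (\<Oplus>\<^bsub>T\<^esub>X\<in>sub A. (p1 X \<oplus>\<^bsub>T\<^esub> ?R1 X) \<oplus>\<^bsub>T\<^esub> (p2 X \<oplus>\<^bsub>T\<^esub> ?R2 X))"
    by (rule T.finsum_cong') (use e1 e2 p1 p2 R in auto)
  also have "\<dots> = (?S p1 \<oplus>\<^bsub>T\<^esub> ?S ?R1) \<oplus>\<^bsub>T\<^esub> (?S p2 \<oplus>\<^bsub>T\<^esub> ?S ?R2)"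
    using p1 p2 R by (simp add: T.finsum_addf Pi_iff)
  also have "\<dots> = (?S p1 \<oplus>\<^bsub>T\<^esub> ?S p2) \<oplus>\<^bsub>T\<^esub> (?S ?R1 \<oplus>\<^bsub>T\<^esub> ?S ?R2)"
  proof -
    have "?S p1 \<in> carrier T" "?S p2 \<in> carrier T" "?S ?R1 \<in> carrier T" "?S ?R2 \<in> carrier T"
      using p1 p2 R by (simp_all add: T.finsum_closed Pi_iff)
    then show ?thesis by (simp only: T.a_assoc T.a_comm T.a_lcomm T.add.m_closed)
  qed
  also have "?S p1 \<oplus>\<^bsub>T\<^esub> ?S p2 = of_nat (count A b + 1) \<odot>\<^bsub>T\<^esub> conv T \<beta> (add_mset b A)"
    unfolding p1_def p2_def by (rule conv_shift[OF T cl A b])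
  also have "?S ?R1 \<oplus>\<^bsub>T\<^esub> ?S ?R2 =
    (\<Oplus>\<^bsub>T\<^esub>c\<in>ok b A. of_nat (count (A - {#c#}) (m c) + 1) \<odot>\<^bsub>T\<^esub> conv T \<beta> (add_mset (m c) (A - {#c#})))"
  proof -
    let ?q1 = "\<lambda>c. \<Oplus>\<^bsub>T\<^esub>X\<in>sub A. if c \<in># X then k1 X c else \<zero>\<^bsub>T\<^esub>"
    let ?q2 = "\<lambda>c. \<Oplus>\<^bsub>T\<^esub>X\<in>sub A. if c \<in># A - X then k2 X c else \<zero>\<^bsub>T\<^esub>"
    have q: "?q1 c \<in> carrier T" "?q2 c \<in> carrier T" if "c \<in> ok b A" for c
      using that k1 k2 by (auto intro!: T.finsum_closed)
    have "?S ?R1 = (\<Oplus>\<^bsub>T\<^esub>c\<in>ok b A. ?q1 c)" "?S ?R2 = (\<Oplus>\<^bsub>T\<^esub>c\<in>ok b A. ?q2 c)"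
      by (rule T.finsum_swap; use k1 k2 in auto)+
    then have "?S ?R1 \<oplus>\<^bsub>T\<^esub> ?S ?R2 = (\<Oplus>\<^bsub>T\<^esub>c\<in>ok b A. ?q1 c \<oplus>\<^bsub>T\<^esub> ?q2 c)"
      using q by (simp add: T.finsum_addf Pi_iff)
    also have "\<dots> = (\<Oplus>\<^bsub>T\<^esub>c\<in>ok b A. of_nat (count (A - {#c#}) (m c) + 1) \<odot>\<^bsub>T\<^esub> conv T \<beta> (add_mset (m c) (A - {#c#})))"
    proof (rule T.finsum_cong')
      fix c assume c: "c \<in> ok b A"
      let ?K = "A - {#c#}"
      have cA: "c \<in># A" using c by (rule okD)
      have K: "set_mset ?K \<subseteq> B" by (rule AX)
      have "?q1 c = (\<Oplus>\<^bsub>T\<^esub>X\<in>add_mset c ` sub ?K. k1 X c)"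
        unfolding sub_with[OF cA, symmetric] by (rule T.finsum_if[symmetric]) (use k1 c in auto)
      also have "\<dots> = (\<Oplus>\<^bsub>T\<^esub>X\<in>sub ?K. k1 (add_mset c X) c)"
        by (rule T.finsum_reindex) (use k1 c sub_with[OF cA] in \<open>auto simp: inj_on_def\<close>)
      also have "\<dots> = (\<Oplus>\<^bsub>T\<^esub>X\<in>sub ?K. of_nat (count X (m c) + 1) \<odot>\<^bsub>T\<^esub> \<beta> (add_mset (m c) X) (?K - X))"
        by (simp add: k1_def)
      finally have 1: "?q1 c = \<dots>" .
      have "?q2 c = (\<Oplus>\<^bsub>T\<^esub>X\<in>sub ?K. k2 X c)"
        unfolding sub_without[OF cA, symmetric] by (rule T.finsum_if[symmetric]) (use k2 c in auto)
      also have "\<dots> = (\<Oplus>\<^bsub>T\<^esub>X\<in>sub ?K. of_nat (count (?K - X) (m c) + 1) \<odot>\<^bsub>T\<^esub> \<beta> X (add_mset (m c) (?K - X)))"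
        by (simp add: k2_def diff_right_commute)
      finally have 2: "?q2 c = \<dots>" .
      show "?q1 c \<oplus>\<^bsub>T\<^esub> ?q2 c = of_nat (count ?K (m c) + 1) \<odot>\<^bsub>T\<^esub> conv T \<beta> (add_mset (m c) ?K)"
        unfolding 1 2 by (rule conv_shift[OF T cl K mB[OF c]])
    next
      show "(\<lambda>c. of_nat (count (A - {#c#}) (m c) + 1) \<odot>\<^bsub>T\<^esub> conv T \<beta> (add_mset (m c) (A - {#c#}))) \<in> ok b A \<rightarrow> carrier T"
      proof
        fix c assume c: "c \<in> ok b A"
        have D: "set_mset (add_mset (m c) (A - {#c#})) \<subseteq> B" using AX[of "{#c#}"] mB[OF c] by auto
        show "of_nat (count (A - {#c#}) (m c) + 1) \<odot>\<^bsub>T\<^esub> conv T \<beta> (add_mset (m c) (A - {#c#})) \<in> carrier T"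
          unfolding conv_def
          by (intro T.sm_closed T.finsum_closed Pi_I cl set_sub[OF D] set_diff[OF D])
      qed
    qed simp
    finally show ?thesis .
  qed
  finally show ?thesis unfolding rec_def m_def by (rule sym)
qed

lemma conv_closed:
  assumes "Qalg T" "\<And>X Y. set_mset X \<subseteq> B \<Longrightarrow> set_mset Y \<subseteq> B \<Longrightarrow> \<beta> X Y \<in> carrier T" "set_mset A \<subseteq> B"
  shows "conv T \<beta> A \<in> carrier T"
proof -
  interpret T: Qalg T by fact
  show ?thesis unfolding conv_def
    by (intro T.finsum_closed Pi_I assms(2) set_sub[OF assms(3)] set_diff[OF assms(3)])
qed

lemma conv_empty:
  assumes "Qalg T" "\<beta> {#} {#} \<in> carrier T" shows "conv T \<beta> {#} = \<beta> {#} {#}"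
proof -
  interpret T: Qalg T by fact
  have "sub {#} = {{#} :: 'b multiset}" by (auto simp: sub_def)
  then show ?thesis using assms by (simp add: conv_def T.finsum_empty)
qed

definition fam :: "(rat, 't) module \<Rightarrow> ('b multiset \<Rightarrow> 't) \<Rightarrow> bool" where
  "fam T w \<longleftrightarrow> clos T w \<and> w {#} = \<one>\<^bsub>T\<^esub> \<and>
     (\<forall>b\<in>B. \<forall>A. set_mset A \<subseteq> B \<longrightarrow> w {#b#} \<otimes>\<^bsub>T\<^esub> w A = rec T b w A)"

lemma famD:
  assumes "fam T w"
  shows "clos T w" "w {#} = \<one>\<^bsub>T\<^esub>" "b \<in> B \<Longrightarrow> set_mset A \<subseteq> B \<Longrightarrow> w {#b#} \<otimes>\<^bsub>T\<^esub> w A = rec T b w A"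
    "set_mset A \<subseteq> B \<Longrightarrow> w A \<in> carrier T"
  using assms by (auto simp: fam_def clos_def)

lemma fam_image:
  assumes "Qalg T" "Qalg T'" "fam T w" "h \<in> alg_hom T T'"
  shows "fam T' (\<lambda>A. h (w A))"
proof -
  interpret h: Qalg_hom T T' h using assms by (auto intro: Qalg_hom.intro simp: Qalg_hom_axioms_def)
  note w = famD[OF assms(3)]
  show ?thesis unfolding fam_def clos_def
  proof (intro conjI allI impI ballI)
    fix b A assume b: "b \<in> B" and A: "set_mset A \<subseteq> B"
    have "h (w {#b#}) \<otimes>\<^bsub>T'\<^esub> h (w A) = h (w {#b#} \<otimes>\<^bsub>T\<^esub> w A)" using w b A by (subst h.hmult) auto
    also have "\<dots> = rec T' b (\<lambda>A. h (w A)) A" unfolding w(3)[OF b A]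
      by (rule rec_linear[symmetric, OF assms(1,2) w(1) b A]) (auto simp: h.hadd h.hsm)
    finally show "h (w {#b#}) \<otimes>\<^bsub>T'\<^esub> h (w A) = rec T' b (\<lambda>A. h (w A)) A" .
  qed (use w h.hone in auto)
qed

text \<open>The recursion determines \<open>G (add_mset b A)\<close> from the values of \<open>G\<close> on multisets of the size of \<open>A\<close>,
  so a solution is determined by \<open>G {#}\<close>.\<close>

lemma rec_solve:
  assumes T: "Qalg T" and G: "clos T G" and b: "b \<in> B" and A: "set_mset A \<subseteq> B"
  shows "G (add_mset b A) = (1 / of_nat (count A b + 1)) \<odot>\<^bsub>T\<^esub> (rec T b G A \<ominus>\<^bsub>T\<^esub>
     (\<Oplus>\<^bsub>T\<^esub>c\<in>ok b A. of_nat (count (A - {#c#}) (the (mu b c)) + 1) \<odot>\<^bsub>T\<^esub> G (add_mset (the (mu b c)) (A - {#c#}))))"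
proof -
  interpret T: Qalg T by fact
  let ?s = "(\<Oplus>\<^bsub>T\<^esub>c\<in>ok b A. of_nat (count (A - {#c#}) (the (mu b c)) + 1) \<odot>\<^bsub>T\<^esub> G (add_mset (the (mu b c)) (A - {#c#})))"
  have 1: "G (add_mset b A) \<in> carrier T" using A b by (intro closD[OF G]) auto
  have 2: "?s \<in> carrier T" by (intro T.finsum_closed Pi_I T.sm_closed rec_summand_closed[OF T G b A])
  have "rec T b G A \<ominus>\<^bsub>T\<^esub> ?s = of_nat (count A b + 1) \<odot>\<^bsub>T\<^esub> G (add_mset b A)"
    unfolding rec_def a_minus_def using 1 2 by (simp add: T.a_assoc T.r_neg)
  then show ?thesis using 1 by (simp add: T.sm_assoc[symmetric])
qed

lemma rec_unique:
  assumes T: "Qalg T" and G: "clos T G" and H: "clos T H" and 0: "G {#} = H {#}"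
    and rG: "\<And>b A. b \<in> B \<Longrightarrow> set_mset A \<subseteq> B \<Longrightarrow> rec T b G A = x b \<otimes>\<^bsub>T\<^esub> G A"
    and rH: "\<And>b A. b \<in> B \<Longrightarrow> set_mset A \<subseteq> B \<Longrightarrow> rec T b H A = x b \<otimes>\<^bsub>T\<^esub> H A"
  shows "set_mset A \<subseteq> B \<Longrightarrow> G A = H A"
proof (induction "size A" arbitrary: A)
  case 0
  then show ?case using assms(4) by simp
next
  case (Suc k)
  interpret T: Qalg T by fact
  from Suc(2) obtain b A' where A: "A = add_mset b A'" "size A' = k"
    by (metis size_eq_Suc_imp_eq_union nat.inject size_add_mset)
  then have b: "b \<in> B" and A': "set_mset A' \<subseteq> B" using Suc by auto
  have e: "G (add_mset (the (mu b c)) (A' - {#c#})) = H (add_mset (the (mu b c)) (A' - {#c#}))" if c: "c \<in> ok b A'" for c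
    using A c okD[OF c] ok_closed[OF b A' c] set_diff[OF A', of "{#c#}"]
    by (intro Suc(1)) (auto simp: size_Suc_Diff1)
  have "rec T b G A' = rec T b H A'" using Suc(1)[of A'] A A' b by (simp add: rG rH)
  moreover have "(\<Oplus>\<^bsub>T\<^esub>c\<in>ok b A'. of_nat (count (A' - {#c#}) (the (mu b c)) + 1) \<odot>\<^bsub>T\<^esub> G (add_mset (the (mu b c)) (A' - {#c#}))) =
     (\<Oplus>\<^bsub>T\<^esub>c\<in>ok b A'. of_nat (count (A' - {#c#}) (the (mu b c)) + 1) \<odot>\<^bsub>T\<^esub> H (add_mset (the (mu b c)) (A' - {#c#})))"
    by (rule T.finsum_cong') (auto simp: e intro!: T.sm_closed rec_summand_closed[OF T H b A'])
  ultimately show ?case unfolding A rec_solve[OF T G b A'] rec_solve[OF T H b A'] by simp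
qed

text \<open>By the Leibniz rule the convolution \<open>u * v\<close> satisfies the recursion for multiplication by
  \<open>u\<^sub>b + v\<^sub>b = w\<^sub>b\<close>, provided \<open>v\<^sub>b\<close> can be moved past \<open>u\<^sub>X\<close>; uniqueness does the rest.\<close>

lemma fam_conv:
  assumes T: "Qalg T" and w: "fam T w" and u: "fam T u" and v: "fam T v"
    and g: "\<And>b. b \<in> B \<Longrightarrow> w {#b#} = u {#b#} \<oplus>\<^bsub>T\<^esub> v {#b#}"
    and comm: "\<And>b X. b \<in> B \<Longrightarrow> set_mset X \<subseteq> B \<Longrightarrow> v {#b#} \<otimes>\<^bsub>T\<^esub> u X = u X \<otimes>\<^bsub>T\<^esub> v {#b#}"
    and A: "set_mset A \<subseteq> B"
  shows "w A = (\<Oplus>\<^bsub>T\<^esub>X\<in>sub A. u X \<otimes>\<^bsub>T\<^esub> v (A - X))"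
proof -
  interpret T: Qalg T by fact
  let ?\<beta> = "\<lambda>X Y. u X \<otimes>\<^bsub>T\<^esub> v Y"
  have cl: "?\<beta> X Y \<in> carrier T" if "set_mset X \<subseteq> B" "set_mset Y \<subseteq> B" for X Y
    using that famD(4)[OF u] famD(4)[OF v] by auto
  have "w A = conv T ?\<beta> A"
  proof (rule rec_unique[OF T famD(1)[OF w] _ _ _ _ A])
    show "clos T (conv T ?\<beta>)" unfolding clos_def by (intro allI impI conv_closed[OF T] cl)
    show "w {#} = conv T ?\<beta> {#}" by (subst conv_empty[OF T]) (auto simp: famD(2)[OF u] famD(2)[OF v] famD(2)[OF w])
    show "rec T b w A = w {#b#} \<otimes>\<^bsub>T\<^esub> w A" if "b \<in> B" "set_mset A \<subseteq> B" for b A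
      using famD(3)[OF w that] by simp
    show "rec T b (conv T ?\<beta>) A = w {#b#} \<otimes>\<^bsub>T\<^esub> conv T ?\<beta> A" if b: "b \<in> B" and A: "set_mset A \<subseteq> B" for b A
    proof -
      have c: "w {#b#} \<in> carrier T" "u {#b#} \<in> carrier T" "v {#b#} \<in> carrier T"
        using b by (auto intro!: famD(4)[OF w] famD(4)[OF u] famD(4)[OF v])
      have "rec T b (\<lambda>X'. ?\<beta> X' (A - X)) X \<oplus>\<^bsub>T\<^esub> rec T b (?\<beta> X) (A - X) = w {#b#} \<otimes>\<^bsub>T\<^esub> ?\<beta> X (A - X)"
        if X: "X \<in> sub A" for X
      proof -
        have XB: "set_mset X \<subseteq> B" "set_mset (A - X) \<subseteq> B" using set_sub[OF A X] set_diff[OF A] by auto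
        note [simp] = famD(4)[OF u XB(1)] famD(4)[OF v XB(2)]
        have 1: "rec T b (\<lambda>X'. ?\<beta> X' (A - X)) X = rec T b u X \<otimes>\<^bsub>T\<^esub> v (A - X)"
          by (rule rec_linear[OF T T famD(1)[OF u] b XB(1)]) (auto simp: T.l_distr T.sm_lmult)
        have 2: "rec T b (?\<beta> X) (A - X) = u X \<otimes>\<^bsub>T\<^esub> rec T b v (A - X)"
          by (rule rec_linear[OF T T famD(1)[OF v] b XB(2)]) (auto simp: T.r_distr T.sm_rmult)
        have "u X \<otimes>\<^bsub>T\<^esub> (v {#b#} \<otimes>\<^bsub>T\<^esub> v (A - X)) = v {#b#} \<otimes>\<^bsub>T\<^esub> (u X \<otimes>\<^bsub>T\<^esub> v (A - X))"
          using c by (simp add: T.m_assoc[symmetric] comm[OF b XB(1)])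
        then show ?thesis unfolding 1 2 famD(3)[OF u b XB(1), symmetric] famD(3)[OF v b XB(2), symmetric] g[OF b]
          using c by (simp add: T.m_assoc T.l_distr)
      qed
      note step = this
      have "rec T b (conv T ?\<beta>) A = (\<Oplus>\<^bsub>T\<^esub>X\<in>sub A. rec T b (\<lambda>X'. ?\<beta> X' (A - X)) X \<oplus>\<^bsub>T\<^esub> rec T b (?\<beta> X) (A - X))"
        by (rule rec_conv[OF T cl A b])
      also have "\<dots> = (\<Oplus>\<^bsub>T\<^esub>X\<in>sub A. w {#b#} \<otimes>\<^bsub>T\<^esub> ?\<beta> X (A - X))"
      proof (rule T.finsum_cong')
        show "(\<lambda>X. w {#b#} \<otimes>\<^bsub>T\<^esub> ?\<beta> X (A - X)) \<in> sub A \<rightarrow> carrier T"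
          using c by (intro Pi_I T.m_closed[OF _ cl] set_sub[OF A] set_diff[OF A]) auto
      qed (rule refl, rule step)
      also have "\<dots> = w {#b#} \<otimes>\<^bsub>T\<^esub> conv T ?\<beta> A"
        unfolding conv_def using c by (intro T.finsum_rdistr[symmetric]) (auto intro!: cl set_sub[OF A] set_diff[OF A])
      finally show ?thesis .
    qed
  qed
  then show ?thesis by (simp add: conv_def)
qed

text \<open>Here the two contributions in the Leibniz rule, \<open>s\<^sub>X s\<^sub>b w\<^sub>Y\<close> and \<open>s\<^sub>X w\<^sub>b w\<^sub>Y\<close>, cancel. So the convolution
  \<open>s * w\<close> is annihilated by all recursion operators, and it vanishes on all nonempty multisets by
  solving the recursion for the largest one.\<close>

lemma fam_antipode:
  assumes T: "Qalg T" and w: "fam T w" and s: "fam (op_alg T) s"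
    and g: "\<And>b. b \<in> B \<Longrightarrow> s {#b#} = \<ominus>\<^bsub>T\<^esub> w {#b#}"
    and A: "set_mset A \<subseteq> B" "A \<noteq> {#}"
  shows "(\<Oplus>\<^bsub>T\<^esub>X\<in>sub A. s X \<otimes>\<^bsub>T\<^esub> w (A - X)) = \<zero>\<^bsub>T\<^esub>"
proof -
  interpret T: Qalg T by fact
  have T': "Qalg (op_alg T)" by (rule T.Qalg_op)
  let ?\<beta> = "\<lambda>X Y. s X \<otimes>\<^bsub>T\<^esub> w Y"
  have sc: "s X \<in> carrier T" if "set_mset X \<subseteq> B" for X using famD(4)[OF s that] by simp
  have cl: "?\<beta> X Y \<in> carrier T" if "set_mset X \<subseteq> B" "set_mset Y \<subseteq> B" for X Y
    using that famD(4)[OF w] sc by auto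
  have clc: "clos T (conv T ?\<beta>)" unfolding clos_def by (intro allI impI conv_closed[OF T] cl)
  have rec_op: "rec (op_alg T) b G A = rec T b G A" for b A and G :: "'b multiset \<Rightarrow> 'a"
    by (simp add: rec_def)
  have r: "rec T b (conv T ?\<beta>) A = \<zero>\<^bsub>T\<^esub>" if b: "b \<in> B" and A: "set_mset A \<subseteq> B" for b A
  proof -
    have c: "w {#b#} \<in> carrier T" using b by (auto intro!: famD(4)[OF w])
    have "rec T b (\<lambda>X'. ?\<beta> X' (A - X)) X \<oplus>\<^bsub>T\<^esub> rec T b (?\<beta> X) (A - X) = \<zero>\<^bsub>T\<^esub>"
      if X: "X \<in> sub A" for X
    proof -
      have XB: "set_mset X \<subseteq> B" "set_mset (A - X) \<subseteq> B" using set_sub[OF A X] set_diff[OF A] by auto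
      note [simp] = sc[OF XB(1)] famD(4)[OF w XB(2)]
      have sclos: "clos T s" using sc by (simp add: clos_def)
      have 1: "rec T b (\<lambda>X'. ?\<beta> X' (A - X)) X = rec T b s X \<otimes>\<^bsub>T\<^esub> w (A - X)"
        by (rule rec_linear[OF T T sclos b XB(1)]) (auto simp: T.l_distr T.sm_lmult)
      have 2: "rec T b (?\<beta> X) (A - X) = s X \<otimes>\<^bsub>T\<^esub> rec T b w (A - X)"
        by (rule rec_linear[OF T T famD(1)[OF w] b XB(2)]) (auto simp: T.r_distr T.sm_rmult)
      have 3: "rec T b s X = s X \<otimes>\<^bsub>T\<^esub> (\<ominus>\<^bsub>T\<^esub> w {#b#})"
        using famD(3)[OF s b XB(1)] g[OF b] by (simp add: rec_op)
      show ?thesis unfolding 1 2 3 famD(3)[OF w b XB(2), symmetric]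
        using c by (simp add: T.m_assoc T.l_minus T.r_minus T.l_neg)
    qed
    then show ?thesis
      by (subst rec_conv[where \<beta> = ?\<beta>, OF T cl A b]) (simp_all add: T.add.finprod_one_eqI)
  qed
  have "set_mset A \<subseteq> B \<Longrightarrow> A \<noteq> {#} \<Longrightarrow> conv T ?\<beta> A = \<zero>\<^bsub>T\<^esub>" for A
  proof (induction "size A" arbitrary: A)
    case (Suc k)
    from Suc(2) obtain b A' where A: "A = add_mset b A'" "size A' = k"
      by (metis size_eq_Suc_imp_eq_union nat.inject size_add_mset)
    then have b: "b \<in> B" and A': "set_mset A' \<subseteq> B" using Suc by auto
    have e: "conv T ?\<beta> (add_mset (the (mu b c)) (A' - {#c#})) = \<zero>\<^bsub>T\<^esub>" if c: "c \<in> ok b A'" for c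
      using A c okD[OF c] ok_closed[OF b A' c] set_diff[OF A', of "{#c#}"]
      by (intro Suc(1)) (auto simp: size_Suc_Diff1)
    then have "(\<Oplus>\<^bsub>T\<^esub>c\<in>ok b A'. of_nat (count (A' - {#c#}) (the (mu b c)) + 1) \<odot>\<^bsub>T\<^esub> conv T ?\<beta> (add_mset (the (mu b c)) (A' - {#c#}))) = \<zero>\<^bsub>T\<^esub>"
      by (intro T.add.finprod_one_eqI) (simp add: e)
    then show ?case unfolding A rec_solve[OF T clc b A'] by (simp add: r[OF b A'] a_minus_def)
  qed simp
  then show ?thesis using A by (simp add: conv_def)
qed

text \<open>For a pair \<open>{b, c}\<close> the product \<open>w\<^sub>b w\<^sub>c\<close> is already accounted for by the absorption term, which leaves
  nothing for \<open>w\<^bsub>{b,c}\<^esub>\<close>; larger multisets then vanish by the recursion.\<close>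

lemma fam_vanish:
  assumes T: "Qalg T" and w: "fam T w"
    and g: "\<And>b c. b \<in> B \<Longrightarrow> c \<in> B \<Longrightarrow> w {#b#} \<otimes>\<^bsub>T\<^esub> w {#c#} = (case mu b c of None \<Rightarrow> \<zero>\<^bsub>T\<^esub> | Some d \<Rightarrow> w {#d#})"
  shows "set_mset A \<subseteq> B \<Longrightarrow> size A \<ge> 2 \<Longrightarrow> w A = \<zero>\<^bsub>T\<^esub>"
proof (induction "size A" arbitrary: A)
  case (Suc k)
  interpret T: Qalg T by fact
  from Suc(2) obtain b A' where A: "A = add_mset b A'" "size A' = k"
    by (metis size_eq_Suc_imp_eq_union nat.inject size_add_mset)
  then have b: "b \<in> B" and A': "set_mset A' \<subseteq> B" using Suc by auto
  note wb = famD(4)[OF w, of "{#b#}"]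
  let ?S = "(\<Oplus>\<^bsub>T\<^esub>c\<in>ok b A'. of_nat (count (A' - {#c#}) (the (mu b c)) + 1) \<odot>\<^bsub>T\<^esub> w (add_mset (the (mu b c)) (A' - {#c#})))"
  have "rec T b w A' \<ominus>\<^bsub>T\<^esub> ?S = \<zero>\<^bsub>T\<^esub>"
  proof (cases "k = 1")
    case True
    then obtain c where c: "A' = {#c#}" using A by (metis size_1_singleton_mset)
    then have cB: "c \<in> B" using A' by auto
    have "?S = (case mu b c of None \<Rightarrow> \<zero>\<^bsub>T\<^esub> | Some d \<Rightarrow> w {#d#})"
    proof (cases "mu b c")
      case None
      then have "ok b A' = {}" by (auto simp: ok_def c)
      then show ?thesis by (simp add: None T.finsum_empty)
    next
      case (Some d)
      then have "ok b A' = {c}" by (auto simp: ok_def c)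
      moreover have "w {#d#} \<in> carrier T" using mu_closed[OF b cB Some] by (auto intro!: famD(4)[OF w])
      ultimately show ?thesis by (simp add: Some c)
    qed
    also have "\<dots> = rec T b w A'" using g[OF b cB] famD(3)[OF w b A'] c by simp
    finally show ?thesis using rec_closed[OF T famD(1)[OF w] b A'] by simp
  next
    case False
    with Suc(2,4) have k: "k \<ge> 2" by linarith
    have e: "w (add_mset (the (mu b c)) (A' - {#c#})) = \<zero>\<^bsub>T\<^esub>" if c: "c \<in> ok b A'" for c
      using A k c okD[OF c] ok_closed[OF b A' c] set_diff[OF A', of "{#c#}"]
      by (intro Suc(1)) (auto simp: size_Suc_Diff1)
    then have "?S = \<zero>\<^bsub>T\<^esub>" by (intro T.add.finprod_one_eqI) (simp add: e)
    moreover have "rec T b w A' = \<zero>\<^bsub>T\<^esub>"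
      using Suc(1)[of A'] A A' k b wb famD(3)[OF w b A'] by simp
    ultimately show ?thesis by simp
  qed
  then show ?case unfolding A rec_solve[OF T famD(1)[OF w] b A'] by simp
qed simp

end

section \<open>Row sums and periodic matrices\<close>

text \<open>A row of a periodic matrix applied to a function. The support is finite for the rows in question,
  although the matrices have infinitely many entries.\<close>

definition rs :: "(int \<Rightarrow> rat) \<Rightarrow> (int \<Rightarrow> rat) \<Rightarrow> rat" where
  "rs x g = (\<Sum>k | x k \<noteq> 0. x k * g k)"

lemma rs_sup: "finite S \<Longrightarrow> {k. x k \<noteq> 0} \<subseteq> S \<Longrightarrow> rs x g = (\<Sum>k\<in>S. x k * g k)"
  unfolding rs_def by (rule sum.mono_neutral_left) auto

lemma rs_add: "finite {k. x k \<noteq> 0} \<Longrightarrow> finite {k. y k \<noteq> 0} \<Longrightarrow> rs (\<lambda>k. x k + y k) g = rs x g + rs y g"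
  by (subst (1 2 3) rs_sup[of "{k. x k \<noteq> 0} \<union> {k. y k \<noteq> 0}"]) (auto simp: distrib_right sum.distrib)

lemma rs_sm: "finite {k. x k \<noteq> 0} \<Longrightarrow> rs (\<lambda>k. r * x k) g = r * rs x g"
  by (subst (1 2) rs_sup[of "{k. x k \<noteq> 0}"]) (auto simp: sum_distrib_left mult_ac)

lemma rs_radd: "rs x (\<lambda>k. g k + h k) = rs x g + rs x h"
  by (simp add: rs_def distrib_left sum.distrib)

lemma rs_rsm: "rs x (\<lambda>k. r * g k) = r * rs x g"
  by (simp add: rs_def sum_distrib_left mult_ac)

lemma rs_rs:
  assumes x: "finite {k. x k \<noteq> 0}" and y: "\<And>k. finite {m. y k m \<noteq> 0}"
  shows "rs (\<lambda>m. rs x (\<lambda>k. y k m)) g = rs x (\<lambda>k. rs (y k) g)"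
    and "finite {m. rs x (\<lambda>k. y k m) \<noteq> 0}"
proof -
  let ?S = "\<Union>k\<in>{k. x k \<noteq> 0}. {m. y k m \<noteq> 0}"
  have S: "finite ?S" using x y by auto
  have sub: "{m. rs x (\<lambda>k. y k m) \<noteq> 0} \<subseteq> ?S"
  proof
    fix m assume "m \<in> {m. rs x (\<lambda>k. y k m) \<noteq> 0}"
    then have "(\<Sum>k | x k \<noteq> 0. x k * y k m) \<noteq> 0" by (simp add: rs_def)
    then obtain k where "k \<in> {k. x k \<noteq> 0}" "x k * y k m \<noteq> 0" by (meson sum.not_neutral_contains_not_neutral)
    then show "m \<in> ?S" by auto
  qed
  then show "finite {m. rs x (\<lambda>k. y k m) \<noteq> 0}" using S finite_subset by blast
  have "rs (\<lambda>m. rs x (\<lambda>k. y k m)) g = (\<Sum>m\<in>?S. \<Sum>k | x k \<noteq> 0. x k * (y k m * g m))"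
    by (subst rs_sup[OF S sub]) (simp add: rs_def sum_distrib_right mult.assoc)
  also have "\<dots> = (\<Sum>k | x k \<noteq> 0. \<Sum>m\<in>?S. x k * (y k m * g m))" by (rule sum.swap)
  also have "\<dots> = rs x (\<lambda>k. rs (y k) g)"
    unfolding rs_def[of x] by (intro sum.cong refl) (subst rs_sup[OF S], auto simp: sum_distrib_left)
  finally show "rs (\<lambda>m. rs x (\<lambda>k. y k m)) g = rs x (\<lambda>k. rs (y k) g)" .
qed

lemma mat_alg_sel [simp]: "carrier (mat_alg n) = per_mats n"
  "x \<otimes>\<^bsub>mat_alg n\<^esub> y = (\<lambda>i j. rs (x i) (\<lambda>k. y k j))"
  "\<one>\<^bsub>mat_alg n\<^esub> = (\<lambda>i j. if i = j then 1 else 0)" "\<zero>\<^bsub>mat_alg n\<^esub> = (\<lambda>i j. 0)"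
  "x \<oplus>\<^bsub>mat_alg n\<^esub> y = (\<lambda>i j. x i j + y i j)" "r \<odot>\<^bsub>mat_alg n\<^esub> x = (\<lambda>i j. r * x i j)"
  by (auto simp: mat_alg_def rs_def)

lemma per_matsD: "x \<in> per_mats n \<Longrightarrow> finite {j. x i j \<noteq> 0}" "x \<in> per_mats n \<Longrightarrow> finite {i. x i j \<noteq> 0}"
  "x \<in> per_mats n \<Longrightarrow> x (i + int n) (j + int n) = x i j"
  by (auto simp: per_mats_def)

lemma finite_neq_subset: "finite S \<Longrightarrow> {k. x k \<noteq> 0} \<subseteq> S \<Longrightarrow> finite {k. x k \<noteq> 0}"
  by (rule finite_subset)

lemma per_mats_mult:
  assumes x: "x \<in> per_mats n" and y: "y \<in> per_mats n"
  shows "(\<lambda>i j. rs (x i) (\<lambda>k. y k j)) \<in> per_mats n"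
proof -
  have 1: "rs (x (i + int n)) (\<lambda>k. y k (j + int n)) = rs (x i) (\<lambda>k. y k j)" for i j
  proof -
    have "bij_betw (\<lambda>k. k + int n) {k. x i k \<noteq> 0} {k. x (i + int n) k \<noteq> 0}"
      by (rule bij_betwI[of _ _ _ "\<lambda>k. k - int n"])
        (use x per_matsD(3)[OF x, of i] in \<open>auto, metis diff_add_cancel\<close>)
    then show ?thesis unfolding rs_def
      by (subst sum.reindex_bij_betw[symmetric]) (auto simp: per_matsD(3)[OF x] per_matsD(3)[OF y])
  qed
  have 2: "finite {j. rs (x i) (\<lambda>k. y k j) \<noteq> 0}" for i
    by (rule rs_rs(2)) (use x y per_matsD in auto)
  have 3: "finite {i. rs (x i) (\<lambda>k. y k j) \<noteq> 0}" for j
  proof (rule finite_subset)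
    show "{i. rs (x i) (\<lambda>k. y k j) \<noteq> 0} \<subseteq> (\<Union>k\<in>{k. y k j \<noteq> 0}. {i. x i k \<noteq> 0})"
    proof
      fix i assume "i \<in> {i. rs (x i) (\<lambda>k. y k j) \<noteq> 0}"
      then have "(\<Sum>k | x i k \<noteq> 0. x i k * y k j) \<noteq> 0" by (simp add: rs_def)
      then obtain k where "k \<in> {k. x i k \<noteq> 0}" "x i k * y k j \<noteq> 0" by (meson sum.not_neutral_contains_not_neutral)
      then show "i \<in> (\<Union>k\<in>{k. y k j \<noteq> 0}. {i. x i k \<noteq> 0})" by auto
    qed
    show "finite (\<Union>k\<in>{k. y k j \<noteq> 0}. {i. x i k \<noteq> 0})"
      by (rule finite_UN_I) (auto simp: per_matsD(2)[OF x] per_matsD(2)[OF y])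
  qed
  show ?thesis using 1 2 3 unfolding per_mats_def by simp
qed

lemma per_mats_add: "x \<in> per_mats n \<Longrightarrow> y \<in> per_mats n \<Longrightarrow> (\<lambda>i j. x i j + y i j :: rat) \<in> per_mats n"
  unfolding per_mats_def
proof (simp, intro conjI allI; elim conjE)
  fix i
  assume "\<forall>i. finite {j. x i j \<noteq> 0}" "\<forall>i. finite {j. y i j \<noteq> 0}"
  then have "finite ({j. x i j \<noteq> 0} \<union> {j. y i j \<noteq> 0})" by simp
  then show "finite {j. x i j + y i j \<noteq> 0}" by (rule finite_neq_subset) auto
next
  fix j
  assume "\<forall>j. finite {i. x i j \<noteq> 0}" "\<forall>j. finite {i. y i j \<noteq> 0}"
  then have "finite ({i. x i j \<noteq> 0} \<union> {i. y i j \<noteq> 0})" by simp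
  then show "finite {i. x i j + y i j \<noteq> 0}" by (rule finite_neq_subset) auto
qed

lemma per_mats_sm: "x \<in> per_mats n \<Longrightarrow> (\<lambda>i j. r * x i j :: rat) \<in> per_mats n"
  unfolding per_mats_def by (cases "r = 0") auto

lemma per_mats_zero: "(\<lambda>i j. 0) \<in> per_mats n" by (simp add: per_mats_def)

lemma mat_alg_Qalg: "Qalg (mat_alg n)"
proof -
  have "ring (mat_alg n)"
  proof (rule ringI)
    show "abelian_group (mat_alg n)"
    proof (rule abelian_groupI)
      fix x :: "int \<Rightarrow> int \<Rightarrow> rat" assume "x \<in> carrier (mat_alg n)"
      then show "\<exists>y\<in>carrier (mat_alg n). y \<oplus>\<^bsub>mat_alg n\<^esub> x = \<zero>\<^bsub>mat_alg n\<^esub>"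
        using per_mats_sm[of x n "-1"] by (intro bexI[of _ "\<lambda>i j. - x i j"]) auto
    qed (auto simp: per_mats_add per_mats_zero add_ac)
    show "monoid (mat_alg n)"
    proof (rule monoidI)
      show "\<one>\<^bsub>mat_alg n\<^esub> \<in> carrier (mat_alg n)" by (simp add: per_mats_def)
      fix x assume x: "x \<in> carrier (mat_alg n)"
      have "rs (\<lambda>j. if i = j then 1 else 0) g = g i" for i g
        by (subst rs_sup[of "{i}"]) auto
      then show "\<one>\<^bsub>mat_alg n\<^esub> \<otimes>\<^bsub>mat_alg n\<^esub> x = x" by simp
      have "rs (x i) (\<lambda>k. if k = j then 1 else 0) = x i j" for i j
        using per_matsD(1)[of x n i] x
        by (subst rs_sup[of "insert j {j. x i j \<noteq> 0}"]) (auto simp: if_distrib cong: if_cong)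
      then show "x \<otimes>\<^bsub>mat_alg n\<^esub> \<one>\<^bsub>mat_alg n\<^esub> = x" by simp
    next
      fix x y z assume "x \<in> carrier (mat_alg n)" "y \<in> carrier (mat_alg n)" "z \<in> carrier (mat_alg n)"
      then show "x \<otimes>\<^bsub>mat_alg n\<^esub> y \<otimes>\<^bsub>mat_alg n\<^esub> z = x \<otimes>\<^bsub>mat_alg n\<^esub> (y \<otimes>\<^bsub>mat_alg n\<^esub> z)"
        by (simp add: rs_rs(1) per_matsD)
    qed (simp add: per_mats_mult)
  next
    fix x y z assume "x \<in> carrier (mat_alg n)" "y \<in> carrier (mat_alg n)" "z \<in> carrier (mat_alg n)"
    then show "(x \<oplus>\<^bsub>mat_alg n\<^esub> y) \<otimes>\<^bsub>mat_alg n\<^esub> z = x \<otimes>\<^bsub>mat_alg n\<^esub> z \<oplus>\<^bsub>mat_alg n\<^esub> y \<otimes>\<^bsub>mat_alg n\<^esub> z"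
      "z \<otimes>\<^bsub>mat_alg n\<^esub> (x \<oplus>\<^bsub>mat_alg n\<^esub> y) = z \<otimes>\<^bsub>mat_alg n\<^esub> x \<oplus>\<^bsub>mat_alg n\<^esub> z \<otimes>\<^bsub>mat_alg n\<^esub> y"
      by (simp_all add: rs_add rs_radd per_matsD)
  qed
  then show ?thesis
    by (intro Qalg.intro Qalg_axioms.intro)
      (auto simp: algebra_simps per_mats_sm rs_rsm rs_sm per_matsD)
qed

lemma lie_bracket_mat:
  assumes "x \<in> per_mats n" "y \<in> per_mats n"
  shows "lie_bracket (mat_alg n) x y = (\<lambda>i j. rs (x i) (\<lambda>k. y k j) - rs (y i) (\<lambda>k. x k j))"
proof -
  interpret Qalg "mat_alg n" by (rule mat_alg_Qalg)
  have "\<ominus>\<^bsub>mat_alg n\<^esub> z = (\<lambda>i j. - z i j)" if "z \<in> per_mats n" for z using sm_m1[of z] that by simp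
  then show ?thesis using assms by (simp add: lie_bracket_def a_minus_def per_mats_mult)
qed

section \<open>The action on functions of lists of letters\<close>

text \<open>A letter \<open>Some (i, m)\<close> stands for the matrix unit \<open>E\<^sub>i\<^sub>m\<close> with row index \<open>i\<close>, and \<open>None\<close> for a formally adjoined
  unit. It is the unit that makes the action faithful enough to separate integral elements.\<close>

type_synonym letter = "(int \<times> int) option"

text \<open>The transpose of right multiplication by \<open>x\<close> on letters, on functions of one letter: \<open>E\<^sub>i\<^sub>l x\<close> has the
  coordinates \<open>x\<^sub>l\<^sub>m\<close>, and the unit times \<open>x\<close> is \<open>x\<close> itself, expanded in the matrix units with row in the
  window from 1 to \<open>n\<close>. Passing to functions turns a right action into a left one.\<close>

definition rho :: "nat \<Rightarrow> (int \<Rightarrow> int \<Rightarrow> rat) \<Rightarrow> (letter \<Rightarrow> rat) \<Rightarrow> letter \<Rightarrow> rat" where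
  "rho n x g a = (case a of None \<Rightarrow> (\<Sum>i\<in>{1..int n}. rs (x i) (\<lambda>m. g (Some (i, m))))
     | Some (i, l) \<Rightarrow> rs (x l) (\<lambda>m. g (Some (i, m))))"

lemma rho_add: "x \<in> per_mats n \<Longrightarrow> y \<in> per_mats n \<Longrightarrow> rho n (\<lambda>i j. x i j + y i j) g a = rho n x g a + rho n y g a"
  by (auto simp: rho_def rs_add per_matsD sum.distrib split: option.split)

lemma rho_sm: "x \<in> per_mats n \<Longrightarrow> rho n (\<lambda>i j. r * x i j) g a = r * rho n x g a"
  by (auto simp: rho_def rs_sm per_matsD sum_distrib_left split: option.split)

lemma rho_mult: "x \<in> per_mats n \<Longrightarrow> y \<in> per_mats n \<Longrightarrow> rho n (\<lambda>i j. rs (x i) (\<lambda>k. y k j)) g a = rho n x (rho n y g) a"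
  by (auto simp: rho_def rs_rs(1) per_matsD split: option.split)

lemma rho_radd: "rho n x (\<lambda>b. g b + h b) a = rho n x g a + rho n x h a"
  by (auto simp: rho_def rs_radd sum.distrib split: option.split)

lemma rho_rsm: "rho n x (\<lambda>b. r * g b) a = r * rho n x g a"
  by (auto simp: rho_def rs_rsm sum_distrib_left split: option.split)

lemma rho_cong: "(\<And>b. g (Some b) = h (Some b)) \<Longrightarrow> rho n x g a = rho n x h a"
  by (auto simp: rho_def split: option.split)

text \<open>Only finitely many values enter, so every linear operator in another variable commutes with \<open>rho\<close>
  (\<open>rho_act_comm\<close>), even though the functions have no finiteness property.\<close>

lemma rho_rep: "\<exists>R c. finite R \<and> (\<forall>g. rho n x g a = (\<Sum>q\<in>R. c q * g q))" if "x \<in> per_mats n"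
proof (cases a)
  case (Some p)
  obtain i l where p: "p = (i, l)" by force
  show ?thesis
  proof (intro exI conjI allI)
    show "finite ((\<lambda>m. Some (i, m)) ` {m. x l m \<noteq> 0})" using per_matsD(1)[OF that] by auto
    fix g show "rho n x g a = (\<Sum>q\<in>(\<lambda>m. Some (i, m)) ` {m. x l m \<noteq> 0}. (x l (snd (the q))) * g q)"
      by (subst sum.reindex) (auto simp: rho_def Some p rs_def inj_on_def)
  qed
next
  case None
  let ?R = "(\<lambda>p. Some p) ` (SIGMA i:{1..int n}. {m. x i m \<noteq> 0})"
  show ?thesis
  proof (intro exI conjI allI)
    show "finite ?R" using per_matsD(1)[OF that] by auto
    fix g show "rho n x g a = (\<Sum>q\<in>?R. (x (fst (the q)) (snd (the q))) * g q)"
      using per_matsD(1)[OF that]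
      by (subst sum.reindex) (auto simp: rho_def None rs_def inj_on_def sum.Sigma split_def)
  qed
qed

text \<open>The action on functions of words is the sum over positions. The operators \<open>act1\<close> and \<open>act2\<close> split off
  the first position; they commute, and this splitting plays the part of the coproduct.\<close>

definition act :: "nat \<Rightarrow> (int \<Rightarrow> int \<Rightarrow> rat) \<Rightarrow> (letter list \<Rightarrow> rat) \<Rightarrow> letter list \<Rightarrow> rat" where
  "act n x f s = (\<Sum>p<length s. rho n x (\<lambda>a. f (s[p := a])) (s ! p))"

definition act1 :: "nat \<Rightarrow> (int \<Rightarrow> int \<Rightarrow> rat) \<Rightarrow> (letter list \<Rightarrow> rat) \<Rightarrow> letter list \<Rightarrow> rat" where
  "act1 n x f s = (case s of [] \<Rightarrow> 0 | a # s' \<Rightarrow> rho n x (\<lambda>b. f (b # s')) a)"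

definition act2 :: "nat \<Rightarrow> (int \<Rightarrow> int \<Rightarrow> rat) \<Rightarrow> (letter list \<Rightarrow> rat) \<Rightarrow> letter list \<Rightarrow> rat" where
  "act2 n x f s = (case s of [] \<Rightarrow> 0 | a # s' \<Rightarrow> act n x (\<lambda>t. f (a # t)) s')"

lemma act_Nil [simp]: "act n x f [] = 0" by (simp add: act_def)
lemma act_Cons: "act n x f (a # s) = rho n x (\<lambda>b. f (b # s)) a + act n x (\<lambda>t. f (a # t)) s"
  by (simp add: act_def sum.lessThan_Suc_shift del: sum.lessThan_Suc)
lemma act12_simps [simp]: "act1 n x f [] = 0" "act1 n x f (a # s) = rho n x (\<lambda>b. f (b # s)) a"
  "act2 n x f [] = 0" "act2 n x f (a # s) = act n x (\<lambda>t. f (a # t)) s"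
  by (simp_all add: act1_def act2_def)

lemma act_split: "act n x = act1 n x \<oplus>\<^bsub>op_ring\<^esub> act2 n x"
proof (intro ext)
  fix f s show "act n x f s = (act1 n x \<oplus>\<^bsub>op_ring\<^esub> act2 n x) f s" by (cases s) (simp_all add: act_Cons)
qed

lemma lin_act: "lin_op (act n x)"
  by (auto simp: lin_op_def act_def rho_radd rho_rsm sum.distrib sum_distrib_left)
lemma lin_act1: "lin_op (act1 n x)"
  unfolding lin_op_def by (intro conjI allI ext; case_tac s; simp add: rho_radd rho_rsm)
lemma lin_act2: "lin_op (act2 n x)"
  unfolding lin_op_def by (intro conjI allI ext; case_tac s; simp add: lin_act[unfolded lin_op_def])

lemma lin_opD: "lin_op T \<Longrightarrow> T (\<lambda>s. f s + g s) = (\<lambda>s. T f s + T g s)" "lin_op T \<Longrightarrow> T (\<lambda>s. r * f s) = (\<lambda>s. r * T f s)"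
  by (auto simp: lin_op_def)

lemma lin_op_sum:
  assumes "lin_op T" "finite R"
  shows "T (\<lambda>s. \<Sum>q\<in>R. c q * F q s) = (\<lambda>s. \<Sum>q\<in>R. c q * T (F q) s)"
  using assms(2)
proof (induction R rule: finite_induct)
  case empty
  have "T (\<lambda>s. 0 * 0) = (\<lambda>s. 0 * T (\<lambda>s. 0) s)" using lin_opD(2)[OF assms(1), of 0 "\<lambda>_. 0"] .
  then show ?case by simp
qed (simp add: lin_opD[OF assms(1)])

lemma rho_act_comm:
  assumes "x \<in> per_mats n" "lin_op T"
  shows "rho n x (\<lambda>b. T (\<lambda>t. f (b # t)) s) a = T (\<lambda>t. rho n x (\<lambda>b. f (b # t)) a) s"
proof -
  obtain R c where R: "finite R" "\<And>g. rho n x g a = (\<Sum>q\<in>R. c q * g q)" using rho_rep[OF assms(1)] by metis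
  show ?thesis unfolding R(2) using lin_op_sum[OF assms(2) R(1), of c "\<lambda>q t. f (q # t)"] by simp
qed

lemma act12_comm: "x \<in> per_mats n \<Longrightarrow> act1 n x (act2 n y f) = act2 n y (act1 n x f)"
proof
  fix s assume "x \<in> per_mats n"
  then show "act1 n x (act2 n y f) s = act2 n y (act1 n x f) s"
    by (cases s) (simp_all add: rho_act_comm[OF _ lin_act])
qed

lemma act1_mult: "x \<in> per_mats n \<Longrightarrow> y \<in> per_mats n \<Longrightarrow> act1 n (\<lambda>i j. rs (x i) (\<lambda>k. y k j)) f = act1 n x (act1 n y f)"
proof
  fix s assume "x \<in> per_mats n" "y \<in> per_mats n"
  then show "act1 n (\<lambda>i j. rs (x i) (\<lambda>k. y k j)) f s = act1 n x (act1 n y f) s"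
    by (cases s) (simp_all add: rho_mult)
qed

lemma per_mats_diff: "x \<in> per_mats n \<Longrightarrow> y \<in> per_mats n \<Longrightarrow> (\<lambda>i j. x i j - y i j :: rat) \<in> per_mats n"
  using per_mats_add[of x n "\<lambda>i j. (-1) * y i j"] per_mats_sm[of y n "-1"] by simp

lemma rho_diff: "x \<in> per_mats n \<Longrightarrow> y \<in> per_mats n \<Longrightarrow> rho n (\<lambda>i j. x i j - y i j) g a = rho n x g a - rho n y g a"
  using rho_add[of x n "\<lambda>i j. (-1) * y i j" g a] rho_sm[of y n "-1" g a] per_mats_sm[of y n "-1"] by simp

text \<open>In the double sum for a commutator, contributions of distinct positions cancel.\<close>

lemma act_bracket:
  assumes x: "x \<in> per_mats n" and y: "y \<in> per_mats n"
  shows "act n (lie_bracket (mat_alg n) x y) f s = act n x (act n y f) s - act n y (act n x f) s"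
proof (induction s arbitrary: f)
  case (Cons a s)
  let ?b = "lie_bracket (mat_alg n) x y"
  have b: "rho n ?b g a = rho n x (rho n y g) a - rho n y (rho n x g) a" for g
    unfolding lie_bracket_mat[OF x y] by (simp add: rho_diff per_mats_mult x y rho_mult)
  have e: "act n x (act n y f) (a # s) = rho n x (rho n y (\<lambda>b. f (b # s))) a + rho n x (\<lambda>b. act n y (\<lambda>t. f (b # t)) s) a
    + rho n y (\<lambda>b. act n x (\<lambda>t. f (b # t)) s) a + act n x (act n y (\<lambda>t. f (a # t))) s"
    if x: "x \<in> per_mats n" and y: "y \<in> per_mats n" for x y
    using rho_act_comm[OF y lin_act, of n x f s a]
    by (simp add: act_Cons rho_radd lin_opD[OF lin_act])
  show ?case unfolding e[OF x y] e[OF y x] by (simp add: act_Cons b Cons)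
qed simp

locale agl =
  fixes n :: nat
  assumes n1: "n \<ge> 1"
begin

abbreviation "MA \<equiv> mat_alg n"
abbreviation "U \<equiv> env_alg MA"
abbreviation "gg \<equiv> env_gen MA"

sublocale E: enveloping "mat_alg n" by (intro enveloping.intro mat_alg_Qalg)

lemma act_add: "x \<in> per_mats n \<Longrightarrow> y \<in> per_mats n \<Longrightarrow> act n (\<lambda>i j. x i j + y i j) f s = act n x f s + act n y f s"
  by (simp add: act_def rho_add sum.distrib)
lemma act_sm: "x \<in> per_mats n \<Longrightarrow> act n (\<lambda>i j. r * x i j) f s = r * act n x f s"
  by (simp add: act_def rho_sm sum_distrib_left)

lemma theta_ex: "\<exists>h. h \<in> alg_hom U op_ring \<and> (\<forall>x\<in>per_mats n. h (gg x) = act n x)"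
proof -
  have br: "act n (lie_bracket MA x y) = act n x \<otimes>\<^bsub>op_ring\<^esub> act n y \<ominus>\<^bsub>op_ring\<^esub> act n y \<otimes>\<^bsub>op_ring\<^esub> act n x"
    if "x \<in> carrier MA" "y \<in> carrier MA" for x y
    using that OP.m_closed[of "act n x" "act n y"] OP.m_closed[of "act n y" "act n x"]
    by (simp add: op_ring_minus lin_act act_bracket fun_eq_iff)
  show ?thesis
  proof (rule E.env_lift_exists[OF op_ring_Qalg, of "act n"])
    show "act n (lie_bracket MA x y) = act n x \<otimes>\<^bsub>op_ring\<^esub> act n y \<ominus>\<^bsub>op_ring\<^esub> act n y \<otimes>\<^bsub>op_ring\<^esub> act n x"
      if "x \<in> carrier MA" "y \<in> carrier MA" for x y by (rule br[OF that])
    show ?thesis if "h \<in> alg_hom U op_ring" "\<And>x. x \<in> carrier MA \<Longrightarrow> h (gg x) = act n x" for h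
      using that by auto
  qed (auto simp: lin_act fun_eq_iff act_add act_sm)
qed

text \<open>The algebra homomorphism extending \<open>act\<close>; likewise \<open>j1\<close> and \<open>j2\<close> below extend \<open>act1\<close> and \<open>act2\<close>.\<close>

definition "theta = (SOME h. h \<in> alg_hom U op_ring \<and> (\<forall>x\<in>per_mats n. h (gg x) = act n x))"

lemma theta: "theta \<in> alg_hom U op_ring" "x \<in> per_mats n \<Longrightarrow> theta (gg x) = act n x"
  using someI_ex[OF theta_ex] unfolding theta_def by auto

lemma j1_ex: "\<exists>h. h \<in> alg_hom U op_ring \<and> (\<forall>x\<in>per_mats n. h (gg x) = act1 n x)"
proof -
  have br: "act1 n (lie_bracket MA x y) = act1 n x \<otimes>\<^bsub>op_ring\<^esub> act1 n y \<ominus>\<^bsub>op_ring\<^esub> act1 n y \<otimes>\<^bsub>op_ring\<^esub> act1 n x"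
    if xy: "x \<in> carrier MA" "y \<in> carrier MA" for x y
  proof -
    have "act1 n (lie_bracket MA x y) f s = act1 n x (act1 n y f) s - act1 n y (act1 n x f) s" for f s
      using xy by (cases s) (simp_all add: lie_bracket_mat rho_diff per_mats_mult rho_mult)
    then show ?thesis
      using that OP.m_closed[of "act1 n x" "act1 n y"] OP.m_closed[of "act1 n y" "act1 n x"]
      by (simp add: op_ring_minus lin_act1 fun_eq_iff)
  qed
  have ad: "act1 n (\<lambda>i j. x i j + y i j) f s = act1 n x f s + act1 n y f s" if "x \<in> per_mats n" "y \<in> per_mats n" for x y f s
    using that by (cases s) (simp_all add: rho_add)
  have sm: "act1 n (\<lambda>i j. r * x i j) f s = r * act1 n x f s" if "x \<in> per_mats n" for x r f s
    using that by (cases s) (simp_all add: rho_sm)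
  show ?thesis
  proof (rule E.env_lift_exists[OF op_ring_Qalg, of "act1 n"])
    show "act1 n (lie_bracket MA x y) = act1 n x \<otimes>\<^bsub>op_ring\<^esub> act1 n y \<ominus>\<^bsub>op_ring\<^esub> act1 n y \<otimes>\<^bsub>op_ring\<^esub> act1 n x"
      if "x \<in> carrier MA" "y \<in> carrier MA" for x y by (rule br[OF that])
    show ?thesis if "h \<in> alg_hom U op_ring" "\<And>x. x \<in> carrier MA \<Longrightarrow> h (gg x) = act1 n x" for h
      using that by auto
  qed (auto simp: lin_act1 fun_eq_iff ad sm)
qed

definition "j1 = (SOME h. h \<in> alg_hom U op_ring \<and> (\<forall>x\<in>per_mats n. h (gg x) = act1 n x))"

lemma j1: "j1 \<in> alg_hom U op_ring" "x \<in> per_mats n \<Longrightarrow> j1 (gg x) = act1 n x"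
  using someI_ex[OF j1_ex] unfolding j1_def by auto

lemma j2_ex: "\<exists>h. h \<in> alg_hom U op_ring \<and> (\<forall>x\<in>per_mats n. h (gg x) = act2 n x)"
proof -
  have br: "act2 n (lie_bracket MA x y) = act2 n x \<otimes>\<^bsub>op_ring\<^esub> act2 n y \<ominus>\<^bsub>op_ring\<^esub> act2 n y \<otimes>\<^bsub>op_ring\<^esub> act2 n x"
    if xy: "x \<in> carrier MA" "y \<in> carrier MA" for x y
  proof -
    have "act2 n (lie_bracket MA x y) f s = act2 n x (act2 n y f) s - act2 n y (act2 n x f) s" for f s
      using xy by (cases s) (simp_all add: act_bracket)
    then show ?thesis
      using that OP.m_closed[of "act2 n x" "act2 n y"] OP.m_closed[of "act2 n y" "act2 n x"]
      by (simp add: op_ring_minus lin_act2 fun_eq_iff)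
  qed
  have ad: "act2 n (\<lambda>i j. x i j + y i j) f s = act2 n x f s + act2 n y f s" if "x \<in> per_mats n" "y \<in> per_mats n" for x y f s
    using that by (cases s) (simp_all add: act_add)
  have sm: "act2 n (\<lambda>i j. r * x i j) f s = r * act2 n x f s" if "x \<in> per_mats n" for x r f s
    using that by (cases s) (simp_all add: act_sm)
  show ?thesis
  proof (rule E.env_lift_exists[OF op_ring_Qalg, of "act2 n"])
    show "act2 n (lie_bracket MA x y) = act2 n x \<otimes>\<^bsub>op_ring\<^esub> act2 n y \<ominus>\<^bsub>op_ring\<^esub> act2 n y \<otimes>\<^bsub>op_ring\<^esub> act2 n x"
      if "x \<in> carrier MA" "y \<in> carrier MA" for x y by (rule br[OF that])
    show ?thesis if "h \<in> alg_hom U op_ring" "\<And>x. x \<in> carrier MA \<Longrightarrow> h (gg x) = act2 n x" for h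
      using that by auto
  qed (auto simp: lin_act2 fun_eq_iff ad sm)
qed

definition "j2 = (SOME h. h \<in> alg_hom U op_ring \<and> (\<forall>x\<in>per_mats n. h (gg x) = act2 n x))"

lemma j2: "j2 \<in> alg_hom U op_ring" "x \<in> per_mats n \<Longrightarrow> j2 (gg x) = act2 n x"
  using someI_ex[OF j2_ex] unfolding j2_def by auto

lemma homs_lin: "u \<in> carrier U \<Longrightarrow> lin_op (theta u)" "u \<in> carrier U \<Longrightarrow> lin_op (j1 u)" "u \<in> carrier U \<Longrightarrow> lin_op (j2 u)"
  using alg_homD(1)[OF theta(1)] alg_homD(1)[OF j1(1)] alg_homD(1)[OF j2(1)] by auto

lemma theta_Nil: "u \<in> carrier U \<Longrightarrow> theta u f [] = env_counit MA u * f []"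
proof (induction arbitrary: f rule: E.env_induct)
  case one
  then show ?case using alg_homD(5)[OF theta(1)] alg_homD(5)[OF E.counit(1)] by (simp add: Q_alg_def)
next
  case (gen x u)
  then have "env_counit MA (gg x \<otimes>\<^bsub>U\<^esub> u) = 0 * env_counit MA u"
    by (simp add: alg_homD(3)[OF E.counit(1)] E.counit(2)) (simp add: Q_alg_def)
  then show ?case using gen by (simp add: alg_homD(3)[OF theta(1)] theta(2))
next
  case (add u v)
  then show ?case by (simp add: alg_homD(2)[OF theta(1)] alg_homD(2)[OF E.counit(1)]) (simp add: Q_alg_def distrib_right)
next
  case (sm r u)
  then show ?case by (simp add: alg_homD(4)[OF theta(1)] alg_homD(4)[OF E.counit(1)]) (simp add: Q_alg_def)
qed

text \<open>Acting on the tail of a word is the full action with the head frozen; this drives the induction on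
  word length in \<open>fam_integral\<close>.\<close>

lemma j2_Cons: "u \<in> carrier U \<Longrightarrow> j2 u f (a # s) = theta u (\<lambda>t. f (a # t)) s"
proof (induction arbitrary: f s rule: E.env_induct)
  case one
  then show ?case using alg_homD(5)[OF theta(1)] alg_homD(5)[OF j2(1)] by simp
next
  case (gen x u)
  have "(\<lambda>t. j2 u f (a # t)) = theta u (\<lambda>t. f (a # t))" using gen by auto
  then show ?case using gen by (simp add: alg_homD(3)[OF theta(1)] alg_homD(3)[OF j2(1)] theta(2) j2(2))
next
  case (add u v)
  then show ?case by (simp add: alg_homD(2)[OF theta(1)] alg_homD(2)[OF j2(1)])
next
  case (sm r u)
  then show ?case by (simp add: alg_homD(4)[OF theta(1)] alg_homD(4)[OF j2(1)])
qed

lemma j12_comm: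
  assumes y: "y \<in> per_mats n"
  shows "u \<in> carrier U \<Longrightarrow> j1 u (act2 n y f) = act2 n y (j1 u f)"
proof (induction arbitrary: f rule: E.env_induct)
  case one
  then show ?case using alg_homD(5)[OF j1(1)] by simp
next
  case (gen x u)
  then show ?case by (simp add: alg_homD(3)[OF j1(1)] j1(2) act12_comm)
next
  case (add u v)
  then show ?case by (simp add: alg_homD(2)[OF j1(1)] lin_opD[OF lin_act2])
next
  case (sm r u)
  then show ?case by (simp add: alg_homD(4)[OF j1(1)] lin_opD[OF lin_act2])
qed

end

section \<open>Matrix units\<close>

lemma Emat_iff: "Emat n i j r c = (if int n dvd (r - i) \<and> c = j + (r - i) then 1 else 0)"
proof -
  have "(\<exists>s. r = i + s * int n \<and> c = j + s * int n) \<longleftrightarrow> int n dvd (r - i) \<and> c = j + (r - i)"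
    by (auto simp: dvd_def algebra_simps)
  then show ?thesis by (simp add: Emat_def)
qed

lemma Emat_per:
  assumes "n \<ge> 1" shows "(Emat n i j :: int \<Rightarrow> int \<Rightarrow> 'a :: zero_neq_one) \<in> per_mats n"
proof -
  let ?E = "Emat n i j :: int \<Rightarrow> int \<Rightarrow> 'a"
  have "finite {c. ?E r c \<noteq> 0}" for r
    by (rule finite_subset[of _ "{j + (r - i)}"]) (auto simp: Emat_iff split: if_splits)
  moreover have "finite {r. ?E r c \<noteq> 0}" for c
    by (rule finite_subset[of _ "{c - j + i}"]) (auto simp: Emat_iff split: if_splits)
  moreover have "?E r c = ?E (r + int n) (c + int n)" for r c
  proof -
    have "int n dvd (r + int n - i) \<longleftrightarrow> int n dvd (r - i)"
      by (metis add_diff_eq add.commute dvd_add_triv_left_iff)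
    then show ?thesis by (auto simp: Emat_iff)
  qed
  ultimately show ?thesis unfolding per_mats_def by blast
qed

lemma per_shift:
  assumes "\<And>i j. A (i + int n) (j + int n) = A i j"
  shows "A (i + s * int n) (j + s * int n) = A i j"
proof (induction s rule: int_induct[where k = 0, case_names base step1 step2])
  case base then show ?case by simp
next
  case (step1 s)
  then show ?case using assms[of "i + s * int n" "j + s * int n"] by (simp add: algebra_simps)
next
  case (step2 s)
  then show ?case using assms[of "i + (s - 1) * int n" "j + (s - 1) * int n"] by (simp add: algebra_simps)
qed

lemma dvd_diff_window:
  assumes "1 \<le> i" "i \<le> int n" "1 \<le> a" "a \<le> int n"
  shows "int n dvd (i - a) \<longleftrightarrow> i = a"
proof
  assume "int n dvd (i - a)"
  moreover have "\<bar>i - a\<bar> < int n" using assms by auto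
  ultimately show "i = a" using zdvd_imp_le[of "int n" "\<bar>i - a\<bar>"] by force
qed simp

lemma Emat_row: "rs (Emat n i j r) g = (if int n dvd (r - i) then g (j + (r - i)) else 0)"
  by (subst rs_sup[of "{j + (r - i)}"]) (auto simp: Emat_iff split: if_splits)

text \<open>The partial product of matrix units: \<open>E\<^sub>i\<^sub>jE\<^sub>k\<^sub>l\<close> is nonzero when \<open>k\<close> is a shift of \<open>j\<close> by a multiple of \<open>n\<close>, and
  then the second factor is shifted so that \<open>k\<close> becomes \<open>j\<close>.\<close>

definition pm :: "nat \<Rightarrow> int \<times> int \<Rightarrow> int \<times> int \<Rightarrow> (int \<times> int) option" where
  "pm n b c = (if int n dvd (snd b - fst c) then Some (fst b, snd c + (snd b - fst c)) else None)"

definition Bp :: "nat \<Rightarrow> (int \<times> int) set" where "Bp n = {(i, j). 1 \<le> i \<and> i \<le> int n \<and> i < j}"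

lemma pm_Bp: "partial_mult (Bp n) (pm n)"
  by standard (auto simp: Bp_def pm_def split: if_splits)

lemma pm_single: "partial_mult {(i, i)} (pm n)"
  by standard (auto simp: pm_def)

lemma Emat_mult:
  "Emat n i j \<otimes>\<^bsub>mat_alg n\<^esub> Emat n k l =
     (case pm n (i, j) (k, l) of None \<Rightarrow> \<zero>\<^bsub>mat_alg n\<^esub> | Some d \<Rightarrow> (Emat n (fst d) (snd d)))"
proof (intro ext)
  fix r c
  have "int n dvd (r - i) \<Longrightarrow> int n dvd (j + (r - i) - k) \<longleftrightarrow> int n dvd (j - k)"
    by (metis add_diff_eq add.commute diff_add_eq dvd_add_left_iff)
  then show "(Emat n i j \<otimes>\<^bsub>mat_alg n\<^esub> Emat n k l) r c =
     (case pm n (i, j) (k, l) of None \<Rightarrow> \<zero>\<^bsub>mat_alg n\<^esub> | Some d \<Rightarrow> (Emat n (fst d) (snd d))) r c"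
    by (auto simp: Emat_row pm_def Emat_iff)
qed

lemma Emat_shift:
  assumes "int n dvd s" shows "Emat n (i + s) (j + s) = Emat n i j"
proof (intro ext)
  fix r c
  have e: "r - (i + s) = (r - i) + (- s)" by simp
  have "int n dvd (r - (i + s)) \<longleftrightarrow> int n dvd (r - i)"
    unfolding e by (rule dvd_add_left_iff) (simp add: assms)
  then show "Emat n (i + s) (j + s) r c = Emat n i j r c" by (simp add: Emat_iff)
qed

text \<open>Transposition reverses products, so lower triangular matrix units obey the rule of \<open>pm\<close> in the
  opposite algebra.\<close>

lemma Emat_mult_T:
  "Emat n l k \<otimes>\<^bsub>mat_alg n\<^esub> Emat n j i =
     (case pm n (i, j) (k, l) of None \<Rightarrow> \<zero>\<^bsub>mat_alg n\<^esub> | Some d \<Rightarrow> (Emat n (snd d) (fst d)))"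
proof (cases "int n dvd (j - k)")
  case True
  then have "int n dvd (k - j)" by (metis dvd_minus_iff minus_diff_eq)
  moreover have "Emat n l (i + (k - j)) = (Emat n (l + (j - k)) i :: int \<Rightarrow> int \<Rightarrow> rat)"
    by (simp add: Emat_shift[OF True, of l "i + (k - j)", symmetric])
  ultimately show ?thesis using True unfolding Emat_mult by (simp add: pm_def)
next
  case False
  then have "\<not> int n dvd (k - j)" by (metis dvd_minus_iff minus_diff_eq)
  then show ?thesis using False unfolding Emat_mult by (simp add: pm_def)
qed

section \<open>Integral elements\<close>

lemma mset_size_cases:
  obtains "X = {#}" | b where "X = {#b#}" | "size X \<ge> 2"
proof -
  consider "X = {#}" | "size X = 1" | "size X \<ge> 2"
    by (metis less_2_cases linorder_not_le One_nat_def size_eq_0_iff_empty)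
  then show ?thesis using that size_1_singleton_mset[of X] by cases blast+
qed

lemma rho_Ints:
  assumes "\<And>i j. x i j \<in> \<int>" "\<And>b. g b \<in> \<int>" shows "rho n x g a \<in> \<int>"
  using assms by (auto simp: rho_def rs_def intro!: Ints_sum Ints_mult split: option.split)

context agl begin

text \<open>The intrinsic description of the integral form.\<close>

definition Wint :: "ugl set" where
  "Wint = {u \<in> carrier (U). \<forall>f. (\<forall>s. f s \<in> \<int>) \<longrightarrow> (\<forall>s. theta u f s \<in> \<int>)}"

lemma WintD: "u \<in> Wint \<Longrightarrow> u \<in> carrier (U)"
  "u \<in> Wint \<Longrightarrow> (\<And>s. f s \<in> \<int>) \<Longrightarrow> theta u f s \<in> \<int>"
  by (auto simp: Wint_def)

lemma Emat_in [simp]: "(Emat n i j :: int \<Rightarrow> int \<Rightarrow> 'a :: zero_neq_one) \<in> per_mats n"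
  by (rule Emat_per[OF n1])

lemma gE [simp]: "gg (Emat n i j) \<in> carrier U"
  by (rule E.gen_closed) simp

lemmas th = alg_homD[OF theta(1)]

lemma Wint_one: "\<one>\<^bsub>U\<^esub> \<in> Wint" by (auto simp: Wint_def th)
lemma Wint_mult: "u \<in> Wint \<Longrightarrow> v \<in> Wint \<Longrightarrow> u \<otimes>\<^bsub>U\<^esub> v \<in> Wint" by (auto simp: Wint_def th)
lemma Wint_add: "u \<in> Wint \<Longrightarrow> v \<in> Wint \<Longrightarrow> u \<oplus>\<^bsub>U\<^esub> v \<in> Wint" by (auto simp: Wint_def th)
lemma Wint_sm: "r \<in> \<int> \<Longrightarrow> u \<in> Wint \<Longrightarrow> r \<odot>\<^bsub>U\<^esub> u \<in> Wint" by (auto simp: Wint_def th)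
lemma Wint_uminus: "u \<in> Wint \<Longrightarrow> \<ominus>\<^bsub>U\<^esub> u \<in> Wint"
  using Wint_sm[of "-1" u] by (simp add: E.U.sm_m1 WintD)
lemma Wint_zero: "\<zero>\<^bsub>U\<^esub> \<in> Wint" using Wint_sm[of 0 "\<one>\<^bsub>U\<^esub>"] Wint_one by simp

lemma Wint_finsum: "(\<And>i. i \<in> I \<Longrightarrow> f i \<in> Wint) \<Longrightarrow> finsum U f I \<in> Wint"
proof (induction I rule: infinite_finite_induct)
  case (insert x F)
  then show ?case using WintD by (subst E.U.finsum_insert) (auto intro!: Wint_add)
qed (simp_all add: Wint_zero E.U.finsum_empty)

lemma Wint_subring: "subring (Wint) U"
  by (rule E.U.subringI) (auto intro: Wint_one Wint_mult Wint_add Wint_uminus WintD)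

text \<open>On the empty word \<open>u\<close> acts by its counit.\<close>

lemma counit_Wint: "u \<in> Wint \<Longrightarrow> env_counit MA u \<in> \<int>"
  using theta_Nil[of u "\<lambda>_. 1"] WintD(2)[of u "\<lambda>_. 1" "[]"] WintD(1)[of u] by simp

lemma j12_commute:
  assumes u: "u \<in> carrier U"
  shows "v \<in> carrier U \<Longrightarrow> j1 u (j2 v f) = j2 v (j1 u f)"
proof (induction v arbitrary: f rule: E.env_induct)
  case one
  then show ?case using alg_homD(5)[OF j2(1)] by simp
next
  case (gen x v)
  then show ?case using u by (simp add: alg_homD(3)[OF j2(1)] j2(2) j12_comm)
next
  case (add v w)
  then show ?case using homs_lin(2)[OF u] by (simp add: alg_homD(2)[OF j2(1)] lin_opD)
next
  case (sm r v)
  then show ?case using homs_lin(2)[OF u] by (simp add: alg_homD(4)[OF j2(1)] lin_opD)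
qed

text \<open>Induction on the word acted upon. By \<open>fam_conv\<close>, \<open>w\<^sub>A\<close> acts on a word as the sum over \<open>X \<subseteq> A\<close> of \<open>w\<^sub>X\<close> on the
  first letter and \<open>w\<^bsub>A-X\<^esub>\<close> on the tail. On a single letter generators multiply like matrices, so
  \<open>fam_vanish\<close> leaves only \<open>X\<close> of size at most one, acting by the identity or by an integral matrix.
  The flag \<open>opp\<close> selects between \<open>U\<close> and its opposite.\<close>

lemma fam_integral:
  assumes pm: "partial_mult B mu" and T: "T = (if opp then op_alg U else U)" and w: "partial_mult.fam B mu T w"
    and g: "\<And>b. b \<in> B \<Longrightarrow> w {#b#} = gg (e b)" and ec: "\<And>b. b \<in> B \<Longrightarrow> e b \<in> per_mats n"
    and ei: "\<And>b i j. b \<in> B \<Longrightarrow> e b i j \<in> \<int>"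
    and em: "\<And>b c. b \<in> B \<Longrightarrow> c \<in> B \<Longrightarrow> (if opp then e c \<otimes>\<^bsub>MA\<^esub> e b else e b \<otimes>\<^bsub>MA\<^esub> e c) =
       (case mu b c of None \<Rightarrow> \<zero>\<^bsub>MA\<^esub> | Some d \<Rightarrow> e d)"
    and A: "set_mset A \<subseteq> B"
  shows "w A \<in> Wint"
proof -
  interpret partial_mult B mu by fact
  define T' :: "(rat, (letter list \<Rightarrow> rat) \<Rightarrow> letter list \<Rightarrow> rat) module"
    where "T' = (if opp then op_alg op_ring else op_ring)"
  define Q where "Q = (if opp then op_alg Q_alg else Q_alg)"
  have QT: "Qalg T" "Qalg T'" "Qalg Q"
    using T Qalg.Qalg_op[OF Qalg_Q] by (auto simp: T'_def Q_def E.Qalg_env E.U.Qalg_op op_ring_Qalg OP.Qalg_op Qalg_Q)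
  interpret T': Qalg T' by (rule QT)
  have hom: "h \<in> alg_hom T T'" if "h \<in> alg_hom U op_ring" for h
    using that T alg_hom_op[OF that] by (auto simp: T'_def)
  have homQ: "h \<in> alg_hom T Q" if "h \<in> alg_hom U Q_alg" for h
    using that T alg_hom_op[OF that] by (auto simp: Q_def)
  note f0 = fam_image[OF QT(1,2) w hom[OF theta(1)]]
  note f1 = fam_image[OF QT(1,2) w hom[OF j1(1)]]
  note f2 = fam_image[OF QT(1,2) w hom[OF j2(1)]]
  note fe = fam_image[OF QT(1,3) w homQ[OF E.counit(1)]]
  have cT: "carrier T = carrier U" using T by auto
  have wc: "set_mset X \<subseteq> B \<Longrightarrow> w X \<in> carrier U" for X
    unfolding cT[symmetric] by (rule famD(4)[OF w])
  have "one T = one U" using T by auto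
  then have w1: "w {#} = \<one>\<^bsub>U\<^esub>" unfolding famD(2)[OF w] .
  have eps: "env_counit MA (w X) \<in> \<int>" if X: "set_mset X \<subseteq> B" for X
  proof -
    have z: "env_counit MA (w {#b#}) = 0" if "b \<in> B" for b using that by (simp add: g ec E.counit(2))
    consider "X = {#}" | b where "X = {#b#}" | "size X \<ge> 2"
      by (rule mset_size_cases)
    then show ?thesis
    proof cases
      case 1
      then show ?thesis using alg_homD(5)[OF E.counit(1)] w1 by (simp add: Q_alg_def)
    next
      case 2
      then show ?thesis using z X by simp
    next
      case 3
      have "env_counit MA (w X) = \<zero>\<^bsub>Q\<^esub>"
      proof (rule fam_vanish[OF QT(3) fe _ X 3])
        fix b c assume bc: "b \<in> B" "c \<in> B"
        show "env_counit MA (w {#b#}) \<otimes>\<^bsub>Q\<^esub> env_counit MA (w {#c#}) =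
          (case mu b c of None \<Rightarrow> \<zero>\<^bsub>Q\<^esub> | Some d \<Rightarrow> env_counit MA (w {#d#}))"
        proof (cases "mu b c")
          case None
          then show ?thesis using z[OF bc(1)] by (simp add: Q_def Q_alg_def)
        next
          case (Some d)
          then show ?thesis using z[OF bc(1)] z[OF mu_closed[OF bc Some]] by (simp add: Q_def Q_alg_def)
        qed
      qed
      then show ?thesis by (simp add: Q_def Q_alg_def)
    qed
  qed
  have conv: "theta (w A) = (\<Oplus>\<^bsub>op_ring\<^esub>X\<in>sub A. j1 (w X) \<otimes>\<^bsub>op_ring\<^esub> j2 (w (A - X)))" if A: "set_mset A \<subseteq> B" for A
  proof -
    have "theta (w A) = (\<Oplus>\<^bsub>T'\<^esub>X\<in>sub A. j1 (w X) \<otimes>\<^bsub>T'\<^esub> j2 (w (A - X)))"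
    proof (rule fam_conv[OF QT(2) f0 f1 f2 _ _ A])
      fix b assume b: "b \<in> B"
      show "theta (w {#b#}) = j1 (w {#b#}) \<oplus>\<^bsub>T'\<^esub> j2 (w {#b#})"
        using b by (simp add: g ec theta(2) j1(2) j2(2) act_split T'_def)
    next
      fix b X assume b: "b \<in> B" and X: "set_mset X \<subseteq> B"
      show "j2 (w {#b#}) \<otimes>\<^bsub>T'\<^esub> j1 (w X) = j1 (w X) \<otimes>\<^bsub>T'\<^esub> j2 (w {#b#})"
        using b wc[OF X] by (simp add: g ec j2(2) T'_def j12_comm)
    qed
    also have "\<dots> = (\<Oplus>\<^bsub>T'\<^esub>X\<in>sub A. j1 (w X) \<otimes>\<^bsub>op_ring\<^esub> j2 (w (A - X)))"
    proof (rule T'.finsum_cong')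
      fix X assume X: "X \<in> sub A"
      then show "j1 (w X) \<otimes>\<^bsub>T'\<^esub> j2 (w (A - X)) = j1 (w X) \<otimes>\<^bsub>op_ring\<^esub> j2 (w (A - X))"
        using wc[OF set_sub[OF A X]] wc[OF set_diff[OF A, of X]]
        by (simp add: T'_def j12_commute)
    next
      show "(\<lambda>X. j1 (w X) \<otimes>\<^bsub>op_ring\<^esub> j2 (w (A - X))) \<in> sub A \<rightarrow> carrier T'"
      proof
        fix X assume X: "X \<in> sub A"
        then show "j1 (w X) \<otimes>\<^bsub>op_ring\<^esub> j2 (w (A - X)) \<in> carrier T'"
        using homs_lin(2)[OF wc[OF set_sub[OF A X]]] homs_lin(3)[OF wc[OF set_diff[OF A, of X]]]
          OP.m_closed[of "j1 (w X)" "j2 (w (A - X))"] by (simp add: T'_def)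
      qed
    qed simp
    finally show ?thesis by (simp add: T'_def)
  qed
  have vanish: "j1 (w X) = \<zero>\<^bsub>T'\<^esub>" if X: "set_mset X \<subseteq> B" "size X \<ge> 2" for X
  proof (rule fam_vanish[OF QT(2) f1 _ X])
    fix b c assume bc: "b \<in> B" "c \<in> B"
    note e = em[OF bc] ec[OF bc(1)] ec[OF bc(2)]
    have z: "act1 n (\<lambda>i j. 0) = (\<lambda>f s. 0)"
    proof (intro ext)
      fix f s show "act1 n (\<lambda>i j. 0) f s = 0" by (cases s) (auto simp: rho_def rs_def split: option.split)
    qed
    have "j1 (w {#b#}) \<otimes>\<^bsub>T'\<^esub> j1 (w {#c#}) = act1 n (if opp then e c \<otimes>\<^bsub>MA\<^esub> e b else e b \<otimes>\<^bsub>MA\<^esub> e c)"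
      using bc e(2,3) by (auto simp: T'_def g j1(2) act1_mult)
    also have "\<dots> = act1 n (case mu b c of None \<Rightarrow> \<zero>\<^bsub>MA\<^esub> | Some d \<Rightarrow> e d)" by (simp only: e(1))
    also have "\<dots> = (case mu b c of None \<Rightarrow> \<zero>\<^bsub>T'\<^esub> | Some d \<Rightarrow> j1 (w {#d#}))"
    proof (cases "mu b c")
      case None
      then show ?thesis by (simp add: z T'_def)
    next
      case (Some d)
      then show ?thesis using mu_closed[OF bc Some] by (simp add: g ec j1(2))
    qed
    finally show "j1 (w {#b#}) \<otimes>\<^bsub>T'\<^esub> j1 (w {#c#}) = (case mu b c of None \<Rightarrow> \<zero>\<^bsub>T'\<^esub> | Some d \<Rightarrow> j1 (w {#d#}))" .
  qed
  have "theta (w A) f s \<in> \<int>" if "set_mset A \<subseteq> B" "\<And>s. f s \<in> \<int>" for A f s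
    using that
  proof (induction s arbitrary: A f)
    case Nil
    then show ?case using theta_Nil[OF wc[OF Nil(1)]] eps[OF Nil(1)] by (auto intro: Ints_mult)
  next
    case (Cons a s)
    have lin: "lin_op (\<lambda>f. j1 (w X) (j2 (w (A - X)) f))" if "X \<in> sub A" for X
      using homs_lin(2)[OF wc[OF set_sub[OF Cons(2) that]]] homs_lin(3)[OF wc[OF set_diff[OF Cons(2), of X]]]
      by (simp add: lin_op_def)
    have j2i: "j2 (w (A - X)) f (b # s) \<in> \<int>" for X b
      unfolding j2_Cons[OF wc[OF set_diff[OF Cons(2), of X]]]
      by (rule Cons.IH) (use set_diff[OF Cons(2)] Cons(3) in auto)
    have "j1 (w X) (j2 (w (A - X)) f) (a # s) \<in> \<int>" if X: "X \<in> sub A" for X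
    proof -
      consider "X = {#}" | b where "X = {#b#}" | "size X \<ge> 2"
        by (rule mset_size_cases)
      then show ?thesis
      proof cases
        case 1
        then show ?thesis using j2i[of "{#}" a] alg_homD(5)[OF j1(1)] w1 by simp
      next
        case 2
        then have b: "b \<in> B" using set_sub[OF Cons(2) X] by simp
        show ?thesis using j2i by (auto simp: 2 g b ec j1(2) ei intro!: rho_Ints)
      next
        case 3
        then show ?thesis using vanish[OF set_sub[OF Cons(2) X]] by (simp add: T'_def)
      qed
    qed
    then show ?case unfolding conv[OF Cons(2)]
      by (simp add: op_ring_finsum lin) (intro Ints_sum, blast)
  qed
  then show ?thesis using A wc[OF A] by (auto simp: Wint_def)
qed

section \<open>Binomials\<close>

lemma falling_closed: "y \<in> carrier U \<Longrightarrow> falling U y t \<in> carrier U"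
  by (induction t) auto

lemma falling_comm: "y \<in> carrier U \<Longrightarrow> y \<otimes>\<^bsub>U\<^esub> falling U y t = falling U y t \<otimes>\<^bsub>U\<^esub> y"
proof (induction t)
  case (Suc t)
  let ?F = "falling U y t" and ?z = "y \<ominus>\<^bsub>U\<^esub> (of_nat t \<odot>\<^bsub>U\<^esub> \<one>\<^bsub>U\<^esub>)"
  have F: "?F \<in> carrier U" and z: "?z \<in> carrier U" using falling_closed Suc by auto
  have "?z \<otimes>\<^bsub>U\<^esub> y = y \<otimes>\<^bsub>U\<^esub> ?z"
    using Suc(2) by (simp add: a_minus_def E.U.l_distr E.U.r_distr E.U.l_minus E.U.r_minus E.U.sm_lmult E.U.sm_rmult)
  then show ?case using Suc F z by (simp add: E.U.m_assoc[symmetric]) (simp add: E.U.m_assoc)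
qed simp

lemma binom_closed: "y \<in> carrier U \<Longrightarrow> binom U y t \<in> carrier U"
  by (simp add: binom_def falling_closed)

lemma binom_rec:
  assumes y: "y \<in> carrier U"
  shows "y \<otimes>\<^bsub>U\<^esub> binom U y t = of_nat (t + 1) \<odot>\<^bsub>U\<^esub> binom U y (Suc t) \<oplus>\<^bsub>U\<^esub> of_nat t \<odot>\<^bsub>U\<^esub> binom U y t"
proof -
  let ?F = "falling U y t"
  have F: "?F \<in> carrier U" using falling_closed y by auto
  have "falling U y (Suc t) \<oplus>\<^bsub>U\<^esub> of_nat t \<odot>\<^bsub>U\<^esub> ?F = ?F \<otimes>\<^bsub>U\<^esub> y"
    using F y by (simp add: a_minus_def E.U.r_distr E.U.r_minus E.U.sm_rmult E.U.a_assoc E.U.l_neg)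
  then have *: "y \<otimes>\<^bsub>U\<^esub> ?F = falling U y (Suc t) \<oplus>\<^bsub>U\<^esub> of_nat t \<odot>\<^bsub>U\<^esub> ?F"
    using falling_comm[OF y] by simp
  have G: "falling U y (Suc t) \<in> carrier U" by (rule falling_closed[OF y])
  have 1: "of_nat (t + 1) * (1 / fact (Suc t)) = (1 / fact t :: rat)"
  proof -
    have nz: "(of_nat (Suc t)::rat) \<noteq> 0" by (rule of_nat_neq_0)
    have "(of_nat (t + 1)::rat) * (1 / fact (Suc t)) = of_nat (Suc t) * (1 / (of_nat (Suc t) * fact t))"
      by (subst fact_Suc) (simp only: Suc_eq_plus1)
    also have "\<dots> = 1 / fact t" using nz by (simp del: of_nat_Suc)
    finally show ?thesis .
  qed
  have "y \<otimes>\<^bsub>U\<^esub> binom U y t = (1 / fact t) \<odot>\<^bsub>U\<^esub> (falling U y (Suc t) \<oplus>\<^bsub>U\<^esub> of_nat t \<odot>\<^bsub>U\<^esub> ?F)"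
    unfolding binom_def *[symmetric] using y F by (simp add: E.U.sm_rmult)
  also have "\<dots> = (1 / fact t) \<odot>\<^bsub>U\<^esub> falling U y (Suc t) \<oplus>\<^bsub>U\<^esub> (of_nat t * (1 / fact t)) \<odot>\<^bsub>U\<^esub> ?F"
    using F G by (simp add: E.U.sm_radd E.U.sm_assoc[symmetric] mult.commute del: falling.simps)
  also have "(1 / fact t) \<odot>\<^bsub>U\<^esub> falling U y (Suc t) = of_nat (t + 1) \<odot>\<^bsub>U\<^esub> binom U y (Suc t)"
    unfolding binom_def using E.U.sm_assoc[OF G, of "of_nat (t + 1)" "1 / fact (Suc t)"] by (simp only: 1)
  also have "(of_nat t * (1 / fact t)) \<odot>\<^bsub>U\<^esub> ?F = of_nat t \<odot>\<^bsub>U\<^esub> binom U y t"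
    unfolding binom_def using E.U.sm_assoc[OF F, of "of_nat t" "1 / fact t"] by simp
  finally show ?thesis .
qed

text \<open>Since \<open>E\<^sub>i\<^sub>i\<close> is idempotent, \<open>y \<cdot> (y choose t) = (t + 1) (y choose t + 1) + t (y choose t)\<close> is the rule
  of a family on the single index \<open>(i, i)\<close>, evaluated at the multiset of \<open>t\<close> copies.\<close>

lemma binom_fam: "partial_mult.fam {(i, i)} (pm n) U (\<lambda>A. binom U (gg (Emat n i i)) (size A))"
proof -
  interpret partial_mult "{(i, i)}" "pm n" by (rule pm_single)
  let ?b = "(i, i)" and ?y = "gg (Emat n i i)"
  have y: "?y \<in> carrier U" by simp
  show ?thesis unfolding fam_def clos_def
  proof (intro conjI allI impI ballI)
    show "binom U ?y (size {#}) = \<one>\<^bsub>U\<^esub>" by (simp add: binom_def)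
    fix b A assume b: "b \<in> {?b}" and A: "set_mset A \<subseteq> {?b}"
    obtain t where A': "A = replicate_mset t ?b" using A by (metis set_mset_subset_singletonD)
    have bb: "b = ?b" using b by simp
    have b1: "binom U ?y (size {#b#}) = ?y" using y by (simp add: binom_def a_minus_def)
    have "rec U b (\<lambda>A. binom U ?y (size A)) A = of_nat (t + 1) \<odot>\<^bsub>U\<^esub> binom U ?y (Suc t) \<oplus>\<^bsub>U\<^esub> of_nat t \<odot>\<^bsub>U\<^esub> binom U ?y t"
    proof (cases t)
      case 0
      then show ?thesis using binom_closed[OF y] by (simp add: A' bb rec_def ok_def E.U.finsum_empty)
    next
      case (Suc k)
      have 1: "ok ?b A = {?b}" by (auto simp: ok_def pm_def A' Suc)
      have 2: "the (pm n ?b ?b) = ?b" by (simp add: pm_def)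
      have 3: "A - {#?b#} = replicate_mset k ?b" by (simp add: A' Suc)
      have 4: "count A ?b = t" "size A = t" by (simp_all add: A')
      show ?thesis unfolding rec_def bb 1
        using binom_closed[OF y] by (simp add: 2 3 4 Suc)
    qed
    then show "binom U ?y (size {#b#}) \<otimes>\<^bsub>U\<^esub> binom U ?y (size A) = rec U b (\<lambda>A. binom U ?y (size A)) A"
      unfolding b1 using binom_rec[OF y] by (simp add: A')
  qed (rule binom_closed[OF y])
qed

lemma Emat_Ints: "Emat n i j r c \<in> (\<int> :: rat set)" by (auto simp: Emat_def)

lemma binom_Wint: "binom U (gg (Emat n i i)) t \<in> Wint"
proof -
  have "(\<lambda>A. binom U (gg (Emat n i i)) (size A)) (replicate_mset t (i,i)) \<in> Wint"
  proof (rule fam_integral[where opp = False and e = "\<lambda>_. Emat n i i", OF pm_single _ binom_fam])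
    fix b c assume "b \<in> {(i,i)}" "c \<in> {(i, i)}"
    then show "(if False then Emat n i i \<otimes>\<^bsub>MA\<^esub> Emat n i i else Emat n i i \<otimes>\<^bsub>MA\<^esub> Emat n i i) = (case pm n b c of None \<Rightarrow> \<zero>\<^bsub>MA\<^esub> | Some d \<Rightarrow> Emat n i i)"
      unfolding Emat_mult by (simp add: pm_def)
  next
    fix b assume "b \<in> {(i,i)}"
    then show "binom U (gg (Emat n i i)) (size {#b#}) = gg (Emat n i i)"
      by (simp add: binom_def a_minus_def)
  qed (auto simp: Emat_Ints)
  then show ?thesis by simp
qed

end

section \<open>Integral spans\<close>

context Qalg begin

lemma Z_span_closed: "X \<subseteq> carrier M \<Longrightarrow> x \<in> Z_span M X \<Longrightarrow> x \<in> carrier M"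
  unfolding Z_span_def using add.generate_in_carrier by simp

lemma Z_span_incl: "x \<in> X \<Longrightarrow> x \<in> Z_span M X"
  unfolding Z_span_def by (rule generate.incl)

lemma Z_span_zero: "\<zero> \<in> Z_span M X"
  unfolding Z_span_def using generate.one[of "add_monoid M" X] by simp

lemma Z_span_add: "x \<in> Z_span M X \<Longrightarrow> y \<in> Z_span M X \<Longrightarrow> x \<oplus> y \<in> Z_span M X"
  unfolding Z_span_def using generate.eng[of x "add_monoid M" X y] by simp

lemma Z_span_uminus: "X \<subseteq> carrier M \<Longrightarrow> x \<in> Z_span M X \<Longrightarrow> \<ominus> x \<in> Z_span M X"
  unfolding Z_span_def using add.generate_m_inv_closed[of X x] by simp

text \<open>The group generated by \<open>X\<close> is built from elements and their inverses; here the inverse is split off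
  as a separate step, which is the convenient form for additive predicates.\<close>

lemma Z_span_induct [consumes 2, case_names zero incl uminus add]:
  assumes "x \<in> Z_span M X" "X \<subseteq> carrier M" "P \<zero>" "\<And>x. x \<in> X \<Longrightarrow> P x"
    "\<And>x. x \<in> carrier M \<Longrightarrow> P x \<Longrightarrow> P (\<ominus> x)"
    "\<And>x y. x \<in> carrier M \<Longrightarrow> y \<in> carrier M \<Longrightarrow> P x \<Longrightarrow> P y \<Longrightarrow> P (x \<oplus> y)"
  shows "P x"
proof -
  have "x \<in> generate (add_monoid M) X \<Longrightarrow> P x \<and> x \<in> carrier M"
  proof (induction rule: generate.induct)
    case (inv h)
    have "\<ominus> h = inv\<^bsub>add_monoid M\<^esub> h" by (simp add: a_inv_def)
    moreover have "P (\<ominus> h) \<and> \<ominus> h \<in> carrier M" using inv assms by blast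
    ultimately show ?case by simp
  qed (use assms in auto)
  then show ?thesis using assms(1) by (auto simp: Z_span_def)
qed

lemma Z_span_int:
  assumes X: "X \<subseteq> carrier M" and r: "r \<in> \<int>" and x: "x \<in> Z_span M X"
  shows "r \<odot> x \<in> Z_span M X"
proof -
  have xc: "x \<in> carrier M" using Z_span_closed[OF X x] .
  have nat: "of_nat k \<odot> x \<in> Z_span M X" for k
    by (induction k) (use xc x in \<open>auto simp: sm_ladd intro!: Z_span_add Z_span_zero\<close>)
  obtain k :: int where k: "r = of_int k" using r by (auto elim: Ints_cases)
  show ?thesis
  proof (cases "k \<ge> 0")
    case True
    then show ?thesis using nat[of "nat k"] by (simp add: k)
  next
    case False
    then have "r = - of_nat (nat (- k))" by (simp add: k)
    then show ?thesis using Z_span_uminus[OF X nat[of "nat (- k)"]] xc by (simp add: sm_uminus)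
  qed
qed

lemma Z_span_finsum:
  assumes X: "X \<subseteq> carrier M"
  shows "(\<And>i. i \<in> I \<Longrightarrow> f i \<in> Z_span M X) \<Longrightarrow> finsum M f I \<in> Z_span M X"
proof (induction I rule: infinite_finite_induct)
  case (insert i I)
  then show ?case using Z_span_closed[OF X] by (subst finsum_insert) (auto intro!: Z_span_add)
qed (auto simp: Z_span_zero finsum_empty)

lemma Z_span_mult:
  assumes X: "X \<subseteq> carrier M" and XX: "\<And>x y. x \<in> X \<Longrightarrow> y \<in> X \<Longrightarrow> x \<otimes> y \<in> Z_span M X"
    and a: "a \<in> Z_span M X" and b: "b \<in> Z_span M X"
  shows "a \<otimes> b \<in> Z_span M X"
  using a X
proof (induction rule: Z_span_induct)
  case zero then show ?case using Z_span_closed[OF X b] Z_span_zero by simp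
next
  case (incl x)
  then have xc: "x \<in> carrier M" using X by auto
  show ?case using b X
  proof (induction rule: Z_span_induct)
    case zero then show ?case using xc Z_span_zero by simp
  next
    case (incl y) then show ?case using XX \<open>x \<in> X\<close> by auto
  next
    case (uminus y) then show ?case using xc Z_span_uminus[OF X] by (simp add: r_minus)
  next
    case (add y z) then show ?case using xc Z_span_add by (simp add: r_distr)
  qed
next
  case (uminus x) then show ?case using Z_span_closed[OF X b] Z_span_uminus[OF X] by (simp add: l_minus)
next
  case (add x y) then show ?case using Z_span_closed[OF X b] Z_span_add by (simp add: l_distr)
qed

end

section \<open>The filtration by word length\<close>

text \<open>The denominator of a product of divided powers.\<close>

definition mfact :: "'b multiset \<Rightarrow> rat" where "mfact M = (\<Prod>c\<in>set_mset M. fact (count M c))"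

lemma mfact_sup: "finite S \<Longrightarrow> set_mset M \<subseteq> S \<Longrightarrow> mfact M = (\<Prod>c\<in>S. fact (count M c))"
  unfolding mfact_def by (rule prod.mono_neutral_left) (auto simp: not_in_iff)

lemma mfact_empty [simp]: "mfact {#} = 1" by (simp add: mfact_def)

lemma mfact_add: "mfact (add_mset b M) = of_nat (count M b + 1) * mfact M"
proof -
  let ?S = "insert b (set_mset M)"
  have "mfact (add_mset b M) = fact (count M b + 1) * (\<Prod>c\<in>?S - {b}. fact (count (add_mset b M) c))"
    by (subst mfact_sup[of ?S]) (auto simp: prod.remove[of ?S b] simp del: fact_Suc)
  also have "(\<Prod>c\<in>?S - {b}. fact (count (add_mset b M) c)) = (\<Prod>c\<in>?S - {b}. fact (count M c) :: rat)"
    by (rule prod.cong) auto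
  also have "fact (count M b + 1) * \<dots> = of_nat (count M b + 1) * (fact (count M b) * \<dots>)" by simp
  also have "fact (count M b) * (\<Prod>c\<in>?S - {b}. fact (count M c) :: rat) = mfact M"
    by (subst mfact_sup[of ?S]) (auto simp: prod.remove[of ?S b])
  finally show ?thesis .
qed

lemma mfact_nz [simp]: "mfact M \<noteq> 0" by (simp add: mfact_def)

lemma mfact_disjoint: "set_mset M \<inter> set_mset N = {} \<Longrightarrow> mfact (M + N) = mfact M * mfact N"
proof (induction N)
  case (add b N)
  then have "count M b = 0" by (auto simp: not_in_iff)
  with add show ?case by (simp add: mfact_add)
qed simp

lemma mfact_inj: "inj_on \<sigma> (set_mset M) \<Longrightarrow> mfact (image_mset \<sigma> M) = mfact M"
proof (induction M)
  case (add b M)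
  have "count (image_mset \<sigma> M) (\<sigma> b) = count M b"
  proof (cases "b \<in># M")
    case True
    then have "\<sigma> -` {\<sigma> b} \<inter> set_mset M = {b}" using add by (auto simp: inj_on_def)
    then show ?thesis by (simp add: count_image_mset)
  next
    case False
    then have "\<sigma> b \<notin># image_mset \<sigma> M" using add by (auto simp: inj_on_def)
    then have "count (image_mset \<sigma> M) (\<sigma> b) = 0" by (simp only: not_in_iff)
    moreover have "count M b = 0" using False by (simp only: not_in_iff)
    ultimately show ?thesis by simp
  qed
  with add show ?case by (simp add: mfact_add)
qed simp

context agl begin

text \<open>\<open>fil m\<close> is the span of the products of fewer than \<open>m\<close> generators, so that \<open>fil 0\<close> is zero. The shift by
  one avoids a special case for errors of order below the constants.\<close>

inductive fil :: "nat \<Rightarrow> ugl \<Rightarrow> bool" where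
  fil_zero: "fil m \<zero>\<^bsub>U\<^esub>"
| fil_one: "fil (Suc m) \<one>\<^bsub>U\<^esub>"
| fil_gen: "x \<in> per_mats n \<Longrightarrow> fil m u \<Longrightarrow> fil (Suc m) (gg x \<otimes>\<^bsub>U\<^esub> u)"
| fil_add: "fil m u \<Longrightarrow> fil m v \<Longrightarrow> fil m (u \<oplus>\<^bsub>U\<^esub> v)"
| fil_sm: "fil m u \<Longrightarrow> fil m (r \<odot>\<^bsub>U\<^esub> u)"

lemma gg_closed [simp]: "x \<in> per_mats n \<Longrightarrow> gg x \<in> carrier U"
  by (rule E.gen_closed) simp

lemma fil_closed [simp]: "fil m u \<Longrightarrow> u \<in> carrier U"
  by (induction rule: fil.induct) auto

lemma fil_0: "fil m u \<Longrightarrow> m = 0 \<Longrightarrow> u = \<zero>\<^bsub>U\<^esub>"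
  by (induction rule: fil.induct) auto

lemma fil_Suc: "fil m u \<Longrightarrow> fil (Suc m) u"
  by (induction rule: fil.induct) (auto intro: fil.intros)

lemma fil_mono: "fil m u \<Longrightarrow> m \<le> k \<Longrightarrow> fil k u"
  by (induction k) (auto simp: le_Suc_eq intro: fil_Suc)

lemma fil_uminus: "fil m u \<Longrightarrow> fil m (\<ominus>\<^bsub>U\<^esub> u)"
  using fil_sm[of m u "-1"] by (simp add: E.U.sm_m1)

lemma fil_minus: "fil m u \<Longrightarrow> fil m v \<Longrightarrow> fil m (u \<ominus>\<^bsub>U\<^esub> v)"
  unfolding a_minus_def by (intro fil_add fil_uminus)

lemma fil_finsum: "(\<And>i. i \<in> I \<Longrightarrow> fil m (f i)) \<Longrightarrow> fil m (finsum U f I)"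
proof (induction I rule: infinite_finite_induct)
  case (insert x F)
  then have "f x \<in> carrier U" "f \<in> F \<rightarrow> carrier U" by (auto intro!: fil_closed)
  with insert show ?case by (subst E.U.finsum_insert) (auto intro!: fil_add)
qed (simp_all add: fil_zero E.U.finsum_empty)

lemma fil_mult: "fil k u \<Longrightarrow> fil m v \<Longrightarrow> fil (k + m - 1) (u \<otimes>\<^bsub>U\<^esub> v)"
proof (induction rule: fil.induct)
  case (fil_one k)
  then show ?case by (auto intro: fil_mono)
next
  case (fil_gen x k u)
  show ?case
  proof (cases "k + m")
    case 0
    then have "u = \<zero>\<^bsub>U\<^esub>" using fil_gen fil_0 by auto
    then show ?thesis using fil_gen by (simp add: fil_zero)
  next
    case (Suc j)
    then have "fil (Suc j) (gg x \<otimes>\<^bsub>U\<^esub> (u \<otimes>\<^bsub>U\<^esub> v))" using fil_gen by (intro fil.fil_gen) auto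
    then show ?thesis using fil_gen Suc by (simp add: E.U.m_assoc)
  qed
next
  case (fil_add m u v)
  then show ?case by (simp add: E.U.l_distr fil.fil_add)
next
  case (fil_sm m u r)
  then show ?case by (simp add: E.U.sm_lmult fil.fil_sm)
qed (simp add: fil_zero)

lemma fil_ex: "u \<in> carrier U \<Longrightarrow> \<exists>m. fil m u"
proof (induction rule: E.env_induct)
  case one show ?case using fil_one by blast
next
  case (gen x u) then show ?case using fil_gen by auto
next
  case (add u v)
  then obtain k m where "fil k u" "fil m v" by auto
  then have "fil (max k m) (u \<oplus>\<^bsub>U\<^esub> v)" by (intro fil_add) (auto intro: fil_mono)
  then show ?case by blast
next
  case (sm r u) then show ?case using fil_sm by blast
qed

abbreviation EE :: "int \<times> int \<Rightarrow> ugl" where "EE c \<equiv> gg (Emat n (fst c) (snd c))"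

definition word :: "(int \<times> int) list \<Rightarrow> ugl" where
  "word cs = foldr (\<lambda>c u. EE c \<otimes>\<^bsub>U\<^esub> u) cs \<one>\<^bsub>U\<^esub>"

lemma word_simps [simp]: "word [] = \<one>\<^bsub>U\<^esub>" "word (c # cs) = EE c \<otimes>\<^bsub>U\<^esub> word cs"
  by (simp_all add: word_def)

lemma word_fil: "fil (Suc (length cs)) (word cs)"
  by (induction cs) (auto intro: fil_one fil_gen)

lemma word_closed [simp]: "word cs \<in> carrier U" using fil_closed[OF word_fil] .

lemma word_append: "word (cs @ ds) = word cs \<otimes>\<^bsub>U\<^esub> word ds"
  by (induction cs) (auto simp: E.U.m_assoc)

lemma minus_zero [simp]: "x \<in> carrier U \<Longrightarrow> x \<ominus>\<^bsub>U\<^esub> x = \<zero>\<^bsub>U\<^esub>" by (simp add: a_minus_def E.U.r_neg)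

lemma minus_trans: "x \<in> carrier U \<Longrightarrow> y \<in> carrier U \<Longrightarrow> z \<in> carrier U \<Longrightarrow>
  x \<ominus>\<^bsub>U\<^esub> z = (x \<ominus>\<^bsub>U\<^esub> y) \<oplus>\<^bsub>U\<^esub> (y \<ominus>\<^bsub>U\<^esub> z)"
  by (simp add: a_minus_def E.U.a_assoc E.U.a_lcomm[of "\<ominus>\<^bsub>U\<^esub> y" y] E.U.r_neg1 E.U.r_neg2)

lemma fil_trans: "fil m (x \<ominus>\<^bsub>U\<^esub> y) \<Longrightarrow> fil m (y \<ominus>\<^bsub>U\<^esub> z) \<Longrightarrow> x \<in> carrier U \<Longrightarrow> y \<in> carrier U \<Longrightarrow> z \<in> carrier U \<Longrightarrow> fil m (x \<ominus>\<^bsub>U\<^esub> z)"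
  by (subst minus_trans[of x y z]) (auto intro: fil_add)

lemma minus_swap: "x \<in> carrier U \<Longrightarrow> y \<in> carrier U \<Longrightarrow> \<ominus>\<^bsub>U\<^esub> (x \<ominus>\<^bsub>U\<^esub> y) = y \<ominus>\<^bsub>U\<^esub> x"
  by (simp add: a_minus_def E.U.minus_add E.U.a_comm)

lemma fil_sym: "fil m (x \<ominus>\<^bsub>U\<^esub> y) \<Longrightarrow> x \<in> carrier U \<Longrightarrow> y \<in> carrier U \<Longrightarrow> fil m (y \<ominus>\<^bsub>U\<^esub> x)"
  using fil_uminus[of m "x \<ominus>\<^bsub>U\<^esub> y"] by (simp add: minus_swap)

lemma word_comm: "fil (Suc (length ds)) (EE c \<otimes>\<^bsub>U\<^esub> word ds \<ominus>\<^bsub>U\<^esub> word ds \<otimes>\<^bsub>U\<^esub> EE c)"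
proof (induction ds)
  case Nil then show ?case by (simp add: fil_zero)
next
  case (Cons d ds)
  let ?w = "word ds"
  let ?b = "lie_bracket MA (Emat n (fst c) (snd c)) (Emat n (fst d) (snd d))"
  have b: "?b \<in> per_mats n" using E.bracket_closed[of "Emat n (fst c) (snd c)" "Emat n (fst d) (snd d)"] by simp
  have sw: "EE c \<otimes>\<^bsub>U\<^esub> EE d = EE d \<otimes>\<^bsub>U\<^esub> EE c \<oplus>\<^bsub>U\<^esub> gg ?b" by (rule E.gen_swap) auto
  have "EE c \<otimes>\<^bsub>U\<^esub> (EE d \<otimes>\<^bsub>U\<^esub> ?w) = EE d \<otimes>\<^bsub>U\<^esub> (EE c \<otimes>\<^bsub>U\<^esub> ?w) \<oplus>\<^bsub>U\<^esub> gg ?b \<otimes>\<^bsub>U\<^esub> ?w"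
    using b by (simp add: E.U.m_assoc[symmetric] sw E.U.l_distr)
  then have "EE c \<otimes>\<^bsub>U\<^esub> word (d # ds) \<ominus>\<^bsub>U\<^esub> word (d # ds) \<otimes>\<^bsub>U\<^esub> EE c =
     gg ?b \<otimes>\<^bsub>U\<^esub> ?w \<oplus>\<^bsub>U\<^esub> EE d \<otimes>\<^bsub>U\<^esub> (EE c \<otimes>\<^bsub>U\<^esub> ?w \<ominus>\<^bsub>U\<^esub> ?w \<otimes>\<^bsub>U\<^esub> EE c)"
    using b by (simp add: a_minus_def E.U.r_distr E.U.r_minus E.U.m_assoc E.U.a_assoc E.U.a_lcomm)
  moreover have "fil (Suc (length (d # ds))) (gg ?b \<otimes>\<^bsub>U\<^esub> ?w)" using fil_gen[OF b word_fil[of ds]] by simp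
  moreover have "fil (Suc (length (d # ds))) (EE d \<otimes>\<^bsub>U\<^esub> (EE c \<otimes>\<^bsub>U\<^esub> ?w \<ominus>\<^bsub>U\<^esub> ?w \<otimes>\<^bsub>U\<^esub> EE c))"
    using fil_gen[OF Emat_in Cons] by simp
  ultimately show ?case by (simp add: fil_add)
qed

text \<open>The associated graded algebra is commutative, because the commutator of two generators is one
  generator.\<close>

lemma word_perm: "mset cs = mset ds \<Longrightarrow> fil (length cs) (word cs \<ominus>\<^bsub>U\<^esub> word ds)"
proof (induction cs arbitrary: ds)
  case Nil then show ?case by (simp add: fil_zero)
next
  case (Cons c cs)
  then have "c \<in> set ds" by (metis list.set_intros(1) set_mset_mset)
  then obtain d1 d2 where ds: "ds = d1 @ c # d2" by (meson split_list)
  then have m: "mset cs = mset (d1 @ d2)" using Cons by simp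
  then have len: "length cs = length d1 + length d2" by (metis mset_eq_length length_append)
  have 1: "fil (Suc (length cs)) (EE c \<otimes>\<^bsub>U\<^esub> (word cs \<ominus>\<^bsub>U\<^esub> word (d1 @ d2)))"
    using fil_gen[OF Emat_in Cons.IH[OF m]] by simp
  have 2: "fil (Suc (length cs)) ((EE c \<otimes>\<^bsub>U\<^esub> word d1 \<ominus>\<^bsub>U\<^esub> word d1 \<otimes>\<^bsub>U\<^esub> EE c) \<otimes>\<^bsub>U\<^esub> word d2)"
    using fil_mult[OF word_comm[of d1 c] word_fil[of d2]] by (simp add: len)
  have "fil (Suc (length cs)) (EE c \<otimes>\<^bsub>U\<^esub> word cs \<ominus>\<^bsub>U\<^esub> EE c \<otimes>\<^bsub>U\<^esub> word (d1 @ d2))"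
    using 1 by (simp add: a_minus_def E.U.r_distr E.U.r_minus)
  moreover have "fil (Suc (length cs)) (EE c \<otimes>\<^bsub>U\<^esub> word (d1 @ d2) \<ominus>\<^bsub>U\<^esub> word ds)"
    using 2 by (simp add: a_minus_def ds word_append E.U.l_distr E.U.l_minus E.U.m_assoc)
  ultimately have "fil (Suc (length cs)) (EE c \<otimes>\<^bsub>U\<^esub> word cs \<ominus>\<^bsub>U\<^esub> word ds)" by (rule fil_trans) auto
  then show ?case by simp
qed

text \<open>The leading term of \<open>u\<close> is the product of divided powers with exponents \<open>D\<close>. Quantifying over all
  orderings of \<open>D\<close> is equivalent to choosing one, by \<open>leadI\<close>.\<close>

definition lead :: "ugl \<Rightarrow> (int \<times> int) multiset \<Rightarrow> bool" where
  "lead u D \<longleftrightarrow> u \<in> carrier U \<and> (\<forall>cs. mset cs = D \<longrightarrow> fil (size D) (mfact D \<odot>\<^bsub>U\<^esub> u \<ominus>\<^bsub>U\<^esub> word cs))"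

lemma leadD: "lead u D \<Longrightarrow> u \<in> carrier U"
  "lead u D \<Longrightarrow> mset cs = D \<Longrightarrow> fil (size D) (mfact D \<odot>\<^bsub>U\<^esub> u \<ominus>\<^bsub>U\<^esub> word cs)"
  by (auto simp: lead_def)

lemma leadI:
  assumes "u \<in> carrier U" "mset cs = D" "fil (size D) (mfact D \<odot>\<^bsub>U\<^esub> u \<ominus>\<^bsub>U\<^esub> word cs)"
  shows "lead u D"
  unfolding lead_def
proof (intro conjI allI impI assms(1))
  fix ds assume ds: "mset ds = D"
  have "fil (size D) (word cs \<ominus>\<^bsub>U\<^esub> word ds)" using word_perm[of cs ds] assms(2) ds by auto
  then show "fil (size D) (mfact D \<odot>\<^bsub>U\<^esub> u \<ominus>\<^bsub>U\<^esub> word ds)" using assms by (intro fil_trans[OF assms(3)]) auto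
qed

lemma fil_of_diff: "fil m (x \<ominus>\<^bsub>U\<^esub> y) \<Longrightarrow> fil m y \<Longrightarrow> x \<in> carrier U \<Longrightarrow> fil m x"
  using fil_add[of m y "x \<ominus>\<^bsub>U\<^esub> y"] E.U.add_diff[of x y] by simp

lemma lead_fil_scaled: assumes "lead u D" shows "fil (Suc (size D)) (mfact D \<odot>\<^bsub>U\<^esub> u)"
proof -
  obtain cs where cs: "mset cs = D" using ex_mset by blast
  show ?thesis
    by (rule fil_of_diff[OF fil_Suc[OF leadD(2)[OF assms cs]]]) (use cs word_fil[of cs] leadD(1)[OF assms] in auto)
qed

lemma lead_fil: assumes "lead u D" shows "fil (Suc (size D)) u"
  using fil_sm[OF lead_fil_scaled[OF assms], of "1 / mfact D"] leadD(1)[OF assms]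
  by (simp add: E.U.sm_assoc[symmetric])

lemma lead_one: "lead \<one>\<^bsub>U\<^esub> {#}" by (rule leadI[of _ "[]"]) (auto intro: fil_zero)

text \<open>Disjoint supports ensure that the denominators multiply.\<close>

lemma lead_mult:
  assumes u: "lead u D" and v: "lead v D'" and dj: "set_mset D \<inter> set_mset D' = {}"
  shows "lead (u \<otimes>\<^bsub>U\<^esub> v) (D + D')"
proof -
  obtain cs where cs: "mset cs = D" using ex_mset by blast
  obtain ds where ds: "mset ds = D'" using ex_mset by blast
  let ?a = "mfact D \<odot>\<^bsub>U\<^esub> u" and ?b = "mfact D' \<odot>\<^bsub>U\<^esub> v"
  note c [simp] = leadD(1)[OF u] leadD(1)[OF v]
  have sz: "size D = length cs" "size D' = length ds" using cs ds by auto
  have 0: "mfact (D + D') \<odot>\<^bsub>U\<^esub> (u \<otimes>\<^bsub>U\<^esub> v) = ?a \<otimes>\<^bsub>U\<^esub> ?b"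
    by (simp add: mfact_disjoint[OF dj] E.U.sm_lmult E.U.sm_rmult E.U.sm_assoc[symmetric] mult.commute)
  have 1: "fil (size D + size D') ((?a \<ominus>\<^bsub>U\<^esub> word cs) \<otimes>\<^bsub>U\<^esub> ?b)"
    using fil_mult[OF leadD(2)[OF u cs] lead_fil_scaled[OF v]] by simp
  have 2: "fil (size D + size D') (word cs \<otimes>\<^bsub>U\<^esub> (?b \<ominus>\<^bsub>U\<^esub> word ds))"
    using fil_mult[OF word_fil[of cs] leadD(2)[OF v ds]] sz by simp
  have "fil (size D + size D') (?a \<otimes>\<^bsub>U\<^esub> ?b \<ominus>\<^bsub>U\<^esub> word cs \<otimes>\<^bsub>U\<^esub> ?b)"
    using 1 by (simp add: a_minus_def E.U.l_distr E.U.l_minus)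
  moreover have "fil (size D + size D') (word cs \<otimes>\<^bsub>U\<^esub> ?b \<ominus>\<^bsub>U\<^esub> word cs \<otimes>\<^bsub>U\<^esub> word ds)"
    using 2 by (simp add: a_minus_def E.U.r_distr E.U.r_minus)
  ultimately have "fil (size D + size D') (?a \<otimes>\<^bsub>U\<^esub> ?b \<ominus>\<^bsub>U\<^esub> word cs \<otimes>\<^bsub>U\<^esub> word ds)" by (rule fil_trans) auto
  then show ?thesis
    by (intro leadI[of _ "cs @ ds"]) (auto simp: cs ds 0 word_append)
qed

text \<open>Modulo shorter words the rule of a family reads \<open>w\<^sub>b w\<^sub>A = (A\<^sub>b + 1) w\<^bsub>A+b\<^esub>\<close>, the rule of divided powers.
  The map \<open>\<sigma>\<close> renames indices, as the negative family is indexed by transposed matrix units.\<close>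

lemma fam_lead:
  assumes pm: "partial_mult B mu" and T: "T = U \<or> T = op_alg U" and w: "partial_mult.fam B mu T w"
    and g: "\<And>b. b \<in> B \<Longrightarrow> w {#b#} = EE (\<sigma> b)" and inj: "inj_on \<sigma> B"
  shows "set_mset A \<subseteq> B \<Longrightarrow> lead (w A) (image_mset \<sigma> A)"
proof (induction "size A" arbitrary: A)
  case 0
  interpret partial_mult B mu by fact
  have "one T = one U" using T by auto
  then have "w A = \<one>\<^bsub>U\<^esub>" using famD(2)[OF w] 0 by simp
  then show ?case using 0 lead_one by simp
next
  case (Suc k)
  interpret partial_mult B mu by fact
  have QT: "Qalg T" using T E.Qalg_env E.U.Qalg_op by auto
  interpret T: Qalg T by (rule QT)
  have sel: "carrier T = carrier U" "add T = add U" "smult T = smult U" "finsum T = finsum U"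
    using T by auto
  have ainv: "a_minus T x y = a_minus U x y" for x y
    using T by (auto simp: a_minus_def a_inv_def op_alg_def)
  from Suc(2) obtain b A' where A: "A = add_mset b A'" "size A' = k"
    by (metis size_eq_Suc_imp_eq_union nat.inject size_add_mset)
  then have b: "b \<in> B" and A': "set_mset A' \<subseteq> B" using Suc by auto
  have wc: "set_mset X \<subseteq> B \<Longrightarrow> w X \<in> carrier U" for X unfolding sel(1)[symmetric] by (rule famD(4)[OF w])
  let ?c = "of_nat (count A' b + 1) :: rat"
  let ?s = "(\<Oplus>\<^bsub>U\<^esub>c\<in>ok b A'. of_nat (count (A' - {#c#}) (the (mu b c)) + 1) \<odot>\<^bsub>U\<^esub> w (add_mset (the (mu b c)) (A' - {#c#})))"
  let ?p = "w {#b#} \<otimes>\<^bsub>T\<^esub> w A'"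
  have lA': "lead (w A') (image_mset \<sigma> A')" using Suc(1)[of A'] A A' by simp
  obtain cs where cs: "mset cs = image_mset \<sigma> A'" using ex_mset by blast
  have s: "fil (Suc k) ?s"
  proof (intro fil_finsum fil_sm)
    fix c assume c: "c \<in> ok b A'"
    let ?X = "add_mset (the (mu b c)) (A' - {#c#})"
    have X: "set_mset ?X \<subseteq> B" "size ?X = k"
      using A c okD[OF c] ok_closed[OF b A' c] set_diff[OF A', of "{#c#}"] by (auto simp: size_Suc_Diff1)
    have "lead (w ?X) (image_mset \<sigma> ?X)" using Suc(1)[of ?X] X by simp
    from lead_fil[OF this] X show "fil (Suc k) (w ?X)" by simp
  qed
  have p: "?p \<in> carrier U" using famD(4)[OF w, of "{#b#}"] wc[OF A'] b T by (auto simp: sel)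
  have nz: "?c \<noteq> 0" using of_nat_neq_0[of "count A' b"] by simp
  have wA: "w A = (1 / ?c) \<odot>\<^bsub>U\<^esub> (?p \<ominus>\<^bsub>U\<^esub> ?s)"
    unfolding A(1) rec_solve[OF QT famD(1)[OF w] b A'] famD(3)[OF w b A', symmetric] sel ainv ..
  have sc: "?s \<in> carrier U" using fil_closed[OF s] .
  have mf: "mfact (image_mset \<sigma> A) = ?c * mfact (image_mset \<sigma> A')"
    using mfact_inj[OF inj_on_subset[OF inj, of "set_mset A"]] mfact_inj[OF inj_on_subset[OF inj A']] Suc(3)
    by (simp add: A(1) mfact_add)
  let ?m = "mfact (image_mset \<sigma> A')"
  have e: "mfact (image_mset \<sigma> A) \<odot>\<^bsub>U\<^esub> w A = ?m \<odot>\<^bsub>U\<^esub> ?p \<ominus>\<^bsub>U\<^esub> ?m \<odot>\<^bsub>U\<^esub> ?s"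
  proof -
    have "mfact (image_mset \<sigma> A) \<odot>\<^bsub>U\<^esub> w A = (?m * ?c * (1 / ?c)) \<odot>\<^bsub>U\<^esub> (?p \<ominus>\<^bsub>U\<^esub> ?s)"
      unfolding wA mf using p sc by (simp only: E.U.sm_assoc[symmetric] E.U.minus_closed mult.commute mult.left_commute)
    also have "?m * ?c * (1 / ?c) = ?m" using nz by simp
    finally show ?thesis using p sc by (simp add: a_minus_def E.U.sm_radd E.U.sm_ruminus)
  qed
  define ds where "ds = (if T = U then \<sigma> b # cs else cs @ [\<sigma> b])"
  have ds: "mset ds = image_mset \<sigma> A" by (auto simp: ds_def cs A(1))
  have "fil (Suc k) (?m \<odot>\<^bsub>U\<^esub> ?p \<ominus>\<^bsub>U\<^esub> word ds)"
  proof (cases "T = U")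
    case True
    have "?m \<odot>\<^bsub>U\<^esub> ?p \<ominus>\<^bsub>U\<^esub> word ds = EE (\<sigma> b) \<otimes>\<^bsub>U\<^esub> (?m \<odot>\<^bsub>U\<^esub> w A' \<ominus>\<^bsub>U\<^esub> word cs)"
      using wc[OF A'] by (simp add: True ds_def g[OF b] a_minus_def E.U.r_distr E.U.r_minus E.U.sm_rmult)
    then show ?thesis using fil_gen[OF Emat_in leadD(2)[OF lA' cs]] A by simp
  next
    case False
    then have op: "T = op_alg U" using T by auto
    have "?m \<odot>\<^bsub>U\<^esub> ?p \<ominus>\<^bsub>U\<^esub> word ds = (?m \<odot>\<^bsub>U\<^esub> w A' \<ominus>\<^bsub>U\<^esub> word cs) \<otimes>\<^bsub>U\<^esub> word [\<sigma> b]"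
      unfolding ds_def if_not_P[OF False] using wc[OF A'] op by (simp add: g[OF b] a_minus_def E.U.l_distr E.U.l_minus E.U.sm_lmult word_append)
    then show ?thesis using fil_mult[OF leadD(2)[OF lA' cs] word_fil[of "[\<sigma> b]"]] A by simp
  qed
  then have "fil (Suc k) ((?m \<odot>\<^bsub>U\<^esub> ?p \<ominus>\<^bsub>U\<^esub> word ds) \<ominus>\<^bsub>U\<^esub> ?m \<odot>\<^bsub>U\<^esub> ?s)"
    by (rule fil_minus[OF _ fil_sm[OF s]])
  also have "(?m \<odot>\<^bsub>U\<^esub> ?p \<ominus>\<^bsub>U\<^esub> word ds) \<ominus>\<^bsub>U\<^esub> ?m \<odot>\<^bsub>U\<^esub> ?s = mfact (image_mset \<sigma> A) \<odot>\<^bsub>U\<^esub> w A \<ominus>\<^bsub>U\<^esub> word ds"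
    unfolding e using p sc by (simp add: a_minus_def E.U.a_assoc E.U.a_comm)
  finally have "fil (Suc k) (mfact (image_mset \<sigma> A) \<odot>\<^bsub>U\<^esub> w A \<ominus>\<^bsub>U\<^esub> word ds)" .
  then show ?case using wc[OF Suc(3)] Suc(2) by (intro leadI[OF _ ds]) auto
qed

section \<open>Evaluation of leading terms\<close>

text \<open>The positions still carrying the adjoined unit.\<close>

definition NP :: "letter list \<Rightarrow> nat set" where "NP s = {p. p < length s \<and> s ! p = None}"

lemma NP_finite [simp]: "finite (NP s)" by (simp add: NP_def)

lemma NP_upd_Some: "NP (s[p := Some b]) = NP s - {p}"
  by (cases "p < length s") (auto simp: NP_def nth_list_update split: if_splits)

text \<open>A generator converts at most one unit into a matrix unit. Too short a product therefore leaves a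
  unit somewhere, where the function vanishes.\<close>

lemma theta_fil_vanish:
  assumes "fil m u" and f: "\<And>s. NP s \<noteq> {} \<Longrightarrow> f s = 0"
  shows "m \<le> card (NP s) \<Longrightarrow> theta u f s = 0"
  using assms(1)
proof (induction arbitrary: s rule: fil.induct)
  case (fil_zero m)
  then show ?case using th(4)[of "\<one>\<^bsub>U\<^esub>" 0] by simp
next
  case (fil_one m)
  then have "NP s \<noteq> {}" by auto
  then show ?case using f th(5) by simp
next
  case (fil_gen x m u)
  have "theta u f (s[p := Some b]) = 0" for p b
  proof (rule fil_gen.IH)
    have "card (NP s) \<le> Suc (card (NP s - {p}))" using card_Suc_Diff1[of "NP s" p] by (cases "p \<in> NP s") auto
    then show "m \<le> card (NP (s[p := Some b]))" using fil_gen.prems by (simp add: NP_upd_Some)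
  qed
  then have "rho n x (\<lambda>a. theta u f (s[p := a])) a' = rho n x (\<lambda>a. 0 * 0) a'" for p a'
    by (intro rho_cong) simp
  then have "act n x (theta u f) s = 0"
    using rho_rsm[of n x 0 "\<lambda>_. 0"] by (simp add: act_def)
  then show ?case using fil_gen by (simp add: th(3) theta(2))
next
  case (fil_add m u v)
  then show ?case by (simp add: th(2))
next
  case (fil_sm m u r)
  then show ?case by (simp add: th(4))
qed

abbreviation idx :: "(int \<times> int) set" where "idx \<equiv> {(i, j). 1 \<le> i \<and> i \<le> int n}"

text \<open>The indicator function of the word \<open>ts\<close> of matrix units.\<close>

definition dl :: "(int \<times> int) list \<Rightarrow> letter list \<Rightarrow> rat" where
  "dl ts s = (if s = map Some ts then 1 else 0)"

lemma dl_NP: "NP s \<noteq> {} \<Longrightarrow> dl ts s = 0"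
  by (auto simp: NP_def dl_def) (metis surj_pair)

lemma rho_E_None: "c \<in> idx \<Longrightarrow> rho n (Emat n (fst c) (snd c)) g None = g (Some c)"
proof -
  assume c: "c \<in> idx"
  obtain i l where il: "c = (i, l)" by force
  have d: "int n dvd (k - i) \<longleftrightarrow> k = i" if "k \<in> {1..int n}" for k
    using dvd_diff_window[of k n i] that c il by auto
  have "rho n (Emat n i l) g None = (\<Sum>k\<in>{1..int n}. if k = i then g (Some (i, l)) else 0)"
    unfolding rho_def by (auto simp: Emat_row d intro!: sum.cong)
  then show ?thesis using c il by simp
qed

text \<open>Each generator has to be spent on one unit, and it has to produce the prescribed letter there. The
  number of ways to distribute the generators over the positions is the product of the factorials
  of the multiplicities.\<close>

lemma theta_word:
  assumes "set cs \<subseteq> idx" "length s = length ts" "card (NP s) = length cs"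
  shows "theta (word cs) (dl ts) s =
    (if (\<forall>p<length s. p \<notin> NP s \<longrightarrow> s ! p = Some (ts ! p)) \<and> mset cs = image_mset ((!) ts) (mset_set (NP s))
     then mfact (mset cs) else 0)"
  using assms
proof (induction cs arbitrary: s)
  case Nil
  then have "NP s = {}" by simp
  moreover have "s = map Some ts \<longleftrightarrow> (\<forall>p<length s. s ! p = Some (ts ! p))" using Nil by (auto simp: list_eq_iff_nth_eq)
  ultimately show ?case using th(5) by (simp add: dl_def)
next
  case (Cons c cs)
  let ?C = "\<forall>p<length s. p \<notin> NP s \<longrightarrow> s ! p = Some (ts ! p)"
  let ?M = "image_mset ((!) ts) (mset_set (NP s))"
  let ?g = "theta (word cs) (dl ts)"
  have c: "c \<in> idx" using Cons by auto
  have 0: "rho n (Emat n (fst c) (snd c)) (\<lambda>a. ?g (s[p := a])) (s ! p) = 0" if p: "p < length s" "p \<notin> NP s" for p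
  proof -
    have "?g (s[p := Some b]) = 0" for b
      by (rule theta_fil_vanish[OF word_fil dl_NP]) (use Cons p in \<open>auto simp: NP_upd_Some\<close>)
    then have "rho n (Emat n (fst c) (snd c)) (\<lambda>a. ?g (s[p := a])) (s ! p) = rho n (Emat n (fst c) (snd c)) (\<lambda>a. 0 * 0) (s ! p)"
      by (intro rho_cong) simp
    then show ?thesis using rho_rsm[of n "Emat n (fst c) (snd c)" 0 "\<lambda>_. 0"] by simp
  qed
  have 1: "rho n (Emat n (fst c) (snd c)) (\<lambda>a. ?g (s[p := a])) (s ! p) =
      (if ts ! p = c \<and> ?C \<and> mset (c # cs) = ?M then mfact (mset cs) else 0)" if p: "p \<in> NP s" for p
  proof -
    have pl: "p < length s" "s ! p = None" using p by (auto simp: NP_def)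
    let ?s = "s[p := Some c]"
    have "?g ?s = (if (\<forall>q<length ?s. q \<notin> NP ?s \<longrightarrow> ?s ! q = Some (ts ! q)) \<and> mset cs = image_mset ((!) ts) (mset_set (NP ?s))
     then mfact (mset cs) else 0)"
      by (rule Cons.IH) (use Cons p in \<open>auto simp: NP_upd_Some\<close>)
    moreover have "(\<forall>q<length ?s. q \<notin> NP ?s \<longrightarrow> ?s ! q = Some (ts ! q)) \<longleftrightarrow> ts ! p = c \<and> ?C"
      using pl p by (auto simp: NP_upd_Some nth_list_update split: if_splits)
    moreover have "mset cs = image_mset ((!) ts) (mset_set (NP ?s)) \<longleftrightarrow> mset (c # cs) = ?M" if "ts ! p = c"
      using p that mset_set.remove[of "NP s" p] by (simp add: NP_upd_Some)
    ultimately show ?thesis using pl rho_E_None[OF c] by auto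
  qed
  have "theta (word (c # cs)) (dl ts) s = act n (Emat n (fst c) (snd c)) ?g s"
    by (simp add: th(3) theta(2))
  also have "\<dots> = (\<Sum>p\<in>NP s. rho n (Emat n (fst c) (snd c)) (\<lambda>a. ?g (s[p := a])) (s ! p))"
    unfolding act_def by (rule sum.mono_neutral_right) (auto simp: 0, auto simp: NP_def)
  also have "\<dots> = (\<Sum>p\<in>NP s. if ts ! p = c then (if ?C \<and> mset (c # cs) = ?M then mfact (mset cs) else 0) else 0)"
    by (rule sum.cong) (use 1 in auto)
  also have "\<dots> = of_nat (card {p\<in>NP s. ts ! p = c}) * (if ?C \<and> mset (c # cs) = ?M then mfact (mset cs) else 0)"
    by (subst sum.inter_filter[symmetric]) auto
  also have "card {p\<in>NP s. ts ! p = c} = count ?M c"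
    by (simp add: count_image_mset Int_def vimage_def conj_commute)
  also have "of_nat (count ?M c) * (if ?C \<and> mset (c # cs) = ?M then mfact (mset cs) else 0) =
     (if ?C \<and> mset (c # cs) = ?M then mfact (mset (c # cs)) else 0)"
    using mfact_add[of c "mset cs"] by (auto simp: of_nat_add dest!: sym[of "add_mset c (mset cs)" ?M])
  finally show ?case .
qed

text \<open>The functional that reads off the coefficient of the leading word \<open>ts\<close>.\<close>

definition kap :: "(int \<times> int) list \<Rightarrow> ugl \<Rightarrow> rat" where
  "kap ts u = theta u (dl ts) (replicate (length ts) None)"

lemma NP_replicate: "NP (replicate r None) = {..<r}" by (auto simp: NP_def)

lemma kap_fil: "fil (length ts) u \<Longrightarrow> kap ts u = 0"
  unfolding kap_def by (rule theta_fil_vanish) (auto simp: dl_NP NP_replicate)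

lemma kap_lin: "u \<in> carrier U \<Longrightarrow> v \<in> carrier U \<Longrightarrow> kap ts (u \<oplus>\<^bsub>U\<^esub> v) = kap ts u + kap ts v"
  "u \<in> carrier U \<Longrightarrow> kap ts (r \<odot>\<^bsub>U\<^esub> u) = r * kap ts u"
  by (simp_all add: kap_def th)

lemma kap_zero: "kap ts \<zero>\<^bsub>U\<^esub> = 0" using kap_lin(2)[of "\<zero>\<^bsub>U\<^esub>" ts 0] by simp

lemma kap_diff: "u \<in> carrier U \<Longrightarrow> v \<in> carrier U \<Longrightarrow> kap ts (u \<ominus>\<^bsub>U\<^esub> v) = kap ts u - kap ts v"
  using kap_lin(1)[of "u \<ominus>\<^bsub>U\<^esub> v" v ts] E.U.add_diff[of u v] by (simp add: E.U.a_comm)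

lemma kap_finsum: "finite S \<Longrightarrow> (\<And>i. i \<in> S \<Longrightarrow> f i \<in> carrier U) \<Longrightarrow> kap ts (finsum U f S) = (\<Sum>i\<in>S. kap ts (f i))"
  by (induction S rule: finite_induct) (auto simp: kap_zero kap_lin E.U.finsum_empty Pi_iff)

lemma kap_word:
  assumes "set cs \<subseteq> idx" "length cs = length ts"
  shows "kap ts (word cs) = (if mset cs = mset ts then mfact (mset cs) else 0)"
proof -
  have "image_mset ((!) ts) (mset_set {..<length ts}) = mset ts"
    by (metis atLeast_upt map_nth mset_map mset_upt atLeast0LessThan mset_set_set)
  then show ?thesis unfolding kap_def
    by (subst theta_word) (use assms in \<open>auto simp: NP_replicate\<close>)
qed

lemma kap_lead:
  assumes u: "lead u D" and D: "set_mset D \<subseteq> idx" "size D = length ts"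
  shows "kap ts u = (if D = mset ts then 1 else 0)"
proof -
  obtain cs where cs: "mset cs = D" using ex_mset by blast
  have len: "length cs = length ts" using cs D by (metis size_mset)
  have "kap ts (mfact D \<odot>\<^bsub>U\<^esub> u \<ominus>\<^bsub>U\<^esub> word cs) = 0" using leadD(2)[OF u cs] D by (intro kap_fil) simp
  then have "mfact D * kap ts u = kap ts (word cs)" using leadD(1)[OF u] by (simp add: kap_diff kap_lin)
  also have "\<dots> = (if D = mset ts then mfact D else 0)"
    using cs D by (subst kap_word) (auto simp: len)
  finally show ?thesis by (auto split: if_splits)
qed

section \<open>Integral elements are integral combinations\<close>

text \<open>A periodic matrix is determined by its rows 1 to \<open>n\<close>, so it is a finite combination of the matrix units
  with row index in this window.\<close>

lemma per_mats_induct [consumes 1, case_names zero step]: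
  assumes x: "x \<in> per_mats n" and "P (\<lambda>i j. 0)"
    and step: "\<And>x r c. x \<in> per_mats n \<Longrightarrow> P x \<Longrightarrow> c \<in> idx \<Longrightarrow> P (\<lambda>i j. x i j + r * Emat n (fst c) (snd c) i j)"
  shows "P (x :: int \<Rightarrow> int \<Rightarrow> rat)"
proof -
  define su where "su x = {(i, j). 1 \<le> i \<and> i \<le> int n \<and> x i j \<noteq> 0}" for x :: "int \<Rightarrow> int \<Rightarrow> rat"
  have fin: "finite (su x)" if "x \<in> per_mats n" for x
  proof -
    have "su x = (SIGMA i:{1..int n}. {j. x i j \<noteq> 0})" by (auto simp: su_def)
    then show ?thesis using per_matsD(1)[OF that] by simp
  qed
  have shift: "x (i + s * int n) (j + s * int n) = x i j" if x: "x \<in> per_mats n" for x :: "int \<Rightarrow> int \<Rightarrow> rat" and i j s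
    by (rule per_shift) (use per_matsD(3)[OF x] in simp)
  have "x \<in> per_mats n \<Longrightarrow> card (su x) = k \<Longrightarrow> P x" for k x
  proof (induction k arbitrary: x)
    case 0
    then have e: "su x = {}" using fin by simp
    have "x i j = 0" for i j
    proof -
      define s where "s = (i - 1) div int n"
      have "i = 1 + (i - 1) mod int n + s * int n" unfolding s_def by simp
      moreover have "0 \<le> (i - 1) mod int n" "(i - 1) mod int n < int n" using n1 by auto
      ultimately have "1 \<le> i - s * int n" "i - s * int n \<le> int n" by linarith+
      then have "x (i - s * int n) (j - s * int n) = 0" using e by (auto simp: su_def)
      then show ?thesis using shift[OF 0(1), of "i - s * int n" s "j - s * int n"] by simp
    qed
    then have "x = (\<lambda>i j. 0)" by blast
    then show ?case using assms(2) by simp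
  next
    case (Suc k)
    then obtain c where c: "c \<in> su x" by (metis card.empty ex_in_conv nat.distinct(1))
    obtain a b where ab: "c = (a, b)" by force
    let ?E = "Emat n a b :: int \<Rightarrow> int \<Rightarrow> rat"
    let ?y = "\<lambda>i j. x i j - x a b * ?E i j"
    have y: "?y \<in> per_mats n"
      using per_mats_diff[OF Suc(2) per_mats_sm[OF Emat_in[of a b], of "x a b"]] .
    have E: "?E i j = (if (i, j) = (a, b) then 1 else 0)" if "1 \<le> i" "i \<le> int n" for i j
      using dvd_diff_window[OF that, of a] c ab by (auto simp: su_def Emat_iff)
    have "su ?y = su x - {c}" using ab c by (auto simp: su_def E split: if_splits)
    then have "card (su ?y) = k" using Suc c fin by simp
    then have "P ?y" using Suc(1) y by simp
    then have "P (\<lambda>i j. ?y i j + x a b * Emat n (fst c) (snd c) i j)"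
      using step[OF y] c by (auto simp: su_def)
    then show ?case by (simp add: ab)
  qed
  then show ?thesis using x by blast
qed

context
  fixes z :: "(int \<times> int) multiset \<Rightarrow> ugl"
  assumes zl: "\<And>D. set_mset D \<subseteq> idx \<Longrightarrow> lead (z D) D"
begin

text \<open>\<open>spn m\<close> is the span of \<open>fil m\<close> and of the elements \<open>z D\<close> with \<open>D\<close> of size \<open>m\<close>. It is generated so as to
  make \<open>spn_gen\<close> a rule induction; \<open>fil_spn\<close> is then the spanning half of the PBW theorem.\<close>

inductive spn :: "nat \<Rightarrow> ugl \<Rightarrow> bool" where
  spn_fil: "fil m u \<Longrightarrow> spn m u"
| spn_z: "set_mset D \<subseteq> idx \<Longrightarrow> size D = m \<Longrightarrow> spn m (z D)"
| spn_add: "spn m u \<Longrightarrow> spn m v \<Longrightarrow> spn m (u \<oplus>\<^bsub>U\<^esub> v)"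
| spn_sm: "spn m u \<Longrightarrow> spn m (r \<odot>\<^bsub>U\<^esub> u)"

lemma spn_closed [simp]: "spn m u \<Longrightarrow> u \<in> carrier U"
  by (induction rule: spn.induct) (auto intro: leadD(1)[OF zl])

text \<open>Multiplying \<open>z D\<close> by the matrix unit at \<open>c\<close> gives a multiple of \<open>z (add_mset c D)\<close> up to shorter words.\<close>

lemma spn_gen:
  assumes x: "x \<in> per_mats n" shows "spn m u \<Longrightarrow> spn (Suc m) (gg x \<otimes>\<^bsub>U\<^esub> u)"
proof (induction rule: spn.induct)
  case (spn_fil m u)
  then show ?case using x by (intro spn.spn_fil fil_gen)
next
  case (spn_z D m)
  note zD = leadD(1)[OF zl[OF spn_z(1)]]
  show ?case using x
  proof (induction rule: per_mats_induct)
    case zero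
    have "gg (\<lambda>i j. 0) = \<zero>\<^bsub>U\<^esub>" using E.gen_sm[of "Emat n 0 0" 0] by simp
    then show ?case using zD by (simp add: spn.spn_fil fil_zero)
  next
    case (step x r c)
    obtain cs where cs: "mset cs = D" using ex_mset by blast
    let ?D = "add_mset c D"
    have cD: "set_mset ?D \<subseteq> idx" using spn_z step by auto
    have m: "size ?D = Suc m" using spn_z by simp
    note zD' = leadD(1)[OF zl[OF cD]]
    have 1: "fil (Suc m) (EE c \<otimes>\<^bsub>U\<^esub> (mfact D \<odot>\<^bsub>U\<^esub> z D \<ominus>\<^bsub>U\<^esub> word cs))"
      using fil_gen[OF Emat_in leadD(2)[OF zl[OF spn_z(1)] cs]] spn_z by simp
    have 2: "fil (Suc m) (mfact ?D \<odot>\<^bsub>U\<^esub> z ?D \<ominus>\<^bsub>U\<^esub> word (c # cs))"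
      using leadD(2)[OF zl[OF cD], of "c # cs"] cs spn_z by simp
    have "fil (Suc m) (EE c \<otimes>\<^bsub>U\<^esub> (mfact D \<odot>\<^bsub>U\<^esub> z D) \<ominus>\<^bsub>U\<^esub> word (c # cs))"
      using 1 zD by (simp add: a_minus_def E.U.r_distr E.U.r_minus)
    then have "fil (Suc m) (EE c \<otimes>\<^bsub>U\<^esub> (mfact D \<odot>\<^bsub>U\<^esub> z D) \<ominus>\<^bsub>U\<^esub> mfact ?D \<odot>\<^bsub>U\<^esub> z ?D)"
      using fil_sym[OF 2] zD zD' by (elim fil_trans) auto
    then have "spn (Suc m) ((EE c \<otimes>\<^bsub>U\<^esub> (mfact D \<odot>\<^bsub>U\<^esub> z D) \<ominus>\<^bsub>U\<^esub> mfact ?D \<odot>\<^bsub>U\<^esub> z ?D) \<oplus>\<^bsub>U\<^esub> mfact ?D \<odot>\<^bsub>U\<^esub> z ?D)"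
      using cD m by (intro spn.spn_add spn.spn_sm spn.spn_z) (auto intro: spn.spn_fil)
    moreover have "(EE c \<otimes>\<^bsub>U\<^esub> (mfact D \<odot>\<^bsub>U\<^esub> z D) \<ominus>\<^bsub>U\<^esub> mfact ?D \<odot>\<^bsub>U\<^esub> z ?D) \<oplus>\<^bsub>U\<^esub> mfact ?D \<odot>\<^bsub>U\<^esub> z ?D = mfact D \<odot>\<^bsub>U\<^esub> (EE c \<otimes>\<^bsub>U\<^esub> z D)"
      using zD zD' E.U.add_diff[of "EE c \<otimes>\<^bsub>U\<^esub> (mfact D \<odot>\<^bsub>U\<^esub> z D)" "mfact ?D \<odot>\<^bsub>U\<^esub> z ?D"]
      by (simp add: E.U.a_comm E.U.sm_rmult)
    ultimately have "spn (Suc m) ((1 / mfact D) \<odot>\<^bsub>U\<^esub> (mfact D \<odot>\<^bsub>U\<^esub> (EE c \<otimes>\<^bsub>U\<^esub> z D)))" by (metis spn.spn_sm)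
    then have "spn (Suc m) (EE c \<otimes>\<^bsub>U\<^esub> z D)" using zD by (simp add: E.U.sm_assoc[symmetric])
    then have "spn (Suc m) (gg x \<otimes>\<^bsub>U\<^esub> z D \<oplus>\<^bsub>U\<^esub> r \<odot>\<^bsub>U\<^esub> (EE c \<otimes>\<^bsub>U\<^esub> z D))"
      using step by (intro spn.spn_add spn.spn_sm)
    moreover have "gg (\<lambda>i j. x i j + r * Emat n (fst c) (snd c) i j) = gg x \<oplus>\<^bsub>U\<^esub> r \<odot>\<^bsub>U\<^esub> EE c"
      using E.gen_add[of x "\<lambda>i j. r * Emat n (fst c) (snd c) i j"] E.gen_sm[of "Emat n (fst c) (snd c)" r] step(1)
      by (simp add: per_mats_sm)
    ultimately show ?case using zD step(1) by (simp add: E.U.l_distr E.U.sm_lmult)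
  qed
next
  case (spn_add m u v)
  then show ?case using x by (simp add: E.U.r_distr spn.spn_add)
next
  case (spn_sm m u r)
  then show ?case using x by (simp add: E.U.sm_rmult spn.spn_sm)
qed

lemma fil_spn: "fil k u \<Longrightarrow> k = Suc m \<Longrightarrow> spn m u"
proof (induction arbitrary: m rule: fil.induct)
  case (fil_zero k) then show ?case by (intro spn_fil fil.fil_zero)
next
  case (fil_one k)
  show ?case
  proof (cases m)
    case 0
    have "\<one>\<^bsub>U\<^esub> = z {#}" using fil_0[OF leadD(2)[OF zl[of "{#}"], of "[]"]] leadD(1)[OF zl[of "{#}"]]
      by simp
    then show ?thesis using spn_z[of "{#}" 0] 0 by simp
  next
    case (Suc m') then show ?thesis by (intro spn_fil) (simp add: fil.fil_one)
  qed
next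
  case (fil_gen x k u)
  show ?case
  proof (cases m)
    case 0
    then have "u = \<zero>\<^bsub>U\<^esub>" using fil_gen fil_0 by auto
    then show ?thesis using fil_gen by (auto intro!: spn_fil fil.fil_zero)
  next
    case (Suc m') then show ?thesis using fil_gen by (auto intro: spn_gen)
  qed
next
  case (fil_add k u v) then show ?case by (auto intro: spn_add)
next
  case (fil_sm k u r) then show ?case by (auto intro: spn_sm)
qed

lemma spn_ex: "spn m u \<Longrightarrow> \<exists>S q. finite S \<and> (\<forall>D\<in>S. set_mset D \<subseteq> idx \<and> size D = m) \<and>
   fil m (u \<ominus>\<^bsub>U\<^esub> (\<Oplus>\<^bsub>U\<^esub>D\<in>S. q D \<odot>\<^bsub>U\<^esub> z D))"
proof (induction rule: spn.induct)
  case (spn_fil m u)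
  then show ?case by (intro exI[of _ "{}"]) (simp add: E.U.finsum_empty a_minus_def)
next
  case (spn_z D m)
  then show ?case using leadD(1)[OF zl[OF spn_z(1)]]
    by (intro exI[of _ "{D}"] exI[of _ "\<lambda>_. 1"]) (simp add: fil_zero E.U.finsum_insert E.U.finsum_empty)
next
  case (spn_add m u v)
  then obtain S q S' q' where S: "finite S" "\<forall>D\<in>S. set_mset D \<subseteq> idx \<and> size D = m"
    "fil m (u \<ominus>\<^bsub>U\<^esub> (\<Oplus>\<^bsub>U\<^esub>D\<in>S. q D \<odot>\<^bsub>U\<^esub> z D))"
    and S': "finite S'" "\<forall>D\<in>S'. set_mset D \<subseteq> idx \<and> size D = m"
    "fil m (v \<ominus>\<^bsub>U\<^esub> (\<Oplus>\<^bsub>U\<^esub>D\<in>S'. q' D \<odot>\<^bsub>U\<^esub> z D))" by blast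
  let ?r = "\<lambda>D. if D \<in> S then q D else 0" and ?r' = "\<lambda>D. if D \<in> S' then q' D else 0"
  have zc: "D \<in> S \<union> S' \<Longrightarrow> z D \<in> carrier U" for D using S(2) S'(2) by (auto intro!: leadD(1)[OF zl])
  have 1: "(\<Oplus>\<^bsub>U\<^esub>D\<in>S. q D \<odot>\<^bsub>U\<^esub> z D) = (\<Oplus>\<^bsub>U\<^esub>D\<in>S \<union> S'. ?r D \<odot>\<^bsub>U\<^esub> z D)"
    by (rule E.U.add.finprod_mono_neutral_cong_left) (use S S' zc in auto)
  have 2: "(\<Oplus>\<^bsub>U\<^esub>D\<in>S'. q' D \<odot>\<^bsub>U\<^esub> z D) = (\<Oplus>\<^bsub>U\<^esub>D\<in>S \<union> S'. ?r' D \<odot>\<^bsub>U\<^esub> z D)"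
    by (rule E.U.add.finprod_mono_neutral_cong_left) (use S S' zc in auto)
  have 3: "(\<Oplus>\<^bsub>U\<^esub>D\<in>S \<union> S'. (?r D + ?r' D) \<odot>\<^bsub>U\<^esub> z D) = (\<Oplus>\<^bsub>U\<^esub>D\<in>S. q D \<odot>\<^bsub>U\<^esub> z D) \<oplus>\<^bsub>U\<^esub> (\<Oplus>\<^bsub>U\<^esub>D\<in>S'. q' D \<odot>\<^bsub>U\<^esub> z D)" (is "_ = ?a \<oplus>\<^bsub>U\<^esub> ?b")
  proof -
    have "(\<Oplus>\<^bsub>U\<^esub>D\<in>S \<union> S'. (?r D + ?r' D) \<odot>\<^bsub>U\<^esub> z D) = (\<Oplus>\<^bsub>U\<^esub>D\<in>S \<union> S'. ?r D \<odot>\<^bsub>U\<^esub> z D \<oplus>\<^bsub>U\<^esub> ?r' D \<odot>\<^bsub>U\<^esub> z D)"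
    proof (rule E.U.finsum_cong'[OF refl])
      show "(?r D + ?r' D) \<odot>\<^bsub>U\<^esub> z D = ?r D \<odot>\<^bsub>U\<^esub> z D \<oplus>\<^bsub>U\<^esub> ?r' D \<odot>\<^bsub>U\<^esub> z D" if "D \<in> S \<union> S'" for D
        by (rule E.U.sm_ladd[OF zc[OF that]])
    qed (use zc in auto)
    also have "\<dots> = (\<Oplus>\<^bsub>U\<^esub>D\<in>S \<union> S'. ?r D \<odot>\<^bsub>U\<^esub> z D) \<oplus>\<^bsub>U\<^esub> (\<Oplus>\<^bsub>U\<^esub>D\<in>S \<union> S'. ?r' D \<odot>\<^bsub>U\<^esub> z D)"
      by (rule E.U.finsum_addf) (use zc in auto)
    finally show ?thesis unfolding 1 2 .
  qed
  have ab: "?a \<in> carrier U" "?b \<in> carrier U" using zc by (auto intro!: E.U.finsum_closed)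
  have "fil m ((u \<ominus>\<^bsub>U\<^esub> ?a) \<oplus>\<^bsub>U\<^esub> (v \<ominus>\<^bsub>U\<^esub> ?b))" using S(3) S'(3) by (rule fil_add)
  moreover have "(u \<ominus>\<^bsub>U\<^esub> ?a) \<oplus>\<^bsub>U\<^esub> (v \<ominus>\<^bsub>U\<^esub> ?b) = (u \<oplus>\<^bsub>U\<^esub> v) \<ominus>\<^bsub>U\<^esub> (?a \<oplus>\<^bsub>U\<^esub> ?b)"
    using ab spn_closed[OF spn_add(1)] spn_closed[OF spn_add(2)]
    by (simp add: a_minus_def E.U.minus_add E.U.a_ac)
  ultimately have "fil m ((u \<oplus>\<^bsub>U\<^esub> v) \<ominus>\<^bsub>U\<^esub> (\<Oplus>\<^bsub>U\<^esub>D\<in>S \<union> S'. (?r D + ?r' D) \<odot>\<^bsub>U\<^esub> z D))" unfolding 3 by simp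
  then show ?case using S S' by (intro exI[of _ "S \<union> S'"] exI[of _ "\<lambda>D. ?r D + ?r' D"]) auto
next
  case (spn_sm m u r)
  then obtain S q where S: "finite S" "\<forall>D\<in>S. set_mset D \<subseteq> idx \<and> size D = m"
    "fil m (u \<ominus>\<^bsub>U\<^esub> (\<Oplus>\<^bsub>U\<^esub>D\<in>S. q D \<odot>\<^bsub>U\<^esub> z D))" by blast
  have zc: "D \<in> S \<Longrightarrow> z D \<in> carrier U" for D using S(2) by (auto intro!: leadD(1)[OF zl])
  let ?a = "\<Oplus>\<^bsub>U\<^esub>D\<in>S. q D \<odot>\<^bsub>U\<^esub> z D"
  have ac: "?a \<in> carrier U" using zc by (auto intro!: E.U.finsum_closed)
  have "(\<Oplus>\<^bsub>U\<^esub>D\<in>S. (r * q D) \<odot>\<^bsub>U\<^esub> z D) = r \<odot>\<^bsub>U\<^esub> ?a"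
  proof -
    have "(\<Oplus>\<^bsub>U\<^esub>D\<in>S. (r * q D) \<odot>\<^bsub>U\<^esub> z D) = (\<Oplus>\<^bsub>U\<^esub>D\<in>S. r \<odot>\<^bsub>U\<^esub> (q D \<odot>\<^bsub>U\<^esub> z D))"
      by (rule E.U.finsum_cong'[OF refl]) (use zc in \<open>simp_all add: E.U.sm_assoc Pi_iff\<close>)
    also have "\<dots> = r \<odot>\<^bsub>U\<^esub> ?a" by (rule E.U.sm_finsum[symmetric]) (use zc in auto)
    finally show ?thesis .
  qed
  moreover have "r \<odot>\<^bsub>U\<^esub> (u \<ominus>\<^bsub>U\<^esub> ?a) = r \<odot>\<^bsub>U\<^esub> u \<ominus>\<^bsub>U\<^esub> r \<odot>\<^bsub>U\<^esub> ?a"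
    using ac spn_closed[OF spn_sm(1)] by (simp add: a_minus_def E.U.sm_radd E.U.sm_ruminus)
  ultimately have "fil m (r \<odot>\<^bsub>U\<^esub> u \<ominus>\<^bsub>U\<^esub> (\<Oplus>\<^bsub>U\<^esub>D\<in>S. (r * q D) \<odot>\<^bsub>U\<^esub> z D))"
    using fil_sm[OF S(3), of r] by simp
  then show ?case using S by (intro exI[of _ S] exI[of _ "\<lambda>D. r * q D"]) auto
qed

text \<open>Induction on the filtration. The functionals \<open>kap\<close> take integral values on integral elements, and they
  compute the coefficients in degree \<open>m\<close>; after subtracting the integral combination of the \<open>z D\<close>, an
  integral element of smaller degree remains.\<close>

lemma Wint_span:
  assumes zW: "\<And>D. set_mset D \<subseteq> idx \<Longrightarrow> z D \<in> Wint"
  shows "u \<in> Wint \<Longrightarrow> u \<in> Z_span U {z D | D. set_mset D \<subseteq> idx}"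
proof -
  let ?Z = "Z_span U {z D | D. set_mset D \<subseteq> idx}"
  have X: "{z D | D. set_mset D \<subseteq> idx} \<subseteq> carrier U" using zW WintD by auto
  have "fil m u \<Longrightarrow> u \<in> Wint \<Longrightarrow> u \<in> ?Z" for m u
  proof (induction m arbitrary: u)
    case 0
    then show ?case using fil_0 E.U.Z_span_zero by auto
  next
    case (Suc m)
    from spn_ex[OF fil_spn[OF Suc(2) refl]] obtain S q where S: "finite S" "\<forall>D\<in>S. set_mset D \<subseteq> idx \<and> size D = m"
      "fil m (u \<ominus>\<^bsub>U\<^esub> (\<Oplus>\<^bsub>U\<^esub>D\<in>S. q D \<odot>\<^bsub>U\<^esub> z D))" by blast
    let ?a = "\<Oplus>\<^bsub>U\<^esub>D\<in>S. q D \<odot>\<^bsub>U\<^esub> z D"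
    have zc: "D \<in> S \<Longrightarrow> z D \<in> carrier U" for D using S(2) by (auto intro!: leadD(1)[OF zl])
    have ac: "?a \<in> carrier U" using zc by (auto intro!: E.U.finsum_closed)
    have uc: "u \<in> carrier U" using Suc(3) by (rule WintD(1))
    (* The coefficient q D is the value at u of the functional attached to an ordering of D. *)
    have q: "q D \<in> \<int>" if D: "D \<in> S" for D
    proof -
      obtain ts where ts: "mset ts = D" using ex_mset by blast
      then have len: "length ts = m" using S(2) D by auto
      have "kap ts (u \<ominus>\<^bsub>U\<^esub> ?a) = 0" using S(3) len by (intro kap_fil) simp
      then have "kap ts u = kap ts ?a" using uc ac by (simp add: kap_diff)
      also have "\<dots> = (\<Sum>D'\<in>S. q D' * kap ts (z D'))" using S(1) zc by (simp add: kap_finsum kap_lin)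
      also have "\<dots> = (\<Sum>D'\<in>S. if D' = D then q D' else 0)"
        by (rule sum.cong[OF refl], subst kap_lead[OF zl]) (use S(2) len ts in auto)
      also have "\<dots> = q D" using S(1) D by simp
      finally have "q D = kap ts u" ..
      also have "kap ts u \<in> \<int>" unfolding kap_def using Suc(3) by (rule WintD(2)) (simp add: dl_def)
      finally show ?thesis .
    qed
    have aW: "?a \<in> Wint" using q S(2) by (intro Wint_finsum Wint_sm zW) auto
    have "?a \<in> ?Z"
    proof (rule E.U.Z_span_finsum[OF X])
      fix D assume D: "D \<in> S"
      show "q D \<odot>\<^bsub>U\<^esub> z D \<in> ?Z" by (rule E.U.Z_span_int[OF X q[OF D] E.U.Z_span_incl]) (use S(2) D in auto)
    qed
    moreover have "u \<ominus>\<^bsub>U\<^esub> ?a \<in> ?Z"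
      using Suc(1)[OF S(3)] Suc(3) aW by (simp add: a_minus_def Wint_add Wint_uminus)
    ultimately have "?a \<oplus>\<^bsub>U\<^esub> (u \<ominus>\<^bsub>U\<^esub> ?a) \<in> ?Z" by (rule E.U.Z_span_add)
    then show ?case using E.U.add_diff[OF uc ac] by simp
  qed
  then show "u \<in> Wint \<Longrightarrow> u \<in> ?Z" using fil_ex[OF WintD(1)] by blast
qed

end

end

section \<open>Interval representations of the cyclic quiver\<close>

text \<open>A basis vector is viewed as a position \<open>pos\<close> on a copy \<open>cpy\<close> of an indecomposable, with constructor
  \<open>vx\<close>. The arrows of a representation, written on coordinate functions, pull back along \<open>pre\<close>.\<close>

definition pre :: "bas \<Rightarrow> bas" where "pre b = (case b of (i, j, c, k) \<Rightarrow> (i, j, c, k - 1))"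
definition pos :: "bas \<Rightarrow> int" where "pos b = (case b of (i, j, c, k) \<Rightarrow> k)"
definition vx :: "int \<times> int \<times> nat \<Rightarrow> int \<Rightarrow> bas" where "vx c k = (fst c, fst (snd c), snd (snd c), k)"
definition cpy :: "bas \<Rightarrow> int \<times> int \<times> nat" where "cpy b = (case b of (i, j, c, k) \<Rightarrow> (i, j, c))"

lemma at_simps [simp]: "pre (vx c k) = vx c (k - 1)" "pos (vx c k) = k" "cpy (vx c k) = c" "vx c k = vx c' k' \<longleftrightarrow> c = c' \<and> k = k'"
  by (auto simp: pre_def pos_def vx_def cpy_def prod_eq_iff)

lemma vx_cases: obtains c k where "b = vx c k"
proof -
  obtain i j c k where "b = (i, j, c, k)" by (cases b) auto
  then have "b = vx (i, j, c) k" by (simp add: vx_def)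
  then show ?thesis using that by blast
qed

text \<open>The basis vectors in intervals \<open>s c \<le> k < e c\<close> on the copies \<open>c \<in> K\<close>. All representations that matter
  are supported on such sets: those of the form \<open>M(A)\<close>, the subrepresentations spanned by tails of
  copies, and the corresponding quotients.\<close>

definition iv :: "(int \<times> int \<times> nat) set \<Rightarrow> (int \<times> int \<times> nat \<Rightarrow> int) \<Rightarrow> (int \<times> int \<times> nat \<Rightarrow> int) \<Rightarrow> bas set" where
  "iv K s e = {b. cpy b \<in> K \<and> s (cpy b) \<le> pos b \<and> pos b < e (cpy b)}"

lemma iv_at [simp]: "vx c k \<in> iv K s e \<longleftrightarrow> c \<in> K \<and> s c \<le> k \<and> k < e c" by (simp add: iv_def)

text \<open>The indecomposable summands of \<open>M(A)\<close>, with \<open>st\<close> and \<open>en\<close> the end points of their intervals.\<close>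

definition KA :: "nat \<Rightarrow> (int \<Rightarrow> int \<Rightarrow> nat) \<Rightarrow> (int \<times> int \<times> nat) set" where
  "KA n A = {(i, j, c). 1 \<le> i \<and> i \<le> int n \<and> i < j \<and> c < A i j}"

abbreviation "st \<equiv> fst :: int \<times> int \<times> nat \<Rightarrow> int"
abbreviation "en \<equiv> (\<lambda>c :: int \<times> int \<times> nat. fst (snd c))"

definition SA :: "nat \<Rightarrow> (int \<Rightarrow> int \<Rightarrow> nat) \<Rightarrow> bas set" where "SA n A = iv (KA n A) st en"

definition vs :: "('f, 'm) ring_scheme \<Rightarrow> bas set \<Rightarrow> (bas \<Rightarrow> 'f) set" where
  "vs F T = {x. (\<forall>b. x b \<in> carrier F) \<and> (\<forall>b. b \<notin> T \<longrightarrow> x b = \<zero>\<^bsub>F\<^esub>)}"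

definition at_v :: "nat \<Rightarrow> int \<Rightarrow> bas set" where "at_v n v = {b. pos b mod int n = v}"

text \<open>The fields \<open>mult\<close> and \<open>one\<close> are those of \<^const>\<open>rep_of\<close>.\<close>

definition vm :: "('f, 'm) ring_scheme \<Rightarrow> bas set \<Rightarrow> ('f, bas \<Rightarrow> 'f) module" where
  "vm F T = \<lparr>carrier = vs F T, mult = undefined, one = undefined, zero = (\<lambda>b. \<zero>\<^bsub>F\<^esub>),
     add = (\<lambda>x y b. x b \<oplus>\<^bsub>F\<^esub> y b), smult = (\<lambda>a x b. a \<otimes>\<^bsub>F\<^esub> x b)\<rparr>"

definition fS :: "('f, 'm) ring_scheme \<Rightarrow> bas set \<Rightarrow> (bas \<Rightarrow> 'f) \<Rightarrow> bas \<Rightarrow> 'f" where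
  "fS F S x b = (if b \<in> S then x (pre b) else \<zero>\<^bsub>F\<^esub>)"

definition RS :: "nat \<Rightarrow> ('f, 'm) ring_scheme \<Rightarrow> bas set \<Rightarrow> ('f, bas \<Rightarrow> 'f) rep" where
  "RS n F S = (\<lambda>v. vm F (S \<inter> at_v n v), \<lambda>v. fS F S)"

lemma vm_sel [simp]: "carrier (vm F T) = vs F T" "x \<oplus>\<^bsub>vm F T\<^esub> y = (\<lambda>b. x b \<oplus>\<^bsub>F\<^esub> y b)"
  "a \<odot>\<^bsub>vm F T\<^esub> x = (\<lambda>b. a \<otimes>\<^bsub>F\<^esub> x b)" "\<zero>\<^bsub>vm F T\<^esub> = (\<lambda>b. \<zero>\<^bsub>F\<^esub>)"
  by (auto simp: vm_def)

lemma vsD: "x \<in> vs F T \<Longrightarrow> x b \<in> carrier F" "x \<in> vs F T \<Longrightarrow> b \<notin> T \<Longrightarrow> x b = \<zero>\<^bsub>F\<^esub>"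
  unfolding vs_def by blast+

lemma vsI: "(\<And>b. x b \<in> carrier F) \<Longrightarrow> (\<And>b. b \<notin> T \<Longrightarrow> x b = \<zero>\<^bsub>F\<^esub>) \<Longrightarrow> x \<in> vs F T"
  unfolding vs_def by blast

lemma vs_closed:
  assumes "field F"
  shows "x \<in> vs F T \<Longrightarrow> y \<in> vs F T \<Longrightarrow> (\<lambda>b. x b \<oplus>\<^bsub>F\<^esub> y b) \<in> vs F T"
    and "a \<in> carrier F \<Longrightarrow> x \<in> vs F T \<Longrightarrow> (\<lambda>b. a \<otimes>\<^bsub>F\<^esub> x b) \<in> vs F T"
    and "(\<lambda>b. \<zero>\<^bsub>F\<^esub>) \<in> vs F T"
proof -
  interpret field F by fact
  show "x \<in> vs F T \<Longrightarrow> y \<in> vs F T \<Longrightarrow> (\<lambda>b. x b \<oplus>\<^bsub>F\<^esub> y b) \<in> vs F T"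
    "a \<in> carrier F \<Longrightarrow> x \<in> vs F T \<Longrightarrow> (\<lambda>b. a \<otimes>\<^bsub>F\<^esub> x b) \<in> vs F T" "(\<lambda>b. \<zero>\<^bsub>F\<^esub>) \<in> vs F T"
    by (auto simp: vs_def)
qed

lemma fS_closed:
  assumes "field F" "x \<in> vs F (S \<inter> at_v n v)"
  shows "fS F S x \<in> vs F (S \<inter> at_v n ((v + 1) mod int n))"
proof -
  interpret field F by fact
  have "fS F S x b = \<zero>\<^bsub>F\<^esub>" if b: "b \<notin> S \<inter> at_v n ((v + 1) mod int n)" for b
  proof (cases "b \<in> S")
    case True
    obtain c k where ck: "b = vx c k" by (rule vx_cases)
    have "\<not> (k - 1) mod int n = v"
    proof
      assume "(k - 1) mod int n = v"
      then have "(v + 1) mod int n = k mod int n" by (metis diff_add_cancel mod_add_left_eq)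
      then show False using b True by (simp add: at_v_def ck)
    qed
    then show ?thesis using True vsD(2)[OF assms(2), of "pre b"] by (simp add: fS_def at_v_def ck)
  qed (simp add: fS_def)
  then show ?thesis using vsD(1)[OF assms(2)] by (auto simp: vs_def fS_def)
qed

subsection \<open>Isomorphisms\<close>

text \<open>The closure properties needed to invert an isomorphism; \<^const>\<open>rep_iso\<close> itself does not ask for them.\<close>

definition rep_ok :: "nat \<Rightarrow> ('f, 'm) ring_scheme \<Rightarrow> ('f, 'v) rep \<Rightarrow> bool" where
  "rep_ok n F M \<longleftrightarrow> (\<forall>i\<in>{0..<int n}.
     (\<forall>x\<in>carrier (fst M i). \<forall>y\<in>carrier (fst M i). x \<oplus>\<^bsub>fst M i\<^esub> y \<in> carrier (fst M i)) \<and>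
     (\<forall>a\<in>carrier F. \<forall>x\<in>carrier (fst M i). a \<odot>\<^bsub>fst M i\<^esub> x \<in> carrier (fst M i)) \<and>
     (\<forall>x\<in>carrier (fst M i). snd M i x \<in> carrier (fst M ((i + 1) mod int n))))"

lemma rep_ok_RS: "field F \<Longrightarrow> rep_ok n F (RS n F S)"
  by (auto simp: rep_ok_def RS_def vs_closed intro!: fS_closed)

definition iso_by :: "nat \<Rightarrow> ('f, 'm) ring_scheme \<Rightarrow> ('f, 'v) rep \<Rightarrow> ('f, 'w) rep \<Rightarrow> (int \<Rightarrow> 'v \<Rightarrow> 'w) \<Rightarrow> bool" where
  "iso_by n F M N h \<longleftrightarrow> (\<forall>i\<in>{0..<int n}.
       bij_betw (h i) (carrier (fst M i)) (carrier (fst N i)) \<and>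
       (\<forall>x\<in>carrier (fst M i). \<forall>y\<in>carrier (fst M i). h i (x \<oplus>\<^bsub>fst M i\<^esub> y) = h i x \<oplus>\<^bsub>fst N i\<^esub> h i y) \<and>
       (\<forall>a\<in>carrier F. \<forall>x\<in>carrier (fst M i). h i (a \<odot>\<^bsub>fst M i\<^esub> x) = a \<odot>\<^bsub>fst N i\<^esub> h i x) \<and>
       (\<forall>x\<in>carrier (fst M i). h ((i + 1) mod int n) (snd M i x) = snd N i (h i x)))"

lemma rep_iso_by: "rep_iso n F M N \<longleftrightarrow> (\<exists>h. iso_by n F M N h)"
  by (simp add: rep_iso_def iso_by_def split_def)

lemma iso_byD:
  assumes "iso_by n F M N h" "i \<in> {0..<int n}"
  shows "bij_betw (h i) (carrier (fst M i)) (carrier (fst N i))"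
    "\<And>x y. x \<in> carrier (fst M i) \<Longrightarrow> y \<in> carrier (fst M i) \<Longrightarrow> h i (x \<oplus>\<^bsub>fst M i\<^esub> y) = h i x \<oplus>\<^bsub>fst N i\<^esub> h i y"
    "\<And>a x. a \<in> carrier F \<Longrightarrow> x \<in> carrier (fst M i) \<Longrightarrow> h i (a \<odot>\<^bsub>fst M i\<^esub> x) = a \<odot>\<^bsub>fst N i\<^esub> h i x"
    "\<And>x. x \<in> carrier (fst M i) \<Longrightarrow> h ((i + 1) mod int n) (snd M i x) = snd N i (h i x)"
    "\<And>x. x \<in> carrier (fst M i) \<Longrightarrow> h i x \<in> carrier (fst N i)"
  using assms unfolding iso_by_def by (blast, blast, blast, blast, meson bij_betwE)

lemma rep_iso_trans: "rep_iso n F M N \<Longrightarrow> rep_iso n F N P \<Longrightarrow> rep_iso n F M P"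
proof -
  assume "rep_iso n F M N" "rep_iso n F N P"
  then obtain h g where h: "iso_by n F M N h" and g: "iso_by n F N P g" by (auto simp: rep_iso_by)
  have "iso_by n F M P (\<lambda>i x. g i (h i x))"
    unfolding iso_by_def
  proof (intro ballI conjI)
    fix i assume i: "i \<in> {0..<int n}"
    show "bij_betw (\<lambda>x. g i (h i x)) (carrier (fst M i)) (carrier (fst P i))"
      using bij_betw_trans[OF iso_byD(1)[OF h i] iso_byD(1)[OF g i]] by (simp add: comp_def)
  qed (simp_all add: iso_byD[OF h] iso_byD[OF g] del: atLeastLessThan_iff)
  then show ?thesis by (auto simp: rep_iso_by)
qed

lemma rep_iso_sym: "rep_ok n F M \<Longrightarrow> rep_iso n F M N \<Longrightarrow> rep_iso n F N M"
proof -
  assume ok: "rep_ok n F M" and "rep_iso n F M N"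
  then obtain h where h: "iso_by n F M N h" by (auto simp: rep_iso_by)
  define g where "g i = inv_into (carrier (fst M i)) (h i)" for i
  have gc: "g i y \<in> carrier (fst M i)" "h i (g i y) = y" if "i \<in> {0..<int n}" "y \<in> carrier (fst N i)" for i y
    using iso_byD(1)[OF h that(1)] that(2) unfolding g_def
    by (simp_all add: bij_betw_def inv_into_into f_inv_into_f)
  have gh: "g i (h i x) = x" if "i \<in> {0..<int n}" "x \<in> carrier (fst M i)" for i x
    using iso_byD(1)[OF h that(1)] that(2) unfolding g_def by (simp add: bij_betw_def)
  have "iso_by n F N M g"
    unfolding iso_by_def
  proof (intro ballI conjI)
    fix i assume i: "i \<in> {0..<int n}"
    have i': "(i + 1) mod int n \<in> {0..<int n}" using i by auto
    show "bij_betw (g i) (carrier (fst N i)) (carrier (fst M i))"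
      unfolding g_def by (rule bij_betw_inv_into[OF iso_byD(1)[OF h i]])
    fix x assume x: "x \<in> carrier (fst N i)"
    have o: "snd M i (g i x) \<in> carrier (fst M ((i + 1) mod int n))" using ok i gc[OF i x] unfolding rep_ok_def by blast
    have "h ((i + 1) mod int n) (snd M i (g i x)) = snd N i x" using iso_byD(4)[OF h i gc(1)[OF i x]] gc(2)[OF i x] by simp
    then show "g ((i + 1) mod int n) (snd N i x) = snd M i (g i x)" using gh[OF i' o] by simp
    fix y assume y: "y \<in> carrier (fst N i)"
    have o: "g i x \<oplus>\<^bsub>fst M i\<^esub> g i y \<in> carrier (fst M i)" using ok i gc[OF i x] gc[OF i y] unfolding rep_ok_def by blast
    have "h i (g i x \<oplus>\<^bsub>fst M i\<^esub> g i y) = x \<oplus>\<^bsub>fst N i\<^esub> y" using iso_byD(2)[OF h i gc(1)[OF i x] gc(1)[OF i y]] gc(2)[OF i x] gc(2)[OF i y] by simp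
    then show "g i (x \<oplus>\<^bsub>fst N i\<^esub> y) = g i x \<oplus>\<^bsub>fst M i\<^esub> g i y" using gh[OF i o] by simp
  next
    fix i a x assume i: "i \<in> {0..<int n}" and a: "a \<in> carrier F" and x: "x \<in> carrier (fst N i)"
    have o: "a \<odot>\<^bsub>fst M i\<^esub> g i x \<in> carrier (fst M i)" using ok i a gc[OF i x] unfolding rep_ok_def by blast
    have "h i (a \<odot>\<^bsub>fst M i\<^esub> g i x) = a \<odot>\<^bsub>fst N i\<^esub> x" using iso_byD(3)[OF h i a gc(1)[OF i x]] gc(2)[OF i x] by simp
    then show "g i (a \<odot>\<^bsub>fst N i\<^esub> x) = a \<odot>\<^bsub>fst M i\<^esub> g i x" using gh[OF i o] by simp
  qed
  then show ?thesis by (auto simp: rep_iso_by)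
qed

lemma rep_iso_id:
  assumes "\<And>i. i \<in> {0..<int n} \<Longrightarrow> carrier (fst M i) = carrier (fst N i)"
    "\<And>i x y. i \<in> {0..<int n} \<Longrightarrow> x \<oplus>\<^bsub>fst M i\<^esub> y = x \<oplus>\<^bsub>fst N i\<^esub> y"
    "\<And>i a x. i \<in> {0..<int n} \<Longrightarrow> a \<odot>\<^bsub>fst M i\<^esub> x = a \<odot>\<^bsub>fst N i\<^esub> x"
    "\<And>i x. i \<in> {0..<int n} \<Longrightarrow> x \<in> carrier (fst M i) \<Longrightarrow> snd M i x = snd N i x"
  shows "rep_iso n F M N" "rep_iso n F N M"
proof -
  have "iso_by n F M N (\<lambda>i x. x)" "iso_by n F N M (\<lambda>i x. x)"
    using assms by (auto simp: iso_by_def bij_betw_def)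
  then show "rep_iso n F M N" "rep_iso n F N M" by (auto simp: rep_iso_by)
qed

lemma rep_basis_SA: "rep_basis n A v = SA n A \<inter> at_v n v"
  by (auto simp: rep_basis_def SA_def iv_def KA_def at_v_def cpy_def pos_def)

lemma rep_of_fst: "fst (rep_of n F A) v = vm F (SA n A \<inter> at_v n v)"
  by (simp add: rep_of_def vm_def vs_def rep_basis_SA)

lemma rep_of_snd:
  assumes "x \<in> vs F (SA n A \<inter> at_v n v)"
  shows "snd (rep_of n F A) v x = fS F (SA n A) x"
proof
  fix b :: bas
  obtain i j c k where b: "b = (i, j, c, k)" by (cases b) auto
  have "x (pre b) = \<zero>\<^bsub>F\<^esub>" if "k < j" "b \<notin> SA n A"
  proof (rule vsD(2)[OF assms])
    show "pre b \<notin> SA n A \<inter> at_v n v" using that by (auto simp: SA_def iv_def KA_def b pre_def cpy_def pos_def)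
  qed
  moreover have "b \<in> SA n A \<Longrightarrow> k < j" by (auto simp: SA_def iv_def b cpy_def pos_def)
  ultimately show "snd (rep_of n F A) v x b = fS F (SA n A) x b"
    by (auto simp: rep_of_def fS_def b pre_def)
qed

text \<open>The two agree only up to isomorphism because \<^const>\<open>rep_of\<close> defines its arrows also outside the
  spaces they act on.\<close>

lemma rep_of_RS: "rep_iso n F (rep_of n F A) (RS n F (SA n A))" "rep_iso n F (RS n F (SA n A)) (rep_of n F A)"
  by (rule rep_iso_id; simp add: rep_of_fst RS_def rep_of_snd)+

text \<open>A relabelling of basis vectors that respects vertices and predecessors induces an isomorphism by
  pulling back coordinates.\<close>

lemma RS_iso:
  assumes F: "field F" and \<beta>: "bij_betw \<beta> S' S"
    and p: "\<And>b. b \<in> S' \<Longrightarrow> pos (\<beta> b) mod int n = pos b mod int n"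
    and q: "\<And>b. b \<in> S' \<Longrightarrow> pre b \<in> S' \<longleftrightarrow> pre (\<beta> b) \<in> S"
    and r: "\<And>b. b \<in> S' \<Longrightarrow> pre b \<in> S' \<Longrightarrow> \<beta> (pre b) = pre (\<beta> b)"
  shows "rep_iso n F (RS n F S) (RS n F S')"
proof -
  interpret field F by fact
  define h where "h v x b = (if b \<in> S' then x (\<beta> b) else \<zero>\<^bsub>F\<^esub>)" for v :: int and x b
  define g where "g y b = (if b \<in> S then y (inv_into S' \<beta> b) else \<zero>\<^bsub>F\<^esub>)" for y b
  have \<beta>S: "b \<in> S' \<Longrightarrow> \<beta> b \<in> S" for b using \<beta> by (auto simp: bij_betw_def)
  have i1: "b \<in> S \<Longrightarrow> inv_into S' \<beta> b \<in> S'" "b \<in> S \<Longrightarrow> \<beta> (inv_into S' \<beta> b) = b" for b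
    using \<beta> by (auto simp: bij_betw_def inv_into_into f_inv_into_f)
  have i2: "b \<in> S' \<Longrightarrow> inv_into S' \<beta> (\<beta> b) = b" for b using \<beta> by (auto simp: bij_betw_def)
  have "iso_by n F (RS n F S) (RS n F S') h"
    unfolding iso_by_def
  proof (intro ballI conjI)
    fix v assume "v \<in> {0..<int n}"
    have hc: "h v x \<in> vs F (S' \<inter> at_v n v)" if "x \<in> vs F (S \<inter> at_v n v)" for x
    proof (rule vsI)
      show "h v x b \<in> carrier F" for b using vsD(1)[OF that] by (simp add: h_def)
      show "h v x b = \<zero>\<^bsub>F\<^esub>" if "b \<notin> S' \<inter> at_v n v" for b
        using that p[of b] vsD(2)[OF \<open>x \<in> _\<close>, of "\<beta> b"] by (auto simp: h_def at_v_def)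
    qed
    have gc: "g y \<in> vs F (S \<inter> at_v n v)" if "y \<in> vs F (S' \<inter> at_v n v)" for y
    proof -
      have "g y b = \<zero>\<^bsub>F\<^esub>" if "b \<notin> S \<inter> at_v n v" for b
        using that vsD(2)[OF \<open>y \<in> _\<close>, of "inv_into S' \<beta> b"] i1[of b] p[of "inv_into S' \<beta> b"] by (auto simp: g_def at_v_def)
      moreover have "g y b \<in> carrier F" for b using vsD(1)[OF that] by (simp add: g_def)
      ultimately show ?thesis by (intro vsI)
    qed
    show "bij_betw (h v) (carrier (fst (RS n F S) v)) (carrier (fst (RS n F S') v))"
    proof (rule bij_betwI[of _ _ _ g])
      show "g (h v x) = x" if "x \<in> carrier (fst (RS n F S) v)" for x
        using that i1 by (auto simp: RS_def g_def h_def fun_eq_iff dest: vsD(2))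
      show "h v (g y) = y" if "y \<in> carrier (fst (RS n F S') v)" for y
        using that i2 \<beta>S by (auto simp: RS_def g_def h_def fun_eq_iff dest: vsD(2))
    qed (use hc gc in \<open>auto simp: RS_def\<close>)
    fix x assume "x \<in> carrier (fst (RS n F S) v)"
    then have x: "x \<in> vs F (S \<inter> at_v n v)" by (simp add: RS_def)
    have "h ((v + 1) mod int n) (fS F S x) b = fS F S' (h v x) b" for b
      using q[of b] r[of b] \<beta>S[of b] vsD(2)[OF x, of "pre (\<beta> b)"] by (auto simp: h_def fS_def)
    then show "h ((v + 1) mod int n) (snd (RS n F S) v x) = snd (RS n F S') v (h v x)"
      by (simp add: RS_def fun_eq_iff)
  qed (auto simp: RS_def h_def fun_eq_iff)
  then show ?thesis by (auto simp: rep_iso_by)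
qed

subsection \<open>Types of interval families\<close>

text \<open>The translate of the interval \<open>[x, y)\<close> by a multiple of \<open>n\<close> that starts between 1 and \<open>n\<close>.\<close>

definition nrm :: "nat \<Rightarrow> int \<Rightarrow> int \<Rightarrow> int \<times> int" where
  "nrm n x y = (let x' = 1 + (x - 1) mod int n in (x', y + (x' - x)))"

text \<open>The nonempty intervals of a given isomorphism type.\<close>

definition itype :: "nat \<Rightarrow> (int \<times> int \<times> nat) set \<Rightarrow> (int \<times> int \<times> nat \<Rightarrow> int) \<Rightarrow> (int \<times> int \<times> nat \<Rightarrow> int) \<Rightarrow> int \<times> int \<Rightarrow> (int \<times> int \<times> nat) set" where
  "itype n K s e d = {c \<in> K. s c < e c \<and> nrm n (s c) (e c) = d}"

lemma nrm_self: "1 \<le> x \<Longrightarrow> x \<le> int n \<Longrightarrow> nrm n x y = (x, y)"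
  by (simp add: nrm_def)

lemma nrmD:
  assumes "nrm n a b = (x, y)" shows "a mod int n = x mod int n" "b - a = y - x"
proof -
  have x: "x = 1 + (a - 1) mod int n" and y: "y = b + (x - a)" using assms by (auto simp: nrm_def Let_def)
  show "b - a = y - x" using y by simp
  show "a mod int n = x mod int n" unfolding x by (simp add: mod_add_right_eq)
qed

lemma nrm_range: "n \<ge> 1 \<Longrightarrow> nrm n a b = (x, y) \<Longrightarrow> 1 \<le> x \<and> x \<le> int n"
proof -
  assume n: "n \<ge> 1" and "nrm n a b = (x, y)"
  then have "x = 1 + (a - 1) mod int n" by (auto simp: nrm_def Let_def)
  moreover have "0 \<le> (a - 1) mod int n" "(a - 1) mod int n < int n" using n by auto
  ultimately show ?thesis by linarith
qed

text \<open>Copies of the same type are matched by arbitrary bijections; along a copy, positions are shifted.\<close>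

lemma type_iso:
  assumes F: "field F" and n: "n \<ge> 1" and K: "finite K"
    and A: "\<And>x y. 1 \<le> x \<Longrightarrow> x \<le> int n \<Longrightarrow> x < y \<Longrightarrow> A x y = card (itype n K s e (x, y))"
  shows "rep_iso n F (RS n F (iv K s e)) (RS n F (SA n A))"
proof -
  have "\<exists>h. bij_betw h {0..<A x y} (itype n K s e (x, y))" if "1 \<le> x" "x \<le> int n" "x < y" for x y
    unfolding A[OF that] by (rule ex_bij_betw_nat_finite) (use K in \<open>simp add: itype_def\<close>)
  then obtain h where h: "\<And>x y. 1 \<le> x \<Longrightarrow> x \<le> int n \<Longrightarrow> x < y \<Longrightarrow> bij_betw (h x y) {0..<A x y} (itype n K s e (x, y))"
    by metis
  define \<gamma> where "\<gamma> c = (case c of (x, y, m) \<Rightarrow> h x y m)" for c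
  have \<gamma>: "\<gamma> c \<in> itype n K s e (st c, en c)" if "c \<in> KA n A" for c
    using that h bij_betwE[OF h] by (auto simp: KA_def \<gamma>_def)
  have inj: "inj_on \<gamma> (KA n A)"
  proof (rule inj_onI)
    fix c c' assume c: "c \<in> KA n A" "c' \<in> KA n A" "\<gamma> c = \<gamma> c'"
    then have "(st c, en c) = (st c', en c')" using \<gamma>[OF c(1)] \<gamma>[OF c(2)] by (auto simp: itype_def)
    then show "c = c'" using c h[of "st c" "en c"] by (auto simp: KA_def \<gamma>_def bij_betw_def inj_on_def)
  qed
  have surj: "\<exists>c'\<in>KA n A. \<gamma> c' = c" if c: "c \<in> K" "s c < e c" for c
  proof -
    obtain x y where xy: "nrm n (s c) (e c) = (x, y)" by force
    then have "1 \<le> x" "x \<le> int n" "x < y" using nrm_range[OF n xy] nrmD[OF xy] c by auto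
    from h[OF this] have "c \<in> h x y ` {0..<A x y}" using c xy by (auto simp: bij_betw_def itype_def)
    then obtain m where "m < A x y" "h x y m = c" by auto
    then show ?thesis using \<open>1 \<le> x\<close> \<open>x \<le> int n\<close> \<open>x < y\<close> by (intro bexI[of _ "(x, y, m)"]) (auto simp: KA_def \<gamma>_def)
  qed
  have \<gamma>': "\<gamma> c \<in> K" "s (\<gamma> c) < e (\<gamma> c)" "s (\<gamma> c) mod int n = st c mod int n" "e (\<gamma> c) - s (\<gamma> c) = en c - st c" if "c \<in> KA n A" for c
    using \<gamma>[OF that] nrmD[of n "s (\<gamma> c)" "e (\<gamma> c)" "st c" "en c"] by (auto simp: itype_def)
  define \<beta> where "\<beta> b = vx (\<gamma> (cpy b)) (pos b - st (cpy b) + s (\<gamma> (cpy b)))" for b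
  have \<beta>vx: "\<beta> (vx c k) = vx (\<gamma> c) (k - st c + s (\<gamma> c))" for c k by (simp add: \<beta>_def)
  have SAat: "vx c k \<in> SA n A \<longleftrightarrow> c \<in> KA n A \<and> st c \<le> k \<and> k < en c" for c k by (simp add: SA_def)
  show ?thesis
  proof (rule RS_iso[OF F, of \<beta>])
    show "bij_betw \<beta> (SA n A) (iv K s e)"
      unfolding bij_betw_def
    proof
      show "inj_on \<beta> (SA n A)"
      proof (rule inj_onI)
        fix b b' assume b: "b \<in> SA n A" "b' \<in> SA n A" "\<beta> b = \<beta> b'"
        obtain c k where bc: "b = vx c k" by (rule vx_cases)
        obtain c' k' where bc': "b' = vx c' k'" by (rule vx_cases)
        have "c = c'" using b inj unfolding bc bc' \<beta>vx SAat by (auto simp: inj_on_def)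
        then show "b = b'" using b(3) unfolding bc bc' \<beta>vx by simp
      qed
      show "\<beta> ` SA n A = iv K s e"
      proof (intro equalityI subsetI)
        fix b assume "b \<in> \<beta> ` SA n A"
        then obtain c k where "vx c k \<in> SA n A" "b = \<beta> (vx c k)" by (metis vx_cases imageE)
        then show "b \<in> iv K s e" using \<gamma>'[of c] by (auto simp: SAat \<beta>vx)
      next
        fix b assume b: "b \<in> iv K s e"
        obtain c k where bc: "b = vx c k" by (rule vx_cases)
        then have c: "c \<in> K" "s c \<le> k" "k < e c" using b by auto
        then obtain c' where c': "c' \<in> KA n A" "\<gamma> c' = c" using surj[of c] by auto
        have "vx c' (k - s c + st c') \<in> SA n A" using c c' \<gamma>'[OF c'(1)] by (auto simp: SAat)
        moreover have "b = \<beta> (vx c' (k - s c + st c'))" using c' by (simp add: \<beta>vx bc)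
        ultimately show "b \<in> \<beta> ` SA n A" by blast
      qed
    qed
  next
    fix b assume b: "b \<in> SA n A"
    obtain c k where bc: "b = vx c k" by (rule vx_cases)
    have c: "c \<in> KA n A" "st c \<le> k" "k < en c" using b by (auto simp: SAat bc)
    show "pos (\<beta> b) mod int n = pos b mod int n"
      using \<gamma>'(3)[OF c(1)] unfolding bc \<beta>vx at_simps by (metis add.commute add_diff_eq diff_add_cancel mod_add_right_eq mod_diff_right_eq add_diff_cancel)
    show "pre b \<in> SA n A \<longleftrightarrow> pre (\<beta> b) \<in> iv K s e"
      using c \<gamma>'[OF c(1)] unfolding bc \<beta>vx at_simps SAat iv_at by auto
    show "\<beta> (pre b) = pre (\<beta> b)" unfolding bc \<beta>vx at_simps by simp
  qed
qed

subsection \<open>Ranks determine the type\<close>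

lemma card_vs:
  assumes F: "field F" "finite (carrier F)" and T: "finite T"
  shows "card (vs F T) = card (carrier F) ^ card T" "finite (vs F T)"
proof -
  interpret field F by fact
  have "bij_betw (\<lambda>x. restrict x T) (vs F T) (T \<rightarrow>\<^sub>E carrier F)"
  proof (rule bij_betwI[of _ _ _ "\<lambda>x b. if b \<in> T then x b else \<zero>\<^bsub>F\<^esub>"])
    show "(\<lambda>x b. if b \<in> T then x b else \<zero>\<^bsub>F\<^esub>) \<in> (T \<rightarrow>\<^sub>E carrier F) \<rightarrow> vs F T" by (auto simp: vs_def)
  qed (auto simp: vs_def fun_eq_iff PiE_def extensional_def)
  then show "card (vs F T) = card (carrier F) ^ card T" "finite (vs F T)"
    using F T by (auto simp: bij_betw_same_card card_PiE bij_betw_finite finite_PiE)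
qed

text \<open>The basis vectors that survive as images of \<open>l\<close> successive arrows starting at the vertex \<open>v\<close>; their number
  is the rank of that path.\<close>

definition Tset :: "nat \<Rightarrow> (int \<Rightarrow> int \<Rightarrow> nat) \<Rightarrow> int \<Rightarrow> nat \<Rightarrow> bas set" where
  "Tset n A v l = {b. cpy b \<in> KA n A \<and> st (cpy b) \<le> pos b - int l \<and> pos b < en (cpy b) \<and> (pos b - int l) mod int n = v}"

lemma Tset_at [simp]: "vx c k \<in> Tset n A v l \<longleftrightarrow> c \<in> KA n A \<and> st c \<le> k - int l \<and> k < en c \<and> (k - int l) mod int n = v"
  by (simp add: Tset_def)

lemma fS_pow:
  assumes x: "x \<in> vs F (SA n A \<inter> at_v n v)"
  shows "(fS F (SA n A) ^^ l) x (vx c k) = (if vx c k \<in> Tset n A v l then x (vx c (k - int l)) else \<zero>\<^bsub>F\<^esub>)"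
proof (induction l arbitrary: k)
  case 0
  have "vx c k \<in> Tset n A v 0 \<longleftrightarrow> vx c k \<in> SA n A \<inter> at_v n v" by (auto simp: SA_def at_v_def)
  then show ?case using vsD(2)[OF x, of "vx c k"] by auto
next
  case (Suc l)
  have "(fS F (SA n A) ^^ Suc l) x (vx c k) = (if vx c k \<in> SA n A then (fS F (SA n A) ^^ l) x (vx c (k - 1)) else \<zero>\<^bsub>F\<^esub>)"
    by (simp add: fS_def)
  also have "\<dots> = (if vx c k \<in> Tset n A v (Suc l) then x (vx c (k - int (Suc l))) else \<zero>\<^bsub>F\<^esub>)"
    unfolding Suc by (auto simp: SA_def algebra_simps)
  finally show ?case .
qed

lemma Tset_sub: "Tset n A v l \<subseteq> SA n A"
proof
  fix b assume "b \<in> Tset n A v l"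
  then show "b \<in> SA n A" by (cases b rule: vx_cases) (auto simp: SA_def)
qed

lemma finite_KA:
  assumes A: "A \<in> Theta_plus n" shows "finite (KA n A)"
proof -
  have f: "finite {j. A i j \<noteq> 0}" for i using A by (auto simp: Theta_plus_def per_mats_def)
  have "KA n A \<subseteq> (SIGMA i:{1..int n}. SIGMA j:{j. A i j \<noteq> 0}. {0..<A i j})"
    by (auto simp: KA_def)
  then show ?thesis by (rule finite_subset) (auto intro!: finite_SigmaI f[simplified])
qed

lemma finite_iv: "finite K \<Longrightarrow> finite (iv K s e)"
proof -
  assume K: "finite K"
  have "iv K s e \<subseteq> (\<Union>c\<in>K. vx c ` {s c..<e c})"
  proof
    fix b assume "b \<in> iv K s e"
    moreover obtain c k where "b = vx c k" by (rule vx_cases)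
    ultimately have "c \<in> K" "b \<in> vx c ` {s c..<e c}" by auto
    then show "b \<in> (\<Union>c\<in>K. vx c ` {s c..<e c})" by (rule UN_I)
  qed
  then show ?thesis by (rule finite_subset) (use K in auto)
qed

lemma fS_pow_image:
  assumes F: "field F"
  shows "(fS F (SA n A) ^^ l) ` vs F (SA n A \<inter> at_v n v) = vs F (Tset n A v l)"
proof (intro equalityI subsetI)
  interpret field F by fact
  fix y assume "y \<in> (fS F (SA n A) ^^ l) ` vs F (SA n A \<inter> at_v n v)"
  then obtain x where x: "x \<in> vs F (SA n A \<inter> at_v n v)" "y = (fS F (SA n A) ^^ l) x" by auto
  have "y b \<in> carrier F \<and> (b \<notin> Tset n A v l \<longrightarrow> y b = \<zero>\<^bsub>F\<^esub>)" for b
    by (cases b rule: vx_cases) (auto simp: x(2) fS_pow[OF x(1)] vsD(1)[OF x(1)] simp del: Tset_at)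
  then show "y \<in> vs F (Tset n A v l)" by (simp add: vs_def)
next
  interpret field F by fact
  fix y assume y: "y \<in> vs F (Tset n A v l)"
  define x where "x b = (if b \<in> SA n A \<inter> at_v n v then y (vx (cpy b) (pos b + int l)) else \<zero>\<^bsub>F\<^esub>)" for b
  have x: "x \<in> vs F (SA n A \<inter> at_v n v)" using vsD(1)[OF y] by (auto simp: vs_def x_def)
  have "(fS F (SA n A) ^^ l) x b = y b" for b
  proof (cases b rule: vx_cases)
    case (1 c k)
    have "vx c k \<in> Tset n A v l \<Longrightarrow> vx c (k - int l) \<in> SA n A \<inter> at_v n v" by (auto simp: SA_def at_v_def)
    then show ?thesis using vsD(2)[OF y, of b] unfolding 1 fS_pow[OF x] by (auto simp: x_def simp del: Tset_at)
  qed
  then have "y = (fS F (SA n A) ^^ l) x" by auto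
  then show "y \<in> (fS F (SA n A) ^^ l) ` vs F (SA n A \<inter> at_v n v)" using x by blast
qed

text \<open>An isomorphism identifies the images of a path, and over a finite field the number of basis vectors
  can be recovered from the number of vectors.\<close>

lemma rank_eq:
  assumes F: "field F" "finite (carrier F)" and A: "finite (KA n A)" "finite (KA n A')"
    and iso: "rep_iso n F (RS n F (SA n A)) (RS n F (SA n A'))" and v: "v \<in> {0..<int n}"
  shows "card (Tset n A v l) = card (Tset n A' v l)"
proof -
  interpret field F by fact
  obtain h where h: "iso_by n F (RS n F (SA n A)) (RS n F (SA n A')) h" using iso by (auto simp: rep_iso_by)
  let ?V = "\<lambda>v. vs F (SA n A \<inter> at_v n v)"
  have cl: "(fS F (SA n A) ^^ l) x \<in> ?V ((v + int l) mod int n)" if "x \<in> ?V v" for x l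
  proof (induction l)
    case 0 then show ?case using that v by simp
  next
    case (Suc l)
    have "((v + int l) mod int n + 1) mod int n = (v + int (Suc l)) mod int n" using mod_add_left_eq[of "v + int l" "int n" 1] by (simp add: add_ac)
    then show ?case using fS_closed[OF F(1) Suc] by simp
  qed
  have hp: "h ((v + int l) mod int n) ((fS F (SA n A) ^^ l) x) = (fS F (SA n A') ^^ l) (h v x)" if x: "x \<in> ?V v" for x
  proof (induction l)
    case 0 then show ?case using v by simp
  next
    case (Suc l)
    have e: "((v + int l) mod int n + 1) mod int n = (v + int (Suc l)) mod int n" using mod_add_left_eq[of "v + int l" "int n" 1] by (simp add: add_ac)
    have "(v + int l) mod int n \<in> {0..<int n}" using v by auto
    from iso_byD(4)[OF h this, of "(fS F (SA n A) ^^ l) x"] cl[OF x, of l]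
    show ?case by (simp add: RS_def e Suc)
  qed
  have bv: "bij_betw (h v) (?V v) (vs F (SA n A' \<inter> at_v n v))" using iso_byD(1)[OF h v] by (simp add: RS_def)
  have "(v + int l) mod int n \<in> {0..<int n}" using v by auto
  from iso_byD(1)[OF h this] have bl: "inj_on (h ((v + int l) mod int n)) (?V ((v + int l) mod int n))"
    by (simp add: RS_def bij_betw_def)
  have "vs F (Tset n A' v l) = (fS F (SA n A') ^^ l) ` h v ` ?V v"
    unfolding fS_pow_image[OF F(1), symmetric] using bv by (simp add: bij_betw_def)
  also have "\<dots> = h ((v + int l) mod int n) ` (fS F (SA n A) ^^ l) ` ?V v"
    by (force simp: image_iff hp)
  also have "card \<dots> = card (vs F (Tset n A v l))"
    unfolding fS_pow_image[OF F(1), symmetric]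
    by (rule card_image, rule inj_on_subset[OF bl]) (use cl in auto)
  finally have "card (vs F (Tset n A' v l)) = card (vs F (Tset n A v l))" .
  moreover have "finite (Tset n A v l)" "finite (Tset n A' v l)"
    using finite_subset[OF Tset_sub] finite_iv A by (auto simp: SA_def)
  moreover have "card (carrier F) > 1"
  proof -
    have "card {\<zero>\<^bsub>F\<^esub>, \<one>\<^bsub>F\<^esub>} \<le> card (carrier F)" using F(2) by (intro card_mono) auto
    then show ?thesis by simp
  qed
  ultimately show ?thesis by (simp add: card_vs[OF F])
qed

text \<open>The multiplicities are second differences of ranks: comparing the path of length \<open>l\<close> from \<open>x\<close> with the
  path of length \<open>l + 1\<close> from \<open>x - 1\<close> isolates the copies starting at \<open>x\<close> and longer than \<open>l\<close>.\<close>

lemma rep_of_type_unique: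
  assumes F: "field F" "finite (carrier F)" and n: "n \<ge> 1" and A: "finite (KA n A)" "finite (KA n A')"
    and iso: "rep_iso n F (RS n F (SA n A)) (RS n F (SA n A'))" and xy: "1 \<le> x" "x \<le> int n" "x < y"
  shows "A x y = A' x y"
proof -
  define L where "L A l = {c \<in> KA n A. st c = x \<and> x + int l < en c}" for A l
  have Lc: "card (L A l) + card (Tset n A ((x - 1) mod int n) (Suc l)) = card (Tset n A (x mod int n) l)"
    if A: "finite (KA n A)" for A l
  proof -
    have fin: "finite (Tset n A v l)" for v l using finite_subset[OF Tset_sub] finite_iv[OF A] by (auto simp: SA_def)
    let ?f = "\<lambda>c. vx c (x + int l)"
    have "?f ` L A l \<union> Tset n A ((x - 1) mod int n) (Suc l) = Tset n A (x mod int n) l"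
    proof (intro equalityI subsetI)
      fix b assume b: "b \<in> ?f ` L A l \<union> Tset n A ((x - 1) mod int n) (Suc l)"
      then show "b \<in> Tset n A (x mod int n) l"
      proof (cases b rule: vx_cases)
        case (1 c k)
        have "(k - int (Suc l)) mod int n = (x - 1) mod int n \<Longrightarrow> (k - int l) mod int n = x mod int n"
        proof -
          assume a: "(k - int (Suc l)) mod int n = (x - 1) mod int n"
          have "k - int l = (k - int (Suc l)) + 1" "x = (x - 1) + 1" by auto
          then show ?thesis using a by (metis mod_add_left_eq)
        qed
        then show ?thesis using b unfolding 1 by (auto simp: L_def)
      qed
    next
      fix b assume b: "b \<in> Tset n A (x mod int n) l"
      then show "b \<in> ?f ` L A l \<union> Tset n A ((x - 1) mod int n) (Suc l)"
      proof (cases b rule: vx_cases)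
        case (1 c k)
        have c: "c \<in> KA n A" "st c \<le> k - int l" "k < en c" "(k - int l) mod int n = x mod int n" using b 1 by auto
        show ?thesis
        proof (cases "st c = k - int l")
          case True
          have "1 \<le> st c" "st c \<le> int n" using c(1) by (auto simp: KA_def)
          then have "st c = x" using nrm_self[of "st c" n 0] nrm_self[of x n 0] xy c(4) True
            by (metis (no_types, lifting) Pair_inject mod_diff_left_eq nrm_def)
          then have "c \<in> L A l" "b = ?f c" using c True 1 by (auto simp: L_def)
          then show ?thesis by blast
        next
          case False
          have "(k - int (Suc l)) mod int n = (x - 1) mod int n"
            using c(4) by (metis (no_types, opaque_lifting) diff_diff_eq mod_diff_left_eq of_nat_Suc add.commute)
          then show ?thesis using c False by (auto simp: 1)
        qed
      qed
    qed
    moreover have "?f ` L A l \<inter> Tset n A ((x - 1) mod int n) (Suc l) = {}" by (auto simp: L_def)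
    moreover have "finite (L A l)" using A by (simp add: L_def)
    moreover have "card (?f ` L A l) = card (L A l)" by (rule card_image) (auto simp: inj_on_def)
    ultimately show ?thesis using card_Un_disjoint[of "?f ` L A l" "Tset n A ((x - 1) mod int n) (Suc l)"] fin by simp
  qed
  have LA: "card (L A (nat (y - x - 1))) = A x y + card (L A (nat (y - x)))" if A: "finite (KA n A)" for A
  proof -
    let ?g = "\<lambda>m. (x, y, m)"
    have "L A (nat (y - x - 1)) = ?g ` {0..<A x y} \<union> L A (nat (y - x))"
      using xy by (auto simp: L_def KA_def image_iff) (smt (verit))
    moreover have "?g ` {0..<A x y} \<inter> L A (nat (y - x)) = {}" using xy by (auto simp: L_def)
    moreover have "finite (L A (nat (y - x)))" using A by (simp add: L_def)
    moreover have "card (?g ` {0..<A x y}) = A x y" by (subst card_image) (auto simp: inj_on_def)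
    ultimately show ?thesis using card_Un_disjoint[of "?g ` {0..<A x y}" "L A (nat (y - x))"] by simp
  qed
  have v: "x mod int n \<in> {0..<int n}" "(x - 1) mod int n \<in> {0..<int n}" using n by auto
  have "card (L A l) = card (L A' l)" for l
    using Lc[OF A(1), of l] Lc[OF A(2), of l] rank_eq[OF F A iso v(1), of l] rank_eq[OF F A iso v(2), of "Suc l"] by linarith
  then show ?thesis using LA[OF A(1)] LA[OF A(2)] by simp
qed

lemma iso_type_iff:
  assumes F: "field F" "finite (carrier F)" and n: "n \<ge> 1" and K: "finite K" and A: "finite (KA n A)"
  shows "rep_iso n F (RS n F (iv K s e)) (rep_of n F A) \<longleftrightarrow>
    (\<forall>x y. 1 \<le> x \<longrightarrow> x \<le> int n \<longrightarrow> x < y \<longrightarrow> A x y = card (itype n K s e (x, y)))"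
proof
  assume "\<forall>x y. 1 \<le> x \<longrightarrow> x \<le> int n \<longrightarrow> x < y \<longrightarrow> A x y = card (itype n K s e (x, y))"
  then show "rep_iso n F (RS n F (iv K s e)) (rep_of n F A)"
    using type_iso[OF F(1) n K] rep_of_RS(2) by (blast intro: rep_iso_trans)
next
  assume iso: "rep_iso n F (RS n F (iv K s e)) (rep_of n F A)"
  define A' where "A' x y = card (itype n K s e (x, y))" for x y
  have "rep_iso n F (RS n F (iv K s e)) (RS n F (SA n A'))"
    by (rule type_iso[OF F(1) n K]) (simp add: A'_def)
  then have "rep_iso n F (RS n F (SA n A')) (RS n F (iv K s e))"
    by (rule rep_iso_sym[OF rep_ok_RS[OF F(1)]])
  then have i: "rep_iso n F (RS n F (SA n A')) (RS n F (SA n A))"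
    using iso rep_of_RS(1) by (blast intro: rep_iso_trans)
  have "finite (KA n A')"
  proof (rule finite_subset)
    show "KA n A' \<subseteq> (\<Union>c\<in>K. (\<lambda>m. (fst (nrm n (s c) (e c)), snd (nrm n (s c) (e c)), m)) ` {0..<card K})"
    proof
      fix d assume d: "d \<in> KA n A'"
      obtain x y m where xym: "d = (x, y, m)" by (cases d) auto
      have m: "m < card (itype n K s e (x, y))" using d by (simp add: KA_def xym A'_def)
      then have "itype n K s e (x, y) \<noteq> {}" by auto
      then obtain c where c: "c \<in> K" "nrm n (s c) (e c) = (x, y)" by (auto simp: itype_def)
      have "card (itype n K s e (x, y)) \<le> card K" using K by (intro card_mono) (auto simp: itype_def)
      then have "d \<in> (\<lambda>m. (fst (nrm n (s c) (e c)), snd (nrm n (s c) (e c)), m)) ` {0..<card K}"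
        using m c by (auto simp: xym)
      then show "d \<in> (\<Union>c\<in>K. (\<lambda>m. (fst (nrm n (s c) (e c)), snd (nrm n (s c) (e c)), m)) ` {0..<card K})"
        using c(1) by blast
    qed
  qed (use K in auto)
  from rep_of_type_unique[OF F n this A i]
  show "\<forall>x y. 1 \<le> x \<longrightarrow> x \<le> int n \<longrightarrow> x < y \<longrightarrow> A x y = card (itype n K s e (x, y))"
    by (simp add: A'_def)
qed

section \<open>Subrepresentations and the torus action\<close>

text \<open>The setting for counting subrepresentations of \<open>M(C)\<close>.\<close>

locale hallrep = F: field F for F :: "('f, 'm) ring_scheme" (structure) +
  fixes n :: nat and C :: "int \<Rightarrow> int \<Rightarrow> nat"
  assumes n1: "n \<ge> 1" and finF: "finite (carrier F)" and CT: "finite (KA n C)"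
begin

abbreviation "K \<equiv> KA n C"
abbreviation "S \<equiv> SA n C"
abbreviation "M \<equiv> rep_of n F C"
abbreviation "I \<equiv> {0..<int n}"
definition V :: "int \<Rightarrow> (bas \<Rightarrow> 'f) set" where "V v = vs F (S \<inter> at_v n v)"
abbreviation "f \<equiv> fS F S"

lemma F_field: "field F" by (rule F.field_axioms)

lemma M_carrier: "carrier (fst M v) = V v" by (simp add: rep_of_fst V_def)
lemma M_add: "x \<oplus>\<^bsub>fst M v\<^esub> y = (\<lambda>b. x b \<oplus> y b)" by (simp add: rep_of_fst)
lemma M_zero: "\<zero>\<^bsub>fst M v\<^esub> = (\<lambda>b. \<zero>)" by (simp add: rep_of_fst)
lemma M_sm: "a \<odot>\<^bsub>fst M v\<^esub> x = (\<lambda>b. a \<otimes> x b)" by (simp add: rep_of_fst)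
lemma M_f: "x \<in> V v \<Longrightarrow> snd M v x = f x" by (simp add: rep_of_snd V_def)

lemma I_next: "v \<in> I \<Longrightarrow> (v + 1) mod int n \<in> I" by auto
lemma V_f: "x \<in> V v \<Longrightarrow> f x \<in> V ((v + 1) mod int n)" unfolding V_def by (rule fS_closed[OF F_field])
lemma V_add: "x \<in> V v \<Longrightarrow> y \<in> V v \<Longrightarrow> (\<lambda>b. x b \<oplus> y b) \<in> V v" unfolding V_def by (rule vs_closed[OF F_field])
lemma V_sm: "a \<in> carrier F \<Longrightarrow> x \<in> V v \<Longrightarrow> (\<lambda>b. a \<otimes> x b) \<in> V v" unfolding V_def by (rule vs_closed[OF F_field])
lemma V_zero: "(\<lambda>b. \<zero>) \<in> V v" unfolding V_def by (rule vs_closed[OF F_field])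
lemma V_in: "x \<in> V v \<Longrightarrow> x b \<in> carrier F" unfolding V_def by (rule vsD(1))

lemma M_group: "abelian_group (fst M v)"
proof (rule abelian_groupI)
  fix x assume "x \<in> carrier (fst M v)"
  then show "\<exists>y\<in>carrier (fst M v). y \<oplus>\<^bsub>fst M v\<^esub> x = \<zero>\<^bsub>fst M v\<^esub>"
    using V_sm[of "\<ominus> \<one>" x v] V_in[of x v]
    by (intro bexI[of _ "\<lambda>b. \<ominus> \<one> \<otimes> x b"]) (auto simp: M_carrier M_add M_zero F.l_minus F.l_neg)
qed (auto simp: M_carrier M_add M_zero V_add V_zero V_in F.a_ac fun_eq_iff intro!: F.a_assoc F.a_comm; use V_in in \<open>simp add: F.a_ac\<close>)+

lemma M_ainv: assumes "x \<in> V v" shows "\<ominus>\<^bsub>fst M v\<^esub> x = (\<lambda>b. \<ominus> x b)"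
proof -
  interpret G: abelian_group "fst M v" by (rule M_group)
  have "(\<lambda>b. \<ominus> \<one> \<otimes> x b) \<in> V v" using assms by (intro V_sm) auto
  then have m: "(\<lambda>b. \<ominus> x b) \<in> V v" using V_in[OF assms] by (simp add: F.l_minus)
  show ?thesis
    by (rule G.minus_equality) (use assms m V_in[OF assms] in \<open>auto simp: M_carrier M_add M_zero F.l_neg\<close>)
qed

text \<open>\<^const>\<open>is_subrep\<close> in terms of coordinate functions.\<close>

definition sr :: "(int \<Rightarrow> (bas \<Rightarrow> 'f) set) \<Rightarrow> bool" where
  "sr N \<longleftrightarrow> N \<in> extensional I \<and> (\<forall>v\<in>I. N v \<subseteq> V v \<and> (\<lambda>b. \<zero>) \<in> N v \<and>
     (\<forall>x\<in>N v. \<forall>y\<in>N v. (\<lambda>b. x b \<oplus> y b) \<in> N v) \<and> (\<forall>a\<in>carrier F. \<forall>x\<in>N v. (\<lambda>b. a \<otimes> x b) \<in> N v) \<and>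
     (\<forall>x\<in>N v. f x \<in> N ((v + 1) mod int n)))"

lemma srD:
  assumes "sr N"
  shows "N \<in> extensional I" "v \<in> I \<Longrightarrow> x \<in> N v \<Longrightarrow> x \<in> V v" "v \<in> I \<Longrightarrow> (\<lambda>b. \<zero>) \<in> N v"
    "v \<in> I \<Longrightarrow> x \<in> N v \<Longrightarrow> y \<in> N v \<Longrightarrow> (\<lambda>b. x b \<oplus> y b) \<in> N v"
    "v \<in> I \<Longrightarrow> a \<in> carrier F \<Longrightarrow> x \<in> N v \<Longrightarrow> (\<lambda>b. a \<otimes> x b) \<in> N v"
    "v \<in> I \<Longrightarrow> x \<in> N v \<Longrightarrow> f x \<in> N ((v + 1) mod int n)"
  using assms unfolding sr_def by blast+

lemma sr_minus:
  assumes "sr N" "v \<in> I" "x \<in> N v" "y \<in> N v" shows "(\<lambda>b. x b \<ominus> y b) \<in> N v"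
proof -
  have "(\<lambda>b. \<ominus> \<one> \<otimes> y b) \<in> N v" using assms by (intro srD(5)) auto
  then have "(\<lambda>b. x b \<oplus> \<ominus> \<one> \<otimes> y b) \<in> N v" using srD(4)[OF assms(1,2,3)] by blast
  then show ?thesis using V_in[OF srD(2)[OF assms(1,2,4)]] by (simp add: a_minus_def F.l_minus)
qed

lemma submodule_sr:
  assumes "sr N" "v \<in> I" shows "subgroup (N v) (add_monoid (fst M v))"
proof (rule subgroup.intro)
  fix x assume x: "x \<in> N v"
  then have xV: "x \<in> V v" using srD(2)[OF assms] by blast
  have "(\<lambda>b. \<ominus> \<one> \<otimes> x b) \<in> N v" using assms x by (intro srD(5)) auto
  then have "\<ominus>\<^bsub>fst M v\<^esub> x \<in> N v" using M_ainv[OF xV] V_in[OF xV] by (simp add: F.l_minus)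
  then show "inv\<^bsub>add_monoid (fst M v)\<^esub> x \<in> N v" by (simp add: a_inv_def)
qed (use srD[OF assms(1)] assms(2) in \<open>auto simp: M_carrier M_add M_zero\<close>)

lemma is_subrep_iff: "is_subrep n F M N \<longleftrightarrow> sr N"
proof
  assume "is_subrep n F M N"
  then have e: "N \<in> extensional I" and s: "\<And>v. v \<in> I \<Longrightarrow> submodule (N v) F (fst M v)"
    and ff: "\<And>v. v \<in> I \<Longrightarrow> snd M v ` N v \<subseteq> N ((v + 1) mod int n)"
    by (auto simp: is_subrep_def split_def)
  show "sr N" unfolding sr_def
  proof (intro conjI ballI e)
    fix v assume v: "v \<in> I"
    interpret N: submodule "N v" F "fst M v" by (rule s[OF v])
    show sub: "N v \<subseteq> V v" using N.subset by (simp add: M_carrier)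
    show "(\<lambda>b. \<zero>) \<in> N v" using N.one_closed by (simp add: M_zero)
    show "(\<lambda>b. x b \<oplus> y b) \<in> N v" if "x \<in> N v" "y \<in> N v" for x y
      using N.m_closed[OF that] by (simp add: M_add)
    show "(\<lambda>b. a \<otimes> x b) \<in> N v" if "a \<in> carrier F" "x \<in> N v" for a x
      using N.smult_closed[OF that] by (simp add: M_sm)
    show "f x \<in> N ((v + 1) mod int n)" if "x \<in> N v" for x
    proof -
      have "snd M v x = f x" using M_f[of x v] that sub by blast
      then show ?thesis using ff[OF v] that by auto
    qed
  qed
next
  assume N: "sr N"
  have "submodule (N v) F (fst M v)" if v: "v \<in> I" for v
    using submodule_sr[OF N v] srD(5)[OF N v] by (auto simp: submodule_def submodule_axioms_def M_sm)
  moreover have "snd M v ` N v \<subseteq> N ((v + 1) mod int n)" if v: "v \<in> I" for v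
    using srD(6)[OF N v] M_f[OF srD(2)[OF N v]] by auto
  ultimately show "is_subrep n F M N" using srD(1)[OF N] by (auto simp: is_subrep_def split_def)
qed

lemma sr_finite: "finite {N. sr N}"
proof (rule finite_subset)
  show "{N. sr N} \<subseteq> (\<Pi>\<^sub>E v\<in>I. Pow (V v))"
    unfolding PiE_def using srD(1,2) by (auto intro!: Pi_I)
  have "finite S" by (simp add: SA_def finite_iv CT)
  then have "finite (V v)" for v unfolding V_def using card_vs(2)[OF F_field finF] by blast
  then show "finite (\<Pi>\<^sub>E v\<in>I. Pow (V v))" by (intro finite_PiE) auto
qed

text \<open>Cosets; they are handled below only through \<open>cs_eq\<close> and the rules for the operations.\<close>

definition cs :: "(int \<Rightarrow> (bas \<Rightarrow> 'f) set) \<Rightarrow> int \<Rightarrow> (bas \<Rightarrow> 'f) \<Rightarrow> (bas \<Rightarrow> 'f) set" where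
  "cs N v x = N v +>\<^bsub>fst M v\<^esub> x"

context
  fixes N assumes N: "sr N"
begin

lemma cs_eq:
  assumes v: "v \<in> I" and x: "x \<in> V v" and y: "y \<in> V v"
  shows "cs N v x = cs N v y \<longleftrightarrow> (\<lambda>b. x b \<ominus> y b) \<in> N v"
proof -
  interpret G: abelian_group "fst M v" by (rule M_group)
  interpret J: abelian_subgroup "N v" "fst M v"
    by (rule abelian_subgroupI3) (auto intro!: additive_subgroup.intro submodule_sr[OF N v] M_group)
  have "cs N v x = cs N v y \<longleftrightarrow> x \<ominus>\<^bsub>fst M v\<^esub> y \<in> N v"
  proof
    assume "cs N v x = cs N v y"
    moreover have "x \<in> cs N v x" unfolding cs_def using x by (intro J.a_rcos_self) (simp add: M_carrier)
    ultimately have "x \<in> N v +>\<^bsub>fst M v\<^esub> y" by (simp add: cs_def)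
    then show "x \<ominus>\<^bsub>fst M v\<^esub> y \<in> N v" using y J.a_rcos_module_imp[of y x] by (simp add: M_carrier a_minus_def)
  next
    assume "x \<ominus>\<^bsub>fst M v\<^esub> y \<in> N v"
    then have "x \<in> N v +>\<^bsub>fst M v\<^esub> y" using x y J.a_rcos_module_rev[of y x] by (simp add: M_carrier a_minus_def)
    then show "cs N v x = cs N v y" unfolding cs_def using x y
      by (intro G.a_repr_independence[symmetric] submodule_sr[OF N v]) (simp_all add: M_carrier)
  qed
  also have "x \<ominus>\<^bsub>fst M v\<^esub> y = (\<lambda>b. x b \<ominus> y b)" unfolding a_minus_def M_ainv[OF y] M_add ..
  finally show ?thesis .
qed

lemma cs_mem:
  assumes v: "v \<in> I" and x: "x \<in> V v" and y: "y \<in> cs N v x"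
  shows "y \<in> V v" "cs N v y = cs N v x"
proof -
  interpret G: abelian_group "fst M v" by (rule M_group)
  obtain k where k: "k \<in> N v" "y = (\<lambda>b. k b \<oplus> x b)" using y by (auto simp: cs_def a_r_coset_def' M_add)
  have kV: "k \<in> V v" using srD(2)[OF N v k(1)] .
  show yV: "y \<in> V v" unfolding k(2) by (rule V_add[OF kV x])
  have "(\<lambda>b. y b \<ominus> x b) = k" unfolding k(2) using V_in[OF kV] V_in[OF x] by (auto simp: a_minus_def F.a_assoc F.r_neg)
  then show "cs N v y = cs N v x" using k(1) by (simp add: cs_eq[OF v yV x])
qed

lemma cs_self: "v \<in> I \<Longrightarrow> x \<in> V v \<Longrightarrow> x \<in> cs N v x"
proof -
  assume v: "v \<in> I" and x: "x \<in> V v"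
  have "x = (\<lambda>b. \<zero>) \<oplus>\<^bsub>fst M v\<^esub> x" using V_in[OF x] by (simp add: M_add)
  then show ?thesis unfolding cs_def a_r_coset_def' using srD(3)[OF N v] by blast
qed

lemma cs_UN:
  assumes v: "v \<in> I" and x: "x \<in> V v" and g: "\<And>y. y \<in> cs N v x \<Longrightarrow> g y = g x"
  shows "(\<Union>y\<in>cs N v x. g y) = g x"
proof -
  have "(\<Union>y\<in>cs N v x. g y) = (\<Union>y\<in>cs N v x. g x)" by (rule SUP_cong[OF refl]) (rule g)
  then show ?thesis using cs_self[OF v x] by auto
qed

lemma quot_carrier: "carrier (fst (quot_rep n M N) v) = cs N v ` V v"
  by (auto simp: quot_rep_def split_def quot_alg_def A_RCOSETS_def' cs_def M_carrier)

lemma quot_add: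
  assumes v: "v \<in> I" and x: "x \<in> V v" and y: "y \<in> V v"
  shows "cs N v x \<oplus>\<^bsub>fst (quot_rep n M N) v\<^esub> cs N v y = cs N v (\<lambda>b. x b \<oplus> y b)"
proof -
  interpret J: abelian_subgroup "N v" "fst M v"
    by (rule abelian_subgroupI3) (auto intro!: additive_subgroup.intro submodule_sr[OF N v] M_group)
  show ?thesis using J.a_rcos_sum[of x y] x y by (simp add: quot_rep_def split_def quot_alg_def cs_def M_carrier M_add)
qed

lemma diff_lin: "x \<in> V v \<Longrightarrow> y \<in> V v \<Longrightarrow> a \<in> carrier F \<Longrightarrow> (\<lambda>b. a \<otimes> x b \<ominus> a \<otimes> y b) = (\<lambda>b. a \<otimes> (x b \<ominus> y b))"
  using V_in[of x v] V_in[of y v] by (auto simp: a_minus_def F.r_distr F.r_minus)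

lemma diff_f: "x \<in> V v \<Longrightarrow> y \<in> V v \<Longrightarrow> (\<lambda>b. f x b \<ominus> f y b) = f (\<lambda>b. x b \<ominus> y b)"
  by (auto simp: fS_def a_minus_def F.r_neg)

lemma quot_sm:
  assumes v: "v \<in> I" and x: "x \<in> V v" and a: "a \<in> carrier F"
  shows "a \<odot>\<^bsub>fst (quot_rep n M N) v\<^esub> cs N v x = cs N v (\<lambda>b. a \<otimes> x b)"
proof -
  have "a \<odot>\<^bsub>fst (quot_rep n M N) v\<^esub> cs N v x = (\<Union>y\<in>cs N v x. cs N v (\<lambda>b. a \<otimes> y b))"
    by (simp add: quot_rep_def split_def quot_alg_def M_sm cs_def)
  also have "\<dots> = cs N v (\<lambda>b. a \<otimes> x b)"
  proof (rule cs_UN[OF v x])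
    fix y assume y: "y \<in> cs N v x"
    note yV = cs_mem[OF v x y]
    have "(\<lambda>b. y b \<ominus> x b) \<in> N v" using yV(2) cs_eq[OF v yV(1) x] by simp
    then have "(\<lambda>b. a \<otimes> (y b \<ominus> x b)) \<in> N v" by (rule srD(5)[OF N v a])
    then show "cs N v (\<lambda>b. a \<otimes> y b) = cs N v (\<lambda>b. a \<otimes> x b)"
      using cs_eq[OF v V_sm[OF a yV(1)] V_sm[OF a x]] diff_lin[OF yV(1) x a] by simp
  qed
  finally show ?thesis .
qed

lemma quot_f:
  assumes v: "v \<in> I" and x: "x \<in> V v"
  shows "snd (quot_rep n M N) v (cs N v x) = cs N ((v + 1) mod int n) (f x)"
proof -
  let ?w = "(v + 1) mod int n"
  have w: "?w \<in> I" by (rule I_next[OF v])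
  have "snd (quot_rep n M N) v (cs N v x) = (\<Union>y\<in>cs N v x. cs N ?w (snd M v y))"
    by (simp add: quot_rep_def split_def Let_def cs_def)
  also have "\<dots> = cs N ?w (snd M v x)"
  proof (rule cs_UN[OF v x])
    fix y assume y: "y \<in> cs N v x"
    note yV = cs_mem[OF v x y]
    have "(\<lambda>b. y b \<ominus> x b) \<in> N v" using yV(2) cs_eq[OF v yV(1) x] by simp
    then have "f (\<lambda>b. y b \<ominus> x b) \<in> N ?w" by (rule srD(6)[OF N v])
    then show "cs N ?w (snd M v y) = cs N ?w (snd M v x)"
      using cs_eq[OF w V_f[OF yV(1)] V_f[OF x]] diff_f[OF yV(1) x] by (simp add: M_f[OF yV(1)] M_f[OF x])
  qed
  finally show ?thesis by (simp add: M_f[OF x])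
qed

lemma rep_ok_quot: "rep_ok n F (quot_rep n M N)"
  unfolding rep_ok_def quot_carrier
  by (auto simp: quot_add quot_sm quot_f V_add V_sm V_f simp del: atLeastLessThan_iff)

text \<open>The isomorphism theorem for quotient representations, with an isomorphism read off from
  representatives.\<close>

lemma quot_from_map:
  assumes onto: "\<And>v. v \<in> I \<Longrightarrow> carrier (fst P v) = \<psi> v ` V v"
    and add: "\<And>v x y. v \<in> I \<Longrightarrow> x \<in> V v \<Longrightarrow> y \<in> V v \<Longrightarrow> \<psi> v (\<lambda>b. x b \<oplus> y b) = \<psi> v x \<oplus>\<^bsub>fst P v\<^esub> \<psi> v y"
    and sm: "\<And>v a x. v \<in> I \<Longrightarrow> a \<in> carrier F \<Longrightarrow> x \<in> V v \<Longrightarrow> \<psi> v (\<lambda>b. a \<otimes> x b) = a \<odot>\<^bsub>fst P v\<^esub> \<psi> v x"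
    and cm: "\<And>v x. v \<in> I \<Longrightarrow> x \<in> V v \<Longrightarrow> \<psi> ((v + 1) mod int n) (f x) = snd P v (\<psi> v x)"
    and ker: "\<And>v x y. v \<in> I \<Longrightarrow> x \<in> V v \<Longrightarrow> y \<in> V v \<Longrightarrow> \<psi> v x = \<psi> v y \<longleftrightarrow> (\<lambda>b. x b \<ominus> y b) \<in> N v"
  shows "rep_iso n F (quot_rep n M N) P"
proof -
  define h where "h v X = \<psi> v (SOME x. x \<in> X)" for v and X :: "(bas \<Rightarrow> 'f) set"
  have h: "h v (cs N v x) = \<psi> v x" if v: "v \<in> I" and x: "x \<in> V v" for v x
  proof -
    have "(SOME y. y \<in> cs N v x) \<in> cs N v x" by (rule someI[of "\<lambda>y. y \<in> cs N v x", OF cs_self[OF v x]])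
    note m = cs_mem[OF v x this]
    then show ?thesis unfolding h_def using ker[OF v m(1) x] cs_eq[OF v m(1) x] by simp
  qed
  have "iso_by n F (quot_rep n M N) P h"
    unfolding iso_by_def
  proof (intro ballI conjI)
    fix v assume v: "v \<in> I"
    show "bij_betw (h v) (carrier (fst (quot_rep n M N) v)) (carrier (fst P v))"
      unfolding quot_carrier onto[OF v]
      by (auto simp: bij_betw_def inj_on_def h[OF v] image_image ker[OF v] cs_eq[OF v] cong: image_cong)
  next
    fix v X Y assume v: "v \<in> I" and "X \<in> carrier (fst (quot_rep n M N) v)" "Y \<in> carrier (fst (quot_rep n M N) v)"
    then obtain x y where "x \<in> V v" "X = cs N v x" "y \<in> V v" "Y = cs N v y" by (auto simp: quot_carrier)
    then show "h v (X \<oplus>\<^bsub>fst (quot_rep n M N) v\<^esub> Y) = h v X \<oplus>\<^bsub>fst P v\<^esub> h v Y"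
      by (simp add: quot_add[OF v] h[OF v] V_add add[OF v])
  next
    fix v a X assume v: "v \<in> I" and a: "a \<in> carrier F" and "X \<in> carrier (fst (quot_rep n M N) v)"
    then obtain x where "x \<in> V v" "X = cs N v x" by (auto simp: quot_carrier)
    then show "h v (a \<odot>\<^bsub>fst (quot_rep n M N) v\<^esub> X) = a \<odot>\<^bsub>fst P v\<^esub> h v X"
      by (simp add: quot_sm[OF v _ a] h[OF v] V_sm[OF a] sm[OF v a])
  next
    fix v X assume v: "v \<in> I" and "X \<in> carrier (fst (quot_rep n M N) v)"
    then obtain x where x: "x \<in> V v" "X = cs N v x" by (auto simp: quot_carrier)
    show "h ((v + 1) mod int n) (snd (quot_rep n M N) v X) = snd P v (h v X)"
      unfolding x(2) quot_f[OF v x(1)] h[OF v x(1)] h[OF I_next[OF v] V_f[OF x(1)]] by (rule cm[OF v x(1)])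
  qed
  then show ?thesis by (auto simp: rep_iso_by)
qed

end

subsection \<open>Scaling one copy\<close>

text \<open>The torus acts by automorphisms of \<open>M(C)\<close>: \<open>sc c t\<close> scales the copy \<open>c\<close> by \<open>t\<close>, and \<open>gN\<close> is the induced action on
  subrepresentations.\<close>

definition sc :: "int \<times> int \<times> nat \<Rightarrow> 'f \<Rightarrow> (bas \<Rightarrow> 'f) \<Rightarrow> bas \<Rightarrow> 'f" where
  "sc c t x b = (if cpy b = c then t \<otimes> x b else x b)"

definition pj :: "int \<times> int \<times> nat \<Rightarrow> (bas \<Rightarrow> 'f) \<Rightarrow> bas \<Rightarrow> 'f" where
  "pj c x b = (if cpy b = c then x b else \<zero>)"

definition gN :: "int \<times> int \<times> nat \<Rightarrow> 'f \<Rightarrow> (int \<Rightarrow> (bas \<Rightarrow> 'f) set) \<Rightarrow> int \<Rightarrow> (bas \<Rightarrow> 'f) set" where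
  "gN c t N = (\<lambda>v\<in>I. sc c t ` N v)"

abbreviation "Fx \<equiv> carrier F - {\<zero>}"

lemma cpy_pre [simp]: "cpy (pre b) = cpy b"
  by (cases b rule: vx_cases) simp

lemma sc_V: "t \<in> carrier F \<Longrightarrow> x \<in> V v \<Longrightarrow> sc c t x \<in> V v"
  unfolding V_def by (rule vsI) (auto simp: sc_def vsD)

lemma sc_add: "t \<in> carrier F \<Longrightarrow> x \<in> V v \<Longrightarrow> y \<in> V v \<Longrightarrow> sc c t (\<lambda>b. x b \<oplus> y b) = (\<lambda>b. sc c t x b \<oplus> sc c t y b)"
  using V_in[of x v] V_in[of y v] by (auto simp: sc_def F.r_distr)

lemma sc_diff: "t \<in> carrier F \<Longrightarrow> x \<in> V v \<Longrightarrow> y \<in> V v \<Longrightarrow> sc c t (\<lambda>b. x b \<ominus> y b) = (\<lambda>b. sc c t x b \<ominus> sc c t y b)"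
  using V_in[of x v] V_in[of y v] by (auto simp: sc_def F.r_distr a_minus_def F.r_minus)

lemma sc_sm: "t \<in> carrier F \<Longrightarrow> a \<in> carrier F \<Longrightarrow> x \<in> V v \<Longrightarrow> sc c t (\<lambda>b. a \<otimes> x b) = (\<lambda>b. a \<otimes> sc c t x b)"
  using V_in[of x v] by (auto simp: sc_def F.m_lcomm)

lemma sc_f: "t \<in> carrier F \<Longrightarrow> sc c t (f x) = f (sc c t x)"
  by (auto simp: sc_def fS_def)

lemma sc_sc: "t \<in> carrier F \<Longrightarrow> s \<in> carrier F \<Longrightarrow> x \<in> V v \<Longrightarrow> sc c t (sc c s x) = sc c (t \<otimes> s) x"
  using V_in[of x v] by (auto simp: sc_def F.m_assoc)

lemma sc_one: "x \<in> V v \<Longrightarrow> sc c \<one> x = x"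
  using V_in[of x v] by (auto simp: sc_def)

lemma sc_zero: "t \<in> carrier F \<Longrightarrow> sc c t (\<lambda>b. \<zero>) = (\<lambda>b. \<zero>)" by (auto simp: sc_def)

lemma pj_sc: "t \<in> carrier F \<Longrightarrow> pj c' (sc c t x) = sc c t (pj c' x)"
  by (auto simp: pj_def sc_def)

lemma Fx_inv: "t \<in> Fx \<Longrightarrow> inv t \<in> Fx \<and> inv t \<otimes> t = \<one> \<and> t \<otimes> inv t = \<one>"
  using F.field_Units F.Units_inv_Units F.Units_l_inv F.Units_r_inv by auto

lemma Fx_mult: "s \<in> Fx \<Longrightarrow> t \<in> Fx \<Longrightarrow> s \<otimes> t \<in> Fx"
  using F.integral[of s t] by auto

lemma gN_gN: "sr N \<Longrightarrow> t \<in> Fx \<Longrightarrow> s \<in> Fx \<Longrightarrow> gN c t (gN c s N) = gN c (t \<otimes> s) N"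
  unfolding gN_def by (rule restrict_ext) (auto simp: image_image sc_sc[OF _ _ srD(2)] cong: image_cong simp del: atLeastLessThan_iff)

lemma gN_one: "sr N \<Longrightarrow> gN c \<one> N = N"
proof (rule extensionalityI[of _ I])
  assume N: "sr N"
  show "N \<in> extensional I" using srD(1)[OF N] .
  fix v assume v: "v \<in> I"
  then show "gN c \<one> N v = N v" using sc_one[OF srD(2)[OF N v]] by (auto simp: gN_def image_iff)
qed (simp add: gN_def)

lemma gN_sr: assumes N: "sr N" and t: "t \<in> Fx" shows "sr (gN c t N)"
  unfolding sr_def
proof (intro conjI ballI)
  show "gN c t N \<in> extensional I" by (simp add: gN_def)
  fix v assume v: "v \<in> I"
  have e: "gN c t N v = sc c t ` N v" "gN c t N ((v + 1) mod int n) = sc c t ` N ((v + 1) mod int n)"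
    using v I_next[OF v] by (auto simp: gN_def)
  note s = srD[OF N]
  have tc: "t \<in> carrier F" using t by simp
  show "gN c t N v \<subseteq> V v" using s(2)[OF v] sc_V[OF tc] unfolding e by blast
  show "(\<lambda>b. \<zero>) \<in> gN c t N v" unfolding e by (rule image_eqI[OF _ s(3)[OF v]]) (simp add: sc_zero[OF tc])
  show "(\<lambda>b. x b \<oplus> y b) \<in> gN c t N v" if xy: "x \<in> gN c t N v" "y \<in> gN c t N v" for x y
  proof -
    obtain x' y' where o: "x' \<in> N v" "y' \<in> N v" "x = sc c t x'" "y = sc c t y'" using xy unfolding e by blast
    show ?thesis unfolding e
      by (rule image_eqI[OF _ s(4)[OF v o(1,2)]]) (simp add: o(3,4) sc_add[OF tc s(2)[OF v o(1)] s(2)[OF v o(2)]])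
  qed
  show "(\<lambda>b. a \<otimes> x b) \<in> gN c t N v" if ax: "a \<in> carrier F" "x \<in> gN c t N v" for a x
  proof -
    obtain x' where o: "x' \<in> N v" "x = sc c t x'" using ax unfolding e by blast
    show ?thesis unfolding e
      by (rule image_eqI[OF _ s(5)[OF v ax(1) o(1)]]) (simp add: o(2) sc_sm[OF tc ax(1) s(2)[OF v o(1)]])
  qed
  show "f x \<in> gN c t N ((v + 1) mod int n)" if x: "x \<in> gN c t N v" for x
  proof -
    obtain x' where o: "x' \<in> N v" "x = sc c t x'" using x unfolding e by blast
    show ?thesis unfolding e
      by (rule image_eqI[OF _ s(6)[OF v o(1)]]) (simp add: o(2) sc_f[OF tc])
  qed
qed

lemma sub_sel [simp]: "carrier (fst (sub_rep M N) v) = N v" "add (fst (sub_rep M N) v) = add (fst M v)"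
  "smult (fst (sub_rep M N) v) = smult (fst M v)" "snd (sub_rep M N) = snd M"
  by (simp_all add: sub_rep_def split_def)

lemma gN_sub_iso:
  assumes N: "sr N" and t: "t \<in> Fx" shows "rep_iso n F (sub_rep M (gN c t N)) (sub_rep M N)"
proof -
  define u where "u = inv t"
  have u: "u \<in> carrier F" "u \<otimes> t = \<one>" "t \<otimes> u = \<one>" "t \<in> carrier F" using Fx_inv[OF t] t by (auto simp: u_def)
  have us: "sc c u (sc c t x) = x" if "v \<in> I" "x \<in> N v" for v x
    using sc_sc[OF u(1,4) srD(2)[OF N that]] sc_one[OF srD(2)[OF N that]] u by simp
  have "iso_by n F (sub_rep M (gN c t N)) (sub_rep M N) (\<lambda>v. sc c u)"
    unfolding iso_by_def
  proof (intro ballI conjI)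
    fix v assume v: "v \<in> I"
    have e: "gN c t N v = sc c t ` N v" using v by (simp add: gN_def)
    have gV: "x \<in> V v" if "x \<in> gN c t N v" for x using srD(2)[OF gN_sr[OF N t] v that] .
    show "bij_betw (sc c u) (carrier (fst (sub_rep M (gN c t N)) v)) (carrier (fst (sub_rep M N) v))"
      unfolding sub_sel e by (rule bij_betwI[of _ _ _ "sc c t"]) (auto simp: us[OF v])
    show "sc c u (x \<oplus>\<^bsub>fst (sub_rep M (gN c t N)) v\<^esub> y) = sc c u x \<oplus>\<^bsub>fst (sub_rep M N) v\<^esub> sc c u y"
      if "x \<in> carrier (fst (sub_rep M (gN c t N)) v)" "y \<in> carrier (fst (sub_rep M (gN c t N)) v)" for x y
      using sc_add[OF u(1) gV gV, of x y] that by (simp add: M_add)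
    show "sc c u (a \<odot>\<^bsub>fst (sub_rep M (gN c t N)) v\<^esub> x) = a \<odot>\<^bsub>fst (sub_rep M N) v\<^esub> sc c u x"
      if "a \<in> carrier F" "x \<in> carrier (fst (sub_rep M (gN c t N)) v)" for a x
      using sc_sm[OF u(1) _ gV, of a x] that by (simp add: M_sm)
    show "sc c u (snd (sub_rep M (gN c t N)) v x) = snd (sub_rep M N) v (sc c u x)"
      if "x \<in> carrier (fst (sub_rep M (gN c t N)) v)" for x
      using that M_f[OF gV, of x] M_f[OF sc_V[OF u(1) gV], of x] by (simp add: sc_f[OF u(1)])
  qed
  then show ?thesis by (auto simp: rep_iso_by)
qed

lemma gN_quot_iso:
  assumes N: "sr N" and t: "t \<in> Fx" shows "rep_iso n F (quot_rep n M (gN c t N)) (quot_rep n M N)"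
proof -
  define u where "u = inv t"
  have u: "u \<in> carrier F" "u \<otimes> t = \<one>" "t \<otimes> u = \<one>" "t \<in> carrier F" using Fx_inv[OF t] t by (auto simp: u_def)
  have us: "sc c u (sc c t x) = x" "sc c t (sc c u x) = x" if "x \<in> V v" for v x
    using sc_sc[OF u(1,4) that] sc_sc[OF u(4,1) that] sc_one[OF that] u by simp_all
  show ?thesis
  proof (rule quot_from_map[OF gN_sr[OF N t], of _ "\<lambda>v x. cs N v (sc c u x)"])
    fix v assume v: "v \<in> I"
    have "sc c u ` V v = V v" using sc_V[OF u(1)] sc_V[OF u(4)] us by (metis (no_types, lifting) image_eqI subsetI subset_antisym image_subsetI)
    then have "cs N v ` V v = cs N v ` sc c u ` V v" by simp
    then show "carrier (fst (quot_rep n M N) v) = (\<lambda>x. cs N v (sc c u x)) ` V v"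
      by (simp add: quot_carrier[OF N] image_image)
    fix x assume x: "x \<in> V v"
    show "cs N ((v + 1) mod int n) (sc c u (f x)) = snd (quot_rep n M N) v (cs N v (sc c u x))"
      by (simp add: quot_f[OF N v sc_V[OF u(1) x]] sc_f[OF u(1)])
    fix y assume y: "y \<in> V v"
    show "cs N v (sc c u (\<lambda>b. x b \<oplus> y b)) = cs N v (sc c u x) \<oplus>\<^bsub>fst (quot_rep n M N) v\<^esub> cs N v (sc c u y)"
      by (simp add: sc_add[OF u(1) x y] quot_add[OF N v sc_V[OF u(1) x] sc_V[OF u(1) y]])
    have d: "(\<lambda>b. x b \<ominus> y b) \<in> V v" using x y V_add[OF x V_sm[OF _ y, of "\<ominus> \<one>"]] V_in[OF y] by (simp add: a_minus_def F.l_minus)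
    have "cs N v (sc c u x) = cs N v (sc c u y) \<longleftrightarrow> sc c u (\<lambda>b. x b \<ominus> y b) \<in> N v"
      unfolding cs_eq[OF N v sc_V[OF u(1) x] sc_V[OF u(1) y]] sc_diff[OF u(1) x y] ..
    also have "\<dots> \<longleftrightarrow> (\<lambda>b. x b \<ominus> y b) \<in> sc c t ` N v"
      using us[OF d] us(1)[OF srD(2)[OF N v]] by (metis (no_types, lifting) imageE imageI)
    finally show "cs N v (sc c u x) = cs N v (sc c u y) \<longleftrightarrow> (\<lambda>b. x b \<ominus> y b) \<in> gN c t N v"
      using v by (simp add: gN_def)
  next
    fix v a x assume v: "v \<in> I" and a: "a \<in> carrier F" and x: "x \<in> V v"
    show "cs N v (sc c u (\<lambda>b. a \<otimes> x b)) = a \<odot>\<^bsub>fst (quot_rep n M N) v\<^esub> cs N v (sc c u x)"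
      by (simp add: sc_sm[OF u(1) a x] quot_sm[OF N v sc_V[OF u(1) x] a])
  qed
qed

subsection \<open>Orbit counting\<close>

text \<open>Stability under the projection to the copy \<open>c\<close>, which turns out to be invariance under scaling of \<open>c\<close>.\<close>

definition PF :: "int \<times> int \<times> nat \<Rightarrow> (int \<Rightarrow> (bas \<Rightarrow> 'f) set) \<Rightarrow> bool" where
  "PF c N \<longleftrightarrow> (\<forall>v\<in>I. \<forall>x\<in>N v. pj c x \<in> N v)"

lemma PF_gN: "sr N \<Longrightarrow> t \<in> Fx \<Longrightarrow> PF c' N \<Longrightarrow> PF c' (gN c t N)"
  unfolding PF_def gN_def by (auto simp: pj_sc simp del: atLeastLessThan_iff)

lemma PF_gN_iff: assumes N: "sr N" and t: "t \<in> Fx" shows "PF c' (gN c t N) \<longleftrightarrow> PF c' N"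
proof
  assume p: "PF c' (gN c t N)"
  have "PF c' (gN c (inv t) (gN c t N))" using PF_gN[OF gN_sr[OF N t] _ p, of "inv t" c] Fx_inv[OF t] by blast
  also have "gN c (inv t) (gN c t N) = N" using gN_gN[OF N _ t, of "inv t" c] Fx_inv[OF t] gN_one[OF N, of c] by simp
  finally show "PF c' N" .
qed (rule PF_gN[OF N t])

text \<open>If \<open>N\<close> is fixed by one \<open>t \<noteq> 1\<close>, then it contains \<open>t x - x\<close>, taken on the copy \<open>c\<close>, that is \<open>t - 1\<close> times the
  projection of \<open>x\<close>.\<close>

lemma stab_PF:
  assumes N: "sr N" and t: "t \<in> Fx" "t \<noteq> \<one>" and fixd: "gN c t N = N"
  shows "PF c N"
  unfolding PF_def
proof (intro ballI)
  fix v x assume v: "v \<in> I" and x: "x \<in> N v"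
  have xV: "x \<in> V v" using srD(2)[OF N v x] .
  have "sc c t x \<in> gN c t N v" using v x by (simp add: gN_def)
  then have "sc c t x \<in> N v" using fixd by simp
  then have d: "(\<lambda>b. sc c t x b \<ominus> x b) \<in> N v" by (rule sr_minus[OF N v _ x])
  let ?r = "t \<ominus> \<one>"
  have r: "?r \<in> Fx" using t F.r_right_minus_eq[of t \<one>] by auto
  have "(\<lambda>b. inv ?r \<otimes> (sc c t x b \<ominus> x b)) \<in> N v" using Fx_inv[OF r] by (intro srD(5)[OF N v _ d]) auto
  moreover have "inv ?r \<otimes> (sc c t x b \<ominus> x b) = pj c x b" for b
  proof (cases "cpy b = c")
    case True
    have xb: "x b \<in> carrier F" using V_in[OF xV] .
    have "t \<otimes> x b \<ominus> x b = ?r \<otimes> x b" using t xb by (simp add: a_minus_def F.l_distr F.l_minus)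
    then show ?thesis using True Fx_inv[OF r] xb r by (simp add: sc_def pj_def F.m_assoc[symmetric])
  next
    case False
    then show ?thesis using V_in[OF xV] Fx_inv[OF r] by (simp add: sc_def pj_def F.r_neg a_minus_def)
  qed
  ultimately show "pj c x \<in> N v" by (simp add: fun_eq_iff[symmetric])
qed

text \<open>By \<open>stab_PF\<close> the group of nonzero scalars acts freely on the subrepresentations that are not stable
  under the projection.\<close>

lemma orbit_step:
  assumes Y: "\<And>N. N \<in> Y \<Longrightarrow> sr N" and cl: "\<And>N t. N \<in> Y \<Longrightarrow> t \<in> Fx \<Longrightarrow> gN c t N \<in> Y"
  shows "(card (carrier F) - 1) dvd (card Y - card {N \<in> Y. PF c N})" "card {N \<in> Y. PF c N} \<le> card Y"
proof -
  have finY: "finite Y" by (rule finite_subset[OF _ sr_finite]) (use Y in auto)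
  then show "card {N \<in> Y. PF c N} \<le> card Y" by (intro card_mono) auto
  let ?Z = "Y - {N \<in> Y. PF c N}"
  (* Orbits of the nonzero scalars: the part of Y outside PF is partitioned into orbits of full size. *)
  define Orb where "Orb N = (\<lambda>t. gN c t N) ` Fx" for N
  have one: "\<one> \<in> Fx" by simp
  have OZ: "Orb N \<subseteq> ?Z" if "N \<in> ?Z" for N
  proof
    fix X assume "X \<in> Orb N"
    then obtain t where t: "t \<in> Fx" "X = gN c t N" unfolding Orb_def by blast
    have NY: "N \<in> Y" "\<not> PF c N" using that by blast+
    show "X \<in> ?Z" unfolding t(2) using cl[OF NY(1) t(1)] PF_gN_iff[OF Y[OF NY(1)] t(1), of c c] NY(2) by blast
  qed
  have self: "N \<in> Orb N" if "N \<in> ?Z" for N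
    using that gN_one[OF Y, of N c] one unfolding Orb_def by (metis (no_types, lifting) Diff_iff image_eqI)
  have card_O: "card (Orb N) = card (carrier F) - 1" if N: "N \<in> ?Z" for N
  proof -
    have sN: "sr N" and nPF: "\<not> PF c N" using N Y by auto
    have "inj_on (\<lambda>t. gN c t N) Fx"
    proof (rule inj_onI)
      fix s t assume s: "s \<in> Fx" and t: "t \<in> Fx" and e: "gN c s N = gN c t N"
      note it = Fx_inv[OF t]
      have "gN c (inv t) (gN c s N) = gN c (inv t) (gN c t N)" using e by simp
      then have "gN c (inv t \<otimes> s) N = N" using gN_gN[OF sN] it s t gN_one[OF sN] by auto
      then have "inv t \<otimes> s = \<one>" using stab_PF[OF sN Fx_mult, of "inv t" s c] it s nPF by auto
      then have "t \<otimes> (inv t \<otimes> s) = t" using t by simp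
      then show "s = t" using it s t by (simp add: F.m_assoc[symmetric])
    qed
    then have "card (Orb N) = card Fx" unfolding Orb_def by (rule card_image)
    then show ?thesis using finF by simp
  qed
  have dj: "Orb N \<inter> Orb N' = {}" if N: "N \<in> ?Z" "N' \<in> ?Z" "Orb N \<noteq> Orb N'" for N N'
  proof (rule ccontr)
    assume "Orb N \<inter> Orb N' \<noteq> {}"
    then obtain s t where s: "s \<in> Fx" and t: "t \<in> Fx" and e: "gN c s N = gN c t N'" unfolding Orb_def by auto
    have sub: "Orb N1 \<subseteq> Orb N2" if "N1 \<in> ?Z" "N2 \<in> ?Z" "s \<in> Fx" "t \<in> Fx" "gN c s N1 = gN c t N2" for N1 N2 s t
    proof
      fix X assume "X \<in> Orb N1"
      then obtain r where r: "r \<in> Fx" "X = gN c r N1" unfolding Orb_def by auto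
      have s1: "sr N1" "sr N2" using that Y by auto
      note isx = Fx_inv[OF that(3)]
      have "N1 = gN c (inv s) (gN c s N1)" using gN_gN[OF s1(1), of "inv s" s c] isx that(3) gN_one[OF s1(1)] by auto
      also have "\<dots> = gN c (inv s \<otimes> t) N2" unfolding that(5) using gN_gN[OF s1(2), of "inv s" t c] isx that(4) by auto
      finally have "X = gN c r (gN c (inv s \<otimes> t) N2)" using r by simp
      also have "\<dots> = gN c (r \<otimes> (inv s \<otimes> t)) N2" using gN_gN[OF s1(2), of r "inv s \<otimes> t" c] r isx that(4) Fx_mult by auto
      finally show "X \<in> Orb N2" unfolding Orb_def using r isx that(4) Fx_mult by blast
    qed
    show False using sub[OF N(1,2) s t e] sub[OF N(2,1) t s e[symmetric]] N(3) by blast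
  qed
  have U: "\<Union>(Orb ` ?Z) = ?Z" using OZ self by blast
  have "(card (carrier F) - 1) dvd card (\<Union>(Orb ` ?Z))"
    by (rule dvd_partition) (use finY card_O dj U in \<open>auto simp del: Diff_iff\<close>)
  then show "(card (carrier F) - 1) dvd (card Y - card {N \<in> Y. PF c N})"
    unfolding U using finY by (simp add: card_Diff_subset)
qed

text \<open>The set counted by the Hall number.\<close>

definition XX :: "(int \<Rightarrow> int \<Rightarrow> nat) \<Rightarrow> (int \<Rightarrow> int \<Rightarrow> nat) \<Rightarrow> (int \<Rightarrow> (bas \<Rightarrow> 'f) set) set" where
  "XX A B = {N. sr N \<and> rep_iso n F (sub_rep M N) (rep_of n F B) \<and> rep_iso n F (quot_rep n M N) (rep_of n F A)}"

lemma hall_number_XX: "hall_number n F A B C = card (XX A B)"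
  by (simp add: hall_number_def XX_def is_subrep_iff)

lemma XX_gN: "N \<in> XX A B \<Longrightarrow> t \<in> Fx \<Longrightarrow> gN c t N \<in> XX A B"
  unfolding XX_def using gN_sr gN_sub_iso gN_quot_iso by (blast intro: rep_iso_trans)

lemma dvd_diff_trans: "a dvd x - y \<Longrightarrow> a dvd y - z \<Longrightarrow> a dvd x - (z :: int)"
  using dvd_add[of a "x - y" "y - z"] by simp

text \<open>One copy is treated at a time, so that the acting group always has \<open>q - 1\<close> elements; scalings of
  different copies preserve each other's conditions.\<close>

lemma torus_count:
  "int (card (carrier F) - 1) dvd int (card (XX A B)) - int (card {N \<in> XX A B. \<forall>c\<in>K. PF c N})"
proof -
  have "D \<subseteq> K \<Longrightarrow> int (card (carrier F) - 1) dvd int (card (XX A B)) - int (card {N \<in> XX A B. \<forall>c\<in>D. PF c N})" if "finite D" for D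
    using that
  proof (induction D rule: finite_induct)
    case (insert c D)
    let ?Y = "{N \<in> XX A B. \<forall>c\<in>D. PF c N}"
    have e: "{N \<in> ?Y. PF c N} = {N \<in> XX A B. \<forall>c\<in>insert c D. PF c N}" by auto
    have Y1: "N \<in> ?Y \<Longrightarrow> sr N" for N by (simp add: XX_def)
    have Y2: "gN c t N \<in> ?Y" if N: "N \<in> ?Y" and t: "t \<in> Fx" for N t
    proof -
      have "N \<in> XX A B" "\<forall>c'\<in>D. PF c' N" using N by blast+
      then have "gN c t N \<in> XX A B" "\<forall>c'\<in>D. PF c' (gN c t N)"
        using XX_gN[OF _ t] PF_gN[OF Y1[OF N] t] by blast+
      then show ?thesis by blast
    qed
    have "card {N \<in> ?Y. PF c N} \<le> card ?Y" by (rule orbit_step(2)[where Y = ?Y and c = c, OF Y1 Y2])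
    then have "int (card ?Y) - int (card {N \<in> ?Y. PF c N}) = int (card ?Y - card {N \<in> ?Y. PF c N})"
      by (simp only: of_nat_diff)
    moreover have "(card (carrier F) - 1) dvd (card ?Y - card {N \<in> ?Y. PF c N})"
      by (rule orbit_step(1)[where Y = ?Y and c = c, OF Y1 Y2])
    ultimately have "int (card (carrier F) - 1) dvd int (card ?Y) - int (card {N \<in> ?Y. PF c N})"
      by (simp only: int_dvd_int_iff)
    moreover have "int (card (carrier F) - 1) dvd int (card (XX A B)) - int (card ?Y)" using insert by auto
    ultimately show ?case unfolding e by (rule dvd_diff_trans[rotated])
  qed simp
  then show ?thesis using CT by blast
qed

end

section \<open>Torus-fixed subrepresentations\<close>

context hallrep begin

text \<open>The subrepresentation spanned by the tails of the copies from \<open>\<kappa> c\<close> on.\<close>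

definition Nk :: "(int \<times> int \<times> nat \<Rightarrow> int) \<Rightarrow> int \<Rightarrow> (bas \<Rightarrow> 'f) set" where
  "Nk \<kappa> = (\<lambda>v\<in>I. vs F (iv K \<kappa> en \<inter> at_v n v))"

definition cut :: "(int \<times> int \<times> nat \<Rightarrow> int) \<Rightarrow> bool" where
  "cut \<kappa> \<longleftrightarrow> (\<forall>c\<in>K. st c \<le> \<kappa> c \<and> \<kappa> c \<le> en c)"

lemma S_vx [simp]: "vx c k \<in> S \<longleftrightarrow> c \<in> K \<and> st c \<le> k \<and> k < en c" by (simp add: SA_def)

lemma at_v_vx [simp]: "vx c k \<in> at_v n v \<longleftrightarrow> k mod int n = v" by (simp add: at_v_def)

lemma Nk_V: "cut \<kappa> \<Longrightarrow> x \<in> vs F (iv K \<kappa> en \<inter> at_v n v) \<Longrightarrow> x \<in> V v"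
proof -
  assume k: "cut \<kappa>" and x: "x \<in> vs F (iv K \<kappa> en \<inter> at_v n v)"
  have "x b = \<zero>" if "b \<notin> S \<inter> at_v n v" for b
  proof (rule vsD(2)[OF x])
    obtain c l where b: "b = vx c l" by (rule vx_cases)
    show "b \<notin> iv K \<kappa> en \<inter> at_v n v" using that k by (auto simp: b cut_def dest: order_trans)
  qed
  then show ?thesis unfolding V_def using vsD(1)[OF x] by (intro vsI)
qed

lemma f_iv:
  assumes k: "cut \<kappa>" and x: "x \<in> vs F (iv K \<kappa> en \<inter> at_v n v)"
  shows "f x = fS F (iv K \<kappa> en) x"
proof
  fix b
  obtain c l where b: "b = vx c l" by (rule vx_cases)
  have "x (vx c (l - 1)) = \<zero>" if "b \<in> S" "b \<notin> iv K \<kappa> en"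
    by (rule vsD(2)[OF x]) (use that in \<open>auto simp: b\<close>)
  moreover have "b \<in> iv K \<kappa> en \<Longrightarrow> b \<in> S" using k by (auto simp: b cut_def dest: order_trans)
  ultimately show "f x b = fS F (iv K \<kappa> en) x b" by (auto simp: fS_def b simp del: S_vx iv_at)
qed

lemma Nk_sr: "cut \<kappa> \<Longrightarrow> sr (Nk \<kappa>)"
  unfolding sr_def
proof (intro conjI ballI)
  assume k: "cut \<kappa>"
  show "Nk \<kappa> \<in> extensional I" by (simp add: Nk_def)
  fix v assume v: "v \<in> I"
  have e: "Nk \<kappa> v = vs F (iv K \<kappa> en \<inter> at_v n v)" "Nk \<kappa> ((v + 1) mod int n) = vs F (iv K \<kappa> en \<inter> at_v n ((v + 1) mod int n))"
    using v I_next[OF v] by (auto simp: Nk_def)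
  show "Nk \<kappa> v \<subseteq> V v" unfolding e using Nk_V[OF k] by blast
  show "(\<lambda>b. \<zero>) \<in> Nk \<kappa> v" unfolding e by (rule vs_closed[OF F_field])
  show "(\<lambda>b. x b \<oplus> y b) \<in> Nk \<kappa> v" if "x \<in> Nk \<kappa> v" "y \<in> Nk \<kappa> v" for x y
    using that unfolding e by (rule vs_closed[OF F_field])
  show "(\<lambda>b. a \<otimes> x b) \<in> Nk \<kappa> v" if "a \<in> carrier F" "x \<in> Nk \<kappa> v" for a x
    using that unfolding e by (rule vs_closed[OF F_field])
  show "f x \<in> Nk \<kappa> ((v + 1) mod int n)" if "x \<in> Nk \<kappa> v" for x
    using that unfolding e by (simp add: f_iv[OF k] fS_closed[OF F_field])
qed

lemma Nk_PF: "PF c (Nk \<kappa>)"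
  unfolding PF_def
proof (intro ballI)
  fix v x assume v: "v \<in> I" and x: "x \<in> Nk \<kappa> v"
  then have "x \<in> vs F (iv K \<kappa> en \<inter> at_v n v)" by (simp add: Nk_def)
  then have "pj c x \<in> vs F (iv K \<kappa> en \<inter> at_v n v)"
    by (intro vsI) (auto simp: pj_def vsD(1) dest: vsD(2))
  then show "pj c x \<in> Nk \<kappa> v" using v by (simp add: Nk_def)
qed

lemma Nk_sub_iso:
  assumes k: "cut \<kappa>"
  shows "rep_iso n F (sub_rep M (Nk \<kappa>)) (RS n F (iv K \<kappa> en))" "rep_iso n F (RS n F (iv K \<kappa> en)) (sub_rep M (Nk \<kappa>))"
proof -
  have 1: "carrier (fst (sub_rep M (Nk \<kappa>)) v) = carrier (fst (RS n F (iv K \<kappa> en)) v)" if "v \<in> I" for v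
    using that by (simp add: Nk_def RS_def)
  have 2: "snd (sub_rep M (Nk \<kappa>)) v x = snd (RS n F (iv K \<kappa> en)) v x" if v: "v \<in> I" and "x \<in> carrier (fst (sub_rep M (Nk \<kappa>)) v)" for v x
  proof -
    have x: "x \<in> vs F (iv K \<kappa> en \<inter> at_v n v)" using that by (simp add: Nk_def)
    show ?thesis using f_iv[OF k x] M_f[OF Nk_V[OF k x]] by (simp add: RS_def)
  qed
  show "rep_iso n F (sub_rep M (Nk \<kappa>)) (RS n F (iv K \<kappa> en))"
    by (rule rep_iso_id(1)[OF 1 _ _ 2]) (auto simp: M_add M_sm RS_def)
  show "rep_iso n F (RS n F (iv K \<kappa> en)) (sub_rep M (Nk \<kappa>))"
    by (rule rep_iso_id(2)[OF 1 _ _ 2]) (auto simp: M_add M_sm RS_def)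
qed

lemma Nk_quot_iso:
  assumes k: "cut \<kappa>"
  shows "rep_iso n F (quot_rep n M (Nk \<kappa>)) (RS n F (iv K st \<kappa>))" "rep_iso n F (RS n F (iv K st \<kappa>)) (quot_rep n M (Nk \<kappa>))"
proof -
  let ?T = "iv K st \<kappa>"
  define \<psi> where "\<psi> x b = (if b \<in> ?T then x b else \<zero>)" for x b
  have TS: "b \<in> ?T \<Longrightarrow> b \<in> S" for b using k by (cases b rule: vx_cases) (auto simp: cut_def dest: less_le_trans)
  have \<psi>V: "\<psi> x \<in> vs F (?T \<inter> at_v n v)" if x: "x \<in> V v" for x v
  proof (rule vsI)
    fix b show "\<psi> x b \<in> carrier F" using V_in[OF x] by (simp add: \<psi>_def)
    assume "b \<notin> ?T \<inter> at_v n v"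
    then show "\<psi> x b = \<zero>" using vsD(2)[OF x[unfolded V_def], of b] by (auto simp: \<psi>_def)
  qed
  show 1: "rep_iso n F (quot_rep n M (Nk \<kappa>)) (RS n F ?T)"
  proof (rule quot_from_map[OF Nk_sr[OF k], of _ "\<lambda>v. \<psi>"])
    fix v assume v: "v \<in> I"
    show "carrier (fst (RS n F ?T) v) = \<psi> ` V v"
    proof (intro equalityI subsetI)
      fix x assume "x \<in> carrier (fst (RS n F ?T) v)"
      then have x: "x \<in> vs F (?T \<inter> at_v n v)" by (simp add: RS_def)
      have "x \<in> V v" unfolding V_def using vsD[OF x] TS by (intro vsI) auto
      moreover have "x = \<psi> x" using vsD(2)[OF x] by (auto simp: \<psi>_def)
      ultimately show "x \<in> \<psi> ` V v" by blast
    next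
      fix x assume "x \<in> \<psi> ` V v"
      then show "x \<in> carrier (fst (RS n F ?T) v)" using \<psi>V by (auto simp: RS_def)
    qed
    fix x assume x: "x \<in> V v"
    show "\<psi> (f x) = snd (RS n F ?T) v (\<psi> x)"
    proof
      fix b
      obtain c l where b: "b = vx c l" by (rule vx_cases)
      have "x (vx c (l - 1)) = \<zero>" if "b \<in> ?T" "vx c (l - 1) \<notin> ?T"
        by (rule vsD(2)[OF x[unfolded V_def]]) (use that in \<open>auto simp: b\<close>)
      then show "\<psi> (f x) b = snd (RS n F ?T) v (\<psi> x) b"
        using TS[of b] by (auto simp: RS_def \<psi>_def fS_def b simp del: S_vx iv_at)
    qed
    fix y assume y: "y \<in> V v"
    show "\<psi> (\<lambda>b. x b \<oplus> y b) = \<psi> x \<oplus>\<^bsub>fst (RS n F ?T) v\<^esub> \<psi> y" by (auto simp: RS_def \<psi>_def)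
    show "\<psi> x = \<psi> y \<longleftrightarrow> (\<lambda>b. x b \<ominus> y b) \<in> Nk \<kappa> v"
    proof
      assume e: "\<psi> x = \<psi> y"
      have "(\<lambda>b. x b \<ominus> y b) \<in> vs F (iv K \<kappa> en \<inter> at_v n v)"
      proof (rule vsI)
        fix b show "x b \<ominus> y b \<in> carrier F" using V_in[OF x] V_in[OF y] by simp
        assume b: "b \<notin> iv K \<kappa> en \<inter> at_v n v"
        show "x b \<ominus> y b = \<zero>"
        proof (cases "b \<in> ?T")
          case True
          then have "x b = y b" using fun_cong[OF e, of b] by (simp add: \<psi>_def)
          then show ?thesis using V_in[OF y] by (simp add: a_minus_def F.r_neg)
        next
          case False
          then have "b \<notin> S \<inter> at_v n v" using b by (cases b rule: vx_cases) auto
          then show ?thesis using vsD(2)[OF x[unfolded V_def]] vsD(2)[OF y[unfolded V_def]] by simp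
        qed
      qed
      then show "(\<lambda>b. x b \<ominus> y b) \<in> Nk \<kappa> v" using v by (simp add: Nk_def)
    next
      assume "(\<lambda>b. x b \<ominus> y b) \<in> Nk \<kappa> v"
      then have d: "(\<lambda>b. x b \<ominus> y b) \<in> vs F (iv K \<kappa> en \<inter> at_v n v)" using v by (simp add: Nk_def)
      show "\<psi> x = \<psi> y"
      proof
        fix b show "\<psi> x b = \<psi> y b"
        proof (cases "b \<in> ?T")
          case True
          then have "b \<notin> iv K \<kappa> en \<inter> at_v n v" by (cases b rule: vx_cases) auto
          then have "x b \<ominus> y b = \<zero>" using vsD(2)[OF d] by simp
          then have "x b = y b" using V_in[OF x] V_in[OF y] by simp
          then show ?thesis by (simp add: \<psi>_def)
        qed (simp add: \<psi>_def)
      qed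
    qed
  next
    fix v a x assume "v \<in> I" "a \<in> carrier F" "x \<in> V v"
    then show "\<psi> (\<lambda>b. a \<otimes> x b) = a \<odot>\<^bsub>fst (RS n F ?T) v\<^esub> \<psi> x" by (auto simp: RS_def \<psi>_def)
  qed
  show "rep_iso n F (RS n F ?T) (quot_rep n M (Nk \<kappa>))"
    by (rule rep_iso_sym[OF rep_ok_quot[OF Nk_sr[OF k]] 1])
qed

text \<open>On each copy let \<open>\<kappa> c\<close> be the first position at which an element of \<open>N\<close> is nonzero. Projecting such an
  element to the copy and applying arrows gives, for every later position, an element of \<open>N\<close> starting
  there, so \<open>N\<close> contains the whole tail of the copy by descending induction on the starting position.
  The projections also decompose any element of \<open>N\<close> into parts on single copies.\<close>

lemma fixed_classify:
  assumes N: "sr N" and PF: "\<And>c. c \<in> K \<Longrightarrow> PF c N"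
  shows "\<exists>\<kappa>. cut \<kappa> \<and> N = Nk \<kappa>"
proof -
  note s = srD[OF N]
  define Q where "Q c = insert (en c) {k. st c \<le> k \<and> k < en c \<and> (\<exists>v\<in>I. \<exists>x\<in>N v. x (vx c k) \<noteq> \<zero>)}" for c
  (* The default en c stands for a copy on which N vanishes. *)
  define \<kappa> where "\<kappa> c = Min (Q c)" for c
  have Qf: "finite (Q c)" "Q c \<noteq> {}" for c
  proof -
    have "Q c \<subseteq> {st c..<en c} \<union> {en c}" by (auto simp: Q_def)
    then show "finite (Q c)" by (rule finite_subset) simp
  qed (simp add: Q_def)
  have \<kappa>Q: "\<kappa> c \<in> Q c" for c unfolding \<kappa>_def by (rule Min_in[OF Qf])
  have \<kappa>min: "k \<in> Q c \<Longrightarrow> \<kappa> c \<le> k" for c k unfolding \<kappa>_def by (rule Min_le[OF Qf(1)])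
  have cut: "cut \<kappa>"
    unfolding cut_def
  proof
    fix c assume "c \<in> K"
    then have "st c \<le> en c" by (auto simp: KA_def)
    then show "st c \<le> \<kappa> c \<and> \<kappa> c \<le> en c" using \<kappa>Q[of c] by (auto simp: Q_def)
  qed
  have sub: "x \<in> vs F (iv K \<kappa> en \<inter> at_v n v)" if v: "v \<in> I" and x: "x \<in> N v" for v x
  proof (rule vsI)
    have xV: "x \<in> V v" using s(2)[OF v x] .
    fix b show "x b \<in> carrier F" using V_in[OF xV] .
    assume b: "b \<notin> iv K \<kappa> en \<inter> at_v n v"
    obtain c k where bc: "b = vx c k" by (rule vx_cases)
    show "x b = \<zero>"
    proof (rule ccontr)
      assume nz: "x b \<noteq> \<zero>"
      then have bS: "b \<in> S \<inter> at_v n v" using vsD(2)[OF xV[unfolded V_def], of b] by blast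
      then have "k \<in> Q c" using v x nz by (auto simp: Q_def bc)
      from \<kappa>min[OF this] show False using b bS by (auto simp: bc)
    qed
  qed
  (* The tail of the copy c from k on, at the vertex v. *)
  define R where "R c k v = {vx c l | l. k \<le> l \<and> l < en c \<and> l mod int n = v}" for c k v
  have copy: "vs F (R c (en c - int d) v) \<subseteq> N v" if c: "c \<in> K" and d: "int d \<le> en c - \<kappa> c" and v: "v \<in> I" for c d v
    using d v
  proof (induction d arbitrary: v)
    case 0
    have "R c (en c) v = {}" for v by (auto simp: R_def)
    then have "x = (\<lambda>b. \<zero>)" if "x \<in> vs F (R c (en c) v)" for x using vsD(2)[OF that] by auto
    then show ?case using s(3)[OF 0(2)] by auto
  next
    case (Suc d)
    let ?k0 = "en c - int (Suc d)"
    have IH: "vs F (R c (?k0 + 1) v) \<subseteq> N v" if "v \<in> I" for v using Suc.IH[OF _ that] Suc.prems by (simp add: algebra_simps)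
    have k0: "\<kappa> c \<le> ?k0" "?k0 < en c" using Suc.prems by auto
    then have "\<kappa> c \<noteq> en c" by linarith
    then obtain v0 x where v0: "v0 \<in> I" and x: "x \<in> N v0" and nz: "x (vx c (\<kappa> c)) \<noteq> \<zero>" and st: "st c \<le> \<kappa> c"
      using \<kappa>Q[of c] by (auto simp: Q_def simp del: atLeastLessThan_iff)
    have xv: "x \<in> vs F (iv K \<kappa> en \<inter> at_v n v0)" by (rule sub[OF v0 x])
    have v0': "\<kappa> c mod int n = v0" using vsD(2)[OF xv, of "vx c (\<kappa> c)"] nz by auto
    define y where "y = pj c x"
    have yN: "y \<in> N v0" unfolding y_def using PF[OF c] v0 x by (auto simp: PF_def)
    have yV: "y \<in> vs F (S \<inter> at_v n v0)" using s(2)[OF v0 yN] by (simp add: V_def)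
    define e where "e = nat (?k0 - \<kappa> c)"
    have e: "int e = ?k0 - \<kappa> c" using k0 by (simp add: e_def)
    (* The element z of N is supported on the copy c, starts at k0, and is nonzero there. *)
    define z where "z = (f ^^ e) y"
    have zN': "(f ^^ m) y \<in> N ((v0 + int m) mod int n)" for m
    proof (induction m)
      case 0 then show ?case using yN v0 by simp
    next
      case (Suc m)
      have "(v0 + int m) mod int n \<in> I" using v0 by auto
      from s(6)[OF this Suc] mod_add_left_eq[of "v0 + int m" "int n" 1] show ?case by (simp add: add_ac)
    qed
    have k0m: "(v0 + int e) mod int n = ?k0 mod int n"
    proof -
      have "\<kappa> c + (?k0 - \<kappa> c) = ?k0" by simp
      then show ?thesis by (simp only: e v0'[symmetric] mod_add_left_eq)
    qed
    have zN: "z \<in> N (?k0 mod int n)" using zN'[of e] unfolding z_def k0m .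
    have zval: "z (vx c' l) = (if c' = c \<and> vx c l \<in> Tset n C v0 e then x (vx c (l - int e)) else \<zero>)" for c' l
      unfolding z_def fS_pow[OF yV] by (auto simp: y_def pj_def)
    have z0: "z (vx c ?k0) = x (vx c (\<kappa> c))"
      unfolding zval using c k0 st v0' by (auto simp: e)
    have zlow: "z (vx c l) = \<zero>" if "l < ?k0" for l
    proof -
      have "x (vx c (l - int e)) = \<zero>" by (rule vsD(2)[OF xv]) (use that e in auto)
      then show ?thesis unfolding zval by simp
    qed
    have zhigh: "z (vx c l) = \<zero>" if "\<not> l < en c" for l unfolding zval using that by auto
    have zmod: "z (vx c l) = \<zero>" if "l mod int n \<noteq> ?k0 mod int n" for l
    proof -
      have "z \<in> V (?k0 mod int n)" using s(2)[OF _ zN] n1 by auto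
      then show ?thesis using vsD(2)[of z F _ "vx c l"] that unfolding V_def by auto
    qed
    show ?case
    proof
      fix w assume w: "w \<in> vs F (R c ?k0 v)"
      show "w \<in> N v"
      proof (cases "v = ?k0 mod int n")
        case False
        have "w \<in> vs F (R c (?k0 + 1) v)"
        proof (rule vsI)
          fix b show "w b \<in> carrier F" using vsD(1)[OF w] .
          assume b: "b \<notin> R c (?k0 + 1) v"
          have "b \<notin> R c ?k0 v"
          proof
            assume "b \<in> R c ?k0 v"
            then obtain l where l: "b = vx c l" "?k0 \<le> l" "l < en c" "l mod int n = v" by (auto simp: R_def)
            then have "l \<noteq> ?k0" using False by auto
            then have "b \<in> R c (?k0 + 1) v" using l by (auto simp: R_def)
            then show False using b by simp
          qed
          then show "w b = \<zero>" by (rule vsD(2)[OF w])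
        qed
        then show ?thesis using IH[OF Suc.prems(2)] by blast
      next
        case True
        let ?a = "x (vx c (\<kappa> c))"
        have a: "?a \<in> Fx" using nz vsD(1)[OF xv] by blast
        (* Subtracting a multiple of z removes the entry at k0 and leaves a shorter tail. *)
        define r where "r = w (vx c ?k0) \<otimes> inv ?a"
        have rc: "r \<in> carrier F" unfolding r_def using vsD(1)[OF w] Fx_inv[OF a] by auto
        have zc: "z b \<in> carrier F" for b using V_in[OF s(2)[OF _ zN]] n1 by auto
        have rz: "(\<lambda>b. r \<otimes> z b) \<in> N v" using s(5)[OF _ rc zN] n1 by (auto simp: True)
        have "(\<lambda>b. w b \<ominus> r \<otimes> z b) \<in> vs F (R c (?k0 + 1) v)"
        proof (rule vsI)
          fix b show "w b \<ominus> r \<otimes> z b \<in> carrier F" using vsD(1)[OF w] rc zc by auto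
          assume b: "b \<notin> R c (?k0 + 1) v"
          obtain c' l where bl: "b = vx c' l" by (rule vx_cases)
          show "w b \<ominus> r \<otimes> z b = \<zero>"
          proof (cases "b = vx c ?k0")
            case True
            have "r \<otimes> ?a = w (vx c ?k0)" unfolding r_def using Fx_inv[OF a] a vsD(1)[OF w] by (simp add: F.m_assoc)
            then show ?thesis unfolding True z0 using vsD(1)[OF w] by (simp add: a_minus_def F.r_neg)
          next
            case False
            have "b \<notin> R c ?k0 v"
            proof
              assume "b \<in> R c ?k0 v"
              then obtain l where l: "b = vx c l" "?k0 \<le> l" "l < en c" "l mod int n = v" by (auto simp: R_def)
              then have "l \<noteq> ?k0" using False by auto
              then have "b \<in> R c (?k0 + 1) v" using l by (auto simp: R_def)
              then show False using b by simp
            qed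
            then have wz: "w b = \<zero>" by (rule vsD(2)[OF w])
            have "z b = \<zero>"
            proof (cases "c' = c")
              case False then show ?thesis unfolding bl zval by simp
            next
              case c': True
              show ?thesis
              proof (cases "l < ?k0 \<or> \<not> l < en c \<or> l mod int n \<noteq> ?k0 mod int n")
                case True then show ?thesis unfolding bl c' using zlow zhigh zmod by blast
              next
                case neg: False
                then have "b \<in> R c ?k0 v" using True unfolding bl c' R_def \<open>v = _\<close> by auto
                then show ?thesis using \<open>b \<notin> R c ?k0 v\<close> by simp
              qed
            qed
            then show ?thesis using wz rc by (simp add: a_minus_def)
          qed
        qed
        then have "(\<lambda>b. w b \<ominus> r \<otimes> z b) \<in> N v" using IH[OF Suc.prems(2)] by blast
        from s(4)[OF Suc.prems(2) this rz] have "(\<lambda>b. (w b \<ominus> r \<otimes> z b) \<oplus> r \<otimes> z b) \<in> N v" .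
        moreover have "(w b \<ominus> r \<otimes> z b) \<oplus> r \<otimes> z b = w b" for b
          using vsD(1)[OF w] rc zc by (simp add: a_minus_def F.a_assoc F.l_neg)
        ultimately show ?thesis by simp
      qed
    qed
  qed
  have all: "x \<in> N v" if D: "finite D" "D \<subseteq> K" and v: "v \<in> I"
    and x: "x \<in> vs F ({b. cpy b \<in> D} \<inter> (iv K \<kappa> en \<inter> at_v n v))" for x D v
    using D x
  proof (induction D arbitrary: x rule: finite_induct)
    case empty
    then have "x = (\<lambda>b. \<zero>)" using vsD(2)[OF empty(2)] by auto
    then show ?case using s(3)[OF v] by simp
  next
    case (insert c D)
    define y where "y b = (if cpy b = c then \<zero> else x b)" for b
    have c: "c \<in> K" using insert by auto
    have "y \<in> vs F ({b. cpy b \<in> D} \<inter> (iv K \<kappa> en \<inter> at_v n v))"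
    proof (rule vsI)
      fix b show "y b \<in> carrier F" using vsD(1)[OF insert(5)] by (simp add: y_def)
      assume "b \<notin> {b. cpy b \<in> D} \<inter> (iv K \<kappa> en \<inter> at_v n v)"
      then show "y b = \<zero>" using vsD(2)[OF insert(5), of b] by (auto simp: y_def)
    qed
    then have yN: "y \<in> N v" using insert by auto
    have "pj c x \<in> vs F (R c (\<kappa> c) v)"
    proof (rule vsI)
      fix b show "pj c x b \<in> carrier F" using vsD(1)[OF insert(5)] by (simp add: pj_def)
      assume b: "b \<notin> R c (\<kappa> c) v"
      obtain c' l where bl: "b = vx c' l" by (rule vx_cases)
      show "pj c x b = \<zero>"
      proof (cases "c' = c")
        case True
        then have "b \<notin> iv K \<kappa> en \<inter> at_v n v" using b by (auto simp: bl R_def)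
        then show ?thesis using vsD(2)[OF insert(5), of b] by (simp add: pj_def)
      qed (simp add: pj_def bl)
    qed
    moreover have "vs F (R c (\<kappa> c) v) \<subseteq> N v"
    proof -
      have le: "\<kappa> c \<le> en c" using cut c by (simp add: cut_def)
      have "vs F (R c (en c - int (nat (en c - \<kappa> c))) v) \<subseteq> N v" by (rule copy[OF c _ v]) (use le in simp)
      moreover have "en c - int (nat (en c - \<kappa> c)) = \<kappa> c" using le by simp
      ultimately show ?thesis by (simp only:)
    qed
    ultimately have pN: "pj c x \<in> N v" by blast
    have "x = (\<lambda>b. y b \<oplus> pj c x b)" using vsD(1)[OF insert(5)] by (auto simp: y_def pj_def)
    then show ?case using s(4)[OF v yN pN] by simp
  qed
  have "N = Nk \<kappa>"
  proof (rule extensionalityI[of _ I])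
    show "N \<in> extensional I" by (rule s(1))
    show "Nk \<kappa> \<in> extensional I" by (simp add: Nk_def)
    fix v assume v: "v \<in> I"
    have "x \<in> N v" if x: "x \<in> vs F (iv K \<kappa> en \<inter> at_v n v)" for x
    proof (rule all[OF CT subset_refl v])
      have "iv K \<kappa> en \<inter> at_v n v = {b. cpy b \<in> K} \<inter> (iv K \<kappa> en \<inter> at_v n v)" by (auto simp: iv_def)
      then show "x \<in> vs F ({b. cpy b \<in> K} \<inter> (iv K \<kappa> en \<inter> at_v n v))" using x by simp
    qed
    then show "N v = Nk \<kappa> v" using sub[OF v] v by (auto simp: Nk_def)
  qed
  then show ?thesis using cut by blast
qed

lemma Nk_XX:
  assumes k: "cut \<kappa>" and A: "finite (KA n A)" and B: "finite (KA n B)"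
  shows "Nk \<kappa> \<in> XX A B \<longleftrightarrow> (\<forall>x y. 1 \<le> x \<longrightarrow> x \<le> int n \<longrightarrow> x < y \<longrightarrow> B x y = card (itype n K \<kappa> en (x, y)) \<and> A x y = card (itype n K st \<kappa> (x, y)))"
proof -
  have "rep_iso n F (sub_rep M (Nk \<kappa>)) (rep_of n F B) \<longleftrightarrow> rep_iso n F (RS n F (iv K \<kappa> en)) (rep_of n F B)"
    using Nk_sub_iso[OF k] by (blast intro: rep_iso_trans)
  moreover have "rep_iso n F (quot_rep n M (Nk \<kappa>)) (rep_of n F A) \<longleftrightarrow> rep_iso n F (RS n F (iv K st \<kappa>)) (rep_of n F A)"
    using Nk_quot_iso[OF k] by (blast intro: rep_iso_trans)
  ultimately show ?thesis
    unfolding XX_def using Nk_sr[OF k] iso_type_iff[OF F_field finF n1 CT A] iso_type_iff[OF F_field finF n1 CT B] by auto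
qed

text \<open>What cutting a summand \<open>[i0, l)\<close> of \<open>M(C)\<close> at \<open>j0\<close> means for multiplicities: it is replaced by its tail
  \<open>[j0, l)\<close>, which must give \<open>M(A)\<close>. For \<open>l = j0\<close> the tail is empty.\<close>

definition cond :: "int \<Rightarrow> int \<Rightarrow> (int \<Rightarrow> int \<Rightarrow> nat) \<Rightarrow> int \<Rightarrow> bool" where
  "cond i0 j0 A l \<longleftrightarrow> (\<forall>x y. 1 \<le> x \<longrightarrow> x \<le> int n \<longrightarrow> x < y \<longrightarrow>
     A x y + (if (x, y) = (i0, l) then 1 else 0) = C x y + (if j0 < l \<and> nrm n j0 l = (x, y) then 1 else 0))"

definition cuts :: "int \<Rightarrow> int \<Rightarrow> (int \<Rightarrow> int \<Rightarrow> nat) \<Rightarrow> (int \<times> int \<times> nat) set" where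
  "cuts i0 j0 A = {c \<in> K. st c = i0 \<and> j0 \<le> en c \<and> cond i0 j0 A (en c)}"

text \<open>If the quotient is a single indecomposable \<open>[i0, j0)\<close>, then exactly one copy is cut, at \<open>j0\<close>, and the others
  lie entirely in the subrepresentation.\<close>

lemma fixed_count:
  assumes b: "1 \<le> i0" "i0 \<le> int n" "i0 < j0" and A: "finite (KA n A)" and E: "finite (KA n (Emat n i0 j0))"
  shows "card {N \<in> XX (Emat n i0 j0) A. \<forall>c\<in>K. PF c N} = card (cuts i0 j0 A)"
proof -
  (* Cut the copy c0 at j0 and leave all others whole. *)
  define kk where "kk c0 = (\<lambda>c :: int \<times> int \<times> nat. if c = c0 then j0 else st c)" for c0
  have nst: "nrm n (st c) y = (st c, y)" if "c \<in> K" for c y using that by (intro nrm_self) (auto simp: KA_def)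
  have Em: "(Emat n i0 j0 x y :: nat) = (if x = i0 \<and> y = j0 then 1 else 0)" if "1 \<le> x" "x \<le> int n" for x y
    using dvd_diff_window[OF that b(1,2)] by (auto simp: Emat_iff)
  have kcut: "cut (kk c0)" if "c0 \<in> K" "st c0 = i0" "j0 \<le> en c0" for c0
    using that b unfolding cut_def kk_def by (auto simp: KA_def)
  have sub_type: "card (itype n K (kk c0) en (x, y)) + (if (x, y) = (i0, en c0) then 1 else 0) = C x y + (if j0 < en c0 \<and> nrm n j0 (en c0) = (x, y) then 1 else 0)"
    if c0: "c0 \<in> K" "st c0 = i0" "j0 \<le> en c0" and xy: "1 \<le> x" "x \<le> int n" "x < y" for c0 x y
  proof -
    let ?P = "{c \<in> K. (st c, en c) = (x, y)}"
    have P: "?P = (\<lambda>m. (x, y, m)) ` {0..<C x y}" using xy by (auto simp: KA_def)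
    then have cP: "card ?P = C x y" by (simp add: card_image inj_on_def)
    have fP: "finite ?P" unfolding P by simp
    have "itype n K (kk c0) en (x, y) = (?P - {c0}) \<union> (if j0 < en c0 \<and> nrm n j0 (en c0) = (x, y) then {c0} else {})"
      using c0 xy nst by (auto simp: itype_def kk_def KA_def)
    moreover have "card ((?P - {c0}) \<union> (if j0 < en c0 \<and> nrm n j0 (en c0) = (x, y) then {c0} else {})) = card (?P - {c0}) + (if j0 < en c0 \<and> nrm n j0 (en c0) = (x, y) then 1 else 0)"
    proof -
      have "card (X \<union> (if q then {c0} else {})) = card X + (if q then 1 else 0)" if "finite X" "c0 \<notin> X" for X q
        using that by simp
      then show ?thesis using fP by blast
    qed
    moreover have "card (?P - {c0}) + (if (x, y) = (i0, en c0) then 1 else 0) = card ?P"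
    proof (cases "c0 \<in> ?P")
      case True
      then have "(x, y) = (i0, en c0)" using c0 by auto
      then show ?thesis using card_Suc_Diff1[OF fP True] by simp
    next
      case False
      then have "(x, y) \<noteq> (i0, en c0)" using c0 by auto
      then show ?thesis using False by auto
    qed
    ultimately show ?thesis using cP by simp
  qed
  have quot_type: "card (itype n K st (kk c0) (x, y)) = Emat n i0 j0 x y"
    if c0: "c0 \<in> K" "st c0 = i0" "j0 \<le> en c0" and xy: "1 \<le> x" "x \<le> int n" "x < y" for c0 x y
  proof -
    have "itype n K st (kk c0) (x, y) = (if x = i0 \<and> y = j0 then {c0} else {})"
      using c0 b nst by (auto simp: itype_def kk_def split: if_splits)
    then show ?thesis unfolding Em[OF xy(1,2)] by simp
  qed
  have "bij_betw (\<lambda>c0. Nk (kk c0)) (cuts i0 j0 A) {N \<in> XX (Emat n i0 j0) A. \<forall>c\<in>K. PF c N}"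
    unfolding bij_betw_def
  proof
    show "inj_on (\<lambda>c0. Nk (kk c0)) (cuts i0 j0 A)"
    proof (rule inj_onI, rule ccontr)
      fix c c' assume c: "c \<in> cuts i0 j0 A" "c' \<in> cuts i0 j0 A" and e: "Nk (kk c) = Nk (kk c')" and ne: "c \<noteq> c'"
      have v: "i0 mod int n \<in> I" using n1 by auto
      let ?x = "\<lambda>b. if b = vx c i0 then \<one> else \<zero>"
      have "?x \<in> vs F (iv K (kk c') en \<inter> at_v n (i0 mod int n))"
      proof (rule vsI)
        fix b :: bas assume "b \<notin> iv K (kk c') en \<inter> at_v n (i0 mod int n)"
        then show "?x b = \<zero>" using c ne b by (auto simp: cuts_def kk_def)
      qed auto
      then have "?x \<in> Nk (kk c) (i0 mod int n)" unfolding e using v by (simp add: Nk_def)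
      then have "?x \<in> vs F (iv K (kk c) en \<inter> at_v n (i0 mod int n))" using v by (simp add: Nk_def)
      from vsD(2)[OF this, of "vx c i0"] show False using b by (auto simp: kk_def)
    qed
    show "(\<lambda>c0. Nk (kk c0)) ` cuts i0 j0 A = {N \<in> XX (Emat n i0 j0) A. \<forall>c\<in>K. PF c N}"
    proof (intro equalityI subsetI)
      fix N assume "N \<in> (\<lambda>c0. Nk (kk c0)) ` cuts i0 j0 A"
      then obtain c0 where c0: "c0 \<in> K" "st c0 = i0" "j0 \<le> en c0" and cd: "cond i0 j0 A (en c0)" and Nc: "N = Nk (kk c0)" by (auto simp: cuts_def)
      have "N \<in> XX (Emat n i0 j0) A" unfolding Nc Nk_XX[OF kcut[OF c0] E A]
      proof (intro allI impI conjI)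
        fix x y assume xy: "1 \<le> x" "x \<le> int n" "x < y"
        show "A x y = card (itype n K (kk c0) en (x, y))"
          using sub_type[OF c0 xy] cd xy unfolding cond_def by (metis add_right_cancel)
        show "Emat n i0 j0 x y = card (itype n K st (kk c0) (x, y))" using quot_type[OF c0 xy] by simp
      qed
      then show "N \<in> {N \<in> XX (Emat n i0 j0) A. \<forall>c\<in>K. PF c N}" using Nk_PF Nc by blast
    next
      fix N assume N: "N \<in> {N \<in> XX (Emat n i0 j0) A. \<forall>c\<in>K. PF c N}"
      then have "sr N" "\<And>c. c \<in> K \<Longrightarrow> PF c N" by (auto simp: XX_def)
      from fixed_classify[OF this] obtain \<kappa> where k: "cut \<kappa>" and Nk: "N = Nk \<kappa>" by auto
      have X: "Nk \<kappa> \<in> XX (Emat n i0 j0) A" using N Nk by auto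
      then have tA: "A x y = card (itype n K \<kappa> en (x, y))" and tE: "Emat n i0 j0 x y = card (itype n K st \<kappa> (x, y))"
        if "1 \<le> x" "x \<le> int n" "x < y" for x y
        using that unfolding Nk_XX[OF k E A] by blast+
      have "card (itype n K st \<kappa> (i0, j0)) = 1" using tE[OF b] Em[OF b(1,2)] by simp
      then obtain c0 where c0: "itype n K st \<kappa> (i0, j0) = {c0}" by (metis One_nat_def card_1_singletonE)
      then have "c0 \<in> itype n K st \<kappa> (i0, j0)" by simp
      then have c0K: "c0 \<in> K" and nc: "nrm n (st c0) (\<kappa> c0) = (i0, j0)" unfolding itype_def by blast+
      have c0': "c0 \<in> K" "st c0 = i0" "\<kappa> c0 = j0" using c0K nc nst[OF c0K, of "\<kappa> c0"] by simp_all
      have j0: "j0 \<le> en c0" using k c0' unfolding cut_def by force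
      have other: "\<kappa> c = st c" if c: "c \<in> K" "c \<noteq> c0" for c
      proof (rule ccontr)
        assume "\<kappa> c \<noteq> st c"
        then have lt: "st c < \<kappa> c" using k c unfolding cut_def by force
        have r: "1 \<le> st c" "st c \<le> int n" using c by (auto simp: KA_def)
        have ci: "c \<in> itype n K st \<kappa> (st c, \<kappa> c)" using c lt nst by (auto simp: itype_def)
        moreover have "finite (itype n K st \<kappa> (st c, \<kappa> c))" using CT by (simp add: itype_def)
        ultimately have "card (itype n K st \<kappa> (st c, \<kappa> c)) \<noteq> 0" by auto
        then have "(Emat n i0 j0 (st c) (\<kappa> c) :: nat) \<noteq> 0" using tE[OF r lt] by simp
        then have "st c = i0" "\<kappa> c = j0" unfolding Em[OF r] by (auto split: if_splits)
        then show False using ci c0 c by auto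
      qed
      have kkc: "\<kappa> c = kk c0 c" if "c \<in> K" for c using that other c0' by (auto simp: kk_def)
      have "iv K \<kappa> en = iv K (kk c0) en" unfolding iv_def by (rule Collect_cong) (metis kkc)
      then have NN: "N = Nk (kk c0)" unfolding Nk by (simp add: Nk_def)
      have "itype n K \<kappa> en d = itype n K (kk c0) en d" for d using kkc by (auto simp: itype_def)
      then have "cond i0 j0 A (en c0)" unfolding cond_def using sub_type[OF c0'(1,2) j0] tA by simp
      then have "c0 \<in> cuts i0 j0 A" using c0' j0 by (auto simp: cuts_def)
      then show "N \<in> (\<lambda>c0. Nk (kk c0)) ` cuts i0 j0 A" using NN by blast
    qed
  qed
  then show ?thesis by (simp add: bij_betw_same_card)
qed

end

section \<open>Hall numbers at q = 1\<close>

text \<open>The prime field, on natural numbers as the definition of Hall polynomials requires.\<close>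

definition Fp :: "nat \<Rightarrow> nat ring" where
  "Fp p = \<lparr>carrier = {0..<p}, mult = (\<lambda>x y. x * y mod p), one = 1, zero = 0, add = (\<lambda>x y. (x + y) mod p)\<rparr>"

lemma Fp_field:
  assumes p: "prime (p :: nat)" shows "field (Fp p)"
proof -
  have p1: "p > 1" using p by (rule prime_gt_1_nat)
  have cr: "cring (Fp p)"
  proof (rule cringI)
    show "abelian_group (Fp p)"
    proof (rule abelian_groupI)
      fix x assume x: "x \<in> carrier (Fp p)"
      then have "((p - x) mod p + x) mod p = 0" by (simp add: Fp_def mod_add_left_eq)
      then show "\<exists>y\<in>carrier (Fp p). y \<oplus>\<^bsub>Fp p\<^esub> x = \<zero>\<^bsub>Fp p\<^esub>"
        using p1 by (intro bexI[of _ "(p - x) mod p"]) (auto simp: Fp_def)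
    qed (use p1 in \<open>auto simp: Fp_def mod_add_left_eq mod_add_right_eq add_ac\<close>)
    show "Group.comm_monoid (Fp p)"
      by (rule comm_monoidI) (use p1 in \<open>auto simp: Fp_def mod_mult_left_eq mod_mult_right_eq mult_ac\<close>)
  qed (auto simp: Fp_def mod_add_eq mod_mult_left_eq mod_mult_right_eq algebra_simps)
  interpret cring "Fp p" by (rule cr)
  have "Units (Fp p) = carrier (Fp p) - {\<zero>\<^bsub>Fp p\<^esub>}"
  proof (intro equalityI subsetI)
    fix x assume x: "x \<in> Units (Fp p)"
    have "x \<noteq> 0"
    proof
      assume "x = 0"
      then obtain y where "0 * y mod p = 1" using x by (auto simp: Units_def Fp_def)
      then show False by simp
    qed
    then show "x \<in> carrier (Fp p) - {\<zero>\<^bsub>Fp p\<^esub>}" using x by (auto simp: Units_def Fp_def)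
  next
    fix x assume "x \<in> carrier (Fp p) - {\<zero>\<^bsub>Fp p\<^esub>}"
    then have x: "0 < x" "x < p" by (auto simp: Fp_def)
    then have "\<not> p dvd x" by (auto dest: dvd_imp_le)
    then have "coprime x p" using p by (metis coprime_commute prime_imp_coprime)
    then obtain y z where "x * y = p * z + 1" using bezout_nat[of x p] x by (auto simp: coprime_iff_gcd_eq_1)
    moreover have "(1 + p * z) mod p = 1" using p1 by (simp only: mod_mult_self2 mod_less)
    ultimately have "x * (y mod p) mod p = 1" by (metis add.commute mod_mult_right_eq)
    then show "x \<in> Units (Fp p)" using x p1
      by (auto simp: Units_def Fp_def mult.commute intro!: bexI[of _ "y mod p"])
  qed
  then show ?thesis by (rule cring_fieldI)
qed

lemma poly_diff_dvd: "(a - b) dvd (poly q a - poly q (b :: int))"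
proof (induction q)
  case (pCons c q)
  have "poly (pCons c q) a - poly (pCons c q) b = (a - b) * poly q a + b * (poly q a - poly q b)" by (simp add: algebra_simps)
  then show ?case using pCons by (auto intro: dvd_add)
qed simp

lemma Emat_Theta: "n \<ge> 1 \<Longrightarrow> i < j \<Longrightarrow> Emat n i j \<in> Theta_plus n"
  using Emat_per[of n i j] by (auto simp: Theta_plus_def Emat_iff)

text \<open>The difference of the two sides is divisible by \<open>p - 1\<close> for all primes \<open>p\<close>.\<close>

lemma hall_poly_one:
  assumes n: "n \<ge> 1" and \<phi>: "hall_polynomials n \<phi>" and b: "1 \<le> i0" "i0 \<le> int n" "i0 < j0"
    and A: "A \<in> Theta_plus n" and C: "C \<in> Theta_plus n"
  shows "poly (\<phi> (Emat n i0 j0) A C) 1 = int (card (hallrep.cuts n C i0 j0 A))"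
proof (rule ccontr)
  let ?q = "\<phi> (Emat n i0 j0) A C" and ?N = "int (card (hallrep.cuts n C i0 j0 A))"
  let ?d = "poly ?q 1 - ?N"
  assume ne: "poly ?q 1 \<noteq> ?N"
  have E: "Emat n i0 j0 \<in> Theta_plus n" using Emat_Theta[OF n b(3)] .
  have dvd: "int (p - 1) dvd ?d" if p: "prime p" for p :: nat
  proof -
    have p1: "p > 1" using p by (rule prime_gt_1_nat)
    interpret H: hallrep "Fp p" n C
      by (intro hallrep.intro hallrep_axioms.intro Fp_field[OF p] n finite_KA[OF C]) (simp add: Fp_def)
    have cd: "card (carrier (Fp p)) = p" by (simp add: Fp_def)
    have "poly ?q (int p) = int (hall_number n (Fp p) (Emat n i0 j0) A C)"
      using \<phi> E A C Fp_field[OF p] unfolding hall_polynomials_def by (metis H.finF cd)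
    then have 1: "int (p - 1) dvd poly ?q (int p) - ?N"
      using H.torus_count[of "Emat n i0 j0" A] H.fixed_count[OF b finite_KA[OF A] finite_KA[OF E]]
      by (simp add: H.hall_number_XX cd)
    have "int (p - 1) = int p - 1" using p1 by simp
    then have 2: "int (p - 1) dvd poly ?q (int p) - poly ?q 1" using poly_diff_dvd[of "int p" 1 ?q] by simp
    show ?thesis using dvd_diff[OF 1 2] by simp
  qed
  (* A prime beyond the nonzero difference contradicts divisibility by p - 1. *)
  obtain p :: nat where p: "prime p" "p > nat \<bar>?d\<bar> + 1" using bigger_prime by blast
  have "int (p - 1) \<le> \<bar>?d\<bar>" using dvd[OF p(1)] ne by (metis abs_of_nat dvd_imp_le_int eq_iff_diff_eq_0)
  then show False using p(2) by linarith
qed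

section \<open>Matrices as multisets\<close>

text \<open>Matrices in \<^const>\<open>Theta_plus\<close> correspond to multisets of pairs in \<^const>\<open>Bp\<close>, with inverse \<open>ms\<close>.\<close>

definition mat :: "nat \<Rightarrow> (int \<times> int) multiset \<Rightarrow> int \<Rightarrow> int \<Rightarrow> nat" where
  "mat n X k l = count X (nrm n k l)"

definition ms :: "nat \<Rightarrow> (int \<Rightarrow> int \<Rightarrow> nat) \<Rightarrow> (int \<times> int) multiset" where
  "ms n A = Abs_multiset (\<lambda>(i, j). if 1 \<le> i \<and> i \<le> int n \<and> i < j then A i j else 0)"

lemma nrm_shift: "nrm n (k + int n) (l + int n) = nrm n k l"
proof -
  have "(k + int n - 1) mod int n = (k - 1) mod int n" by (metis add_diff_eq diff_add_eq mod_add_self2)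
  then show ?thesis by (simp add: nrm_def Let_def)
qed

lemma nrm_idem: "n \<ge> 1 \<Longrightarrow> nrm n k l = (x, y) \<Longrightarrow> 1 \<le> x \<and> x \<le> int n \<and> y - x = l - k \<and> int n dvd (k - x)"
  using nrm_range[of n k l x y] nrmD[of n k l x y] by (auto simp: mod_eq_dvd_iff)

lemma nrm_eq:
  assumes n: "n \<ge> 1" and xy: "1 \<le> i" "i \<le> int n"
  shows "nrm n k l = (i, j) \<longleftrightarrow> int n dvd (k - i) \<and> l = j + (k - i)"
proof
  assume "nrm n k l = (i, j)"
  then show "int n dvd (k - i) \<and> l = j + (k - i)" using nrm_idem[OF n] by fastforce
next
  assume a: "int n dvd (k - i) \<and> l = j + (k - i)"
  obtain x y where e: "nrm n k l = (x, y)" by force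
  note i = nrm_idem[OF n e]
  have "int n dvd (x - i)"
  proof -
    have "x - i = (k - i) - (k - x)" by simp
    then show ?thesis using a i by (metis dvd_diff)
  qed
  moreover have "\<bar>x - i\<bar> < int n" using i xy by auto
  ultimately have "x = i" using zdvd_imp_le[of "int n" "\<bar>x - i\<bar>"] by force
  then show "nrm n k l = (i, j)" using e i a by auto
qed

lemma mat_Theta:
  assumes n: "n \<ge> 1" and X: "set_mset X \<subseteq> Bp n" shows "mat n X \<in> Theta_plus n"
proof -
  have le: "mat n X k l = 0" if "l \<le> k" for k l
  proof -
    obtain x y where e: "nrm n k l = (x, y)" by force
    have "(x, y) \<notin> Bp n" using nrm_idem[OF n e] that by (auto simp: Bp_def)
    then show ?thesis using X by (auto simp: mat_def e not_in_iff[symmetric])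
  qed
  have nz: "(\<exists>c\<in>set_mset X. nrm n k l = c)" if "mat n X k l \<noteq> 0" for k l
    using that by (auto simp: mat_def)
  have r: "finite {l. mat n X k l \<noteq> 0}" for k
  proof (rule finite_subset)
    show "{l. mat n X k l \<noteq> 0} \<subseteq> (\<lambda>c. snd c - fst c + k) ` set_mset X"
    proof
      fix l assume "l \<in> {l. mat n X k l \<noteq> 0}"
      then have "mat n X k l \<noteq> 0" by simp
      then obtain c where c: "c \<in> set_mset X" "nrm n k l = c" using nz by blast
      then have "l = snd c - fst c + k" using nrm_idem[OF n, of k l "fst c" "snd c"] by auto
      then show "l \<in> (\<lambda>c. snd c - fst c + k) ` set_mset X" using c by blast
    qed
  qed simp
  have cc: "finite {k. mat n X k l \<noteq> 0}" for l
  proof (rule finite_subset)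
    show "{k. mat n X k l \<noteq> 0} \<subseteq> (\<lambda>c. l - (snd c - fst c)) ` set_mset X"
    proof
      fix k assume "k \<in> {k. mat n X k l \<noteq> 0}"
      then have "mat n X k l \<noteq> 0" by simp
      then obtain c where c: "c \<in> set_mset X" "nrm n k l = c" using nz by blast
      then have "k = l - (snd c - fst c)" using nrm_idem[OF n, of k l "fst c" "snd c"] by auto
      then show "k \<in> (\<lambda>c. l - (snd c - fst c)) ` set_mset X" using c by blast
    qed
  qed simp
  show ?thesis using le r cc by (auto simp: Theta_plus_def per_mats_def mat_def nrm_shift)
qed

lemma count_ms:
  assumes A: "A \<in> Theta_plus n"
  shows "count (ms n A) (i, j) = (if 1 \<le> i \<and> i \<le> int n \<and> i < j then A i j else 0)"
proof -
  have "finite {j. A i j \<noteq> 0}" for i using A by (auto simp: Theta_plus_def per_mats_def)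
  then have "finite (SIGMA i:{1..int n}. {j. A i j \<noteq> 0})" by auto
  moreover have "{x. 0 < (case x of (i, j) \<Rightarrow> if 1 \<le> i \<and> i \<le> int n \<and> i < j then A i j else 0)} \<subseteq> (SIGMA i:{1..int n}. {j. A i j \<noteq> 0})"
    by (auto split: if_splits)
  ultimately have "finite {x. 0 < (case x of (i, j) \<Rightarrow> if 1 \<le> i \<and> i \<le> int n \<and> i < j then A i j else 0)}"
    by (rule finite_subset[rotated])
  then show ?thesis unfolding ms_def by (subst count_Abs_multiset) auto
qed

lemma ms_Bp: "A \<in> Theta_plus n \<Longrightarrow> set_mset (ms n A) \<subseteq> Bp n"
proof
  fix c assume "A \<in> Theta_plus n" "c \<in># ms n A"
  then show "c \<in> Bp n" using count_ms[of A n "fst c" "snd c"]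
    by (cases c) (auto simp: Bp_def count_greater_zero_iff[symmetric] simp del: count_greater_zero_iff split: if_splits)
qed

lemma mat_ms: assumes n: "n \<ge> 1" and A: "A \<in> Theta_plus n" shows "mat n (ms n A) = A"
proof (intro ext)
  fix k l
  obtain x y where e: "nrm n k l = (x, y)" by force
  note i = nrm_idem[OF n e]
  then obtain s where s: "k = x + s * int n" by (metis add.commute diff_add_cancel dvdE mult.commute)
  have "\<And>i j. A (i + int n) (j + int n) = A i j" using A by (auto simp: Theta_plus_def per_mats_def)
  from per_shift[of A n, OF this, of x s y] have "A k l = A x y" using s i by (simp add: algebra_simps)
  moreover have "A x y = 0" if "\<not> x < y" using A that by (auto simp: Theta_plus_def)
  ultimately show "mat n (ms n A) k l = A k l" using i by (auto simp: mat_def e count_ms[OF A])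
qed

lemma mat_Bp: "(x, y) \<in> Bp n \<Longrightarrow> mat n X x y = count X (x, y)"
  by (auto simp: mat_def Bp_def nrm_self)

lemma mat_inj: "set_mset X \<subseteq> Bp n \<Longrightarrow> set_mset Y \<subseteq> Bp n \<Longrightarrow> mat n X = mat n Y \<longleftrightarrow> X = Y"
proof
  assume X: "set_mset X \<subseteq> Bp n" "set_mset Y \<subseteq> Bp n" and e: "mat n X = mat n Y"
  show "X = Y"
  proof (rule multiset_eqI)
    fix c show "count X c = count Y c"
    proof (cases "c \<in> Bp n")
      case True then show ?thesis using mat_Bp[of "fst c" "snd c" n X] mat_Bp[of "fst c" "snd c" n Y] e by simp
    next
      case False
      then have "c \<notin># X" "c \<notin># Y" using X by auto
      then show ?thesis by (simp add: not_in_iff)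
    qed
  qed
qed simp

lemma mat_single: "n \<ge> 1 \<Longrightarrow> (i, j) \<in> Bp n \<Longrightarrow> mat n {#(i, j)#} = Emat n i j"
proof (intro ext)
  fix k l assume n: "n \<ge> 1" and b: "(i, j) \<in> Bp n"
  then have "nrm n k l = (i, j) \<longleftrightarrow> int n dvd (k - i) \<and> l = j + (k - i)" by (intro nrm_eq) (auto simp: Bp_def)
  then show "mat n {#(i, j)#} k l = Emat n i j k l" by (auto simp: mat_def Emat_iff)
qed

lemma mat_empty: "mat n {#} = (\<lambda>i j. 0)" by (intro ext) (simp add: mat_def)

text \<open>In terms of multisets, \<open>C\<close> arises from \<open>A\<close> by adding \<open>(i0, j0)\<close> or by prolonging an interval \<open>[j0, l)\<close> of \<open>A\<close> to
  \<open>[i0, l)\<close>. These are the two kinds of terms in the rule of a family.\<close>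

lemma cond_iff:
  assumes n: "n \<ge> 1" and b: "(i0, j0) \<in> Bp n" and A: "set_mset A \<subseteq> Bp n" and C: "set_mset C \<subseteq> Bp n" and l: "j0 \<le> l"
  shows "hallrep.cond n (mat n C) i0 j0 (mat n A) l \<longleftrightarrow> add_mset (i0, l) A = C + (if j0 < l then {#nrm n j0 l#} else {#})"
proof -
  interpret H: hallrep "Fp 2" n "mat n C"
    by (intro hallrep.intro hallrep_axioms.intro Fp_field two_is_prime_nat n finite_KA[OF mat_Theta[OF n C]]) (simp add: Fp_def)
  let ?L = "add_mset (i0, l) A" and ?R = "C + (if j0 < l then {#nrm n j0 l#} else {#})"
  have il: "(i0, l) \<in> Bp n" using b l by (auto simp: Bp_def)
  obtain u w where uw: "nrm n j0 l = (u, w)" by force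
  have "j0 < l \<Longrightarrow> (u, w) \<in> Bp n" using nrm_idem[OF n uw] by (auto simp: Bp_def)
  then have LR: "set_mset ?L \<subseteq> Bp n" "set_mset ?R \<subseteq> Bp n" using il A C by (auto simp: uw)
  have cnt: "(mat n A x y + (if (x, y) = (i0, l) then 1 else 0) = mat n C x y + (if j0 < l \<and> nrm n j0 l = (x, y) then 1 else 0)) \<longleftrightarrow> count ?L (x, y) = count ?R (x, y)"
    if "(x, y) \<in> Bp n" for x y
    using that by (auto simp: mat_Bp)
  have "H.cond i0 j0 (mat n A) l \<longleftrightarrow> (\<forall>x y. (x, y) \<in> Bp n \<longrightarrow> count ?L (x, y) = count ?R (x, y))"
    unfolding H.cond_def using cnt by (auto simp: Bp_def simp del: count_add_mset count_union)
  also have "\<dots> \<longleftrightarrow> ?L = ?R"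
  proof
    assume a: "\<forall>x y. (x, y) \<in> Bp n \<longrightarrow> count ?L (x, y) = count ?R (x, y)"
    show "?L = ?R"
    proof (rule multiset_eqI)
      fix c show "count ?L c = count ?R c"
      proof (cases "c \<in> Bp n")
        case True then show ?thesis using a by (cases c) auto
      next
        case False
        then have "c \<notin># ?L" "c \<notin># ?R" using LR by blast+
        then show ?thesis by (simp only: not_in_iff)
      qed
    qed
  qed simp
  finally show ?thesis .
qed

lemma cuts_eq:
  assumes n: "n \<ge> 1" and b: "(i0, j0) \<in> Bp n" and A: "set_mset A \<subseteq> Bp n" and C: "set_mset C \<subseteq> Bp n"
  shows "hallrep.cuts n (mat n C) i0 j0 (mat n A) =
    {(i0, l, m) | l m. j0 \<le> l \<and> m < count C (i0, l) \<and> add_mset (i0, l) A = C + (if j0 < l then {#nrm n j0 l#} else {#})}"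
proof -
  interpret H: hallrep "Fp 2" n "mat n C"
    by (intro hallrep.intro hallrep_axioms.intro Fp_field two_is_prime_nat n finite_KA[OF mat_Theta[OF n C]]) (simp add: Fp_def)
  have "(i, l, m) \<in> H.cuts i0 j0 (mat n A) \<longleftrightarrow> i = i0 \<and> j0 \<le> l \<and> m < count C (i0, l) \<and> add_mset (i0, l) A = C + (if j0 < l then {#nrm n j0 l#} else {#})" for i l m
  proof (cases "i = i0 \<and> j0 \<le> l")
    case True
    then have "(i0, l) \<in> Bp n" using b by (auto simp: Bp_def)
    then have "(i0, l, m) \<in> KA n (mat n C) \<longleftrightarrow> m < count C (i0, l)" by (auto simp: KA_def mat_Bp) (auto simp: Bp_def)
    then show ?thesis using True cond_iff[OF n b A C, of l] by (simp add: H.cuts_def)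
  qed (auto simp: H.cuts_def)
  note mem = this
  show ?thesis
  proof (rule Set.set_eqI)
    fix x :: "int \<times> int \<times> nat" obtain i l m where x: "x = (i, l, m)" by (cases x)
    show "x \<in> H.cuts i0 j0 (mat n A) \<longleftrightarrow> x \<in> {(i0, l, m) | l m. j0 \<le> l \<and> m < count C (i0, l) \<and> add_mset (i0, l) A = C + (if j0 < l then {#nrm n j0 l#} else {#})}"
      unfolding x mem by blast
  qed
qed

lemma set_single_param:
  assumes "\<And>l. J l \<Longrightarrow> P l \<Longrightarrow> l = l0" "J l0" "P l0"
  shows "{(i, l, m) | l m. J l \<and> m < f l \<and> P l} = (\<lambda>m. (i, l0, m)) ` {0..<f l0 :: nat}"
proof (intro equalityI subsetI)
  fix x assume "x \<in> {(i, l, m) | l m. J l \<and> m < f l \<and> P l}"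
  then obtain l m where x: "x = (i, l, m)" "J l" "m < f l" "P l" by blast
  then have "l = l0" using assms(1) by blast
  then show "x \<in> (\<lambda>m. (i, l0, m)) ` {0..<f l0}" using x by simp
next
  fix x assume "x \<in> (\<lambda>m. (i, l0, m)) ` {0..<f l0}"
  then obtain m where "x = (i, l0, m)" "m < f l0" by auto
  then show "x \<in> {(i, l, m) | l m. J l \<and> m < f l \<and> P l}" using assms(2,3) by blast
qed

context
  fixes n :: nat and b :: "int \<times> int" and A C :: "(int \<times> int) multiset"
  assumes n: "n \<ge> 1" and b: "b \<in> Bp n" and A: "set_mset A \<subseteq> Bp n" and C: "set_mset C \<subseteq> Bp n"
begin

interpretation P: partial_mult "Bp n" "pm n" by (rule pm_Bp)

abbreviation "cutn \<equiv> card (hallrep.cuts n (mat n C) (fst b) (snd b) (mat n A))"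
abbreviation "new c \<equiv> add_mset (the (pm n b c)) (A - {#c#})"

lemma okc:
  assumes c: "c \<in> P.ok b A"
  shows "the (pm n b c) = (fst b, snd c + (snd b - fst c))" "nrm n (snd b) (snd c + (snd b - fst c)) = c"
    "snd b < snd c + (snd b - fst c)" "c \<noteq> the (pm n b c)"
proof -
  have cB: "c \<in> Bp n" and d: "int n dvd (snd b - fst c)" using c A by (auto simp: P.ok_def pm_def split: if_splits)
  show 1: "the (pm n b c) = (fst b, snd c + (snd b - fst c))" using d by (simp add: pm_def)
  show "nrm n (snd b) (snd c + (snd b - fst c)) = c"
    using nrm_eq[OF n, of "fst c" "snd b" "snd c + (snd b - fst c)" "snd c"] cB d by (auto simp: Bp_def)
  show "snd b < snd c + (snd b - fst c)" using cB by (auto simp: Bp_def)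
  show "c \<noteq> the (pm n b c)" unfolding 1 using b by (auto simp: Bp_def prod_eq_iff)
qed

lemma cut_card1: "C = add_mset b A \<Longrightarrow> cutn = count C b"
proof -
  assume C': "C = add_mset b A"
  obtain i0 j0 where b0: "b = (i0, j0)" by force
  have "l = j0" if "j0 \<le> l" "add_mset (i0, l) A = C + (if j0 < l then {#nrm n j0 l#} else {#})" for l
  proof (rule ccontr)
    assume "l \<noteq> j0"
    then have "size (add_mset (i0, l) A) = size (C + {#nrm n j0 l#})" using that by simp
    then show False by (simp add: C')
  qed
  then have "hallrep.cuts n (mat n C) (fst b) (snd b) (mat n A) = (\<lambda>m. (i0, j0, m)) ` {0..<count C b}"
    using cuts_eq[OF n b[unfolded b0] A C] by (auto simp: b0 C')
  then show ?thesis by (simp add: card_image inj_on_def)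
qed

lemma cut_card2:
  assumes c: "c \<in> P.ok b A" and C': "C = new c"
  shows "cutn = count C (the (pm n b c))"
proof -
  obtain i0 j0 where b0: "b = (i0, j0)" by force
  let ?l0 = "snd c + (snd b - fst c)"
  note o = okc[OF c]
  have cA: "c \<in># A" using c by (rule P.okD)
  have "l = ?l0" if l: "j0 \<le> l" "add_mset (i0, l) A = C + (if j0 < l then {#nrm n j0 l#} else {#})" for l
  proof -
    have sz: "size C = size A" using C' cA by (simp add: size_Suc_Diff1)
    have "j0 < l"
    proof (rule ccontr)
      assume "\<not> j0 < l"
      then have "size (add_mset (i0, l) A) = size C" using l by simp
      then show False using sz by simp
    qed
    then have e: "add_mset (i0, l) A = add_mset (nrm n j0 l) C" using l by simp
    have "add_mset (i0, l) (add_mset c (A - {#c#})) = add_mset (nrm n j0 l) (add_mset (the (pm n b c)) (A - {#c#}))"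
      using e cA unfolding C' by simp
    then have "{#(i0, l), c#} + (A - {#c#}) = {#nrm n j0 l, the (pm n b c)#} + (A - {#c#})" by simp
    then have "{#(i0, l), c#} = {#nrm n j0 l, the (pm n b c)#}" by (simp only: add_right_cancel)
    then have "the (pm n b c) \<in># {#(i0, l), c#}" by simp
    then have "the (pm n b c) = (i0, l)" using o(4) by auto
    then show ?thesis using o(1) by simp
  qed
  moreover have "add_mset (i0, ?l0) A = C + {#nrm n j0 ?l0#}"
    using o(1,2) cA unfolding C' by (simp add: b0)
  ultimately have "hallrep.cuts n (mat n C) (fst b) (snd b) (mat n A) = (\<lambda>m. (i0, ?l0, m)) ` {0..<count C (i0, ?l0)}"
    unfolding b0 fst_conv snd_conv cuts_eq[OF n b[unfolded b0] A C]
    by (intro set_single_param) (use o(3) in \<open>auto simp: b0\<close>)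
  then show ?thesis using o(1) by (simp add: card_image inj_on_def b0)
qed

lemma cut_card3:
  assumes "C \<noteq> add_mset b A" "\<And>c. c \<in> P.ok b A \<Longrightarrow> C \<noteq> new c"
  shows "cutn = 0"
proof -
  obtain i0 j0 where b0: "b = (i0, j0)" by force
  have "False" if l: "j0 \<le> l" "add_mset (i0, l) A = C + (if j0 < l then {#nrm n j0 l#} else {#})" for l
  proof (cases "j0 < l")
    case False
    then have "l = j0" using l by simp
    then show False using l assms(1) by (simp add: b0)
  next
    case True
    obtain u w where uw: "nrm n j0 l = (u, w)" by force
    note i = nrm_idem[OF n uw]
    have e: "add_mset (i0, l) A = add_mset (u, w) C" using l True by (simp add: uw)
    have ne: "(u, w) \<noteq> (i0, l)" using i b by (auto simp: b0 Bp_def)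
    then have mem: "(u, w) \<in># A" using e by (metis insert_noteq_member)
    have pmu: "pm n b (u, w) = Some (i0, l)" using i by (simp add: pm_def b0)
    have "(u, w) \<in> P.ok b A" using mem pmu by (simp add: P.ok_def)
    moreover have "C = new (u, w)"
    proof -
      have "add_mset (u, w) C = add_mset (i0, l) (add_mset (u, w) (A - {#(u, w)#}))" using e mem by simp
      then have "add_mset (u, w) C = add_mset (u, w) (add_mset (i0, l) (A - {#(u, w)#}))" by (simp add: add_mset_commute)
      then show ?thesis by (simp add: pmu)
    qed
    ultimately show False using assms(2) by blast
  qed
  then have "hallrep.cuts n (mat n C) (fst b) (snd b) (mat n A) = {}"
    unfolding b0 fst_conv snd_conv cuts_eq[OF n b[unfolded b0] A C] by blast
  then show ?thesis by simp
qed

text \<open>The structure constants of the rule of a family, in the form in which they appear as coefficients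
  of \<open>u\<^sub>C\<close>: at most one of the summands is nonzero, and it counts the copies that can be cut.\<close>

lemma cut_sum:
  "cutn = (count A b + 1) * (if C = add_mset b A then 1 else 0) +
    (\<Sum>c\<in>P.ok b A. (count (A - {#c#}) (the (pm n b c)) + 1) * (if C = new c then 1 else 0))"
proof -
  have ex: "\<not> (C = add_mset b A \<and> C = new c)" if "c \<in> P.ok b A" for c
  proof
    assume a: "C = add_mset b A \<and> C = new c"
    then have "size (add_mset b A) = size (new c)" by metis
    then show False using P.okD[OF that] by (simp add: size_Suc_Diff1)
  qed
  have un: "c = c'" if c: "c \<in> P.ok b A" "c' \<in> P.ok b A" "new c = new c'" for c c'
  proof (rule ccontr)
    assume ne: "c \<noteq> c'"
    have cA: "c \<in># A" "c' \<in># A" using c by (auto dest: P.okD)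
    have pne: "the (pm n b c) \<noteq> the (pm n b c')"
    proof
      assume "the (pm n b c) = the (pm n b c')"
      then have "snd c + (snd b - fst c) = snd c' + (snd b - fst c')" using okc(1)[OF c(1)] okc(1)[OF c(2)] by simp
      then show False using okc(2)[OF c(1)] okc(2)[OF c(2)] ne by metis
    qed
    have "count (new c) c = count A c - 1" using okc(4)[OF c(1)] by simp
    moreover have "count (new c') c \<ge> count A c" using ne by simp
    moreover have "count A c > 0" using cA by (simp only: count_greater_zero_iff)
    moreover have "count (new c) c = count (new c') c" by (simp only: c(3))
    ultimately show False by linarith
  qed
  define K where "K c = count (A - {#c#}) (the (pm n b c)) + 1" for c
  define N where "N c = new c" for c
  have ex': "C \<noteq> N c" if "C = add_mset b A" "c \<in> P.ok b A" for c unfolding N_def using ex[OF that(2)] that(1) by blast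
  have un': "c = c'" if "c \<in> P.ok b A" "c' \<in> P.ok b A" "N c = N c'" for c c' using un[OF that(1,2)] that(3) by (simp only: N_def)
  have cn: "cutn = K c" if "c \<in> P.ok b A" "C = N c" for c
  proof -
    have "cutn = count C (the (pm n b c))" by (rule cut_card2[OF that(1)]) (use that(2) in \<open>simp only: N_def\<close>)
    also have "\<dots> = K c" unfolding that(2) N_def K_def by (simp only: count_add_mset if_True) simp
    finally show ?thesis .
  qed
  (* The sizes of the multisets tell the first case from the second, and C determines c in the second. *)
  consider "C = add_mset b A" | c where "c \<in> P.ok b A" "C = N c" | "C \<noteq> add_mset b A" "\<And>c. c \<in> P.ok b A \<Longrightarrow> C \<noteq> N c" by blast
  then have "cutn = (count A b + 1) * (if C = add_mset b A then 1 else 0) + (\<Sum>c\<in>P.ok b A. K c * (if C = N c then 1 else 0))"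
  proof cases
    case 1
    then have "(\<Sum>c\<in>P.ok b A. K c * (if C = N c then 1 else 0)) = 0"
      using ex' by (intro sum.neutral) auto
    moreover have "cutn = count A b + 1" unfolding cut_card1[OF 1] unfolding 1 by simp
    ultimately show ?thesis using 1 by simp
  next
    case (2 c)
    have "K c' * (if C = N c' then 1 else 0) = (if c' = c then K c else 0)" if "c' \<in> P.ok b A" for c'
      using un'[OF 2(1) that] 2(2) by (cases "c' = c") auto
    then have "(\<Sum>c'\<in>P.ok b A. K c' * (if C = N c' then 1 else 0)) = (\<Sum>c'\<in>P.ok b A. if c' = c then K c else 0)"
      by (rule sum.cong[OF refl])
    also have "\<dots> = K c" using 2(1) by simp
    finally have "(\<Sum>c'\<in>P.ok b A. K c' * (if C = N c' then 1 else 0)) = K c" .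
    moreover have "C \<noteq> add_mset b A" using ex'[OF _ 2(1)] 2(2) by metis
    ultimately show ?thesis using cn[OF 2] by simp
  next
    case 3
    have "(\<Sum>c\<in>P.ok b A. K c * (if C = N c then 1 else 0)) = 0"
      by (intro sum.neutral) (use 3(2) in auto)
    moreover have "cutn = 0" by (rule cut_card3) (use 3 in \<open>simp_all only: N_def not_False_eq_True\<close>)
    ultimately show ?thesis using 3(1) by simp
  qed
  then show ?thesis unfolding K_def N_def .
qed

end

section \<open>The Hall algebra at v = 1\<close>

lemma at_one_sup: "finite S \<Longrightarrow> Poly_Mapping.keys p \<subseteq> S \<Longrightarrow> at_one p = (\<Sum>k\<in>S. Poly_Mapping.lookup p k)"
  unfolding at_one_def by (rule sum.mono_neutral_left) (auto simp: in_keys_iff)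

lemma at_one_add: "at_one (p + q) = at_one p + at_one q"
proof -
  let ?S = "Poly_Mapping.keys p \<union> Poly_Mapping.keys q"
  have "Poly_Mapping.keys (p + q) \<subseteq> ?S" by (rule keys_add)
  then show ?thesis by (simp add: at_one_sup[of ?S] lookup_add sum.distrib)
qed

lemma at_one_zero [simp]: "at_one 0 = 0" by (simp add: at_one_def)

lemma at_one_single: "at_one (Poly_Mapping.single k a) = a"
  by (subst at_one_sup[of "{k}"]) (auto simp: keys_single)

lemma at_one_sum: "at_one (\<Sum>i\<in>I. f i) = (\<Sum>i\<in>I. at_one (f i))"
  by (induction I rule: infinite_finite_induct) (auto simp: at_one_add)

text \<open>The power of \<open>v\<close> in front of the Hall polynomial specializes to 1.\<close>

lemma at_one_hall: "at_one (hall_const n \<phi> A B C) = poly (\<phi> A B C) 1"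
proof -
  have "v_pow e * in_v2 q = (\<Sum>k\<le>Polynomial.degree q. Poly_Mapping.single (e + 2 * int k) (Polynomial.coeff q k))" for e q
    by (simp add: v_pow_def in_v2_def sum_distrib_left mult_single)
  then show ?thesis by (simp add: hall_const_def at_one_sum at_one_single poly_altdef)
qed

lemma hall_Q_sel: "carrier (hall_Q n \<phi>) = {f. finite {x. f x \<noteq> 0} \<and> {x. f x \<noteq> 0} \<subseteq> Theta_plus n}"
  "f \<oplus>\<^bsub>hall_Q n \<phi>\<^esub> g = (\<lambda>x. f x + g x)" "r \<odot>\<^bsub>hall_Q n \<phi>\<^esub> f = (\<lambda>x. r * f x)" "\<one>\<^bsub>hall_Q n \<phi>\<^esub> = bvec (\<lambda>i j. 0)"
  by (auto simp: hall_Q_def hall_at_one_def basis_alg_def bvec_def)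

lemma hall_mult_bvec:
  "bvec A \<otimes>\<^bsub>hall_Q n \<phi>\<^esub> bvec B = (\<lambda>C. if C \<in> Theta_plus n then of_int (poly (\<phi> A B C) 1) else 0)"
proof -
  have "{x. bvec A x \<noteq> (0 :: rat)} = {A}" "{x. bvec B x \<noteq> (0 :: rat)} = {B}" by (auto simp: bvec_def)
  then show ?thesis by (auto simp: hall_Q_def hall_at_one_def basis_alg_def at_one_hall bvec_def)
qed

lemma bvec_hall: "A \<in> Theta_plus n \<Longrightarrow> bvec A \<in> carrier (hall_Q n \<phi>)"
  by (auto simp: hall_Q_sel bvec_def)

lemma hall_hom_sum:
  assumes h: "h \<in> alg_hom (hall_Q n \<phi>) T" and T: "Qalg T" and S: "finite S" and C: "\<And>i. i \<in> S \<Longrightarrow> D i \<in> Theta_plus n"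
  shows "(\<lambda>x. \<Sum>i\<in>S. r i * bvec (D i) x) \<in> carrier (hall_Q n \<phi>) \<and>
    h (\<lambda>x. \<Sum>i\<in>S. r i * bvec (D i) x) = (\<Oplus>\<^bsub>T\<^esub>i\<in>S. r i \<odot>\<^bsub>T\<^esub> h (bvec (D i)))"
  using S C
proof (induction S rule: finite_induct)
  case empty
  interpret T: Qalg T by fact
  have "(\<lambda>x. 0) \<in> carrier (hall_Q n \<phi>)" by (simp add: hall_Q_sel)
  moreover from this have "h (\<lambda>x. 0) = \<zero>\<^bsub>T\<^esub>" using alg_homD(4)[OF h, of "\<lambda>x. 0" 0] alg_homD(1)[OF h] by (simp add: hall_Q_sel)
  ultimately show ?case by (simp add: T.finsum_empty)
next
  case (insert i S)
  interpret T: Qalg T by fact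
  let ?f = "\<lambda>x. \<Sum>i\<in>S. r i * bvec (D i) x"
  have IH: "?f \<in> carrier (hall_Q n \<phi>)" "h ?f = (\<Oplus>\<^bsub>T\<^esub>i\<in>S. r i \<odot>\<^bsub>T\<^esub> h (bvec (D i)))" using insert by auto
  have b: "bvec (D i) \<in> carrier (hall_Q n \<phi>)" using insert by (intro bvec_hall) auto
  have rb: "r i \<odot>\<^bsub>hall_Q n \<phi>\<^esub> bvec (D i) \<in> carrier (hall_Q n \<phi>)"
    using b by (auto simp: hall_Q_sel intro: finite_subset[OF _ finite.insertI[OF finite.emptyI, of "D i"]])
  have e: "(\<lambda>x. \<Sum>i\<in>insert i S. r i * bvec (D i) x) = r i \<odot>\<^bsub>hall_Q n \<phi>\<^esub> bvec (D i) \<oplus>\<^bsub>hall_Q n \<phi>\<^esub> ?f"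
    using insert by (simp add: hall_Q_sel)
  have hb: "j \<in> insert i S \<Longrightarrow> h (bvec (D j)) \<in> carrier T" for j
    using insert by (intro alg_homD(1)[OF h] bvec_hall) auto
  have "r i \<odot>\<^bsub>hall_Q n \<phi>\<^esub> bvec (D i) \<oplus>\<^bsub>hall_Q n \<phi>\<^esub> ?f \<in> carrier (hall_Q n \<phi>)"
  proof -
    have "{x. r i * bvec (D i) x + ?f x \<noteq> 0} \<subseteq> insert (D i) {x. ?f x \<noteq> 0}" by (auto simp: bvec_def)
    then show ?thesis using IH(1) insert(4)[of i] unfolding hall_Q_sel
      by (auto intro: finite_subset)
  qed
  moreover have "h (r i \<odot>\<^bsub>hall_Q n \<phi>\<^esub> bvec (D i) \<oplus>\<^bsub>hall_Q n \<phi>\<^esub> ?f) = r i \<odot>\<^bsub>T\<^esub> h (bvec (D i)) \<oplus>\<^bsub>T\<^esub> (\<Oplus>\<^bsub>T\<^esub>i\<in>S. r i \<odot>\<^bsub>T\<^esub> h (bvec (D i)))"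
    using alg_homD(2)[OF h rb IH(1)] alg_homD(4)[OF h b] IH(2) by simp
  ultimately show ?case unfolding e using insert(1,2) hb by (subst T.finsum_insert) auto
qed

text \<open>The coefficient of \<open>u\<^sub>C\<close> in \<open>u\<^sub>b u\<^sub>A\<close> is the number of cuts by \<open>hall_poly_one\<close>, hence the one prescribed by
  the recursion by \<open>cut_sum\<close>.\<close>

lemma hall_fam:
  assumes n: "n \<ge> 1" and \<phi>: "hall_polynomials n \<phi>" and T: "Qalg T" and h: "h \<in> alg_hom (hall_Q n \<phi>) T"
  shows "partial_mult.fam (Bp n) (pm n) T (\<lambda>X. h (bvec (mat n X)))"
proof -
  interpret P: partial_mult "Bp n" "pm n" by (rule pm_Bp)
  interpret T: Qalg T by fact
  have bc: "bvec (mat n X) \<in> carrier (hall_Q n \<phi>)" if "set_mset X \<subseteq> Bp n" for X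
    by (rule bvec_hall[OF mat_Theta[OF n that]])
  show ?thesis unfolding P.fam_def P.clos_def
  proof (intro conjI allI impI ballI)
    show "h (bvec (mat n X)) \<in> carrier T" if "set_mset X \<subseteq> Bp n" for X using alg_homD(1)[OF h bc[OF that]] .
    show "h (bvec (mat n {#})) = \<one>\<^bsub>T\<^esub>" using alg_homD(5)[OF h] by (simp add: mat_empty hall_Q_sel)
  next
    fix b A assume b: "b \<in> Bp n" and A: "set_mset A \<subseteq> Bp n"
    let ?new = "\<lambda>c. add_mset (the (pm n b c)) (A - {#c#})"
    define D where "D o' = (case o' of None \<Rightarrow> add_mset b A | Some c \<Rightarrow> ?new c)" for o'
    define r :: "_ \<Rightarrow> rat" where "r o' = (case o' of None \<Rightarrow> of_nat (count A b + 1) | Some c \<Rightarrow> of_nat (count (A - {#c#}) (the (pm n b c)) + 1))" for o'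
    let ?S = "insert None (Some ` P.ok b A)"
    have DB: "set_mset (D o') \<subseteq> Bp n" if "o' \<in> ?S" for o'
      using that b A P.ok_closed[OF b A] P.set_diff[OF A] unfolding D_def by (auto simp: subset_eq)
    have "bvec (mat n {#b#}) \<otimes>\<^bsub>hall_Q n \<phi>\<^esub> bvec (mat n A) = (\<lambda>x. \<Sum>o'\<in>?S. r o' * bvec (mat n (D o')) x)"
    proof
      fix x
      show "(bvec (mat n {#b#}) \<otimes>\<^bsub>hall_Q n \<phi>\<^esub> bvec (mat n A)) x = (\<Sum>o'\<in>?S. r o' * bvec (mat n (D o')) x)"
      proof (cases "x \<in> Theta_plus n")
        case False
        then have "bvec (mat n (D o')) x = (0 :: rat)" if "o' \<in> ?S" for o'
          using mat_Theta[OF n DB[OF that]] by (auto simp: bvec_def)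
        then have "(\<Sum>o'\<in>?S. r o' * bvec (mat n (D o')) x) = 0" by (intro sum.neutral ballI) (simp only: mult_zero_right)
        then show ?thesis using False by (simp add: hall_mult_bvec)
      next
        case True
        define C where "C = ms n x"
        have C: "set_mset C \<subseteq> Bp n" and xC: "x = mat n C" using ms_Bp[OF True] mat_ms[OF n True] by (auto simp: C_def)
        have "poly (\<phi> (mat n {#b#}) (mat n A) x) 1 = int (card (hallrep.cuts n (mat n C) (fst b) (snd b) (mat n A)))"
          using hall_poly_one[OF n \<phi> _ _ _ mat_Theta[OF n A] True, of "fst b" "snd b"] b mat_single[OF n, of "fst b" "snd b"]
          by (auto simp: Bp_def xC)
        then have "(bvec (mat n {#b#}) \<otimes>\<^bsub>hall_Q n \<phi>\<^esub> bvec (mat n A)) x = of_nat (card (hallrep.cuts n (mat n C) (fst b) (snd b) (mat n A)))"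
          using True by (simp add: hall_mult_bvec)
        also have "\<dots> = of_nat ((count A b + 1) * (if C = add_mset b A then 1 else 0) +
          (\<Sum>c\<in>P.ok b A. (count (A - {#c#}) (the (pm n b c)) + 1) * (if C = ?new c then 1 else 0)))"
          by (simp only: cut_sum[OF n b A C])
        also have "\<dots> = r None * bvec (mat n (D None)) x + (\<Sum>c\<in>P.ok b A. r (Some c) * bvec (mat n (D (Some c))) x)"
        proof -
          have 1: "bvec (mat n (D o')) x = (if C = D o' then 1 else 0 :: rat)" if "o' \<in> ?S" for o'
            using mat_inj[OF C DB[OF that]] by (auto simp: bvec_def xC)
          have "r None * bvec (mat n (D None)) x = of_nat ((count A b + 1) * (if C = add_mset b A then 1 else 0))"
            using 1[of None] by (simp add: r_def D_def)
          moreover have "r (Some c) * bvec (mat n (D (Some c))) x = of_nat ((count (A - {#c#}) (the (pm n b c)) + 1) * (if C = ?new c then 1 else 0))"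
            if "c \<in> P.ok b A" for c
            using 1[of "Some c"] that by (simp add: r_def D_def del: count_diff)
          ultimately show ?thesis by (simp only: of_nat_add of_nat_sum cong: sum.cong)
        qed
        also have "\<dots> = (\<Sum>o'\<in>?S. r o' * bvec (mat n (D o')) x)"
          by (subst sum.insert) (auto simp: sum.reindex)
        finally show ?thesis .
      qed
    qed
    then have "h (bvec (mat n {#b#})) \<otimes>\<^bsub>T\<^esub> h (bvec (mat n A)) = h (\<lambda>x. \<Sum>o'\<in>?S. r o' * bvec (mat n (D o')) x)"
      using alg_homD(3)[OF h bc bc, of "{#b#}" A] b A by simp
    also have "\<dots> = (\<Oplus>\<^bsub>T\<^esub>o'\<in>?S. r o' \<odot>\<^bsub>T\<^esub> h (bvec (mat n (D o'))))"
      using hall_hom_sum[OF h T, of ?S "\<lambda>o'. mat n (D o')" r] mat_Theta[OF n DB] by simp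
    also have "\<dots> = r None \<odot>\<^bsub>T\<^esub> h (bvec (mat n (D None))) \<oplus>\<^bsub>T\<^esub> (\<Oplus>\<^bsub>T\<^esub>o'\<in>Some ` P.ok b A. r o' \<odot>\<^bsub>T\<^esub> h (bvec (mat n (D o'))))"
      by (rule T.finsum_insert) (use alg_homD(1)[OF h bc[OF DB]] in auto)
    also have "(\<Oplus>\<^bsub>T\<^esub>o'\<in>Some ` P.ok b A. r o' \<odot>\<^bsub>T\<^esub> h (bvec (mat n (D o')))) = (\<Oplus>\<^bsub>T\<^esub>c\<in>P.ok b A. r (Some c) \<odot>\<^bsub>T\<^esub> h (bvec (mat n (D (Some c)))))"
      by (rule T.finsum_reindex) (use alg_homD(1)[OF h bc[OF DB]] in auto)
    finally show "h (bvec (mat n {#b#})) \<otimes>\<^bsub>T\<^esub> h (bvec (mat n A)) = P.rec T b (\<lambda>X. h (bvec (mat n X))) A"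
      by (simp add: P.rec_def r_def D_def del: count_diff)
  qed
qed

section \<open>The integral form consists of the integral elements\<close>

text \<open>The normalized transposed index, so that \<open>\<iota>\<^sup>-\<close> sends the generator at \<open>c\<close> to the matrix unit at \<open>sg n c\<close>. It
  exchanges the upper and the lower triangular indices.\<close>

definition sg :: "nat \<Rightarrow> int \<times> int \<Rightarrow> int \<times> int" where "sg n c = nrm n (snd c) (fst c)"

lemma sg_inj: assumes n: "n \<ge> 1" shows "inj_on (sg n) (Bp n)"
proof (rule inj_onI)
  fix c d assume c: "c \<in> Bp n" "d \<in> Bp n" and e: "sg n c = sg n d"
  obtain x y where xy: "nrm n (snd c) (fst c) = (x, y)" by force
  then have xy': "nrm n (snd d) (fst d) = (x, y)" using e by (simp add: sg_def)
  note i = nrm_idem[OF n xy] nrm_idem[OF n xy']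
  have "int n dvd (snd c - x) - (snd d - x)" by (rule dvd_diff) (use i in auto)
  moreover have "(snd c - x) - (snd d - x) = fst c - fst d" using i by auto
  ultimately have "int n dvd \<bar>fst c - fst d\<bar>" by simp
  moreover have "\<bar>fst c - fst d\<bar> < int n" using c by (auto simp: Bp_def)
  ultimately have "fst c = fst d" using zdvd_not_zless[of "\<bar>fst c - fst d\<bar>" "int n"] by force
  then show "c = d" using i by (auto simp: prod_eq_iff)
qed

lemma sg_lower:
  assumes n: "n \<ge> 1" and c: "1 \<le> fst c" "fst c \<le> int n" "snd c < fst c"
  shows "sg n c \<in> Bp n" "sg n (sg n c) = c"
proof -
  obtain i j where ij: "nrm n (snd c) (fst c) = (i, j)" by force
  note I = nrm_idem[OF n ij]
  show "sg n c \<in> Bp n" using I c by (auto simp: sg_def ij Bp_def)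
  have e: "j - fst c = - (snd c - i)" using I by simp
  have "int n dvd j - fst c" unfolding e dvd_minus_iff using I by blast
  then have "nrm n j i = (fst c, snd c)" using I by (subst nrm_eq[OF n c(1,2)]) auto
  then show "sg n (sg n c) = c" by (simp add: sg_def ij)
qed

lemma Emat_sg: "n \<ge> 1 \<Longrightarrow> Emat n (fst (sg n c)) (snd (sg n c)) = Emat n (snd c) (fst c)"
proof -
  assume n: "n \<ge> 1"
  obtain x y where xy: "nrm n (snd c) (fst c) = (x, y)" by force
  note i = nrm_idem[OF n xy]
  have e: "int n dvd snd c - x" "x + (snd c - x) = snd c" "y + (snd c - x) = fst c" using i by auto
  show ?thesis unfolding sg_def xy fst_conv snd_conv by (rule Emat_shift[OF e(1), of x y, unfolded e(2,3), symmetric])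
qed

context agl begin

lemma foldr_mult_Wint: "(\<And>x. x \<in> set xs \<Longrightarrow> f x \<in> Wint) \<Longrightarrow> foldr (mult U) (map f xs) \<one>\<^bsub>U\<^esub> \<in> Wint"
  by (induction xs) (auto simp: Wint_one Wint_mult)

lemma Z_span_Wint: "X \<subseteq> Wint \<Longrightarrow> x \<in> Z_span U X \<Longrightarrow> x \<in> Wint"
proof -
  assume X: "X \<subseteq> Wint" and x: "x \<in> Z_span U X"
  have "X \<subseteq> carrier U" using X WintD(1) by blast
  with x show "x \<in> Wint"
    by (induction rule: E.U.Z_span_induct) (use X in \<open>auto simp: Wint_zero Wint_uminus Wint_add\<close>)
qed

lemma binom_lead: "lead (binom U (gg (Emat n i i)) t) (replicate_mset t (i, i))"
  using fam_lead[OF pm_single _ binom_fam, of i id "replicate_mset t (i, i)"]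
  by (simp add: binom_def a_minus_def set_mset_subset_singletonD)

lemma foldr_lead:
  assumes "distinct xs"
  shows "lead (foldr (mult U) (map (\<lambda>i. binom U (gg (Emat n i i)) (l i)) xs) \<one>\<^bsub>U\<^esub>) (\<Sum>i\<leftarrow>xs. replicate_mset (l i) (i, i))"
  using assms
proof (induction xs)
  case (Cons i xs)
  have "set_mset (\<Sum>i\<leftarrow>xs. replicate_mset (l i) (i, i)) \<subseteq> (\<lambda>i. (i, i)) ` set xs" by (induction xs) auto
  then have "set_mset (replicate_mset (l i) (i, i)) \<inter> set_mset (\<Sum>i\<leftarrow>xs. replicate_mset (l i) (i, i)) = {}" using Cons(2) by auto
  from lead_mult[OF binom_lead Cons.IH this] Cons(2) show ?case by simp
qed (simp add: lead_one)

lemma count_diag: "distinct xs \<Longrightarrow> count (\<Sum>i\<leftarrow>xs. replicate_mset (l i) (i, i)) (x, y) = (if x = y \<and> x \<in> set xs then l x else 0)"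
  by (induction xs) auto

context
  fixes \<phi> \<iota>p \<iota>m
  assumes \<phi>: "hall_polynomials n \<phi>" and ip: "is_iota_plus n \<phi> \<iota>p" and im: "is_iota_minus n \<phi> \<iota>m"
begin

abbreviation "wp X \<equiv> \<iota>p (bvec (mat n X))"
abbreviation "wm X \<equiv> \<iota>m (bvec (mat n X))"

lemma iota_hom: "\<iota>p \<in> alg_hom (hall_Q n \<phi>) U" "\<iota>m \<in> alg_hom (hall_Q n \<phi>) (op_alg U)"
proof -
  show "\<iota>p \<in> alg_hom (hall_Q n \<phi>) U" using ip by (simp add: is_iota_plus_def Ugl_def)
  have "\<iota>m \<in> alg_hom (op_alg (hall_Q n \<phi>)) U" using im by (simp add: is_iota_minus_def Ugl_def)
  from alg_hom_op[OF this] show "\<iota>m \<in> alg_hom (hall_Q n \<phi>) (op_alg U)" by simp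
qed

lemma w_fam: "partial_mult.fam (Bp n) (pm n) U (\<lambda>X. wp X)" "partial_mult.fam (Bp n) (pm n) (op_alg U) (\<lambda>X. wm X)"
  by (rule hall_fam[OF n1 \<phi> E.Qalg_env iota_hom(1)], rule hall_fam[OF n1 \<phi> E.U.Qalg_op iota_hom(2)])

lemma w_single:
  assumes c: "c \<in> Bp n"
  shows "wp {#c#} = EE c" "wm {#c#} = EE (sg n c)"
proof -
  have m: "mat n {#c#} = Emat n (fst c) (snd c)" using mat_single[OF n1, of "fst c" "snd c"] c by simp
  show "wp {#c#} = EE c" using ip c unfolding m is_iota_plus_def by (auto simp: Bp_def UE_def)
  show "wm {#c#} = EE (sg n c)" using im c unfolding m is_iota_minus_def Emat_sg[OF n1] by (auto simp: Bp_def UE_def)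
qed

lemma w_closed: assumes "set_mset X \<subseteq> Bp n" shows "wp X \<in> carrier U" "wm X \<in> carrier U"
  using partial_mult.famD(4)[OF pm_Bp w_fam(1) assms] partial_mult.famD(4)[OF pm_Bp w_fam(2) assms] by auto

lemma w_Wint: assumes X: "set_mset X \<subseteq> Bp n" shows "wp X \<in> Wint" "wm X \<in> Wint"
proof -
  show "wp X \<in> Wint"
  proof (rule fam_integral[where opp = False and e = "\<lambda>c. Emat n (fst c) (snd c)", OF pm_Bp _ w_fam(1) _ _ _ _ X])
    fix b c show "(if False then Emat n (fst c) (snd c) \<otimes>\<^bsub>MA\<^esub> Emat n (fst b) (snd b) else Emat n (fst b) (snd b) \<otimes>\<^bsub>MA\<^esub> Emat n (fst c) (snd c)) = (case pm n b c of None \<Rightarrow> \<zero>\<^bsub>MA\<^esub> | Some d \<Rightarrow> Emat n (fst d) (snd d))"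
      by (simp only: if_False Emat_mult prod.collapse)
  qed (auto simp: w_single Emat_Ints)
  show "wm X \<in> Wint"
  proof (rule fam_integral[where opp = True and e = "\<lambda>c. Emat n (snd c) (fst c)", OF pm_Bp _ w_fam(2) _ _ _ _ X])
    fix b c show "(if True then Emat n (snd c) (fst c) \<otimes>\<^bsub>MA\<^esub> Emat n (snd b) (fst b) else Emat n (snd b) (fst b) \<otimes>\<^bsub>MA\<^esub> Emat n (snd c) (fst c)) = (case pm n b c of None \<Rightarrow> \<zero>\<^bsub>MA\<^esub> | Some d \<Rightarrow> Emat n (snd d) (fst d))"
      by (simp only: if_True Emat_mult_T[of n "snd c" "fst c" "snd b" "fst b"] prod.collapse)
  qed (auto simp: w_single Emat_Ints Emat_sg[OF n1])
qed

lemma hall_Z_rep: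
  assumes f: "f \<in> hall_Z_in_Q n \<phi>"
  shows "\<exists>S r. finite S \<and> S \<subseteq> Theta_plus n \<and> (\<forall>A. r A \<in> \<int>) \<and> f = (\<lambda>x. \<Sum>A\<in>S. r A * bvec A x)"
proof -
  obtain g where g: "finite {x. g x \<noteq> (0 :: int)}" "{x. g x \<noteq> 0} \<subseteq> Theta_plus n" "f = (\<lambda>A. of_int (g A))"
    using f by (auto simp: hall_Z_in_Q_def hall_Z_def hall_at_one_def basis_alg_def)
  have "f = (\<lambda>x. \<Sum>A\<in>{x. g x \<noteq> 0}. of_int (g A) * bvec A x)"
  proof
    fix x show "f x = (\<Sum>A\<in>{x. g x \<noteq> 0}. of_int (g A) * bvec A x)"
      using g(1) by (simp add: g(3) bvec_def if_distrib[of "\<lambda>a. _ * a"] cong: if_cong)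
  qed
  then show ?thesis using g(1,2) by (intro exI[of _ "{x. g x \<noteq> 0}"] exI[of _ "\<lambda>A. of_int (g A)"]) auto
qed

lemma bvec_hall_Z: "set_mset X \<subseteq> Bp n \<Longrightarrow> bvec (mat n X) \<in> hall_Z_in_Q n \<phi>"
  using mat_Theta[OF n1, of X]
  by (auto simp: hall_Z_in_Q_def hall_Z_def hall_at_one_def basis_alg_def bvec_def split: if_splits intro!: image_eqI[of _ _ "bvec (mat n X)"])

lemma iota_Wint: assumes f: "f \<in> hall_Z_in_Q n \<phi>" shows "\<iota>p f \<in> Wint" "\<iota>m f \<in> Wint"
proof -
  obtain S r where S: "finite S" "S \<subseteq> Theta_plus n" "\<forall>A. r A \<in> \<int>" "f = (\<lambda>x. \<Sum>A\<in>S. r A * bvec A x)"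
    using hall_Z_rep[OF f] by blast
  have 1: "\<iota>p f = (\<Oplus>\<^bsub>U\<^esub>A\<in>S. r A \<odot>\<^bsub>U\<^esub> \<iota>p (bvec A))" unfolding S(4)
    using hall_hom_sum[OF iota_hom(1) E.Qalg_env S(1), of "\<lambda>A. A" r] S(2) by auto
  have 2: "\<iota>m f = (\<Oplus>\<^bsub>U\<^esub>A\<in>S. r A \<odot>\<^bsub>U\<^esub> \<iota>m (bvec A))" unfolding S(4)
    using hall_hom_sum[OF iota_hom(2) E.U.Qalg_op S(1), of "\<lambda>A. A" r] S(2) by auto
  have A: "\<iota>p (bvec A) \<in> Wint \<and> \<iota>m (bvec A) \<in> Wint" if "A \<in> S" for A
    using w_Wint[OF ms_Bp[of A n]] mat_ms[OF n1, of A] that S(2) by auto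
  show "\<iota>p f \<in> Wint" unfolding 1 by (intro Wint_finsum Wint_sm) (use S(3) A in auto)
  show "\<iota>m f \<in> Wint" unfolding 2 by (intro Wint_finsum Wint_sm) (use S(3) A in auto)
qed

abbreviation "H \<equiv> UZ n \<phi> \<iota>p \<iota>m"

abbreviation "cartan l \<equiv> foldr (mult U) (map (\<lambda>i. binom U (gg (Emat n i i)) (l i)) [1..int n]) \<one>\<^bsub>U\<^esub>"

lemma cartan_Wint: "cartan l \<in> Wint" by (intro foldr_mult_Wint binom_Wint)

lemma UZ_zero_eq: "UZ_zero n = Z_span U {cartan l | l. l \<in> per_seqs n}"
  by (simp add: UZ_zero_def Ugl_def UE_def)

lemma UZ_zero_Wint: "y \<in> UZ_zero n \<Longrightarrow> y \<in> Wint"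
  unfolding UZ_zero_eq by (rule Z_span_Wint) (auto simp: cartan_Wint)

abbreviation "gens \<equiv> {x \<otimes>\<^bsub>U\<^esub> y \<otimes>\<^bsub>U\<^esub> z | x y z. x \<in> \<iota>p ` hall_Z_in_Q n \<phi> \<and> y \<in> UZ_zero n \<and> z \<in> \<iota>m ` hall_Z_in_Q n \<phi>}"

lemma H_eq: "H = Z_span U gens" by (simp add: UZ_def Ugl_def)

lemma gens_Wint: "gens \<subseteq> Wint" using iota_Wint UZ_zero_Wint by (auto intro!: Wint_mult)

lemma H_Wint: "H \<subseteq> Wint" unfolding H_eq using Z_span_Wint[OF gens_Wint] by blast

text \<open>The multiset \<open>D\<close> is split into its upper triangular, diagonal and lower triangular parts.\<close>

lemma z_ex:
  assumes D: "set_mset D \<subseteq> idx"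
  shows "\<exists>X l Y. set_mset X \<subseteq> Bp n \<and> set_mset Y \<subseteq> Bp n \<and> l \<in> per_seqs n \<and>
    lead (wp X \<otimes>\<^bsub>U\<^esub> cartan l \<otimes>\<^bsub>U\<^esub> wm Y) D"
proof -
  let ?up = "filter_mset (\<lambda>c. fst c < snd c) D" and ?lo = "filter_mset (\<lambda>c. snd c < fst c) D"
  let ?di = "filter_mset (\<lambda>c. fst c = snd c) D"
  define Y where "Y = image_mset (sg n) ?lo"
  (* The diagonal exponents, extended periodically. *)
  define l where "l i = (let k = 1 + (i - 1) mod int n in count D (k, k))" for i
  have X: "set_mset ?up \<subseteq> Bp n" using D by (auto simp: Bp_def)
  have lo: "1 \<le> fst c \<and> fst c \<le> int n \<and> snd c < fst c" if "c \<in># ?lo" for c using that D by auto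
  have Y: "set_mset Y \<subseteq> Bp n"
  proof
    fix c assume "c \<in># Y"
    then obtain d where d: "d \<in># ?lo" "c = sg n d" unfolding Y_def set_image_mset by (elim imageE) blast
    show "c \<in> Bp n" unfolding d(2) using sg_lower(1)[OF n1, of d] lo[OF d(1)] by blast
  qed
  have "image_mset (sg n) Y = image_mset id ?lo" unfolding Y_def image_mset.compositionality
  proof (rule image_mset_cong)
    fix c assume c: "c \<in># ?lo"
    show "(sg n \<circ> sg n) c = id c" using sg_lower(2)[OF n1, of c] lo[OF c] by simp
  qed
  then have sY: "image_mset (sg n) Y = ?lo" by simp
  have lp: "l \<in> per_seqs n"
  proof -
    have "(i + int n - 1) mod int n = (i - 1) mod int n" for i by (metis add_diff_eq diff_add_eq mod_add_self2)
    then show ?thesis by (simp add: per_seqs_def l_def)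
  qed
  have l: "l i = count D (i, i)" if "i \<in> {1..int n}" for i using that by (simp add: l_def)
  have di: "(\<Sum>i\<leftarrow>[1..int n]. replicate_mset (l i) (i, i)) = ?di"
  proof (rule multiset_eqI)
    fix c
    have "c \<notin># ?di" if "\<not> (fst c = snd c \<and> fst c \<in> {1..int n})" using that D by auto
    then show "count (\<Sum>i\<leftarrow>[1..int n]. replicate_mset (l i) (i, i)) c = count ?di c"
      using count_diag[of "[1..int n]" l "fst c" "snd c"] l[of "fst c"] by (cases c) (auto simp: not_in_iff)
  qed
  have "lead (wp ?up) (image_mset id ?up)"
    by (rule fam_lead[OF pm_Bp _ w_fam(1) _ _ X]) (auto simp: w_single)
  then have 1: "lead (wp ?up) ?up" by simp
  have 2: "lead (cartan l) ?di" using foldr_lead[of "[1..int n]" l] di by simp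
  have 3: "lead (wm Y) ?lo" unfolding sY[symmetric]
    by (rule fam_lead[OF pm_Bp _ w_fam(2) _ sg_inj[OF n1] Y]) (auto simp: w_single)
  have "lead (wp ?up \<otimes>\<^bsub>U\<^esub> cartan l \<otimes>\<^bsub>U\<^esub> wm Y) (?up + ?di + ?lo)"
    by (rule lead_mult[OF lead_mult[OF 1 2] 3]) auto
  moreover have "?up + ?di + ?lo = D" by (rule multiset_eqI) auto
  ultimately show ?thesis using X Y lp by (intro exI[of _ ?up] exI[of _ l] exI[of _ Y]) simp
qed

lemma H_prod:
  assumes "set_mset X \<subseteq> Bp n" "set_mset Y \<subseteq> Bp n" "l \<in> per_seqs n"
  shows "wp X \<otimes>\<^bsub>U\<^esub> cartan l \<otimes>\<^bsub>U\<^esub> wm Y \<in> gens"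
proof -
  have "cartan l \<in> UZ_zero n" unfolding UZ_zero_eq by (rule E.U.Z_span_incl) (use assms in auto)
  then show ?thesis using bvec_hall_Z assms by blast
qed

text \<open>The triangular products are generators of the integral form, so \<open>Wint_span\<close> applies.\<close>

lemma Wint_H: "Wint \<subseteq> H"
proof
  fix u assume u: "u \<in> Wint"
  define z where "z D = (SOME u. \<exists>X l Y. set_mset X \<subseteq> Bp n \<and> set_mset Y \<subseteq> Bp n \<and> l \<in> per_seqs n \<and>
    u = wp X \<otimes>\<^bsub>U\<^esub> cartan l \<otimes>\<^bsub>U\<^esub> wm Y \<and> lead u D)" for D
  have z: "\<exists>X l Y. set_mset X \<subseteq> Bp n \<and> set_mset Y \<subseteq> Bp n \<and> l \<in> per_seqs n \<and>
    z D = wp X \<otimes>\<^bsub>U\<^esub> cartan l \<otimes>\<^bsub>U\<^esub> wm Y \<and> lead (z D) D" if "set_mset D \<subseteq> idx" for D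
    unfolding z_def by (rule someI_ex) (use z_ex[OF that] in blast)
  have zg: "z D \<in> gens" if D: "set_mset D \<subseteq> idx" for D
  proof -
    obtain X l Y where x: "set_mset X \<subseteq> Bp n" "set_mset Y \<subseteq> Bp n" "l \<in> per_seqs n" "z D = wp X \<otimes>\<^bsub>U\<^esub> cartan l \<otimes>\<^bsub>U\<^esub> wm Y" "lead (z D) D"
      using z[OF D] by (elim exE conjE)
    show ?thesis unfolding x(4) by (rule H_prod[OF x(1,2,3)])
  qed
  have "u \<in> Z_span U {z D | D. set_mset D \<subseteq> idx}"
  proof (rule Wint_span[OF _ _ u])
    show "lead (z D) D" if "set_mset D \<subseteq> idx" for D using z[OF that] by (elim exE conjE)
    show "z D \<in> Wint" if "set_mset D \<subseteq> idx" for D by (rule subsetD[OF gens_Wint zg[OF that]])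
  qed
  then show "u \<in> H" unfolding H_eq Z_span_def
    by (rule subsetD[OF E.U.add.mono_generate, rotated]) (use zg in blast)
qed

lemma H_eq_Wint: "H = Wint" using H_Wint Wint_H by auto

end

end

section \<open>The Hopf structure on families\<close>

context agl begin

abbreviation "TT \<equiv> tensor_alg U U"
abbreviation "tn \<equiv> tens U U"
abbreviation "\<Delta> \<equiv> env_comult MA"
abbreviation "anti \<equiv> env_antipode MA"

lemma tens_homs: "(\<lambda>u. tn u \<one>\<^bsub>U\<^esub>) \<in> alg_hom U TT" "(\<lambda>u. tn \<one>\<^bsub>U\<^esub> u) \<in> alg_hom U TT"
  by (rule alg_homI; simp add: E.UU.tens_mult E.UU.tens_ladd E.UU.tens_radd E.UU.tens_lsm E.UU.tens_rsm E.UU.tens_one)+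

text \<open>The maps \<open>u \<mapsto> u \<otimes> 1\<close> and \<open>u \<mapsto> 1 \<otimes> u\<close> have commuting images, and the coproduct of a generator is the sum of
  the two, so \<open>fam_conv\<close> applies.\<close>

lemma comult_fam:
  assumes pm: "partial_mult B mu" and T: "T = (if opp then op_alg U else U)" and w: "partial_mult.fam B mu T w"
    and g: "\<And>b. b \<in> B \<Longrightarrow> w {#b#} = gg (e b)" and ec: "\<And>b. b \<in> B \<Longrightarrow> e b \<in> per_mats n"
    and A: "set_mset A \<subseteq> B"
  shows "\<Delta> (w A) = (\<Oplus>\<^bsub>TT\<^esub>X\<in>sub A. tn (w X) (w (A - X)))"
proof -
  interpret partial_mult B mu by fact
  define T' where "T' = (if opp then op_alg TT else TT)"
  have QT: "Qalg T" "Qalg T'"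
    using T by (auto simp: T'_def E.Qalg_env E.U.Qalg_op E.UU.Qalg_tensor E.UU.T.Qalg_op)
  have hom: "h \<in> alg_hom T T'" if "h \<in> alg_hom U TT" for h
    using that T alg_hom_op[OF that] by (auto simp: T'_def)
  note f0 = fam_image[OF QT w hom[OF E.comult(1)]]
  note f1 = fam_image[OF QT w hom[OF tens_homs(1)]]
  note f2 = fam_image[OF QT w hom[OF tens_homs(2)]]
  have cT: "carrier T = carrier U" using T by auto
  have wc: "set_mset X \<subseteq> B \<Longrightarrow> w X \<in> carrier U" for X
    unfolding cT[symmetric] by (rule famD(4)[OF w])
  have tt: "tn u \<one>\<^bsub>U\<^esub> \<otimes>\<^bsub>T'\<^esub> tn \<one>\<^bsub>U\<^esub> v = tn u v" "tn \<one>\<^bsub>U\<^esub> v \<otimes>\<^bsub>T'\<^esub> tn u \<one>\<^bsub>U\<^esub> = tn u v"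
    if "u \<in> carrier U" "v \<in> carrier U" for u v
    using that by (simp_all add: T'_def E.UU.tens_mult)
  have "\<Delta> (w A) = (\<Oplus>\<^bsub>T'\<^esub>X\<in>sub A. tn (w X) \<one>\<^bsub>U\<^esub> \<otimes>\<^bsub>T'\<^esub> tn \<one>\<^bsub>U\<^esub> (w (A - X)))"
  proof (rule fam_conv[OF QT(2) f0 f1 f2 _ _ A])
    fix b assume b: "b \<in> B"
    show "\<Delta> (w {#b#}) = tn (w {#b#}) \<one>\<^bsub>U\<^esub> \<oplus>\<^bsub>T'\<^esub> tn \<one>\<^bsub>U\<^esub> (w {#b#})"
      using E.comult(2)[of "e b"] ec[OF b] by (simp add: g[OF b] T'_def)
  next
    fix b X assume b: "b \<in> B" and X: "set_mset X \<subseteq> B"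
    show "tn \<one>\<^bsub>U\<^esub> (w {#b#}) \<otimes>\<^bsub>T'\<^esub> tn (w X) \<one>\<^bsub>U\<^esub> = tn (w X) \<one>\<^bsub>U\<^esub> \<otimes>\<^bsub>T'\<^esub> tn \<one>\<^bsub>U\<^esub> (w {#b#})"
      using tt[OF wc[OF X] wc[of "{#b#}"]] b by simp
  qed
  also have "\<dots> = (\<Oplus>\<^bsub>TT\<^esub>X\<in>sub A. tn (w X) \<one>\<^bsub>U\<^esub> \<otimes>\<^bsub>T'\<^esub> tn \<one>\<^bsub>U\<^esub> (w (A - X)))" by (simp add: T'_def)
  also have "\<dots> = (\<Oplus>\<^bsub>TT\<^esub>X\<in>sub A. tn (w X) (w (A - X)))"
    using wc set_sub[OF A] set_diff[OF A] by (intro E.UU.T.finsum_cong') (auto simp: tt)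
  finally show ?thesis .
qed

text \<open>By \<open>fam_antipode\<close> the antipode of \<open>w\<^sub>A\<close> is minus the sum of the \<open>S(w\<^sub>X) w\<^bsub>A-X\<^esub>\<close> over proper \<open>X \<subset> A\<close>, which is
  integral by induction on the size.\<close>

lemma antipode_fam:
  assumes pm: "partial_mult B mu" and T: "T = (if opp then op_alg U else U)" and w: "partial_mult.fam B mu T w"
    and g: "\<And>b. b \<in> B \<Longrightarrow> w {#b#} = gg (e b)" and ec: "\<And>b. b \<in> B \<Longrightarrow> e b \<in> per_mats n"
    and wW: "\<And>X. set_mset X \<subseteq> B \<Longrightarrow> w X \<in> Wint"
  shows "set_mset A \<subseteq> B \<Longrightarrow> anti (w A) \<in> Wint"
proof (induction "size A" arbitrary: A rule: less_induct)
  case less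
  interpret partial_mult B mu by fact
  have QT: "Qalg T" "Qalg (op_alg T)" using T by (auto simp: E.Qalg_env E.U.Qalg_op)
  have hom: "anti \<in> alg_hom T (op_alg T)" using T E.antipode(1) alg_hom_op[OF E.antipode(1)] by auto
  note s = fam_image[OF QT w hom]
  have sel: "carrier T = carrier U" "add T = add U" "zero T = zero U" "one T = one U" "finsum T = finsum U"
    using T by auto
  have ai: "a_inv T x = a_inv U x" for x using T by (auto simp: a_inv_def op_alg_def)
  have tm: "x \<otimes>\<^bsub>T\<^esub> y \<in> Wint" if "x \<in> Wint" "y \<in> Wint" for x y using T that by (auto simp: Wint_mult)
  have ac: "anti x \<in> carrier U" if "x \<in> carrier U" for x using alg_homD(1)[OF E.antipode(1) that] by simp
  note wc = WintD(1)[OF wW]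
  show ?case
  proof (cases "A = {#}")
    case True
    then show ?thesis using famD(2)[OF w] alg_homD(5)[OF E.antipode(1)] by (simp add: sel Wint_one)
  next
    case False
    let ?r = "\<lambda>X. anti (w X) \<otimes>\<^bsub>T\<^esub> w (A - X)"
    have XB: "set_mset X \<subseteq> B" "set_mset (A - X) \<subseteq> B" if "X \<in> sub A" for X using set_sub[OF less(2) that] set_diff[OF less(2)] .
    have rc: "?r X \<in> carrier U" if "X \<in> sub A" for X using XB[OF that] ac wc T by auto
    have "(\<Oplus>\<^bsub>T\<^esub>X\<in>sub A. ?r X) = \<zero>\<^bsub>T\<^esub>"
    proof (rule fam_antipode[OF QT(1) w s _ less(2) False])
      fix b assume "b \<in> B"
      then show "anti (w {#b#}) = \<ominus>\<^bsub>T\<^esub> w {#b#}" using E.antipode(2)[of "e b"] ec[of b] by (simp add: g ai)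
    qed
    moreover have AA: "A \<in> sub A" by (simp add: sub_def)
    ultimately have "(\<Oplus>\<^bsub>U\<^esub>X\<in>insert A (sub A - {A}). ?r X) = \<zero>\<^bsub>U\<^esub>"
      by (simp add: sel insert_absorb)
    then have "?r A \<oplus>\<^bsub>U\<^esub> (\<Oplus>\<^bsub>U\<^esub>X\<in>sub A - {A}. ?r X) = \<zero>\<^bsub>U\<^esub>"
      using rc rc[OF AA] by (subst (asm) E.U.finsum_insert) (auto simp del: cancel_comm_monoid_add_class.diff_cancel)
    moreover have "?r A = anti (w A)" using T ac[OF wc[OF less(2)]] famD(2)[OF w] by (auto simp: sel)
    moreover have W: "(\<Oplus>\<^bsub>U\<^esub>X\<in>sub A - {A}. ?r X) \<in> Wint"
    proof (intro Wint_finsum tm)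
      fix X assume X: "X \<in> sub A - {A}"
      then have "X \<subset># A" by (auto simp: sub_def subset_mset.less_le)
      then have "size X < size A" by (rule mset_subset_size)
      then show "anti (w X) \<in> Wint" using less(1) XB X by blast
      show "w (A - X) \<in> Wint" using wW XB X by blast
    qed
    ultimately have "anti (w A) = \<ominus>\<^bsub>U\<^esub> (\<Oplus>\<^bsub>U\<^esub>X\<in>sub A - {A}. ?r X)"
      using E.U.minus_equality[of "anti (w A)" "\<Oplus>\<^bsub>U\<^esub>X\<in>sub A - {A}. ?r X"] ac[OF wc[OF less(2)]] WintD(1)[OF W] by simp
    then show ?thesis using W by (simp add: Wint_uminus)
  qed
qed

lemma binom_single: "binom U (gg (Emat n i i)) (size {#b#}) = gg (Emat n i i)"
  by (simp add: binom_def a_minus_def)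

lemma binom_comult:
  "\<Delta> (binom U (gg (Emat n i i)) t) = (\<Oplus>\<^bsub>TT\<^esub>j\<in>{0..t}. tn (binom U (gg (Emat n i i)) j) (binom U (gg (Emat n i i)) (t - j)))"
proof -
  let ?b = "\<lambda>t. binom U (gg (Emat n i i)) t" and ?R = "\<lambda>j. replicate_mset j (i, i)"
  have c: "?b t \<in> carrier U" for t by (rule binom_closed) simp
  have "sub (?R t) = ?R ` {0..t}"
  proof (intro equalityI subsetI)
    fix X assume "X \<in> sub (?R t)"
    then have X: "X \<subseteq># ?R t" by (rule sub_D)
    then have "set_mset X \<subseteq> {(i, i)}" using set_mset_mono[OF X] by (auto split: if_splits)
    then obtain j where j: "X = ?R j" by (metis set_mset_subset_singletonD)
    then have "j \<le> t" using size_mset_mono[OF X] by simp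
    then show "X \<in> ?R ` {0..t}" using j by auto
  qed (auto simp: sub_iff)
  moreover have "\<Delta> (?b (size (?R t))) = (\<Oplus>\<^bsub>TT\<^esub>X\<in>sub (?R t). tn (?b (size X)) (?b (size (?R t - X))))"
    by (rule comult_fam[where opp = False and e = "\<lambda>_. Emat n i i", OF pm_single _ binom_fam])
       (auto simp only: binom_single Emat_in if_False set_mset_replicate_mset_subset split: if_splits)
  ultimately have "\<Delta> (?b t) = (\<Oplus>\<^bsub>TT\<^esub>X\<in>?R ` {0..t}. tn (?b (size X)) (?b (size (?R t - X))))" by simp
  also have "\<dots> = (\<Oplus>\<^bsub>TT\<^esub>j\<in>{0..t}. tn (?b (size (?R j))) (?b (size (?R t - ?R j))))"
    using c by (intro E.UU.T.finsum_reindex) (auto simp: inj_on_def replicate_mset_eq_iff)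
  also have "\<dots> = (\<Oplus>\<^bsub>TT\<^esub>j\<in>{0..t}. tn (?b j) (?b (t - j)))"
  proof (intro E.UU.T.finsum_cong')
    fix j assume "j \<in> {0..t}"
    then have "?R j \<subseteq># ?R t" by (simp add: subseteq_mset_def)
    then show "tn (?b (size (?R j))) (?b (size (?R t - ?R j))) = tn (?b j) (?b (t - j))" by (simp add: size_Diff_submset)
  qed (use c in auto)
  finally show ?thesis .
qed

lemma binom_antipode: "anti (binom U (gg (Emat n i i)) t) \<in> Wint"
proof -
  have "anti (binom U (gg (Emat n i i)) (size (replicate_mset t (i, i)))) \<in> Wint"
    by (rule antipode_fam[where opp = False and e = "\<lambda>_. Emat n i i", OF pm_single _ binom_fam])
       (auto simp only: binom_single Emat_in if_False binom_Wint set_mset_replicate_mset_subset split: if_splits)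
  then show ?thesis by simp
qed

section \<open>Integral Hopf structure\<close>

abbreviation "YY \<equiv> {tn a b | a b. a \<in> Wint \<and> b \<in> Wint}"

lemma YY_closed: "YY \<subseteq> carrier TT" using WintD(1) by auto

lemma YY_mult: "x \<in> Z_span TT YY \<Longrightarrow> y \<in> Z_span TT YY \<Longrightarrow> x \<otimes>\<^bsub>TT\<^esub> y \<in> Z_span TT YY"
proof (rule E.UU.T.Z_span_mult[OF YY_closed])
  fix x y assume "x \<in> YY" "y \<in> YY"
  then obtain a b a' b' where "x = tn a b" "y = tn a' b'" and W: "a \<in> Wint" "b \<in> Wint" "a' \<in> Wint" "b' \<in> Wint" by blast
  then have "x \<otimes>\<^bsub>TT\<^esub> y = tn (a \<otimes>\<^bsub>U\<^esub> a') (b \<otimes>\<^bsub>U\<^esub> b')" using WintD(1) by (simp add: E.UU.tens_mult)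
  then have "x \<otimes>\<^bsub>TT\<^esub> y \<in> YY" using W Wint_mult by blast
  then show "x \<otimes>\<^bsub>TT\<^esub> y \<in> Z_span TT YY" by (rule E.UU.T.Z_span_incl)
qed

text \<open>The elements on which coproduct and antipode are integral. They form a ring, because the antipode
  is an antihomomorphism, so only generators have to be checked.\<close>

definition hopfint :: "ugl set" where
  "hopfint = {u \<in> carrier U. \<Delta> u \<in> Z_span TT YY \<and> anti u \<in> Wint}"

sublocale cm: Qalg_hom U TT "\<Delta>" by unfold_locales (rule E.comult(1))
sublocale an: Qalg_hom U "op_alg U" "anti"
  by (intro Qalg_hom.intro Qalg_hom_axioms.intro E.Qalg_env E.U.Qalg_op E.antipode(1))

lemma hopfint_one: "\<one>\<^bsub>U\<^esub> \<in> hopfint"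
proof -
  have "\<one>\<^bsub>TT\<^esub> \<in> YY" using E.UU.tens_one Wint_one by (intro CollectI exI[of _ "\<one>\<^bsub>U\<^esub>"]) auto
  then show ?thesis using E.UU.T.Z_span_incl[of "\<one>\<^bsub>TT\<^esub>" YY] Wint_one by (simp add: hopfint_def cm.hone an.hone)
qed

lemma hopfint_mult: "u \<in> hopfint \<Longrightarrow> v \<in> hopfint \<Longrightarrow> u \<otimes>\<^bsub>U\<^esub> v \<in> hopfint"
  by (auto simp: hopfint_def cm.hmult an.hmult YY_mult Wint_mult)

lemma hopfint_add: "u \<in> hopfint \<Longrightarrow> v \<in> hopfint \<Longrightarrow> u \<oplus>\<^bsub>U\<^esub> v \<in> hopfint"
  by (auto simp: hopfint_def cm.hadd an.hadd E.UU.T.Z_span_add Wint_add)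

lemma hopfint_sm: "r \<in> \<int> \<Longrightarrow> u \<in> hopfint \<Longrightarrow> r \<odot>\<^bsub>U\<^esub> u \<in> hopfint"
  by (auto simp: hopfint_def cm.hsm an.hsm E.UU.T.Z_span_int[OF YY_closed] Wint_sm)

lemma hopfint_uminus: "u \<in> hopfint \<Longrightarrow> \<ominus>\<^bsub>U\<^esub> u \<in> hopfint"
  using hopfint_sm[of "-1" u] by (simp add: E.U.sm_m1 hopfint_def)

lemma hopfint_zero: "\<zero>\<^bsub>U\<^esub> \<in> hopfint"
  using hopfint_sm[of 0 "\<one>\<^bsub>U\<^esub>"] hopfint_one by simp

lemma hopfint_finsum: "(\<And>i. i \<in> I \<Longrightarrow> f i \<in> hopfint) \<Longrightarrow> finsum U f I \<in> hopfint"
proof (induction I rule: infinite_finite_induct)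
  case (insert i I)
  then show ?case using hopfint_add by (subst E.U.finsum_insert) (auto simp: hopfint_def)
qed (auto simp: hopfint_zero E.U.finsum_empty)

lemma hopfint_foldr: "(\<And>x. x \<in> set xs \<Longrightarrow> f x \<in> hopfint) \<Longrightarrow> foldr (mult U) (map f xs) \<one>\<^bsub>U\<^esub> \<in> hopfint"
  by (induction xs) (auto simp: hopfint_one hopfint_mult)

lemma hopfint_Z_span: assumes "X \<subseteq> hopfint" shows "Z_span U X \<subseteq> hopfint"
proof
  fix x assume x: "x \<in> Z_span U X"
  have "X \<subseteq> carrier U" using assms by (auto simp: hopfint_def)
  with x show "x \<in> hopfint"
    by (induction rule: E.U.Z_span_induct) (use assms in \<open>auto simp: hopfint_zero hopfint_uminus hopfint_add\<close>)
qed

lemma tens_sum_YY: "(\<And>i. i \<in> I \<Longrightarrow> f i \<in> Wint) \<Longrightarrow> (\<And>i. i \<in> I \<Longrightarrow> g i \<in> Wint) \<Longrightarrow>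
  (\<Oplus>\<^bsub>TT\<^esub>i\<in>I. tn (f i) (g i)) \<in> Z_span TT YY"
  by (rule E.UU.T.Z_span_finsum[OF YY_closed], rule E.UU.T.Z_span_incl) blast

lemma hopfint_binom: "binom U (gg (Emat n i i)) t \<in> hopfint"
  using binom_antipode by (auto simp: hopfint_def binom_closed binom_comult intro!: tens_sum_YY binom_Wint)

context
  fixes \<phi> \<iota>p \<iota>m
  assumes \<phi>: "hall_polynomials n \<phi>" and ip: "is_iota_plus n \<phi> \<iota>p" and im: "is_iota_minus n \<phi> \<iota>m"
begin

lemma w_comult:
  assumes A: "set_mset A \<subseteq> Bp n"
  shows "\<Delta> (wp \<iota>p A) = (\<Oplus>\<^bsub>TT\<^esub>X\<in>sub A. tn (wp \<iota>p X) (wp \<iota>p (A - X)))"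
    "\<Delta> (wm \<iota>m A) = (\<Oplus>\<^bsub>TT\<^esub>X\<in>sub A. tn (wm \<iota>m X) (wm \<iota>m (A - X)))"
  by (rule comult_fam[where opp = False and e = "\<lambda>c. Emat n (fst c) (snd c)", OF pm_Bp _ w_fam(1)[OF \<phi> ip im] _ _ A];
        simp add: w_single[OF \<phi> ip im])
     (rule comult_fam[where opp = True and e = "\<lambda>c. Emat n (fst (sg n c)) (snd (sg n c))", OF pm_Bp _ w_fam(2)[OF \<phi> ip im] _ _ A];
        simp add: w_single[OF \<phi> ip im])

lemma w_hopfint:
  assumes A: "set_mset A \<subseteq> Bp n"
  shows "wp \<iota>p A \<in> hopfint" "wm \<iota>m A \<in> hopfint"
proof -
  note W = w_Wint[OF \<phi> ip im]
  have XA: "set_mset X \<subseteq> Bp n" "set_mset (A - X) \<subseteq> Bp n" if "X \<in> sub A" for X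
    using partial_mult.set_sub[OF pm_Bp A that] partial_mult.set_diff[OF pm_Bp A] .
  have "anti (wp \<iota>p A) \<in> Wint"
    by (rule antipode_fam[where opp = False and e = "\<lambda>c. Emat n (fst c) (snd c)", OF pm_Bp _ w_fam(1)[OF \<phi> ip im] _ _ W(1) A])
       (simp_all add: w_single[OF \<phi> ip im])
  then show "wp \<iota>p A \<in> hopfint" using W(1) XA WintD(1)[OF W(1)[OF A]] by (auto simp: hopfint_def w_comult[OF A] intro!: tens_sum_YY)
  have "anti (wm \<iota>m A) \<in> Wint"
    by (rule antipode_fam[where opp = True and e = "\<lambda>c. Emat n (fst (sg n c)) (snd (sg n c))", OF pm_Bp _ w_fam(2)[OF \<phi> ip im] _ _ W(2) A])
       (simp_all add: w_single[OF \<phi> ip im])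
  then show "wm \<iota>m A \<in> hopfint" using W(2) XA WintD(1)[OF W(2)[OF A]] by (auto simp: hopfint_def w_comult[OF A] intro!: tens_sum_YY)
qed

lemma iota_hopfint: assumes f: "f \<in> hall_Z_in_Q n \<phi>" shows "\<iota>p f \<in> hopfint" "\<iota>m f \<in> hopfint"
proof -
  obtain S r where S: "finite S" "S \<subseteq> Theta_plus n" "\<forall>A. r A \<in> \<int>" "f = (\<lambda>x. \<Sum>A\<in>S. r A * bvec A x)"
    using hall_Z_rep[OF \<phi> ip im f] by blast
  note h = iota_hom[OF \<phi> ip im]
  have 1: "\<iota>p f = (\<Oplus>\<^bsub>U\<^esub>A\<in>S. r A \<odot>\<^bsub>U\<^esub> \<iota>p (bvec A))" unfolding S(4)
    using hall_hom_sum[OF h(1) E.Qalg_env S(1), of "\<lambda>A. A" r] S(2) by auto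
  have 2: "\<iota>m f = (\<Oplus>\<^bsub>U\<^esub>A\<in>S. r A \<odot>\<^bsub>U\<^esub> \<iota>m (bvec A))" unfolding S(4)
    using hall_hom_sum[OF h(2) E.U.Qalg_op S(1), of "\<lambda>A. A" r] S(2) by auto
  have A: "\<iota>p (bvec A) \<in> hopfint \<and> \<iota>m (bvec A) \<in> hopfint" if "A \<in> S" for A
    using w_hopfint[OF ms_Bp[of A n]] mat_ms[OF n1, of A] that S(2) by auto
  show "\<iota>p f \<in> hopfint" unfolding 1 by (intro hopfint_finsum hopfint_sm) (use S(3) A in auto)
  show "\<iota>m f \<in> hopfint" unfolding 2 by (intro hopfint_finsum hopfint_sm) (use S(3) A in auto)
qed

lemma UZ_hopfint: "UZ n \<phi> \<iota>p \<iota>m \<subseteq> hopfint"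
proof -
  have "UZ_zero n \<subseteq> hopfint" unfolding UZ_zero_eq[OF \<phi> ip im]
    by (rule hopfint_Z_span) (auto intro!: hopfint_foldr hopfint_binom)
  then show ?thesis unfolding H_eq[OF \<phi> ip im]
    by (intro hopfint_Z_span) (auto intro!: hopfint_mult iota_hopfint)
qed

lemma UZ_hopf: "Z_hopf_subalgebra U \<Delta> (env_counit MA) anti (UZ n \<phi> \<iota>p \<iota>m)"
  using UZ_hopfint Wint_subring counit_Wint
  unfolding Z_hopf_subalgebra_def H_eq_Wint[OF \<phi> ip im] hopfint_def by blast

end

end

section \<open>Semisimple representations\<close>

text \<open>The multiset of the semisimple representation \<open>S\<^sub>l\<close>.\<close>

definition ssm :: "nat \<Rightarrow> (int \<Rightarrow> nat) \<Rightarrow> (int \<times> int) multiset" where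
  "ssm n l = (\<Sum>i\<leftarrow>[1..int n]. replicate_mset (l i) (i, i + 1))"

lemma count_ssm: "count (ssm n l) (x, y) = (if y = x + 1 \<and> 1 \<le> x \<and> x \<le> int n then l x else 0)"
proof -
  have "distinct xs \<Longrightarrow> count (\<Sum>i\<leftarrow>xs. replicate_mset (l i) (i, i + 1)) (x, y) = (if y = x + 1 \<and> x \<in> set xs then l x else 0)" for xs
    by (induction xs) auto
  then show ?thesis by (simp add: ssm_def)
qed

lemma ssm_Bp: "set_mset (ssm n l) \<subseteq> Bp n"
proof
  fix c assume "c \<in># ssm n l"
  then have "count (ssm n l) (fst c, snd c) \<noteq> 0" by simp
  then show "c \<in> Bp n" unfolding count_ssm by (cases c) (auto simp: Bp_def split: if_splits)
qed

lemma ss_mat_ssm: assumes n: "n \<ge> 1" shows "ss_mat n l = mat n (ssm n l)"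
proof (intro ext)
  fix k m
  obtain x y where xy: "nrm n k m = (x, y)" by force
  note I = nrm_idem[OF n xy]
  have "Emat n i (i + 1) k m = (if i = x \<and> y = x + 1 then 1 else 0 :: nat)" if "i \<in> {1..int n}" for i
    using nrm_eq[OF n, of i k m "i + 1"] that xy by (auto simp: Emat_iff)
  then have "ss_mat n l k m = (\<Sum>i = 1..int n. if i = x then (if y = x + 1 then l x else 0) else 0)"
    unfolding ss_mat_def by (intro sum.cong) auto
  also have "\<dots> = mat n (ssm n l) k m" using I by (simp add: mat_def xy count_ssm)
  finally show "ss_mat n l k m = mat n (ssm n l) k m" .
qed

lemma per_seqs_mod: assumes l: "l \<in> per_seqs n" shows "l (1 + (i - 1) mod int n) = l i"
proof -
  have "l (1 + (i - 1) mod int n + ((i - 1) div int n) * int n) = l (1 + (i - 1) mod int n)"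
    by (rule per_shift[of "\<lambda>i j. l i"]) (use l in \<open>simp add: per_seqs_def\<close>)
  moreover have "1 + (i - 1) mod int n + ((i - 1) div int n) * int n = i" by (metis add.assoc add.commute diff_add_cancel mod_div_mult_eq)
  ultimately show ?thesis by simp
qed

lemma ssm_eqI:
  assumes "\<And>i. 1 \<le> i \<Longrightarrow> i \<le> int n \<Longrightarrow> count X (i, i + 1) = l i" "set_mset X \<subseteq> (\<lambda>i. (i, i + 1)) ` {1..int n}"
  shows "ssm n l = X"
proof (rule multiset_eqI)
  fix c show "count (ssm n l) c = count X c"
  proof (cases "c \<in># X")
    case True then show ?thesis using assms by (auto simp: count_ssm)
  next
    case False
    then show ?thesis using assms(1)[of "fst c"] by (cases c) (auto simp: count_ssm not_in_iff)
  qed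
qed

text \<open>A submultiset is given by its multiplicities at the pairs \<open>(i, i + 1)\<close> with \<open>i\<close> from 1 to \<open>n\<close>, and these
  extend uniquely to a periodic sequence.\<close>

lemma splittings_sub:
  assumes n: "n \<ge> 1" and l: "l \<in> per_seqs n"
  shows "bij_betw (\<lambda>p. ssm n (fst p)) (splittings n l) (sub (ssm n l))"
    and "p \<in> splittings n l \<Longrightarrow> ssm n l - ssm n (fst p) = ssm n (snd p)"
proof -
  have add: "ssm n l = ssm n (fst p) + ssm n (snd p)" if "p \<in> splittings n l" for p
    using that by (intro multiset_eqI) (auto simp: splittings_def count_ssm split: prod.split)
  then show "p \<in> splittings n l \<Longrightarrow> ssm n l - ssm n (fst p) = ssm n (snd p)" by simp
  show "bij_betw (\<lambda>p. ssm n (fst p)) (splittings n l) (sub (ssm n l))"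
    unfolding bij_betw_def
  proof (intro conjI equalityI subsetI)
    show "inj_on (\<lambda>p. ssm n (fst p)) (splittings n l)"
    proof (rule inj_onI)
      fix p q assume p: "p \<in> splittings n l" and q: "q \<in> splittings n l" and e: "ssm n (fst p) = ssm n (fst q)"
      have "fst p i = fst q i" for i
      proof -
        let ?k = "1 + (i - 1) mod int n"
        have "1 \<le> ?k" "?k \<le> int n" using n pos_mod_bound[of "int n" "i - 1"] pos_mod_sign[of "int n" "i - 1"] by linarith+
        then have "fst p ?k = fst q ?k" using arg_cong[OF e, of "\<lambda>X. count X (?k, ?k + 1)"] by (simp add: count_ssm)
        then show ?thesis using p q by (auto simp: splittings_def per_seqs_mod)
      qed
      moreover from this have "snd p i = snd q i" for i
      proof -
        have "l i = fst p i + snd p i" "l i = fst q i + snd q i" using p q by (auto simp: splittings_def)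
        then show ?thesis using \<open>fst p i = fst q i\<close> by simp
      qed
      ultimately show "p = q" by (simp add: prod_eq_iff ext)
    qed
  next
    fix X assume "X \<in> (\<lambda>p. ssm n (fst p)) ` splittings n l"
    then show "X \<in> sub (ssm n l)" using add by (auto simp: sub_def)
  next
    fix X assume X: "X \<in> sub (ssm n l)"
    define l1 where "l1 i = (let k = 1 + (i - 1) mod int n in count X (k, k + 1))" for i
    have le: "l1 i \<le> l i" for i
    proof -
      let ?k = "1 + (i - 1) mod int n"
      have "count X (?k, ?k + 1) \<le> count (ssm n l) (?k, ?k + 1)" using X by (simp add: sub_iff)
      also have "\<dots> \<le> l ?k" by (simp add: count_ssm)
      finally show ?thesis by (simp add: l1_def per_seqs_mod[OF l])
    qed
    have "(i + int n - 1) mod int n = (i - 1) mod int n" for i by (metis add_diff_eq diff_add_eq mod_add_self2)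
    then have per: "l1 \<in> per_seqs n" by (simp add: per_seqs_def l1_def)
    have "(l1, \<lambda>i. l i - l1 i) \<in> splittings n l" using per l le by (auto simp: splittings_def per_seqs_def)
    moreover have "ssm n l1 = X"
    proof (rule ssm_eqI)
      show "count X (i, i + 1) = l1 i" if "1 \<le> i" "i \<le> int n" for i using that by (simp add: l1_def)
      show "set_mset X \<subseteq> (\<lambda>i. (i, i + 1)) ` {1..int n}"
      proof
        fix c assume "c \<in># X"
        then have "c \<in># ssm n l" using X by (meson mset_subset_eqD sub_D)
        then have "count (ssm n l) (fst c, snd c) \<noteq> 0" by simp
        then show "c \<in> (\<lambda>i. (i, i + 1)) ` {1..int n}" unfolding count_ssm by (cases c) (auto split: if_splits)
      qed
    qed
    ultimately show "X \<in> (\<lambda>p. ssm n (fst p)) ` splittings n l" by (intro image_eqI[of _ _ "(l1, \<lambda>i. l i - l1 i)"]) auto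
  qed
qed

lemma (in agl) split_comult:
  assumes l: "l \<in> per_seqs n" and wc: "\<And>X. set_mset X \<subseteq> Bp n \<Longrightarrow> w (mat n X) \<in> carrier U"
    and c: "\<Delta> (w (mat n (ssm n l))) = (\<Oplus>\<^bsub>TT\<^esub>X\<in>sub (ssm n l). tn (w (mat n X)) (w (mat n (ssm n l - X))))"
  shows "\<Delta> (w (ss_mat n l)) = (\<Oplus>\<^bsub>TT\<^esub>p\<in>splittings n l. tn (w (ss_mat n (fst p))) (w (ss_mat n (snd p))))"
proof -
  note sp = splittings_sub[OF n1 l]
  have wc': "w (mat n (ssm n l)) \<in> carrier U" for l by (rule wc[OF ssm_Bp])
  have sc: "w (mat n X) \<in> carrier U" "w (mat n (ssm n l - X)) \<in> carrier U" if "X \<in> sub (ssm n l)" for X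
    using wc partial_mult.set_sub[OF pm_Bp ssm_Bp that] partial_mult.set_diff[OF pm_Bp ssm_Bp] by auto
  have "\<Delta> (w (mat n (ssm n l))) = (\<Oplus>\<^bsub>TT\<^esub>X\<in>(\<lambda>p. ssm n (fst p)) ` splittings n l. tn (w (mat n X)) (w (mat n (ssm n l - X))))"
    using c bij_betw_imp_surj_on[OF sp(1)] by simp
  also have "\<dots> = (\<Oplus>\<^bsub>TT\<^esub>p\<in>splittings n l. tn (w (mat n (ssm n (fst p)))) (w (mat n (ssm n l - ssm n (fst p)))))"
    by (rule E.UU.T.finsum_reindex[OF _ bij_betw_imp_inj_on[OF sp(1)]])
       (unfold bij_betw_imp_surj_on[OF sp(1)], auto intro!: E.UU.tens_closed sc)
  also have "\<dots> = (\<Oplus>\<^bsub>TT\<^esub>p\<in>splittings n l. tn (w (mat n (ssm n (fst p)))) (w (mat n (ssm n (snd p)))))"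
    using wc' by (intro E.UU.T.finsum_cong') (auto simp: sp(2))
  finally show ?thesis unfolding ss_mat_ssm[OF n1] .
qed

theorem corollary9p3:
  fixes n :: nat and \<phi> :: hall_polys and \<iota>p \<iota>m :: iota
  assumes "n \<ge> 2"
    and "hall_polynomials n \<phi>"
    and "is_iota_plus n \<phi> \<iota>p"
    and "is_iota_minus n \<phi> \<iota>m"
  shows "Z_hopf_subalgebra (Ugl n) (env_comult (mat_alg n)) (env_counit (mat_alg n))
           (env_antipode (mat_alg n)) (UZ n \<phi> \<iota>p \<iota>m) \<and>
    (\<forall>l\<in>per_seqs n. env_comult (mat_alg n) (\<iota>p (u_lam n l)) =
       (\<Oplus>\<^bsub>tensor_alg (Ugl n) (Ugl n)\<^esub>p \<in> splittings n l.
          tens (Ugl n) (Ugl n) (\<iota>p (u_lam n (fst p))) (\<iota>p (u_lam n (snd p))))) \<and>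
    (\<forall>l\<in>per_seqs n. env_comult (mat_alg n) (\<iota>m (u_lam n l)) =
       (\<Oplus>\<^bsub>tensor_alg (Ugl n) (Ugl n)\<^esub>p \<in> splittings n l.
          tens (Ugl n) (Ugl n) (\<iota>m (u_lam n (fst p))) (\<iota>m (u_lam n (snd p))))) \<and>
    (\<forall>i t. 1 \<le> i \<longrightarrow> i \<le> int n \<longrightarrow> env_comult (mat_alg n) (binom (Ugl n) (UE n i i) t) =
       (\<Oplus>\<^bsub>tensor_alg (Ugl n) (Ugl n)\<^esub>j \<in> {0..t}.
          tens (Ugl n) (Ugl n) (binom (Ugl n) (UE n i i) j) (binom (Ugl n) (UE n i i) (t - j))))"
proof -
  interpret agl n by (rule agl.intro) (use assms(1) in simp)
  note a = assms(2-4)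
  have "\<Delta> (\<iota>p (u_lam n l)) = (\<Oplus>\<^bsub>TT\<^esub>p \<in> splittings n l. tn (\<iota>p (u_lam n (fst p))) (\<iota>p (u_lam n (snd p))))"
    if "l \<in> per_seqs n" for l
    using split_comult[OF that, where w = "\<lambda>M. \<iota>p (bvec M)"] w_closed[OF a] w_comult[OF a ssm_Bp] by blast
  moreover have "\<Delta> (\<iota>m (u_lam n l)) = (\<Oplus>\<^bsub>TT\<^esub>p \<in> splittings n l. tn (\<iota>m (u_lam n (fst p))) (\<iota>m (u_lam n (snd p))))"
    if "l \<in> per_seqs n" for l
    using split_comult[OF that, where w = "\<lambda>M. \<iota>m (bvec M)"] w_closed[OF a] w_comult[OF a ssm_Bp] by blast
  ultimately show ?thesis unfolding Ugl_def UE_def using UZ_hopf[OF a] binom_comult by blast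
qed

end
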